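(* Let $V$ be a finite-dimensional faithful $\mathring{\mathfrak{k}}$-module and let $\mathfrak{V}=\mathcal{U}(\mathfrak{N}(\mathbb{K}[u]))\otimes_{\mathcal{U}(\mathring{\mathfrak{k}})}V$ be the induced $\mathfrak{N}(\mathbb{K}[u])$-module. It inherits an $\mathbb{N}$-grading $\mathfrak{V}=\bigoplus_{i=0}^{\infty}\mathfrak{V}_i$ from $\mathfrak{N}(\mathbb{K}[u])$ such that, for every $N$, $\mathfrak{V}^{(N)}=\bigoplus_{i=N}^{\infty}\mathfrak{V}_i$ is an invariant submodule. The quotient $\mathfrak{V}/\mathfrak{V}^{(N)}$ is a finite-dimensional $\mathfrak{N}(\mathbb{P}_N)$-module and therefore (via pullback along the homomorphisms $\rho_\pm^{(N)}:\mathfrak{k}\to\mathfrak{N}(\mathbb{P}_N)$) provides a representation of $\mathfrak{k}$. On the formal completion $\overline{\mathfrak{V}}=\{(v_i)_{i\in\mathbb{N}}\mid v_i\in\mathfrak{V}_i\}$ of $\mathfrak{V}$ there exists a natural, faithful $\mathfrak{N}(\mathbb{K}[[u]])$-action. Furthermore, $\overline{\mathfrak{V}}$ is the inverse limit of the quotients $\mathfrak{V}/\mathfrak{V}^{(N)}$, and $\mathfrak{k}$ is residually finite-dimensional.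
   Context: $\mathbb{K}\in\{\mathbb{R},\mathbb{C}\}$, $\mathbb{N}=\{0,1,2,\dots\}$. $\mathfrak{g}=\mathfrak{g}(A)(\mathbb{K})$ is a split untwisted affine Kac--Moody algebra, $\mathfrak{k}$ its subalgebra fixed by the (linear) Cartan--Chevalley involution ($e_i\mapsto -f_i$, $f_i\mapsto-e_i$, $h\mapsto -h$), $\mathring{\mathfrak{g}}$ the split finite-dimensional simple Lie algebra obtained by deleting the affine node, and $\mathring{\mathfrak{g}}=\mathring{\mathfrak{k}}\oplus\mathring{\mathfrak{p}}$ the decomposition into $\pm1$ eigenspaces of its Cartan--Chevalley involution. Explicitly $\mathfrak{k}=(\mathfrak{L}^{+}\otimes\mathring{\mathfrak{k}})\oplus(\mathfrak{L}^{-}\otimes\mathring{\mathfrak{p}})$ with $[P\otimes x,Q\otimes y]=(PQ)\otimes[x,y]$, where $\mathfrak{L}^{\pm}\subset\mathbb{K}[t,t^{-1}]$ are the $\pm1$ eigenspaces of $t\mapsto t^{-1}$. For $R$ one of $\mathbb{K}[u]$, $\mathbb{K}[[u]]$, $\mathbb{P}_N=\mathbb{K}[[u]]/(u^{N+1})$, let $R^{\pm}$ be the even/odd parts with respect to $u\mapsto -u$ and $\mathfrak{N}(R)=(R^{+}\otimes\mathring{\mathfrak{k}})\oplus(R^{-}\otimes\mathring{\mathfrak{p}})$ with bracket $[P\otimes x,Q\otimes y]=(PQ)\otimes[x,y]$. $\mathfrak{N}(\mathbb{K}[u])$ is $\mathbb{N}$-graded by degree in $u$, with degree-$k$ part $\mathfrak{N}^{(k)}=u^k\otimes\mathring{\mathfrak{k}}$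 for $k$ even and $u^k\otimes\mathring{\mathfrak{p}}$ for $k$ odd; $\mathcal{U}(\mathfrak{N}(\mathbb{K}[u]))$ inherits the grading, and $\mathring{\mathfrak{k}}=\mathfrak{N}^{(0)}$. The grading on $\mathfrak{V}$ is $\deg(a\otimes v)=\deg(a)$. The $\mathfrak{N}(\mathbb{P}_N)$-module structure on $\mathfrak{V}/\mathfrak{V}^{(N)}$ is the one through which the $\mathfrak{N}(\mathbb{K}[u])$-action factors, using $\mathbb{K}[u]/(u^{N+1})\cong\mathbb{P}_N$. $\rho_\pm^{(N)}:\mathfrak{k}\to\mathfrak{N}(\mathbb{P}_N)$ is the surjective Lie algebra homomorphism obtained by substituting $t=\pm\frac{1-u}{1+u}$, expanding in powers of $u$ and reducing modulo $u^{N+1}$ (that is, $P(t)\otimes x\mapsto \big(P(\pm\tfrac{1-u}{1+u})\bmod u^{N+1}\big)\otimes x$). The natural action of $x=(x_i)_{i\in\mathbb{N}}\in\mathfrak{N}(\mathbb{K}[[u]])$, $x_i\in\mathfrak{N}^{(i)}$, on $v=(v_i)\in\overline{\mathfrak{V}}$ is $(x\cdot v)_i=\sum_{j=0}^{i}x_j\cdot v_{i-j}$. A Lie algebra is residually finite-dimensional if for each nonzero element $x$ there is a finite-dimensional representation on which $x$ acts non-trivially. *)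

theory Defs
  imports
    "HOL-Computational_Algebra.Polynomial_FPS"
    "HOL-Library.Poly_Mapping"
    "HOL.Complex"
    "HOL-Algebra.Algebra"
    "HOL-Algebra.Algebraic_Closure_Type"
begin

section \<open>The ground field\<close>

text \<open>A field type isomorphic to the field of real numbers or to the field of complex numbers
  (a ring homomorphism out of a field is injective).\<close>

class real_or_complex = field +
  assumes real_or_complex: "\<exists>\<phi> :: 'a \<Rightarrow> complex.
    (\<forall>x y. \<phi> (x + y) = \<phi> x + \<phi> y) \<and> (\<forall>x y. \<phi> (x * y) = \<phi> x * \<phi> y) \<and> \<phi> 1 = 1 \<and>
    (range \<phi> = \<real> \<or> range \<phi> = UNIV)"

instance real :: real_or_complex
proof
  show "\<exists>\<phi> :: real \<Rightarrow> complex.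
    (\<forall>x y. \<phi> (x + y) = \<phi> x + \<phi> y) \<and> (\<forall>x y. \<phi> (x * y) = \<phi> x * \<phi> y) \<and> \<phi> 1 = 1 \<and>
    (range \<phi> = \<real> \<or> range \<phi> = UNIV)"
    by (rule exI[of _ complex_of_real]) (simp add: Reals_def)
qed

instance complex :: real_or_complex
proof
  show "\<exists>\<phi> :: complex \<Rightarrow> complex.
    (\<forall>x y. \<phi> (x + y) = \<phi> x + \<phi> y) \<and> (\<forall>x y. \<phi> (x * y) = \<phi> x * \<phi> y) \<and> \<phi> 1 = 1 \<and>
    (range \<phi> = \<real> \<or> range \<phi> = UNIV)"
    by (rule exI[of _ "\<lambda>z. z"]) simp
qed

abbreviation KK :: "'k::field ring" where "KK \<equiv> ring_of_type_algebra"


section \<open>Vector spaces\<close>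

text \<open>Vector spaces are modules over \<^term>\<open>KK\<close>. The record fields \<^const>\<open>monoid.mult\<close> and \<^const>\<open>monoid.one\<close>,
  which every module record carries, are left unspecified unless there is a product.\<close>

definition lin_span :: "('k::field, 'a, 'm) module_scheme \<Rightarrow> 'a set \<Rightarrow> 'a set" where
  "lin_span V S = {finsum V (\<lambda>b. c b \<odot>\<^bsub>V\<^esub> b) B | c B. finite B \<and> B \<subseteq> S}"

definition fin_dim :: "('k::field, 'a, 'm) module_scheme \<Rightarrow> bool" where
  "fin_dim V \<longleftrightarrow> (\<exists>B. finite B \<and> B \<subseteq> carrier V \<and> lin_span V B = carrier V)"

definition lin_map ::
  "('k::field, 'a, 'm) module_scheme \<Rightarrow> ('k, 'b, 'n) module_scheme \<Rightarrow> ('a \<Rightarrow> 'b) \<Rightarrow> bool" where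
  "lin_map V W f \<longleftrightarrow> f \<in> carrier V \<rightarrow> carrier W \<and>
    (\<forall>x\<in>carrier V. \<forall>y\<in>carrier V. f (x \<oplus>\<^bsub>V\<^esub> y) = f x \<oplus>\<^bsub>W\<^esub> f y) \<and>
    (\<forall>c. \<forall>x\<in>carrier V. f (c \<odot>\<^bsub>V\<^esub> x) = c \<odot>\<^bsub>W\<^esub> f x)"

text \<open>The set \<open>C\<close> of families, with the pointwise operations of the \<open>M i\<close>.\<close>

definition pi_module ::
  "('i \<Rightarrow> ('k, 'a, 'm) module_scheme) \<Rightarrow> ('i \<Rightarrow> 'a) set \<Rightarrow> ('k, 'i \<Rightarrow> 'a) module" where
  "pi_module M C = \<lparr>carrier = C, monoid.mult = undefined, monoid.one = undefined,
     ring.zero = (\<lambda>i. \<zero>\<^bsub>M i\<^esub>), ring.add = (\<lambda>f g i. f i \<oplus>\<^bsub>M i\<^esub> g i),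
     module.smult = (\<lambda>c f i. c \<odot>\<^bsub>M i\<^esub> f i)\<rparr>"

definition mod_quot :: "('k, 'a, 'm) module_scheme \<Rightarrow> 'a set \<Rightarrow> ('k, 'a set) module" where
  "mod_quot M S = \<lparr>carrier = a_rcosets\<^bsub>M\<^esub> S, monoid.mult = undefined, monoid.one = undefined,
     ring.zero = S, ring.add = set_add M, module.smult = (\<lambda>c Z. \<Union>x\<in>Z. S +>\<^bsub>M\<^esub> (c \<odot>\<^bsub>M\<^esub> x))\<rparr>"

definition free_module :: "'x set \<Rightarrow> ('k::field, 'x \<Rightarrow> 'k) module" where
  "free_module S = \<lparr>carrier = {p. finite {x. p x \<noteq> 0} \<and> {x. p x \<noteq> 0} \<subseteq> S},
     monoid.mult = undefined, monoid.one = undefined, ring.zero = (\<lambda>_. 0), ring.add = (\<lambda>p q x. p x + q x),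
     module.smult = (\<lambda>c p x. c * p x)\<rparr>"

definition single :: "'x \<Rightarrow> 'x \<Rightarrow> 'k::zero_neq_one" where
  "single x = (\<lambda>y. if y = x then 1 else 0)"

definition is_direct_sum ::
  "('k::field, 'a, 'm) module_scheme \<Rightarrow> (nat \<Rightarrow> 'a set) \<Rightarrow> bool" where
  "is_direct_sum V D \<longleftrightarrow> (\<forall>i. submodule (D i) KK V) \<and>
    (\<forall>v\<in>carrier V. \<exists>!s. (\<forall>i. s i \<in> D i) \<and> finite {i. s i \<noteq> \<zero>\<^bsub>V\<^esub>} \<and>
       v = finsum V s {i. s i \<noteq> \<zero>\<^bsub>V\<^esub>})"

definition inverse_limit ::
  "(nat \<Rightarrow> ('k, 'a) module) \<Rightarrow> (nat \<Rightarrow> nat \<Rightarrow> 'a \<Rightarrow> 'a) \<Rightarrow> ('k, nat \<Rightarrow> 'a) module" where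
  "inverse_limit Q bond = pi_module Q
     {Z. (\<forall>N. Z N \<in> carrier (Q N)) \<and> (\<forall>M N. M \<le> N \<longrightarrow> bond M N (Z N) = Z M)}"


section \<open>Lie algebras and representations\<close>

record ('k, 'a) lie = "('k, 'a) module" +
  lbracket :: "'a \<Rightarrow> 'a \<Rightarrow> 'a"

locale lie_algebra = module KK L
  for L :: "('k::field, 'a, 'm) lie_scheme" (structure) +
  assumes lbracket_closed:
      "\<lbrakk>x \<in> carrier L; y \<in> carrier L\<rbrakk> \<Longrightarrow> lbracket L x y \<in> carrier L"
    and lbracket_add_left:
      "\<lbrakk>x \<in> carrier L; y \<in> carrier L; z \<in> carrier L\<rbrakk> \<Longrightarrow>
        lbracket L (x \<oplus> y) z = lbracket L x z \<oplus> lbracket L y z"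
    and lbracket_add_right:
      "\<lbrakk>x \<in> carrier L; y \<in> carrier L; z \<in> carrier L\<rbrakk> \<Longrightarrow>
        lbracket L x (y \<oplus> z) = lbracket L x y \<oplus> lbracket L x z"
    and lbracket_smult_left:
      "\<lbrakk>x \<in> carrier L; y \<in> carrier L\<rbrakk> \<Longrightarrow> lbracket L (c \<odot> x) y = c \<odot> lbracket L x y"
    and lbracket_smult_right:
      "\<lbrakk>x \<in> carrier L; y \<in> carrier L\<rbrakk> \<Longrightarrow> lbracket L x (c \<odot> y) = c \<odot> lbracket L x y"
    and lbracket_self: "x \<in> carrier L \<Longrightarrow> lbracket L x x = \<zero>"
    and jacobi:
      "\<lbrakk>x \<in> carrier L; y \<in> carrier L; z \<in> carrier L\<rbrakk> \<Longrightarrow>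
        lbracket L x (lbracket L y z) \<oplus> lbracket L y (lbracket L z x)
          \<oplus> lbracket L z (lbracket L x y) = \<zero>"

definition lie_hom ::
  "('k::field, 'a, 'm) lie_scheme \<Rightarrow> ('k, 'b, 'n) lie_scheme \<Rightarrow> ('a \<Rightarrow> 'b) \<Rightarrow> bool" where
  "lie_hom L M f \<longleftrightarrow> lin_map L M f \<and>
    (\<forall>x\<in>carrier L. \<forall>y\<in>carrier L. f (lbracket L x y) = lbracket M (f x) (f y))"

definition lie_ideal :: "('k::field, 'a, 'm) lie_scheme \<Rightarrow> 'a set \<Rightarrow> bool" where
  "lie_ideal L I \<longleftrightarrow> submodule I KK L \<and> (\<forall>x\<in>carrier L. \<forall>y\<in>I. lbracket L x y \<in> I)"

definition lie_subalgebra :: "('k::field, 'a, 'm) lie_scheme \<Rightarrow> 'a set \<Rightarrow> bool" where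
  "lie_subalgebra L H \<longleftrightarrow> submodule H KK L \<and> (\<forall>x\<in>H. \<forall>y\<in>H. lbracket L x y \<in> H)"

definition lie_of_module ::
  "('k, 'a) module \<Rightarrow> ('a \<Rightarrow> 'a \<Rightarrow> 'a) \<Rightarrow> ('k, 'a) lie" where
  "lie_of_module M br = \<lparr>carrier = carrier M, monoid.mult = monoid.mult M, monoid.one = monoid.one M, ring.zero = ring.zero M,
     ring.add = ring.add M, module.smult = module.smult M, lbracket = br\<rparr>"

locale lie_rep = L: lie_algebra L + V: module KK V
  for L :: "('k::field, 'a, 'm) lie_scheme" and V :: "('k, 'v, 'n) module_scheme" +
  fixes act :: "'a \<Rightarrow> 'v \<Rightarrow> 'v"
  assumes act_closed: "\<lbrakk>x \<in> carrier L; v \<in> carrier V\<rbrakk> \<Longrightarrow> act x v \<in> carrier V"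
    and act_add_left:
      "\<lbrakk>x \<in> carrier L; y \<in> carrier L; v \<in> carrier V\<rbrakk> \<Longrightarrow>
        act (x \<oplus>\<^bsub>L\<^esub> y) v = act x v \<oplus>\<^bsub>V\<^esub> act y v"
    and act_add_right:
      "\<lbrakk>x \<in> carrier L; v \<in> carrier V; w \<in> carrier V\<rbrakk> \<Longrightarrow>
        act x (v \<oplus>\<^bsub>V\<^esub> w) = act x v \<oplus>\<^bsub>V\<^esub> act x w"
    and act_smult_left:
      "\<lbrakk>x \<in> carrier L; v \<in> carrier V\<rbrakk> \<Longrightarrow> act (c \<odot>\<^bsub>L\<^esub> x) v = c \<odot>\<^bsub>V\<^esub> act x v"
    and act_smult_right:
      "\<lbrakk>x \<in> carrier L; v \<in> carrier V\<rbrakk> \<Longrightarrow> act x (c \<odot>\<^bsub>V\<^esub> v) = c \<odot>\<^bsub>V\<^esub> act x v"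
    and act_lbracket:
      "\<lbrakk>x \<in> carrier L; y \<in> carrier L; v \<in> carrier V\<rbrakk> \<Longrightarrow>
        act (lbracket L x y) v = act x (act y v) \<ominus>\<^bsub>V\<^esub> act y (act x v)"

definition faithful ::
  "('k::field, 'a, 'm) lie_scheme \<Rightarrow> ('k, 'v, 'n) module_scheme \<Rightarrow> ('a \<Rightarrow> 'v \<Rightarrow> 'v) \<Rightarrow> bool" where
  "faithful L V act \<longleftrightarrow>
    (\<forall>x\<in>carrier L. (\<forall>v\<in>carrier V. act x v = \<zero>\<^bsub>V\<^esub>) \<longrightarrow> x = \<zero>\<^bsub>L\<^esub>)"

text \<open>The representation spaces may be taken inside the space of scalar sequences because that
  space contains a copy of every finite-dimensional vector space.\<close>

definition residually_finite_dimensional :: "('k::field, 'a, 'm) lie_scheme \<Rightarrow> bool" where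
  "residually_finite_dimensional L \<longleftrightarrow>
    (\<forall>x\<in>carrier L. x \<noteq> \<zero>\<^bsub>L\<^esub> \<longrightarrow>
      (\<exists>(W :: ('k, nat \<Rightarrow> 'k) module) act.
        lie_rep L W act \<and> fin_dim W \<and> (\<exists>w\<in>carrier W. act x w \<noteq> \<zero>\<^bsub>W\<^esub>)))"


section \<open>Split simple Lie algebras with their Cartan--Chevalley involution\<close>

text \<open>A finite-dimensional simple Lie algebra is split iff it has Chevalley generators
  \<open>e i\<close>, \<open>f i\<close>, \<open>h i\<close> as below; \<open>a\<close> is its Cartan matrix, and the span of the \<open>h i\<close> a split Cartan
  subalgebra. The Serre relations follow from finite-dimensionality. The values on the generators
  determine \<open>\<theta>\<close>, and make it involutive.\<close>

locale split_simple_lie_algebra = lie_algebra G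
  for G :: "('k::field, 'g) lie" (structure) +
  fixes n :: nat and a :: "nat \<Rightarrow> nat \<Rightarrow> int" and e f h :: "nat \<Rightarrow> 'g" and \<theta> :: "'g \<Rightarrow> 'g"
  assumes finite_dimensional: "fin_dim G"
    and nonabelian: "\<exists>x\<in>carrier G. \<exists>y\<in>carrier G. lbracket G x y \<noteq> \<zero>"
    and simple: "lie_ideal G I \<Longrightarrow> I = {\<zero>} \<or> I = carrier G"
    and cartan_diag: "i < n \<Longrightarrow> a i i = 2"
    and cartan_off_diag: "\<lbrakk>i < n; j < n; i \<noteq> j\<rbrakk> \<Longrightarrow> a i j \<le> 0"
    and cartan_zero: "\<lbrakk>i < n; j < n; a i j = 0\<rbrakk> \<Longrightarrow> a j i = 0"
    and generators_closed:
      "i < n \<Longrightarrow> e i \<in> carrier G" "i < n \<Longrightarrow> f i \<in> carrier G" "i < n \<Longrightarrow> h i \<in> carrier G"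
    and h_independent:
      "\<lbrakk>finsum G (\<lambda>i. c i \<odot> h i) {..<n} = \<zero>; i < n\<rbrakk> \<Longrightarrow> c i = 0"
    and h_h: "\<lbrakk>i < n; j < n\<rbrakk> \<Longrightarrow> lbracket G (h i) (h j) = \<zero>"
    and h_e: "\<lbrakk>i < n; j < n\<rbrakk> \<Longrightarrow> lbracket G (h i) (e j) = of_int (a i j) \<odot> e j"
    and h_f: "\<lbrakk>i < n; j < n\<rbrakk> \<Longrightarrow> lbracket G (h i) (f j) = of_int (- a i j) \<odot> f j"
    and e_f: "\<lbrakk>i < n; j < n\<rbrakk> \<Longrightarrow> lbracket G (e i) (f j) = (if i = j then h i else \<zero>)"
    and generated:
      "\<lbrakk>lie_subalgebra G H; \<And>i. i < n \<Longrightarrow> e i \<in> H \<and> f i \<in> H\<rbrakk> \<Longrightarrow> H = carrier G"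
    and involution_hom: "lie_hom G G \<theta>"
    and involution_e: "i < n \<Longrightarrow> \<theta> (e i) = \<ominus> f i"
    and involution_f: "i < n \<Longrightarrow> \<theta> (f i) = \<ominus> e i"
    and involution_h: "i < n \<Longrightarrow> \<theta> (h i) = \<ominus> h i"

definition fix_space :: "('k, 'g) lie \<Rightarrow> ('g \<Rightarrow> 'g) \<Rightarrow> 'g set" where
  "fix_space G \<theta> = {x \<in> carrier G. \<theta> x = x}"

definition anti_space :: "('k, 'g) lie \<Rightarrow> ('g \<Rightarrow> 'g) \<Rightarrow> 'g set" where
  "anti_space G \<theta> = {x \<in> carrier G. \<theta> x = \<ominus>\<^bsub>G\<^esub> x}"

definition k_fin :: "('k, 'g) lie \<Rightarrow> ('g \<Rightarrow> 'g) \<Rightarrow> ('k, 'g) lie" where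
  "k_fin G \<theta> = G\<lparr>carrier := fix_space G \<theta>\<rparr>"


section \<open>Twisted current algebras\<close>

text \<open>For an algebra \<open>R\<close> of Laurent polynomials, polynomials or power series, \<open>R \<otimes> G\<close> is realised
  inside the space of families of elements of \<open>G\<close>: the coefficient family \<open>p\<close> of an element of \<open>R\<close>
  and \<open>x\<close> in \<open>G\<close> have the pure tensor \<open>m \<mapsto> p m \<odot> x\<close>.\<close>

definition pure :: "('k, 'g) lie \<Rightarrow> ('m \<Rightarrow> 'k) \<Rightarrow> 'g \<Rightarrow> 'm \<Rightarrow> 'g" where
  "pure G p x = (\<lambda>m. p m \<odot>\<^bsub>G\<^esub> x)"

definition family_module :: "('k, 'g) lie \<Rightarrow> ('k, 'm \<Rightarrow> 'g) module" where
  "family_module G = pi_module (\<lambda>_. G) {x. \<forall>m. x m \<in> carrier G}"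

text \<open>The sum of \<open>Rp \<otimes> fix_space\<close> and \<open>Rm \<otimes> anti_space\<close> with bracket \<open>br\<close>.\<close>

definition twisted ::
  "('k::field, 'g) lie \<Rightarrow> ('g \<Rightarrow> 'g) \<Rightarrow> ('m \<Rightarrow> 'k) set \<Rightarrow> ('m \<Rightarrow> 'k) set \<Rightarrow>
    (('m \<Rightarrow> 'g) \<Rightarrow> ('m \<Rightarrow> 'g) \<Rightarrow> ('m \<Rightarrow> 'g)) \<Rightarrow> ('k, 'm \<Rightarrow> 'g) lie" where
  "twisted G \<theta> Rp Rm br = lie_of_module ((family_module G)\<lparr>carrier :=
     lin_span (family_module G) {pure G p x | p x. p \<in> Rp \<and> x \<in> fix_space G \<theta>}
     <+>\<^bsub>family_module G\<^esub>
     lin_span (family_module G) {pure G p x | p x. p \<in> Rm \<and> x \<in> anti_space G \<theta>}\<rparr>) br"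

text \<open>Laurent polynomials are elements of \<^typ>\<open>int \<Rightarrow>\<^sub>0 'k\<close>, and \<^term>\<open>Poly_Mapping.map_key uminus\<close>
  is the substitution of the inverse of \<open>t\<close>.\<close>

definition laurent_plus :: "(int \<Rightarrow> 'k::field) set" where
  "laurent_plus = Poly_Mapping.lookup ` {P :: int \<Rightarrow>\<^sub>0 'k. Poly_Mapping.map_key uminus P = P}"

definition laurent_minus :: "(int \<Rightarrow> 'k::field) set" where
  "laurent_minus = Poly_Mapping.lookup ` {P :: int \<Rightarrow>\<^sub>0 'k. Poly_Mapping.map_key uminus P = - P}"

definition laurent_bracket ::
  "('k, 'g) lie \<Rightarrow> (int \<Rightarrow> 'g) \<Rightarrow> (int \<Rightarrow> 'g) \<Rightarrow> int \<Rightarrow> 'g" where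
  "laurent_bracket G x y = (\<lambda>m. finsum G (\<lambda>i. lbracket G (x i) (y (m - i))) {i. x i \<noteq> \<zero>\<^bsub>G\<^esub>})"

text \<open>The subalgebra of the untwisted affine Kac--Moody algebra of \<open>G\<close> fixed by its Cartan--Chevalley
  involution. The involution sends the tensor of the power \<open>m\<close> of \<open>t\<close> with \<open>x\<close> to the tensor of the
  power \<open>- m\<close> with \<open>\<theta> x\<close>, and negates the central element and the derivation. So its fixed points
  lie in the loop algebra, and the central cocycle vanishes on them.\<close>

definition k_aff :: "('k::field, 'g) lie \<Rightarrow> ('g \<Rightarrow> 'g) \<Rightarrow> ('k, int \<Rightarrow> 'g) lie" where
  "k_aff G \<theta> = twisted G \<theta> laurent_plus laurent_minus (laurent_bracket G)"

definition even_part :: "'k::field fps set \<Rightarrow> (nat \<Rightarrow> 'k) set" where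
  "even_part R = fps_nth ` {p \<in> R. fps_compose p (- fps_X) = p}"

definition odd_part :: "'k::field fps set \<Rightarrow> (nat \<Rightarrow> 'k) set" where
  "odd_part R = fps_nth ` {p \<in> R. fps_compose p (- fps_X) = - p}"

definition current_bracket ::
  "('k, 'g) lie \<Rightarrow> (nat \<Rightarrow> 'g) \<Rightarrow> (nat \<Rightarrow> 'g) \<Rightarrow> nat \<Rightarrow> 'g" where
  "current_bracket G x y = (\<lambda>m. finsum G (\<lambda>i. lbracket G (x i) (y (m - i))) {..m})"

definition cut_at :: "('k, 'g) lie \<Rightarrow> nat \<Rightarrow> (nat \<Rightarrow> 'g) \<Rightarrow> nat \<Rightarrow> 'g" where
  "cut_at G N x = (\<lambda>m. if m \<le> N then x m else \<zero>\<^bsub>G\<^esub>)"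

definition N_poly :: "('k::field, 'g) lie \<Rightarrow> ('g \<Rightarrow> 'g) \<Rightarrow> ('k, nat \<Rightarrow> 'g) lie" where
  "N_poly G \<theta> = twisted G \<theta> (even_part (range fps_of_poly)) (odd_part (range fps_of_poly))
     (current_bracket G)"

definition N_series :: "('k::field, 'g) lie \<Rightarrow> ('g \<Rightarrow> 'g) \<Rightarrow> ('k, nat \<Rightarrow> 'g) lie" where
  "N_series G \<theta> = twisted G \<theta> (even_part UNIV) (odd_part UNIV) (current_bracket G)"

text \<open>A class of power series modulo the power \<open>N + 1\<close> of the variable is represented by its
  member of degree at most \<open>N\<close>.\<close>

definition N_trunc :: "('k::field, 'g) lie \<Rightarrow> ('g \<Rightarrow> 'g) \<Rightarrow> nat \<Rightarrow> ('k, nat \<Rightarrow> 'g) lie" where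
  "N_trunc G \<theta> N = twisted G \<theta>
     (even_part (range (fps_cutoff (Suc N)))) (odd_part (range (fps_cutoff (Suc N))))
     (\<lambda>x y. cut_at G N (current_bracket G x y))"

text \<open>The element of degree \<open>k\<close> with coefficient \<open>x\<close>.\<close>

definition mono :: "('k, 'g) lie \<Rightarrow> nat \<Rightarrow> 'g \<Rightarrow> nat \<Rightarrow> 'g" where
  "mono G k x = (\<lambda>m. if m = k then x else \<zero>\<^bsub>G\<^esub>)"

definition N_deg :: "('k, 'g) lie \<Rightarrow> ('g \<Rightarrow> 'g) \<Rightarrow> nat \<Rightarrow> (nat \<Rightarrow> 'g) set" where
  "N_deg G \<theta> k = mono G k ` (if even k then fix_space G \<theta> else anti_space G \<theta>)"

text \<open>The substitution of \<open>s (1 - u) / (1 + u)\<close> for \<open>t\<close>, modulo the power \<open>N + 1\<close> of \<open>u\<close>; the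
  homomorphisms in question are those for \<open>s = 1\<close> and \<open>s = -1\<close>.\<close>

definition rho :: "('k::field, 'g) lie \<Rightarrow> 'k \<Rightarrow> nat \<Rightarrow> (int \<Rightarrow> 'g) \<Rightarrow> nat \<Rightarrow> 'g" where
  "rho G s N x = cut_at G N (\<lambda>m. finsum G
     (\<lambda>i. fps_nth ((fps_const s * ((1 - fps_X) / (1 + fps_X))) powi i) m \<odot>\<^bsub>G\<^esub> x i)
     {i. x i \<noteq> \<zero>\<^bsub>G\<^esub>})"


section \<open>Universal enveloping algebras and induced modules\<close>

definition free_alg :: "'a set \<Rightarrow> ('k::field, 'a list \<Rightarrow> 'k) module" where
  "free_alg S = (free_module (lists S))\<lparr>
     monoid.mult := (\<lambda>p q w. \<Sum>i\<le>length w. p (take i w) * q (drop i w)), monoid.one := single []\<rparr>"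

text \<open>The enveloping algebra is the free associative algebra on the set of elements of \<open>L\<close>, modulo
  the relations which make \<open>x \<mapsto> [x]\<close> linear and turn brackets into commutators.\<close>

definition env_ideal :: "('k::field, 'a, 'm) lie_scheme \<Rightarrow> ('a list \<Rightarrow> 'k) set" where
  "env_ideal L = (let F = free_alg (carrier L) in Idl\<^bsub>F\<^esub>
     ({single [x \<oplus>\<^bsub>L\<^esub> y] \<ominus>\<^bsub>F\<^esub> (single [x] \<oplus>\<^bsub>F\<^esub> single [y]) | x y. x \<in> carrier L \<and> y \<in> carrier L} \<union>
      {single [c \<odot>\<^bsub>L\<^esub> x] \<ominus>\<^bsub>F\<^esub> c \<odot>\<^bsub>F\<^esub> single [x] | c x. x \<in> carrier L} \<union>
      {single [lbracket L x y] \<ominus>\<^bsub>F\<^esub> (single [x, y] \<ominus>\<^bsub>F\<^esub> single [y, x]) | x y.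
         x \<in> carrier L \<and> y \<in> carrier L}))"

definition env :: "('k::field, 'a, 'm) lie_scheme \<Rightarrow> ('k, ('a list \<Rightarrow> 'k) set) module" where
  "env L = (let F = free_alg (carrier L); J = env_ideal L in
     (mod_quot F J)\<lparr>monoid.mult := monoid.mult (F Quot J), monoid.one := monoid.one (F Quot J)\<rparr>)"

definition env_word :: "('k::field, 'a, 'm) lie_scheme \<Rightarrow> 'a list \<Rightarrow> ('a list \<Rightarrow> 'k) set" where
  "env_word L w = env_ideal L +>\<^bsub>free_alg (carrier L)\<^esub> single w"

text \<open>The map from the enveloping algebra of a subalgebra of \<open>L\<close> to that of \<open>L\<close>.\<close>

definition env_incl ::
  "('k::field, 'a, 'm) lie_scheme \<Rightarrow> ('a list \<Rightarrow> 'k) set \<Rightarrow> ('a list \<Rightarrow> 'k) set" where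
  "env_incl L b = env_ideal L <+>\<^bsub>free_alg (carrier L)\<^esub> b"

text \<open>The action of the enveloping algebra on a representation; it does not depend on the chosen
  member of the coset.\<close>

definition env_act ::
  "('k::field, 'v, 'n) module_scheme \<Rightarrow> ('a \<Rightarrow> 'v \<Rightarrow> 'v) \<Rightarrow> ('a list \<Rightarrow> 'k) set \<Rightarrow> 'v \<Rightarrow> 'v" where
  "env_act V act b v = (let p = (SOME p. p \<in> b) in
     finsum V (\<lambda>w. p w \<odot>\<^bsub>V\<^esub> foldr act w v) {w. p w \<noteq> 0})"

definition env_deg ::
  "('k::field, 'a, 'm) lie_scheme \<Rightarrow> (nat \<Rightarrow> 'a set) \<Rightarrow> nat \<Rightarrow> ('a list \<Rightarrow> 'k) set set" where
  "env_deg L gr k = lin_span (env L)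
     {env_word L w | w ks. list_all2 (\<lambda>x j. x \<in> gr j) w ks \<and> sum_list ks = k}"

text \<open>The tensor product of \<open>env L\<close> with \<open>V\<close> over the enveloping algebra of the subalgebra \<open>H\<close>:
  the free vector space on pairs, modulo bilinearity and balancedness.\<close>

abbreviation pair_space ::
  "('k::field, 'a, 'm) lie_scheme \<Rightarrow> ('k, 'v) module \<Rightarrow>
    ('k, ('a list \<Rightarrow> 'k) set \<times> 'v \<Rightarrow> 'k) module" where
  "pair_space L V \<equiv> free_module (carrier (env L) \<times> carrier V)"

definition balance ::
  "('k::field, 'a, 'm) lie_scheme \<Rightarrow> 'a set \<Rightarrow> ('k, 'v) module \<Rightarrow> ('a \<Rightarrow> 'v \<Rightarrow> 'v) \<Rightarrow>
    (('a list \<Rightarrow> 'k) set \<times> 'v \<Rightarrow> 'k) set" where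
  "balance L H V act = (let U = env L; F = pair_space L V in lin_span F
     ({single (r \<oplus>\<^bsub>U\<^esub> s, v) \<ominus>\<^bsub>F\<^esub> (single (r, v) \<oplus>\<^bsub>F\<^esub> single (s, v)) | r s v.
         r \<in> carrier U \<and> s \<in> carrier U \<and> v \<in> carrier V} \<union>
      {single (r, v \<oplus>\<^bsub>V\<^esub> w) \<ominus>\<^bsub>F\<^esub> (single (r, v) \<oplus>\<^bsub>F\<^esub> single (r, w)) | r v w.
         r \<in> carrier U \<and> v \<in> carrier V \<and> w \<in> carrier V} \<union>
      {single (c \<odot>\<^bsub>U\<^esub> r, v) \<ominus>\<^bsub>F\<^esub> c \<odot>\<^bsub>F\<^esub> single (r, v) | c r v.
         r \<in> carrier U \<and> v \<in> carrier V} \<union>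
      {single (r, c \<odot>\<^bsub>V\<^esub> v) \<ominus>\<^bsub>F\<^esub> c \<odot>\<^bsub>F\<^esub> single (r, v) | c r v.
         r \<in> carrier U \<and> v \<in> carrier V} \<union>
      {single (r \<otimes>\<^bsub>U\<^esub> env_incl L b, v) \<ominus>\<^bsub>F\<^esub> single (r, env_act V act b v) | r b v.
         r \<in> carrier U \<and> b \<in> carrier (env (L\<lparr>carrier := H\<rparr>)) \<and> v \<in> carrier V}))"

definition induced ::
  "('k::field, 'a, 'm) lie_scheme \<Rightarrow> 'a set \<Rightarrow> ('k, 'v) module \<Rightarrow> ('a \<Rightarrow> 'v \<Rightarrow> 'v) \<Rightarrow>
    ('k, (('a list \<Rightarrow> 'k) set \<times> 'v \<Rightarrow> 'k) set) module" where
  "induced L H V act = mod_quot (pair_space L V) (balance L H V act)"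

definition tensor ::
  "('k::field, 'a, 'm) lie_scheme \<Rightarrow> 'a set \<Rightarrow> ('k, 'v) module \<Rightarrow> ('a \<Rightarrow> 'v \<Rightarrow> 'v) \<Rightarrow>
    ('a list \<Rightarrow> 'k) set \<Rightarrow> 'v \<Rightarrow> (('a list \<Rightarrow> 'k) set \<times> 'v \<Rightarrow> 'k) set" where
  "tensor L H V act r v = balance L H V act +>\<^bsub>pair_space L V\<^esub> single (r, v)"

text \<open>The action of \<open>x\<close> sends \<open>r \<otimes> v\<close> to \<open>x r \<otimes> v\<close>.\<close>

definition induced_act ::
  "('k::field, 'a, 'm) lie_scheme \<Rightarrow> 'a set \<Rightarrow> ('k, 'v) module \<Rightarrow> ('a \<Rightarrow> 'v \<Rightarrow> 'v) \<Rightarrow>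
    'a \<Rightarrow> (('a list \<Rightarrow> 'k) set \<times> 'v \<Rightarrow> 'k) set \<Rightarrow> (('a list \<Rightarrow> 'k) set \<times> 'v \<Rightarrow> 'k) set" where
  "induced_act L H V act x Z = (let F = pair_space L V in
     \<Union>p\<in>Z. balance L H V act +>\<^bsub>F\<^esub>
       finsum F (\<lambda>(r, v). p (r, v) \<odot>\<^bsub>F\<^esub> single (env_word L [x] \<otimes>\<^bsub>env L\<^esub> r, v)) {z. p z \<noteq> 0})"


section \<open>The induced module of the polynomial current algebra\<close>

text \<open>A representation \<open>(V, act)\<close> of the fixed subalgebra of \<open>G\<close> is regarded as a representation of
  the degree-zero subalgebra by identifying \<open>x\<close> with \<open>mono G 0 x\<close>.\<close>

type_synonym ('k, 'g, 'v) ind = "(((nat \<Rightarrow> 'g) list \<Rightarrow> 'k) set \<times> 'v \<Rightarrow> 'k) set"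

locale current_induction =
  fixes G :: "('k::field, 'g) lie" and \<theta> :: "'g \<Rightarrow> 'g"
    and V :: "('k, 'v) module" and act :: "'g \<Rightarrow> 'v \<Rightarrow> 'v"
begin

definition ind :: "('k, ('k, 'g, 'v) ind) module" where
  "ind = induced (N_poly G \<theta>) (N_deg G \<theta> 0) V (\<lambda>x. act (x 0))"

definition ind_act :: "(nat \<Rightarrow> 'g) \<Rightarrow> ('k, 'g, 'v) ind \<Rightarrow> ('k, 'g, 'v) ind" where
  "ind_act = induced_act (N_poly G \<theta>) (N_deg G \<theta> 0) V (\<lambda>x. act (x 0))"

definition ind_deg :: "nat \<Rightarrow> ('k, 'g, 'v) ind set" where
  "ind_deg i = lin_span ind
     {tensor (N_poly G \<theta>) (N_deg G \<theta> 0) V (\<lambda>x. act (x 0)) r v | r v.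
        r \<in> env_deg (N_poly G \<theta>) (N_deg G \<theta>) i \<and> v \<in> carrier V}"

definition ind_ge :: "nat \<Rightarrow> ('k, 'g, 'v) ind set" where
  "ind_ge N = lin_span ind (\<Union>i\<in>{N..}. ind_deg i)"

definition ind_quot :: "nat \<Rightarrow> ('k, ('k, 'g, 'v) ind set) module" where
  "ind_quot N = mod_quot ind (ind_ge N)"

definition quot_act_poly ::
  "nat \<Rightarrow> (nat \<Rightarrow> 'g) \<Rightarrow> ('k, 'g, 'v) ind set \<Rightarrow> ('k, 'g, 'v) ind set" where
  "quot_act_poly N x Z = (\<Union>v\<in>Z. ind_ge N +>\<^bsub>ind\<^esub> ind_act x v)"

text \<open>The action of the truncated algebra through which \<^const>\<open>quot_act_poly\<close> factors.\<close>

definition quot_act ::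
  "nat \<Rightarrow> (nat \<Rightarrow> 'g) \<Rightarrow> ('k, 'g, 'v) ind set \<Rightarrow> ('k, 'g, 'v) ind set" where
  "quot_act N y = quot_act_poly N (SOME x. x \<in> carrier (N_poly G \<theta>) \<and> cut_at G N x = y)"

definition completion :: "('k, nat \<Rightarrow> ('k, 'g, 'v) ind) module" where
  "completion = pi_module (\<lambda>_. ind) {v. \<forall>i. v i \<in> ind_deg i}"

definition completion_act ::
  "(nat \<Rightarrow> 'g) \<Rightarrow> (nat \<Rightarrow> ('k, 'g, 'v) ind) \<Rightarrow> nat \<Rightarrow> ('k, 'g, 'v) ind" where
  "completion_act x v = (\<lambda>i. finsum ind (\<lambda>j. ind_act (mono G j (x j)) (v (i - j))) {..i})"

text \<open>The canonical map from the quotient at \<open>N\<close> to the quotient at \<open>M \<le> N\<close>.\<close>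

definition quot_bond :: "nat \<Rightarrow> nat \<Rightarrow> ('k, 'g, 'v) ind set \<Rightarrow> ('k, 'g, 'v) ind set" where
  "quot_bond M N Z = (\<Union>v\<in>Z. ind_ge M +>\<^bsub>ind\<^esub> v)"

definition completion_proj :: "nat \<Rightarrow> (nat \<Rightarrow> ('k, 'g, 'v) ind) \<Rightarrow> ('k, 'g, 'v) ind set" where
  "completion_proj N v = ind_ge N +>\<^bsub>ind\<^esub> finsum ind v {..<N}"

end

end

theory Submission
  imports Defs
begin

text \<open>
  Write \<open>N(R)\<close> for the twisted current algebra over \<open>R\<close>. Almost everything rests on one tool, the
  universal property of the induced module (\<open>ex_equivariant_lift\<close>): a linear map from \<open>V\<close> to an
  \<open>N(K[u])\<close>-module which commutes with the degree-zero subalgebra extends to an equivariant map from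
  the induced module. It is applied to two well-chosen modules.

  The first one gives the grading. Families of vectors of the induced module, indexed by degrees,
  form an \<open>N(K[[u]])\<close>-module under convolution. Placing \<open>V\<close> in degree \<open>0\<close> extends to a map that
  sends every vector to the family of its homogeneous components (\<open>components_deg\<close>). Hence
  the homogeneous parts are independent, and a vector lies in the \<open>n\<close>-th step of the filtration iff its
  components of degree less than \<open>n\<close> vanish (\<open>ind_ge_iff\<close>). With this description the statements about
  the quotients, the completion and the inverse limit become computations with components. The
  quotients are finite-dimensional because letters of degree \<open>0\<close> can be moved to the right, where they
  act on \<open>V\<close>, so that each homogeneous part is generated from the lower ones by letters of positive
  degree, and these lie in finite-dimensional spaces (\<open>ind_deg_raised\<close>).

  The second one gives faithfulness. Let \<open>x\<close> in \<open>N(K[u])\<close> act on \<open>G[[u]] \<otimes> G* \<otimes> V\<close> through its full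
  adjoint action on the first factor and through its constant coefficient on the other two. As the
  identity in \<open>G \<otimes> G*\<close> is invariant, \<open>v \<mapsto> id \<otimes> v\<close> is a map as above. The monomial \<open>u^k y\<close> sends \<open>id \<otimes> v\<close> to
  \<open>u^k ad y \<otimes> v\<close> if \<open>k > 0\<close>, which is nonzero for suitable \<open>v\<close> unless \<open>y = 0\<close> because \<open>G\<close> has no centre; it sends it to
  \<open>id \<otimes> y v\<close> if \<open>k = 0\<close>, and \<open>V\<close> is faithful. So a nonzero monomial moves some vector of \<open>V\<close> in the
  induced module (\<open>ind_act_mono_faithful\<close>). A power series applied to a vector of \<open>V\<close>, seen in degree
  \<open>0\<close> of the completion, exhibits the actions of its coefficients in separate degrees.

  For residual finiteness, the substitution of \<open>(1 - u) / (1 + u)\<close> for \<open>t\<close> is studied without truncation.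
  It is injective since the integral powers of this series are linearly independent
  (\<open>cayley_powi_independent\<close>). So a nonzero element of the affine algebra has a nonzero
  coefficient in some degree \<open>k\<close>, and it acts nontrivially on the quotient at \<open>k + 1\<close>.

  Simplicity of \<open>G\<close> enters through the triviality of its centre. This also yields the Jacobi
  identity for the current algebras: an element is determined by its adjoint matrix, whose entries are
  power series, and the bracket is the commutator of these matrices.
\<close>

section \<open>Linear algebra over the field of scalars\<close>

lemma KK_simps [simp]:
  "carrier KK = UNIV" "a \<oplus>\<^bsub>KK\<^esub> b = a + b" "a \<otimes>\<^bsub>KK\<^esub> b = a * b" "\<zero>\<^bsub>KK\<^esub> = 0" "\<one>\<^bsub>KK\<^esub> = 1"
  for a b :: "'k::field"
  by (simp_all add: ring_of_type_algebra_def)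

lemma KK_minus [simp]: "\<ominus>\<^bsub>KK\<^esub> a = - a" for a :: "'k::field"
proof -
  interpret cring "KK :: 'k ring" by (rule cring_from_type_algebra)
  show ?thesis by (rule minus_equality) simp_all
qed

locale vec_space = module "KK :: 'k::field ring" V
  for V :: "('k::field, 'a, 'm) module_scheme" (structure)
begin

lemma smult_add_left: "x \<in> carrier V \<Longrightarrow> (a + b) \<odot> x = a \<odot> x \<oplus> b \<odot> x"
  using smult_l_distr[of a b x] by simp

lemma smult_add_right: "\<lbrakk>x \<in> carrier V; y \<in> carrier V\<rbrakk> \<Longrightarrow> a \<odot> (x \<oplus> y) = a \<odot> x \<oplus> a \<odot> y"
  using smult_r_distr[of a x y] by simp

lemma smult_smult: "x \<in> carrier V \<Longrightarrow> a \<odot> (b \<odot> x) = (a * b) \<odot> x"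
  using smult_assoc1[of a b x] by simp

lemma smult_1 [simp]: "x \<in> carrier V \<Longrightarrow> 1 \<odot> x = x"
  using smult_one[of x] by simp

lemma smult_0 [simp]: "x \<in> carrier V \<Longrightarrow> 0 \<odot> x = \<zero>"
  using smult_l_null[of x] by simp

lemma smult_zero [simp]: "a \<odot> \<zero> = \<zero>"
  using smult_r_null[of a] by simp

lemma smult_minus_left: "x \<in> carrier V \<Longrightarrow> (- a) \<odot> x = \<ominus> (a \<odot> x)"
  using smult_l_minus[of a x] by simp

lemma minus_eq_smult: "x \<in> carrier V \<Longrightarrow> \<ominus> x = (-1) \<odot> x"
  using smult_minus_left[of x 1] by simp

lemma smult_minus_right: "x \<in> carrier V \<Longrightarrow> a \<odot> (\<ominus> x) = \<ominus> (a \<odot> x)"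
  using smult_r_minus[of a x] by simp

lemma diff_eq_smult: "\<lbrakk>x \<in> carrier V; y \<in> carrier V\<rbrakk> \<Longrightarrow> x \<ominus> y = x \<oplus> (-1) \<odot> y"
  by (simp add: minus_eq minus_eq_smult)

lemma smult_diff: "\<lbrakk>x \<in> carrier V; y \<in> carrier V\<rbrakk> \<Longrightarrow> a \<odot> (x \<ominus> y) = a \<odot> x \<ominus> a \<odot> y"
  by (simp add: minus_eq smult_add_right smult_minus_right)

lemma diff_self [simp]: "x \<in> carrier V \<Longrightarrow> x \<ominus> x = \<zero>"
  by (simp add: minus_eq r_neg)

lemma minus_diff: "\<lbrakk>x \<in> carrier V; y \<in> carrier V\<rbrakk> \<Longrightarrow> \<ominus> (x \<ominus> y) = y \<ominus> x"
  by (simp add: minus_eq minus_add a_comm)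

lemma diff_add_diff: "\<lbrakk>x \<in> carrier V; y \<in> carrier V; z \<in> carrier V\<rbrakk> \<Longrightarrow> (x \<ominus> y) \<oplus> (y \<ominus> z) = x \<ominus> z"
  by (simp add: minus_eq a_assoc r_neg1)

lemma add_eq_imp_diff_eq:
  assumes "x \<oplus> y = z \<oplus> w" "x \<in> carrier V" "y \<in> carrier V" "z \<in> carrier V" "w \<in> carrier V"
  shows "x \<ominus> z = w \<ominus> y"
proof -
  have "w \<ominus> y = \<ominus> z \<oplus> (z \<oplus> w) \<oplus> \<ominus> y" using assms(2-5) by (simp add: r_neg1 minus_eq)
  also have "\<dots> = \<ominus> z \<oplus> (x \<oplus> y) \<oplus> \<ominus> y" by (simp only: assms(1))
  also have "\<dots> = x \<ominus> z" using assms(2-5) by (simp add: a_assoc r_neg minus_eq) (simp add: a_comm)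
  finally show ?thesis by simp
qed

lemma diff_zero [simp]: "x \<in> carrier V \<Longrightarrow> x \<ominus> \<zero> = x"
  by (metis minus_eq minus_equality r_zero zero_closed)

lemma diff_eq_zero_iff: "\<lbrakk>x \<in> carrier V; y \<in> carrier V\<rbrakk> \<Longrightarrow> x \<ominus> y = \<zero> \<longleftrightarrow> x = y"
  by (metis diff_self minus_eq minus_minus minus_equality a_inv_closed)

lemma finsum_smult:
  "f \<in> A \<rightarrow> carrier V \<Longrightarrow> c \<odot> finsum V f A = finsum V (\<lambda>i. c \<odot> f i) A"
  by (cases "finite A") (simp_all add: finsum_smult_ldistr finsum_infinite)

lemma finsum_mono_neutral:
  assumes "finite B" "A \<subseteq> B" "\<And>i. i \<in> B - A \<Longrightarrow> f i = \<zero>" "\<And>i. i \<in> A \<Longrightarrow> f i \<in> carrier V"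
  shows "finsum V f A = finsum V f B"
proof -
  have "f \<in> B \<rightarrow> carrier V" using assms by (metis DiffI Pi_I zero_closed)
  then show ?thesis using assms by (intro add.finprod_mono_neutral_cong_left) auto
qed

lemma finsum_in_single:
  assumes "finite A" "i \<in> A" "f i \<in> carrier V" "\<And>j. \<lbrakk>j \<in> A; j \<noteq> i\<rbrakk> \<Longrightarrow> f j = \<zero>"
  shows "finsum V f A = f i"
proof -
  have "finsum V f {i} = finsum V f A"
    using assms by (intro finsum_mono_neutral) auto
  then show ?thesis using assms(3) by (simp add: finsum_insert)
qed

lemma finsum_induct_closed:
  assumes "\<zero> \<in> H" "\<And>x y. \<lbrakk>x \<in> H; y \<in> H\<rbrakk> \<Longrightarrow> x \<oplus> y \<in> H" "H \<subseteq> carrier V" "\<And>i. i \<in> A \<Longrightarrow> f i \<in> H"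
  shows "finsum V f A \<in> H"
proof (cases "finite A")
  case True
  then show ?thesis using assms(4)
  proof (induction A)
    case (insert a A)
    have "finsum V f (insert a A) = f a \<oplus> finsum V f A"
      using insert assms(3) by (intro finsum_insert) auto
    then show ?case using insert assms(2) by simp
  qed (simp add: assms(1))
qed (simp add: assms(1) finsum_infinite)

text \<open>The reordering behind iterated convolutions: both sides run over the pairs with sum at most \<open>n\<close>.\<close>

lemma finsum_triangle:
  assumes "\<And>j k. f j k \<in> carrier V"
  shows "finsum V (\<lambda>j. finsum V (\<lambda>k. f j k) {..n - j}) {..n::nat} =
    finsum V (\<lambda>m. finsum V (\<lambda>j. f j (m - j)) {..m}) {..n}"
proof (induction n)
  case 0
  then show ?case using assms by simp
next
  case (Suc n)
  have [simp]: "\<And>j A. (\<lambda>k. f j (g k)) \<in> A \<rightarrow> carrier V" for g using assms by auto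
  have [simp]: "\<And>A g h. (\<lambda>j. finsum V (\<lambda>k. f (g j k) (h j k)) (B j)) \<in> A \<rightarrow> carrier V" for B
    using assms by auto
  have "finsum V (\<lambda>j. finsum V (\<lambda>k. f j k) {..Suc n - j}) {..n} =
    finsum V (\<lambda>j. f j (Suc n - j) \<oplus> finsum V (\<lambda>k. f j k) {..n - j}) {..n}"
  proof (rule finsum_cong')
    fix j assume "j \<in> {..n}"
    then have "Suc n - j = Suc (n - j)" by auto
    then show "finsum V (\<lambda>k. f j k) {..Suc n - j} = f j (Suc n - j) \<oplus> finsum V (\<lambda>k. f j k) {..n - j}"
      using assms by (simp add: finsum_Suc)
  qed (use assms in auto)
  also have "\<dots> = finsum V (\<lambda>j. f j (Suc n - j)) {..n} \<oplus>
      finsum V (\<lambda>m. finsum V (\<lambda>j. f j (m - j)) {..m}) {..n}"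
    using assms by (simp add: finsum_addf Suc)
  finally show ?case
    using assms by (simp add: finsum_Suc a_ac)
qed

lemma finsum_diff:
  assumes "f \<in> A \<rightarrow> carrier V" "g \<in> A \<rightarrow> carrier V"
  shows "finsum V (\<lambda>i. f i \<ominus> g i) A = finsum V f A \<ominus> finsum V g A"
proof -
  have "finsum V (\<lambda>i. f i \<ominus> g i) A = finsum V (\<lambda>i. f i \<oplus> (-1) \<odot> g i) A"
    using assms by (intro finsum_cong') (auto simp: diff_eq_smult Pi_iff)
  also have "\<dots> = finsum V f A \<oplus> (-1) \<odot> finsum V g A"
    using assms by (subst finsum_smult) (auto intro!: finsum_addf)
  finally show ?thesis using assms by (simp add: diff_eq_smult)
qed

lemma finsum_reflect:
  assumes "f \<in> {..m} \<rightarrow> carrier V"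
  shows "finsum V (\<lambda>j. f (m - j)) {..m} = finsum V f {..m::nat}"
proof -
  have "k \<in> (\<lambda>j. m - j) ` {..m}" if "k \<le> m" for k using that by (intro image_eqI[of _ _ "m - k"]) auto
  then have "(\<lambda>j. m - j) ` {..m} = {..m}" by auto
  moreover have "inj_on (\<lambda>j. m - j) {..m}" by (auto simp: inj_on_def)
  ultimately show ?thesis using finsum_reindex[of f "\<lambda>j. m - j" "{..m}"] assms by simp
qed

lemma subspaceI:
  assumes "H \<subseteq> carrier V" "\<zero> \<in> H" "\<And>x y. \<lbrakk>x \<in> H; y \<in> H\<rbrakk> \<Longrightarrow> x \<oplus> y \<in> H"
    "\<And>c x. x \<in> H \<Longrightarrow> c \<odot> x \<in> H"
  shows "submodule H KK V"
  using assms by (intro submoduleI) (auto simp: minus_eq_smult subset_iff)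

lemma submodule_subset: "submodule H KK V \<Longrightarrow> H \<subseteq> carrier V"
  and submodule_mem_carrier: "\<lbrakk>submodule H KK V; x \<in> H\<rbrakk> \<Longrightarrow> x \<in> carrier V"
  and submodule_add: "\<lbrakk>submodule H KK V; x \<in> H; y \<in> H\<rbrakk> \<Longrightarrow> x \<oplus> y \<in> H"
  and submodule_smult: "\<lbrakk>submodule H KK V; x \<in> H\<rbrakk> \<Longrightarrow> c \<odot> x \<in> H"
  and submodule_minus: "\<lbrakk>submodule H KK V; x \<in> H\<rbrakk> \<Longrightarrow> \<ominus> x \<in> H"
  using submoduleE[of H] by auto

lemma submodule_zero: "submodule H KK V \<Longrightarrow> \<zero> \<in> H"
  using submoduleE[of H] by (metis equals0I r_neg subsetD)

lemma submodule_finsum: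
  "\<lbrakk>submodule H KK V; \<And>i. i \<in> A \<Longrightarrow> f i \<in> H\<rbrakk> \<Longrightarrow> finsum V f A \<in> H"
  by (rule finsum_induct_closed) (auto simp: submodule_zero submodule_add dest: submodule_subset)

lemma lin_span_memI:
  "\<lbrakk>finite B; B \<subseteq> S\<rbrakk> \<Longrightarrow> finsum V (\<lambda>b. c b \<odot> b) B \<in> lin_span V S"
  unfolding lin_span_def by blast

lemma submodule_lin_span:
  assumes S: "S \<subseteq> carrier V"
  shows "submodule (lin_span V S) KK V"
proof (rule subspaceI)
  show "lin_span V S \<subseteq> carrier V"
    unfolding lin_span_def using S by (auto intro!: finsum_closed)
  show "\<zero> \<in> lin_span V S"
    using lin_span_memI[of "{}" S] by simp
next
  fix x y assume "x \<in> lin_span V S" "y \<in> lin_span V S"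
  then obtain b B c C where B: "finite B" "B \<subseteq> S" "x = finsum V (\<lambda>v. b v \<odot> v) B"
    and C: "finite C" "C \<subseteq> S" "y = finsum V (\<lambda>v. c v \<odot> v) C"
    unfolding lin_span_def by auto
  define b' where "b' = (\<lambda>v. if v \<in> B then b v else 0)"
  define c' where "c' = (\<lambda>v. if v \<in> C then c v else 0)"
  have BC: "B \<subseteq> carrier V" "C \<subseteq> carrier V" using B C S by auto
  have "x = finsum V (\<lambda>v. b' v \<odot> v) B"
    unfolding B(3) using BC by (intro finsum_cong') (auto simp: b'_def)
  also have "\<dots> = finsum V (\<lambda>v. b' v \<odot> v) (B \<union> C)"
    using BC B C by (intro finsum_mono_neutral) (auto simp: b'_def)
  finally have x: "x = finsum V (\<lambda>v. b' v \<odot> v) (B \<union> C)" .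
  have "y = finsum V (\<lambda>v. c' v \<odot> v) C"
    unfolding C(3) using BC by (intro finsum_cong') (auto simp: c'_def)
  also have "\<dots> = finsum V (\<lambda>v. c' v \<odot> v) (B \<union> C)"
    using BC B C by (intro finsum_mono_neutral) (auto simp: c'_def)
  finally have y: "y = finsum V (\<lambda>v. c' v \<odot> v) (B \<union> C)" .
  have "x \<oplus> y = finsum V (\<lambda>v. b' v \<odot> v \<oplus> c' v \<odot> v) (B \<union> C)"
    unfolding x y using BC by (intro finsum_addf[symmetric]) auto
  also have "\<dots> = finsum V (\<lambda>v. (b' v + c' v) \<odot> v) (B \<union> C)"
    using BC by (intro finsum_cong') (auto simp: smult_add_left)
  finally show "x \<oplus> y \<in> lin_span V S"
    using lin_span_memI[of "B \<union> C" S "\<lambda>v. b' v + c' v"] B C by simp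
next
  fix a x assume "x \<in> lin_span V S"
  then obtain b B where B: "finite B" "B \<subseteq> S" "x = finsum V (\<lambda>v. b v \<odot> v) B"
    unfolding lin_span_def by auto
  have BV: "B \<subseteq> carrier V" using B S by auto
  have "a \<odot> x = finsum V (\<lambda>v. a \<odot> (b v \<odot> v)) B"
    unfolding B(3) using BV by (intro finsum_smult) auto
  also have "\<dots> = finsum V (\<lambda>v. (a * b v) \<odot> v) B"
    using BV by (intro finsum_cong') (auto simp: smult_smult)
  finally show "a \<odot> x \<in> lin_span V S"
    using lin_span_memI[of B S "\<lambda>v. a * b v"] B by simp
qed

lemma lin_span_superset: "S \<subseteq> carrier V \<Longrightarrow> S \<subseteq> lin_span V S"
proof
  fix x assume "S \<subseteq> carrier V" "x \<in> S"
  then show "x \<in> lin_span V S"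
    using lin_span_memI[of "{x}" S "\<lambda>_. 1"] by (auto simp: finsum_insert subset_iff)
qed

lemma lin_span_base: "\<lbrakk>S \<subseteq> carrier V; x \<in> S\<rbrakk> \<Longrightarrow> x \<in> lin_span V S"
  using lin_span_superset by auto

lemma lin_span_least: "\<lbrakk>submodule H KK V; S \<subseteq> H\<rbrakk> \<Longrightarrow> lin_span V S \<subseteq> H"
  unfolding lin_span_def by (auto intro!: submodule_finsum submodule_smult)

lemma lin_span_mono: "S \<subseteq> T \<Longrightarrow> lin_span V S \<subseteq> lin_span V T"
  unfolding lin_span_def by blast

lemma lin_span_closed: "S \<subseteq> carrier V \<Longrightarrow> lin_span V S \<subseteq> carrier V"
  by (rule submodule_subset[OF submodule_lin_span])

lemma lin_span_induct [consumes 2, case_names zero add smult base]: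
  assumes "x \<in> lin_span V S" "S \<subseteq> carrier V" "P \<zero>"
    "\<And>x y. \<lbrakk>x \<in> carrier V; y \<in> carrier V; P x; P y\<rbrakk> \<Longrightarrow> P (x \<oplus> y)"
    "\<And>c x. \<lbrakk>x \<in> carrier V; P x\<rbrakk> \<Longrightarrow> P (c \<odot> x)"
    "\<And>x. x \<in> S \<Longrightarrow> P x"
  shows "P x"
proof -
  have "submodule {x \<in> carrier V. P x} KK V" using assms by (intro subspaceI) auto
  moreover have "S \<subseteq> {x \<in> carrier V. P x}" using assms(2,6) by auto
  ultimately show ?thesis using lin_span_least assms(1) by blast
qed

lemma submodule_vec_space: "submodule H KK V \<Longrightarrow> vec_space (V\<lparr>carrier := H\<rparr>)"
  unfolding vec_space_def
  by (rule submodule.submodule_is_module) (auto intro: module_axioms)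

end

lemma vec_spaceI:
  fixes V :: "('k::field, 'a, 'm) module_scheme" (structure)
  assumes "\<zero> \<in> carrier V" "\<And>x y. \<lbrakk>x \<in> carrier V; y \<in> carrier V\<rbrakk> \<Longrightarrow> x \<oplus> y \<in> carrier V"
    "\<And>c x. x \<in> carrier V \<Longrightarrow> c \<odot> x \<in> carrier V"
    "\<And>x y. \<lbrakk>x \<in> carrier V; y \<in> carrier V\<rbrakk> \<Longrightarrow> x \<oplus> y = y \<oplus> x"
    "\<And>x y z. \<lbrakk>x \<in> carrier V; y \<in> carrier V; z \<in> carrier V\<rbrakk> \<Longrightarrow> (x \<oplus> y) \<oplus> z = x \<oplus> (y \<oplus> z)"
    "\<And>x. x \<in> carrier V \<Longrightarrow> \<zero> \<oplus> x = x"
    "\<And>a b x. x \<in> carrier V \<Longrightarrow> (a + b) \<odot> x = a \<odot> x \<oplus> b \<odot> x"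
    "\<And>a x y. \<lbrakk>x \<in> carrier V; y \<in> carrier V\<rbrakk> \<Longrightarrow> a \<odot> (x \<oplus> y) = a \<odot> x \<oplus> a \<odot> y"
    "\<And>a b x. x \<in> carrier V \<Longrightarrow> (a * b) \<odot> x = a \<odot> (b \<odot> x)"
    "\<And>x. x \<in> carrier V \<Longrightarrow> 1 \<odot> x = x"
    "\<And>x. x \<in> carrier V \<Longrightarrow> 0 \<odot> x = \<zero>"
  shows "vec_space V"
proof -
  have "(-1) \<odot> x \<oplus> x = \<zero>" if "x \<in> carrier V" for x
    using assms(7)[OF that, of "-1" 1] assms(10,11)[OF that] by simp
  then have "abelian_group V"
    using assms by (intro abelian_groupI) (auto intro!: bexI[of _ "(-1) \<odot> _"])
  then show ?thesis
    unfolding vec_space_def using assms by (intro moduleI) (auto intro: cring_from_type_algebra)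
qed

subsection \<open>Linear maps and functionals\<close>

locale linear_mapping = V: vec_space V + W: vec_space W
  for V :: "('k::field, 'a, 'm) module_scheme" and W :: "('k, 'b, 'n) module_scheme" +
  fixes f :: "'a \<Rightarrow> 'b"
  assumes lin_map: "lin_map V W f"
begin

lemma closed [simp]: "x \<in> carrier V \<Longrightarrow> f x \<in> carrier W"
  and add: "\<lbrakk>x \<in> carrier V; y \<in> carrier V\<rbrakk> \<Longrightarrow> f (x \<oplus>\<^bsub>V\<^esub> y) = f x \<oplus>\<^bsub>W\<^esub> f y"
  and smult: "x \<in> carrier V \<Longrightarrow> f (c \<odot>\<^bsub>V\<^esub> x) = c \<odot>\<^bsub>W\<^esub> f x"
  using lin_map unfolding lin_map_def by auto

lemma zero: "f \<zero>\<^bsub>V\<^esub> = \<zero>\<^bsub>W\<^esub>"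
  using smult[of "\<zero>\<^bsub>V\<^esub>" 0] by simp

lemma minus: "x \<in> carrier V \<Longrightarrow> f (\<ominus>\<^bsub>V\<^esub> x) = \<ominus>\<^bsub>W\<^esub> f x"
  by (simp add: V.minus_eq_smult W.minus_eq_smult smult)

lemma diff: "\<lbrakk>x \<in> carrier V; y \<in> carrier V\<rbrakk> \<Longrightarrow> f (x \<ominus>\<^bsub>V\<^esub> y) = f x \<ominus>\<^bsub>W\<^esub> f y"
  by (simp add: V.minus_eq W.minus_eq add minus)

lemma sum: "g \<in> A \<rightarrow> carrier V \<Longrightarrow> f (finsum V g A) = finsum W (\<lambda>i. f (g i)) A"
proof (induction A rule: infinite_finite_induct)
  case (insert a A)
  then have g: "g \<in> A \<rightarrow> carrier V" "g a \<in> carrier V" by auto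
  then have "f (finsum V g (insert a A)) = f (g a \<oplus>\<^bsub>V\<^esub> finsum V g A)"
    using insert.hyps by (simp add: V.finsum_insert)
  also have "\<dots> = f (g a) \<oplus>\<^bsub>W\<^esub> f (finsum V g A)"
    using g by (intro add V.finsum_closed)
  also have "\<dots> = finsum W (\<lambda>i. f (g i)) (insert a A)"
    using insert g by (subst W.finsum_insert) (auto simp: Pi_iff)
  finally show ?case .
qed (simp_all add: zero V.finsum_infinite W.finsum_infinite)

lemma submodule_vimage:
  assumes "submodule H KK W"
  shows "submodule {x \<in> carrier V. f x \<in> H} KK V"
  using assms by (intro V.subspaceI) (auto simp: zero add smult W.submodule_zero W.submodule_add W.submodule_smult)

lemma submodule_image:
  assumes "submodule H KK V"
  shows "submodule (f ` H) KK W"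
proof (rule W.subspaceI)
  show "f ` H \<subseteq> carrier W" using V.submodule_subset[OF assms] by auto
  show "\<zero>\<^bsub>W\<^esub> \<in> f ` H" using V.submodule_zero[OF assms] zero by (metis imageI)
next
  fix x y assume "x \<in> f ` H" "y \<in> f ` H"
  then obtain a b where "a \<in> H" "b \<in> H" "x = f a" "y = f b" by auto
  then show "x \<oplus>\<^bsub>W\<^esub> y \<in> f ` H"
    using V.submodule_add[OF assms] add V.submodule_mem_carrier[OF assms] by (metis imageI)
next
  fix c x assume "x \<in> f ` H"
  then obtain a where "a \<in> H" "x = f a" by auto
  then show "c \<odot>\<^bsub>W\<^esub> x \<in> f ` H"
    using V.submodule_smult[OF assms] smult V.submodule_mem_carrier[OF assms] by (metis imageI)
qed

lemma image_lin_span: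
  assumes S: "S \<subseteq> carrier V"
  shows "f ` lin_span V S = lin_span W (f ` S)"
proof
  have fS: "f ` S \<subseteq> carrier W" using S by auto
  show "f ` lin_span V S \<subseteq> lin_span W (f ` S)"
    using V.lin_span_least[OF submodule_vimage[OF W.submodule_lin_span[OF fS]], of S] S
      W.lin_span_superset[OF fS] by auto
  show "lin_span W (f ` S) \<subseteq> f ` lin_span V S"
    using S V.lin_span_superset by (intro W.lin_span_least submodule_image V.submodule_lin_span) auto
qed

lemma fin_dim_image:
  assumes "fin_dim V" "f ` carrier V = carrier W"
  shows "fin_dim W"
proof -
  from assms(1) obtain B where "finite B" "B \<subseteq> carrier V" "lin_span V B = carrier V"
    unfolding fin_dim_def by auto
  then show ?thesis
    unfolding fin_dim_def using assms(2) image_lin_span[of B]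
    by (intro exI[of _ "f ` B"]) auto
qed

end

lemma linear_mappingI:
  assumes "vec_space V" "vec_space W" "\<And>x. x \<in> carrier V \<Longrightarrow> f x \<in> carrier W"
    "\<And>x y. \<lbrakk>x \<in> carrier V; y \<in> carrier V\<rbrakk> \<Longrightarrow> f (x \<oplus>\<^bsub>V\<^esub> y) = f x \<oplus>\<^bsub>W\<^esub> f y"
    "\<And>c x. x \<in> carrier V \<Longrightarrow> f (c \<odot>\<^bsub>V\<^esub> x) = c \<odot>\<^bsub>W\<^esub> f x"
  shows "linear_mapping V W f"
  using assms by (auto simp: linear_mapping_def linear_mapping_axioms_def lin_map_def)

lemma linear_mapping_compose:
  assumes "linear_mapping U V f" "linear_mapping V W g"
  shows "linear_mapping U W (\<lambda>x. g (f x))"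
proof -
  interpret f: linear_mapping U V f by fact
  interpret g: linear_mapping V W g by fact
  show ?thesis
    by (rule linear_mappingI) (simp_all add: f.V.vec_space_axioms g.W.vec_space_axioms f.add g.add f.smult g.smult)
qed

lemma linear_mapping_eq_on_span:
  assumes "linear_mapping V W f" "linear_mapping V W g" "S \<subseteq> carrier V"
    "\<And>x. x \<in> S \<Longrightarrow> f x = g x" "x \<in> lin_span V S"
  shows "f x = g x"
proof -
  interpret f: linear_mapping V W f by fact
  interpret g: linear_mapping V W g by fact
  show ?thesis using assms(5,3)
    by (induction rule: f.V.lin_span_induct) (simp_all add: f.zero g.zero f.add g.add f.smult g.smult assms(4))
qed

lemma (in vec_space) fin_dimI:
  assumes "finite S" "S \<subseteq> carrier V" "carrier V \<subseteq> lin_span V S"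
  shows "fin_dim V"
  using assms lin_span_closed[of S] by (auto simp: fin_dim_def)

lemma linear_mapping_add:
  assumes "linear_mapping V W f" "linear_mapping V W g"
  shows "linear_mapping V W (\<lambda>x. f x \<oplus>\<^bsub>W\<^esub> g x)"
proof -
  interpret f: linear_mapping V W f by fact
  interpret g: linear_mapping V W g by fact
  show ?thesis
    by (rule linear_mappingI)
      (simp_all add: f.V.vec_space_axioms f.W.vec_space_axioms f.add g.add f.smult g.smult f.W.a_ac f.W.smult_add_right)
qed

lemma linear_mapping_smult:
  assumes "linear_mapping V W f"
  shows "linear_mapping V W (\<lambda>x. c \<odot>\<^bsub>W\<^esub> f x)"
proof -
  interpret f: linear_mapping V W f by fact
  show ?thesis
    by (rule linear_mappingI)
      (simp_all add: f.V.vec_space_axioms f.W.vec_space_axioms f.add f.smult f.W.smult_add_right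
        f.W.smult_smult mult.commute)
qed

lemma linear_mapping_cong:
  assumes "linear_mapping V W f" "\<And>x. x \<in> carrier V \<Longrightarrow> f x = g x"
  shows "linear_mapping V W g"
proof -
  interpret f: linear_mapping V W f by fact
  show ?thesis
    using assms(2)[symmetric] by (intro linear_mappingI)
      (simp_all add: f.V.vec_space_axioms f.W.vec_space_axioms f.add f.smult)
qed

lemma linear_mapping_diff:
  assumes "linear_mapping V W f" "linear_mapping V W g"
  shows "linear_mapping V W (\<lambda>x. f x \<ominus>\<^bsub>W\<^esub> g x)"
proof -
  interpret f: linear_mapping V W f by fact
  interpret g: linear_mapping V W g by fact
  show ?thesis
    by (rule linear_mapping_cong[OF linear_mapping_add[OF assms(1) linear_mapping_smult[OF assms(2), of "-1"]]])
      (simp add: f.W.diff_eq_smult)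
qed

lemma (in linear_mapping) zero_on_span:
  assumes "S \<subseteq> carrier V" "\<And>x. x \<in> S \<Longrightarrow> f x = \<zero>\<^bsub>W\<^esub>" "x \<in> lin_span V S"
  shows "f x = \<zero>\<^bsub>W\<^esub>"
  using assms(3,1) by (induction rule: V.lin_span_induct) (simp_all add: zero add smult assms(2))

lemma (in linear_mapping) maps_span:
  assumes "S \<subseteq> carrier V" "submodule T KK W" "\<And>x. x \<in> S \<Longrightarrow> f x \<in> T" "x \<in> lin_span V S"
  shows "f x \<in> T"
  using assms(4,1) by (induction rule: V.lin_span_induct)
    (simp_all add: zero add smult assms(3) W.submodule_zero[OF assms(2)] W.submodule_add[OF assms(2)]
      W.submodule_smult[OF assms(2)])

definition functional :: "('k::field, 'a, 'm) module_scheme \<Rightarrow> ('a \<Rightarrow> 'k) \<Rightarrow> bool" where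
  "functional V l \<longleftrightarrow>
    (\<forall>x\<in>carrier V. \<forall>y\<in>carrier V. l (x \<oplus>\<^bsub>V\<^esub> y) = l x + l y) \<and>
    (\<forall>c. \<forall>x\<in>carrier V. l (c \<odot>\<^bsub>V\<^esub> x) = c * l x)"

context vec_space
begin

lemma functional_add: "\<lbrakk>functional V l; x \<in> carrier V; y \<in> carrier V\<rbrakk> \<Longrightarrow> l (x \<oplus> y) = l x + l y"
  and functional_smult: "\<lbrakk>functional V l; x \<in> carrier V\<rbrakk> \<Longrightarrow> l (c \<odot> x) = c * l x"
  unfolding functional_def by auto

lemma functional_zero: "functional V l \<Longrightarrow> l \<zero> = 0"
  using functional_smult[of l \<zero> 0] by simp

lemma functional_minus: "\<lbrakk>functional V l; x \<in> carrier V\<rbrakk> \<Longrightarrow> l (\<ominus> x) = - l x"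
  by (simp add: minus_eq_smult functional_smult)

lemma functional_diff: "\<lbrakk>functional V l; x \<in> carrier V; y \<in> carrier V\<rbrakk> \<Longrightarrow> l (x \<ominus> y) = l x - l y"
  by (simp add: minus_eq functional_add functional_minus)

lemma functional_finsum:
  "\<lbrakk>functional V l; g \<in> A \<rightarrow> carrier V\<rbrakk> \<Longrightarrow> l (finsum V g A) = (\<Sum>i\<in>A. l (g i))"
proof (induction A rule: infinite_finite_induct)
  case (insert a A)
  then have g: "g \<in> A \<rightarrow> carrier V" "g a \<in> carrier V" by auto
  then have "l (finsum V g (insert a A)) = l (g a \<oplus> finsum V g A)"
    using insert.hyps by (simp add: finsum_insert)
  also have "\<dots> = l (g a) + l (finsum V g A)"
    using g insert.prems by (intro functional_add finsum_closed)
  finally show ?case using insert g by simp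
qed (simp_all add: functional_zero finsum_infinite)

end

definition dual_basis :: "('k::field, 'a, 'm) module_scheme \<Rightarrow> 'a set \<Rightarrow> ('a \<Rightarrow> 'a \<Rightarrow> 'k) \<Rightarrow> bool" where
  "dual_basis V B l \<longleftrightarrow> finite B \<and> B \<subseteq> carrier V \<and> (\<forall>b. functional V (l b)) \<and>
    (\<forall>v\<in>carrier V. v = finsum V (\<lambda>b. l b v \<odot>\<^bsub>V\<^esub> b) B)"

text \<open>In a spanning set of least size the coefficients of a vector are unique, since otherwise one
  member would be a combination of the others; and unique coefficients depend linearly on the vector.\<close>

lemma (in vec_space) ex_dual_basis:
  assumes "fin_dim V"
  obtains B l where "dual_basis V B l"
proof -
  define spans where "spans B \<longleftrightarrow> finite B \<and> B \<subseteq> carrier V \<and> lin_span V B = carrier V" for B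
  from assms obtain B0 where "spans B0" unfolding fin_dim_def spans_def by blast
  from ex_has_least_nat[where P = spans and m = card, OF this]
  obtain B where B: "spans B" and min: "\<And>C. spans C \<Longrightarrow> card B \<le> card C" by blast
  have fin: "finite B" and BV: "B \<subseteq> carrier V" and span: "lin_span V B = carrier V"
    using B by (auto simp: spans_def)
  have unique: "c x = c' x"
    if eq: "finsum V (\<lambda>b. c b \<odot> b) B = finsum V (\<lambda>b. c' b \<odot> b) B" and x: "x \<in> B" for c c' x
  proof (rule ccontr)
    assume neq: "c x \<noteq> c' x"
    \<comment> \<open>the coefficients of \<open>x\<close> as a combination of the other members\<close>
    define d where "d b = (c' b - c b) / (c x - c' x)" for b
    let ?C = "B - {x}"
    have xV: "x \<in> carrier V" using x BV by auto
    have split: "finsum V (\<lambda>b. a b \<odot> b) B = a x \<odot> x \<oplus> finsum V (\<lambda>b. a b \<odot> b) ?C" for a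
    proof -
      have "B = insert x ?C" using x by auto
      then have "finsum V (\<lambda>b. a b \<odot> b) B = finsum V (\<lambda>b. a b \<odot> b) (insert x ?C)" by simp
      also have "\<dots> = a x \<odot> x \<oplus> finsum V (\<lambda>b. a b \<odot> b) ?C"
        using fin BV xV by (intro finsum_insert) auto
      finally show ?thesis .
    qed
    have [simp]: "finsum V (\<lambda>b. a b \<odot> b) C \<in> carrier V" if "C \<subseteq> B" for a C
      using that BV by (auto intro!: finsum_closed)
    have "c x \<odot> x \<ominus> c' x \<odot> x = finsum V (\<lambda>b. c' b \<odot> b) ?C \<ominus> finsum V (\<lambda>b. c b \<odot> b) ?C"
      using eq[unfolded split[of c] split[of c']]
      by (rule add_eq_imp_diff_eq) (use xV in auto)
    also have "\<dots> = finsum V (\<lambda>b. (c' b - c b) \<odot> b) ?C"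
    proof -
      have "finsum V (\<lambda>b. (c' b - c b) \<odot> b) ?C = finsum V (\<lambda>b. c' b \<odot> b \<oplus> (-1) \<odot> (c b \<odot> b)) ?C"
      proof (rule finsum_cong')
        fix b assume "b \<in> ?C"
        then have "b \<in> carrier V" using BV by auto
        then show "(c' b - c b) \<odot> b = c' b \<odot> b \<oplus> (-1) \<odot> (c b \<odot> b)"
          using smult_add_left[of b "c' b" "- c b"] by (simp add: smult_smult)
      qed (use BV in auto)
      also have "\<dots> = finsum V (\<lambda>b. c' b \<odot> b) ?C \<oplus> finsum V (\<lambda>b. (-1) \<odot> (c b \<odot> b)) ?C"
        using BV by (intro finsum_addf) auto
      also have "finsum V (\<lambda>b. (-1) \<odot> (c b \<odot> b)) ?C = (-1) \<odot> finsum V (\<lambda>b. c b \<odot> b) ?C"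
        using BV by (intro finsum_smult[symmetric]) auto
      finally show ?thesis by (simp add: diff_eq_smult)
    qed
    finally have "(c x - c' x) \<odot> x = finsum V (\<lambda>b. (c' b - c b) \<odot> b) ?C"
      using smult_add_left[OF xV, of "c x" "- c' x"] xV by (simp add: minus_eq smult_minus_left)
    then have "(1 / (c x - c' x)) \<odot> ((c x - c' x) \<odot> x) =
        (1 / (c x - c' x)) \<odot> finsum V (\<lambda>b. (c' b - c b) \<odot> b) ?C" by simp
    also have "\<dots> = finsum V (\<lambda>b. (1 / (c x - c' x)) \<odot> ((c' b - c b) \<odot> b)) ?C"
      using BV by (intro finsum_smult) auto
    also have "\<dots> = finsum V (\<lambda>b. d b \<odot> b) ?C"
    proof (rule finsum_cong')
      fix b assume "b \<in> ?C"
      then show "(1 / (c x - c' x)) \<odot> ((c' b - c b) \<odot> b) = d b \<odot> b"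
        using BV by (simp add: smult_smult d_def subset_iff)
    qed (use BV in auto)
    finally have "x = finsum V (\<lambda>b. d b \<odot> b) ?C"
      using neq xV by (simp add: smult_smult)
    then have "x \<in> lin_span V ?C"
      using fin by (metis lin_span_memI finite_Diff order_refl)
    then have "B \<subseteq> lin_span V ?C"
      using lin_span_superset[of ?C] BV by auto
    then have "lin_span V B \<subseteq> lin_span V ?C"
      using BV by (intro lin_span_least submodule_lin_span) auto
    then have "spans ?C"
      using fin BV span lin_span_closed[of ?C] by (auto simp: spans_def)
    from min[OF this] show False
      using x fin by (metis card_Diff1_less leD)
  qed
  have "\<exists>c. v = finsum V (\<lambda>b. c b \<odot> b) B" if v: "v \<in> carrier V" for v
  proof -
    from v obtain c C where C: "finite C" "C \<subseteq> B" "v = finsum V (\<lambda>b. c b \<odot> b) C"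
      using span unfolding lin_span_def by blast
    let ?c = "\<lambda>b. if b \<in> C then c b else 0"
    have "v = finsum V (\<lambda>b. ?c b \<odot> b) C"
      unfolding C(3) using C BV by (intro finsum_cong') auto
    also have "\<dots> = finsum V (\<lambda>b. ?c b \<odot> b) B"
      using C BV fin by (intro finsum_mono_neutral) auto
    finally show ?thesis by (rule exI[of _ ?c])
  qed
  then obtain c where c: "\<And>v. v \<in> carrier V \<Longrightarrow> v = finsum V (\<lambda>b. c v b \<odot> b) B"
    by metis
  define l where "l b v = (if b \<in> B then c v b else 0)" for b v
  have l: "v = finsum V (\<lambda>b. l b v \<odot> b) B" if "v \<in> carrier V" for v
  proof -
    have "v = finsum V (\<lambda>b. c v b \<odot> b) B" by (rule c[OF that])
    also have "\<dots> = finsum V (\<lambda>b. l b v \<odot> b) B"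
      using BV by (intro finsum_cong') (auto simp: l_def)
    finally show ?thesis .
  qed
  have "functional V (l b)" for b
    unfolding functional_def
  proof (intro conjI ballI allI)
    fix x y assume x: "x \<in> carrier V" and y: "y \<in> carrier V"
    have "finsum V (\<lambda>b. l b (x \<oplus> y) \<odot> b) B = x \<oplus> y" using l x y by simp
    also have "\<dots> = finsum V (\<lambda>b. l b x \<odot> b) B \<oplus> finsum V (\<lambda>b. l b y \<odot> b) B"
      using l[OF x] l[OF y] by simp
    also have "\<dots> = finsum V (\<lambda>b. l b x \<odot> b \<oplus> l b y \<odot> b) B"
      using BV by (intro finsum_addf[symmetric]) auto
    also have "\<dots> = finsum V (\<lambda>b. (l b x + l b y) \<odot> b) B"
      using BV by (intro finsum_cong') (auto simp: smult_add_left)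
    finally show "l b (x \<oplus> y) = l b x + l b y"
      using unique[of "\<lambda>b. l b (x \<oplus> y)" "\<lambda>b. l b x + l b y" b] by (cases "b \<in> B") (auto simp: l_def)
  next
    fix a x assume x: "x \<in> carrier V"
    have "finsum V (\<lambda>b. l b (a \<odot> x) \<odot> b) B = a \<odot> x" using l x by simp
    also have "\<dots> = a \<odot> finsum V (\<lambda>b. l b x \<odot> b) B"
      using l[OF x] by simp
    also have "\<dots> = finsum V (\<lambda>b. a \<odot> (l b x \<odot> b)) B"
      using BV by (intro finsum_smult) auto
    also have "\<dots> = finsum V (\<lambda>b. (a * l b x) \<odot> b) B"
      using BV by (intro finsum_cong') (auto simp: smult_smult)
    finally show "l b (a \<odot> x) = a * l b x"
      using unique[of "\<lambda>b. l b (a \<odot> x)" "\<lambda>b. a * l b x" b] by (cases "b \<in> B") (auto simp: l_def)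
  qed
  then show ?thesis using that[of B l] fin BV l by (simp add: dual_basis_def)
qed

locale dual_based_space = vec_space V for V :: "('k::field, 'a, 'm) module_scheme" (structure) +
  fixes B :: "'a set" and l :: "'a \<Rightarrow> 'a \<Rightarrow> 'k"
  assumes dual_basis: "dual_basis V B l"
begin

lemma finite_basis: "finite B"
  and basis_closed: "b \<in> B \<Longrightarrow> b \<in> carrier V"
  and coord_functional: "functional V (l b)"
  and expand: "v \<in> carrier V \<Longrightarrow> finsum V (\<lambda>b. l b v \<odot> b) B = v"
  using dual_basis by (auto simp: dual_basis_def)

lemmas coord_add = functional_add[OF coord_functional]
  and coord_smult = functional_smult[OF coord_functional]
  and coord_zero = functional_zero[OF coord_functional]
  and coord_minus = functional_minus[OF coord_functional]
  and coord_diff = functional_diff[OF coord_functional]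
  and coord_finsum = functional_finsum[OF coord_functional]

lemma eqI: "\<lbrakk>x \<in> carrier V; y \<in> carrier V; \<And>b. b \<in> B \<Longrightarrow> l b x = l b y\<rbrakk> \<Longrightarrow> x = y"
proof -
  assume "x \<in> carrier V" "y \<in> carrier V" "\<And>b. b \<in> B \<Longrightarrow> l b x = l b y"
  moreover from this have "finsum V (\<lambda>b. l b x \<odot> b) B = finsum V (\<lambda>b. l b y \<odot> b) B"
    using basis_closed by (intro finsum_cong') auto
  ultimately show "x = y" by (simp add: expand)
qed

lemma functional_expand:
  assumes "functional V g" "v \<in> carrier V"
  shows "g v = (\<Sum>b\<in>B. l b v * g b)"
proof -
  have "g v = g (finsum V (\<lambda>b. l b v \<odot> b) B)" using assms by (simp add: expand)
  also have "\<dots> = (\<Sum>b\<in>B. g (l b v \<odot> b))"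
    using assms basis_closed by (intro functional_finsum) auto
  finally show ?thesis using assms basis_closed by (simp add: functional_smult)
qed

end

subsection \<open>Quotients, families and free modules\<close>

context vec_space
begin

lemma mem_coset_iff:
  assumes "submodule S KK V" "x \<in> carrier V"
  shows "y \<in> S +> x \<longleftrightarrow> y \<in> carrier V \<and> y \<ominus> x \<in> S"
proof -
  interpret submodule S KK V by fact
  interpret S: abelian_subgroup S V
    using is_subgroup abelian_group_axioms
    by (intro abelian_subgroupI3) (auto simp: additive_subgroup_def)
  show ?thesis
    using S.a_rcos_module[OF assms(2), of y] S.a_elemrcos_carrier[OF assms(2), of y] by (auto simp: minus_eq)
qed

lemma coset_self: "\<lbrakk>submodule S KK V; x \<in> carrier V\<rbrakk> \<Longrightarrow> x \<in> S +> x"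
  by (simp add: mem_coset_iff submodule_zero)

lemma coset_eq_iff:
  assumes "submodule S KK V" "x \<in> carrier V" "y \<in> carrier V"
  shows "S +> x = S +> y \<longleftrightarrow> x \<ominus> y \<in> S"
proof
  assume "S +> x = S +> y"
  then show "x \<ominus> y \<in> S" using coset_self[OF assms(1,2)] mem_coset_iff[OF assms(1,3)] by auto
next
  assume *: "x \<ominus> y \<in> S"
  have "z \<ominus> x \<in> S \<longleftrightarrow> z \<ominus> y \<in> S" if z: "z \<in> carrier V" for z
  proof -
    have "y \<ominus> x \<in> S" using submodule_minus[OF assms(1) *] assms by (simp add: minus_diff)
    moreover have "z \<ominus> y = (z \<ominus> x) \<oplus> (x \<ominus> y)" "z \<ominus> x = (z \<ominus> y) \<oplus> (y \<ominus> x)"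
      using z assms by (simp_all add: diff_add_diff)
    ultimately show ?thesis using * submodule_add[OF assms(1)] by metis
  qed
  then show "S +> x = S +> y" using mem_coset_iff assms by blast
qed

lemma coset_eq_zero_iff:
  assumes "submodule S KK V" "x \<in> carrier V"
  shows "S +> x = S \<longleftrightarrow> x \<in> S"
proof -
  have "S +> \<zero> = S" using submodule_subset[OF assms(1)] by (rule a_coset_add_zero)
  then show ?thesis using coset_eq_iff[OF assms zero_closed] assms by simp
qed

lemma UN_coset:
  assumes S: "submodule S KK V" and x: "x \<in> carrier V" and "\<And>y. \<lbrakk>y \<in> carrier V; y \<ominus> x \<in> S\<rbrakk> \<Longrightarrow> g y = g x"
  shows "(\<Union>y\<in>S +> x. g y) = g x"
proof -
  have "g y = g x" if "y \<in> S +> x" for y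
    using that assms(3) mem_coset_iff[OF S x] by blast
  then show ?thesis using coset_self[OF S x] by blast
qed

end

lemma carrier_mod_quot: "carrier (mod_quot V S) = (\<lambda>x. S +>\<^bsub>V\<^esub> x) ` carrier V"
  by (auto simp: mod_quot_def A_RCOSETS_def')

context vec_space
begin

lemma mod_quot_carrierE:
  assumes "Z \<in> carrier (mod_quot V S)"
  obtains x where "x \<in> carrier V" "Z = S +> x"
  using assms by (auto simp: carrier_mod_quot)

lemma mod_quot_add:
  assumes "submodule S KK V" "x \<in> carrier V" "y \<in> carrier V"
  shows "(S +> x) \<oplus>\<^bsub>mod_quot V S\<^esub> (S +> y) = S +> (x \<oplus> y)"
proof -
  interpret submodule S KK V by fact
  interpret S: abelian_subgroup S V
    using is_subgroup abelian_group_axioms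
    by (intro abelian_subgroupI3) (auto simp: additive_subgroup_def)
  show ?thesis using S.a_rcos_sum[OF assms(2,3)] by (simp add: mod_quot_def)
qed

lemma mod_quot_smult:
  assumes "submodule S KK V" "x \<in> carrier V"
  shows "c \<odot>\<^bsub>mod_quot V S\<^esub> (S +> x) = S +> (c \<odot> x)"
proof -
  have "(\<Union>y\<in>S +> x. S +> (c \<odot> y)) = S +> (c \<odot> x)"
  proof (rule UN_coset[OF assms])
    fix y assume "y \<in> carrier V" "y \<ominus> x \<in> S"
    then show "S +> (c \<odot> y) = S +> (c \<odot> x)"
      using assms submodule_smult[OF assms(1), of "y \<ominus> x" c] by (simp add: coset_eq_iff smult_diff)
  qed
  then show ?thesis by (simp add: mod_quot_def)
qed

lemma mod_quot_zero: "\<zero>\<^bsub>mod_quot V S\<^esub> = S"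
  by (simp add: mod_quot_def)

lemma vec_space_mod_quot:
  assumes S: "submodule S KK V"
  shows "vec_space (mod_quot V S)"
proof (rule vec_spaceI)
  have zero: "S +> \<zero> = S" using coset_eq_zero_iff[OF S] submodule_zero[OF S] by auto
  then show "\<zero>\<^bsub>mod_quot V S\<^esub> \<in> carrier (mod_quot V S)"
    unfolding mod_quot_zero carrier_mod_quot by (metis imageI zero_closed)
  fix Z assume "Z \<in> carrier (mod_quot V S)"
  then obtain x where x: "x \<in> carrier V" "Z = S +> x" by (rule mod_quot_carrierE)
  show "\<zero>\<^bsub>mod_quot V S\<^esub> \<oplus>\<^bsub>mod_quot V S\<^esub> Z = Z"
    using mod_quot_add[OF S zero_closed x(1)] x by (simp add: zero mod_quot_zero)
  show "0 \<odot>\<^bsub>mod_quot V S\<^esub> Z = \<zero>\<^bsub>mod_quot V S\<^esub>"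
    using x by (simp add: zero mod_quot_zero mod_quot_smult[OF S])
qed (auto simp: mod_quot_add[OF S] mod_quot_smult[OF S] a_ac smult_add_left smult_add_right smult_smult
    elim!: mod_quot_carrierE simp: carrier_mod_quot)

lemma linear_mapping_coset:
  assumes S: "submodule S KK V"
  shows "linear_mapping V (mod_quot V S) (\<lambda>x. S +> x)"
  by (rule linear_mappingI)
    (auto simp: vec_space_axioms vec_space_mod_quot[OF S] carrier_mod_quot mod_quot_add[OF S] mod_quot_smult[OF S])

end

text \<open>The quotient maps in the definitions are unions over all representatives of a coset. Such a union
  collapses to a single coset because \<open>f\<close> sends \<open>S\<close> into \<open>T\<close>.\<close>

lemma (in linear_mapping) UN_coset:
  assumes S: "submodule S KK V" and T: "submodule T KK W" and "f ` S \<subseteq> T" and x: "x \<in> carrier V"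
  shows "(\<Union>y\<in>S +>\<^bsub>V\<^esub> x. T +>\<^bsub>W\<^esub> f y) = T +>\<^bsub>W\<^esub> f x"
proof (rule V.UN_coset[OF S x])
  fix y assume y: "y \<in> carrier V" "y \<ominus>\<^bsub>V\<^esub> x \<in> S"
  then have "f (y \<ominus>\<^bsub>V\<^esub> x) \<in> T" using assms by auto
  then show "T +>\<^bsub>W\<^esub> f y = T +>\<^bsub>W\<^esub> f x"
    using x y by (simp add: W.coset_eq_iff[OF T] diff)
qed

lemma (in linear_mapping) ex_quotient_map:
  assumes S: "submodule S KK V" and ker: "\<And>x. x \<in> S \<Longrightarrow> f x = \<zero>\<^bsub>W\<^esub>"
  obtains g where "linear_mapping (mod_quot V S) W g" "\<And>x. x \<in> carrier V \<Longrightarrow> g (S +>\<^bsub>V\<^esub> x) = f x"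
proof -
  define g where "g Z = f (SOME x. x \<in> Z)" for Z
  have g: "g (S +>\<^bsub>V\<^esub> x) = f x" if x: "x \<in> carrier V" for x
  proof -
    define y where "y = (SOME y. y \<in> S +>\<^bsub>V\<^esub> x)"
    have "y \<in> S +>\<^bsub>V\<^esub> x" unfolding y_def using V.coset_self[OF S x] by (rule someI)
    then have y: "y \<in> carrier V" "y \<ominus>\<^bsub>V\<^esub> x \<in> S" using V.mem_coset_iff[OF S x] by auto
    then have "f y \<ominus>\<^bsub>W\<^esub> f x = \<zero>\<^bsub>W\<^esub>" using x ker[OF y(2)] by (simp add: diff)
    then show ?thesis using x y by (simp add: g_def y_def[symmetric] W.diff_eq_zero_iff)
  qed
  have "linear_mapping (mod_quot V S) W g"
    by (rule linear_mappingI)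
      (auto simp: V.vec_space_mod_quot[OF S] W.vec_space_axioms V.mod_quot_add[OF S] V.mod_quot_smult[OF S]
        g add smult elim!: V.mod_quot_carrierE)
  then show ?thesis using g that by blast
qed

lemma pi_module_simps [simp]:
  "carrier (pi_module M C) = C" "\<zero>\<^bsub>pi_module M C\<^esub> = (\<lambda>i. \<zero>\<^bsub>M i\<^esub>)"
  "x \<oplus>\<^bsub>pi_module M C\<^esub> y = (\<lambda>i. x i \<oplus>\<^bsub>M i\<^esub> y i)" "c \<odot>\<^bsub>pi_module M C\<^esub> x = (\<lambda>i. c \<odot>\<^bsub>M i\<^esub> x i)"
  by (simp_all add: pi_module_def)

lemma vec_space_pi_module:
  assumes M: "\<And>i. vec_space (M i)" and C: "\<And>x i. x \<in> C \<Longrightarrow> x i \<in> carrier (M i)"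
    "(\<lambda>i. \<zero>\<^bsub>M i\<^esub>) \<in> C" "\<And>x y. \<lbrakk>x \<in> C; y \<in> C\<rbrakk> \<Longrightarrow> (\<lambda>i. x i \<oplus>\<^bsub>M i\<^esub> y i) \<in> C"
    "\<And>c x. x \<in> C \<Longrightarrow> (\<lambda>i. c \<odot>\<^bsub>M i\<^esub> x i) \<in> C"
  shows "vec_space (pi_module M C)"
proof -
  interpret vec_space "M i" for i by (rule M)
  show ?thesis
    by (rule vec_spaceI) (auto simp: C a_ac smult_add_left smult_add_right smult_smult intro!: ext)
qed

lemma free_module_simps [simp]:
  "carrier (free_module S) = {p. finite {x. p x \<noteq> 0} \<and> {x. p x \<noteq> 0} \<subseteq> S}"
  "\<zero>\<^bsub>free_module S\<^esub> = (\<lambda>_. 0)"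
  "p \<oplus>\<^bsub>free_module S\<^esub> q = (\<lambda>x. p x + q x)" "c \<odot>\<^bsub>free_module S\<^esub> p = (\<lambda>x. c * p x)"
  by (simp_all add: free_module_def)

lemma finite_support_add:
  "\<lbrakk>finite {x. p x \<noteq> 0}; finite {x. q x \<noteq> 0}\<rbrakk> \<Longrightarrow> finite {x. p x + q x \<noteq> (0::'k::field)}"
  by (rule finite_subset[of _ "{x. p x \<noteq> 0} \<union> {x. q x \<noteq> 0}"]) auto

lemma vec_space_free_module: "vec_space (free_module S)"
  by (rule vec_spaceI) (auto simp: algebra_simps finite_support_add subset_iff, metis add.right_neutral)

lemma single_in_free_module [simp]: "x \<in> S \<Longrightarrow> single x \<in> carrier (free_module S)"
  by (auto simp: single_def)

lemma single_support [simp]: "{y. single x y \<noteq> (0::'k::zero_neq_one)} = {x}"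
  by (auto simp: single_def)

text \<open>The linear extension of a map on the basis.\<close>

definition lin_ext :: "('k::field, 'a, 'm) module_scheme \<Rightarrow> ('x \<Rightarrow> 'a) \<Rightarrow> ('x \<Rightarrow> 'k) \<Rightarrow> 'a" where
  "lin_ext V g p = finsum V (\<lambda>x. p x \<odot>\<^bsub>V\<^esub> g x) {x. p x \<noteq> 0}"

context vec_space
begin

lemma lin_ext_superset:
  assumes "finite A" "{x. p x \<noteq> 0} \<subseteq> A" "\<And>x. x \<in> A \<Longrightarrow> g x \<in> carrier V"
  shows "lin_ext V g p = finsum V (\<lambda>x. p x \<odot> g x) A"
  unfolding lin_ext_def using assms by (intro finsum_mono_neutral) auto

lemma linear_mapping_lin_ext:
  assumes g: "\<And>x. x \<in> S \<Longrightarrow> g x \<in> carrier V"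
  shows "linear_mapping (free_module S) V (lin_ext V g)"
proof (rule linear_mappingI)
  fix p :: "'b \<Rightarrow> 'k" assume p: "p \<in> carrier (free_module S)"
  then show "lin_ext V g p \<in> carrier V"
    unfolding lin_ext_def using g by (auto intro!: finsum_closed)
  show "lin_ext V g (c \<odot>\<^bsub>free_module S\<^esub> p) = c \<odot> lin_ext V g p" for c
  proof -
    have "lin_ext V g (c \<odot>\<^bsub>free_module S\<^esub> p) = finsum V (\<lambda>x. (c * p x) \<odot> g x) {x. p x \<noteq> 0}"
      using p g by (subst lin_ext_superset[of "{x. p x \<noteq> 0}"]) auto
    also have "\<dots> = finsum V (\<lambda>x. c \<odot> (p x \<odot> g x)) {x. p x \<noteq> 0}"
      using p g by (intro finsum_cong') (auto simp: smult_smult subset_iff)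
    also have "\<dots> = c \<odot> lin_ext V g p"
      unfolding lin_ext_def using p g by (intro finsum_smult[symmetric]) auto
    finally show ?thesis .
  qed
  fix q :: "'b \<Rightarrow> 'k" assume q: "q \<in> carrier (free_module S)"
  let ?A = "{x. p x \<noteq> 0} \<union> {x. q x \<noteq> 0}"
  have A: "finite ?A" "\<And>x. x \<in> ?A \<Longrightarrow> g x \<in> carrier V" using p q g by auto
  have "lin_ext V g (p \<oplus>\<^bsub>free_module S\<^esub> q) = finsum V (\<lambda>x. (p x + q x) \<odot> g x) ?A"
    using A by (subst lin_ext_superset[of ?A]) auto
  also have "\<dots> = finsum V (\<lambda>x. p x \<odot> g x \<oplus> q x \<odot> g x) ?A"
    using A by (intro finsum_cong') (auto simp: smult_add_left)
  also have "\<dots> = finsum V (\<lambda>x. p x \<odot> g x) ?A \<oplus> finsum V (\<lambda>x. q x \<odot> g x) ?A"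
    using A by (intro finsum_addf) auto
  also have "\<dots> = lin_ext V g p \<oplus> lin_ext V g q"
    using A by (subst (1 2) lin_ext_superset[of ?A]) auto
  finally show "lin_ext V g (p \<oplus>\<^bsub>free_module S\<^esub> q) = lin_ext V g p \<oplus> lin_ext V g q" .
qed (simp_all add: vec_space_free_module vec_space_axioms)

lemma lin_ext_single [simp]: "g x \<in> carrier V \<Longrightarrow> lin_ext V g (single x) = g x"
  using lin_ext_superset[of "{x}" "single x" g] by (simp add: finsum_insert) (simp add: single_def)

end

lemma lin_span_single: "lin_span (free_module S) (single ` S) = carrier (free_module S :: ('k::field, 'x \<Rightarrow> 'k) module)"
proof
  let ?F = "free_module S :: ('k, 'x \<Rightarrow> 'k) module"
  interpret F: vec_space ?F by (rule vec_space_free_module)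
  have S: "single ` S \<subseteq> carrier ?F" by (auto simp: single_def split: if_splits)
  show "lin_span ?F (single ` S) \<subseteq> carrier ?F" using F.lin_span_closed[OF S] .
  have sub: "submodule (lin_span ?F (single ` S)) KK ?F" by (rule F.submodule_lin_span[OF S])
  show "carrier ?F \<subseteq> lin_span ?F (single ` S)"
  proof
    fix p assume p: "p \<in> carrier ?F"
    define A where "A = {x. p x \<noteq> 0}"
    have A: "finite A" "A \<subseteq> S" "\<And>x. x \<notin> A \<Longrightarrow> p x = 0" using p by (auto simp: A_def)
    have "(\<lambda>x. if x \<in> A then p x else 0) \<in> lin_span ?F (single ` S)"
      using A(1,2)
    proof (induction A)
      case empty
      then show ?case using F.submodule_zero[OF sub] by simp
    next
      case (insert a A)
      have "p a \<odot>\<^bsub>?F\<^esub> single a \<in> lin_span ?F (single ` S)"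
        using insert S by (intro F.submodule_smult[OF sub] F.lin_span_base) auto
      then have "p a \<odot>\<^bsub>?F\<^esub> single a \<oplus>\<^bsub>?F\<^esub> (\<lambda>x. if x \<in> A then p x else 0) \<in> lin_span ?F (single ` S)"
        using insert by (intro F.submodule_add[OF sub]) auto
      moreover have "p a \<odot>\<^bsub>?F\<^esub> single a \<oplus>\<^bsub>?F\<^esub> (\<lambda>x. if x \<in> A then p x else 0) =
          (\<lambda>x. if x \<in> insert a A then p x else 0)"
        using insert.hyps by (auto simp: single_def)
      ultimately show ?case by (simp only:)
    qed
    moreover have "(\<lambda>x. if x \<in> A then p x else 0) = p" using A(3) by auto
    ultimately show "p \<in> lin_span ?F (single ` S)" by simp
  qed
qed

text \<open>A finite basis is numbered injectively, and a vector becomes the sequence of its coordinates.\<close>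

lemma ex_sequence_embedding:
  assumes "vec_space V" "fin_dim V"
  obtains \<psi> where "linear_mapping V (free_module (UNIV :: nat set)) \<psi>" "inj_on \<psi> (carrier V)"
proof -
  interpret vec_space V by (rule assms(1))
  obtain B l where "dual_basis V B l" using ex_dual_basis[OF assms(2)] .
  then interpret dual_based_space V B l by unfold_locales
  obtain g :: "_ \<Rightarrow> nat" where g: "inj_on g B" using finite_imp_inj_to_nat_seg[OF finite_basis] by blast
  define \<psi> where "\<psi> v = (\<lambda>n. if n \<in> g ` B then l (inv_into B g n) v else 0)" for v
  have "finite {n. \<psi> v n \<noteq> 0}" for v
    by (rule finite_subset[of _ "g ` B"]) (auto simp: \<psi>_def finite_basis)
  then have "linear_mapping V (free_module UNIV) \<psi>"
    by (intro linear_mappingI)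
      (auto simp: vec_space_axioms vec_space_free_module \<psi>_def fun_eq_iff coord_add coord_smult)
  moreover have "inj_on \<psi> (carrier V)"
  proof (rule inj_onI)
    fix u v assume uv: "u \<in> carrier V" "v \<in> carrier V" and eq: "\<psi> u = \<psi> v"
    have "l b u = l b v" if "b \<in> B" for b
      using fun_cong[OF eq, of "g b"] that by (simp add: \<psi>_def inv_into_f_f[OF g])
    then show "u = v" by (rule eqI[OF uv])
  qed
  ultimately show ?thesis by (rule that)
qed

section \<open>Lie algebras and their representations\<close>

sublocale lie_algebra \<subseteq> vec_space L
  by unfold_locales

sublocale lie_rep \<subseteq> L: vec_space L + V: vec_space V
  by unfold_locales

lemma lie_algebraI:
  fixes L :: "('k::field, 'a, 'm) lie_scheme" (structure)
  assumes "vec_space L"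
    "\<And>x y. \<lbrakk>x \<in> carrier L; y \<in> carrier L\<rbrakk> \<Longrightarrow> lbracket L x y \<in> carrier L"
    "\<And>x y z. \<lbrakk>x \<in> carrier L; y \<in> carrier L; z \<in> carrier L\<rbrakk> \<Longrightarrow>
        lbracket L (x \<oplus> y) z = lbracket L x z \<oplus> lbracket L y z"
    "\<And>x y z. \<lbrakk>x \<in> carrier L; y \<in> carrier L; z \<in> carrier L\<rbrakk> \<Longrightarrow>
        lbracket L x (y \<oplus> z) = lbracket L x y \<oplus> lbracket L x z"
    "\<And>c x y. \<lbrakk>x \<in> carrier L; y \<in> carrier L\<rbrakk> \<Longrightarrow> lbracket L (c \<odot> x) y = c \<odot> lbracket L x y"
    "\<And>c x y. \<lbrakk>x \<in> carrier L; y \<in> carrier L\<rbrakk> \<Longrightarrow> lbracket L x (c \<odot> y) = c \<odot> lbracket L x y"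
    "\<And>x. x \<in> carrier L \<Longrightarrow> lbracket L x x = \<zero>"
    "\<And>x y z. \<lbrakk>x \<in> carrier L; y \<in> carrier L; z \<in> carrier L\<rbrakk> \<Longrightarrow>
        lbracket L x (lbracket L y z) \<oplus> lbracket L y (lbracket L z x) \<oplus> lbracket L z (lbracket L x y) = \<zero>"
  shows "lie_algebra L"
  using assms by (simp add: lie_algebra_def lie_algebra_axioms_def vec_space_def)

lemma lie_repI:
  fixes L :: "('k::field, 'a, 'm) lie_scheme" and V :: "('k, 'v, 'n) module_scheme"
  assumes "lie_algebra L" "vec_space V"
    "\<And>x v. \<lbrakk>x \<in> carrier L; v \<in> carrier V\<rbrakk> \<Longrightarrow> act x v \<in> carrier V"
    "\<And>x y v. \<lbrakk>x \<in> carrier L; y \<in> carrier L; v \<in> carrier V\<rbrakk> \<Longrightarrow>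
        act (x \<oplus>\<^bsub>L\<^esub> y) v = act x v \<oplus>\<^bsub>V\<^esub> act y v"
    "\<And>x v w. \<lbrakk>x \<in> carrier L; v \<in> carrier V; w \<in> carrier V\<rbrakk> \<Longrightarrow>
        act x (v \<oplus>\<^bsub>V\<^esub> w) = act x v \<oplus>\<^bsub>V\<^esub> act x w"
    "\<And>c x v. \<lbrakk>x \<in> carrier L; v \<in> carrier V\<rbrakk> \<Longrightarrow> act (c \<odot>\<^bsub>L\<^esub> x) v = c \<odot>\<^bsub>V\<^esub> act x v"
    "\<And>c x v. \<lbrakk>x \<in> carrier L; v \<in> carrier V\<rbrakk> \<Longrightarrow> act x (c \<odot>\<^bsub>V\<^esub> v) = c \<odot>\<^bsub>V\<^esub> act x v"
    "\<And>x y v. \<lbrakk>x \<in> carrier L; y \<in> carrier L; v \<in> carrier V\<rbrakk> \<Longrightarrow>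
        act (lbracket L x y) v = act x (act y v) \<ominus>\<^bsub>V\<^esub> act y (act x v)"
  shows "lie_rep L V act"
  using assms by (simp add: lie_rep_def lie_rep_axioms_def vec_space_def)

context lie_algebra
begin

lemma lbracket_zero_left [simp]: "x \<in> carrier L \<Longrightarrow> lbracket L \<zero> x = \<zero>"
  using lbracket_smult_left[of \<zero> x 0] by (simp add: lbracket_closed)

lemma lbracket_zero_right [simp]: "x \<in> carrier L \<Longrightarrow> lbracket L x \<zero> = \<zero>"
  using lbracket_smult_right[of x \<zero> 0] by (simp add: lbracket_closed)

lemma lbracket_minus_left: "\<lbrakk>x \<in> carrier L; y \<in> carrier L\<rbrakk> \<Longrightarrow> lbracket L (\<ominus> x) y = \<ominus> lbracket L x y"
  by (simp add: minus_eq_smult lbracket_smult_left lbracket_closed)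

lemma lbracket_minus_right: "\<lbrakk>x \<in> carrier L; y \<in> carrier L\<rbrakk> \<Longrightarrow> lbracket L x (\<ominus> y) = \<ominus> lbracket L x y"
  by (simp add: minus_eq_smult lbracket_smult_right lbracket_closed)

lemma lbracket_flip:
  assumes "x \<in> carrier L" "y \<in> carrier L"
  shows "lbracket L y x = \<ominus> lbracket L x y"
proof -
  have "lbracket L (x \<oplus> y) (x \<oplus> y) = \<zero>" using assms by (simp add: lbracket_self)
  then have "lbracket L y x \<oplus> lbracket L x y = \<zero>"
    using assms by (simp add: lbracket_add_left lbracket_add_right lbracket_self[OF assms(1)]
        lbracket_self[OF assms(2)] lbracket_closed)
  then show ?thesis using assms by (metis minus_equality lbracket_closed)
qed

lemma lie_algebra_restrict:
  assumes "lie_subalgebra L H"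
  shows "lie_algebra (L\<lparr>carrier := H\<rparr>)"
proof -
  have H: "submodule H KK L" "\<And>x y. \<lbrakk>x \<in> H; y \<in> H\<rbrakk> \<Longrightarrow> lbracket L x y \<in> H"
    using assms by (auto simp: lie_subalgebra_def)
  have [simp]: "\<And>x. x \<in> H \<Longrightarrow> x \<in> carrier L" using submodule_mem_carrier[OF H(1)] .
  show ?thesis
    by (rule lie_algebraI)
      (simp_all add: submodule_vec_space H lbracket_add_left lbracket_add_right
        lbracket_smult_left lbracket_smult_right lbracket_self jacobi)
qed

lemma linear_lbracket_right: "x \<in> carrier L \<Longrightarrow> linear_mapping L L (lbracket L x)"
  by (rule linear_mappingI; simp add: vec_space_axioms lbracket_closed lbracket_add_right lbracket_smult_right)

end

lemma lie_rep_pullback: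
  assumes "lie_rep M V act" "lie_algebra L" "lie_hom L M f"
  shows "lie_rep L V (\<lambda>x. act (f x))"
proof -
  interpret lie_rep M V act by fact
  have [simp]: "\<And>x. x \<in> carrier L \<Longrightarrow> f x \<in> carrier M"
    using assms(3) by (auto simp: lie_hom_def lin_map_def)
  show ?thesis
    using assms(2,3)
    by (intro lie_repI) (simp_all add: V.vec_space_axioms act_closed act_add_left
        act_add_right act_smult_left act_smult_right act_lbracket lie_hom_def lin_map_def)
qed

text \<open>All elements of \<open>M\<close> lift to \<open>L\<close>, so the axioms are inherited from the pullback.\<close>

lemma lie_rep_pushforward:
  assumes rep: "lie_rep L V (\<lambda>x. act (f x))" and M: "lie_algebra M" and f: "lie_hom L M f"
    and surj: "f ` carrier L = carrier M"
  shows "lie_rep M V act"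
proof -
  interpret lie_rep L V "\<lambda>x. act (f x)" by (rule rep)
  have hom: "f (x \<oplus>\<^bsub>L\<^esub> y) = f x \<oplus>\<^bsub>M\<^esub> f y" "f (c \<odot>\<^bsub>L\<^esub> x) = c \<odot>\<^bsub>M\<^esub> f x"
    "f (lbracket L x y) = lbracket M (f x) (f y)" if "x \<in> carrier L" "y \<in> carrier L" for c x y
    using f that by (auto simp: lie_hom_def lin_map_def)
  show ?thesis
  proof (rule lie_repI)
    fix x y v assume "x \<in> carrier M" "y \<in> carrier M" and v: "v \<in> carrier V"
    then obtain a b where ab: "a \<in> carrier L" "x = f a" "b \<in> carrier L" "y = f b" using surj by (metis imageE)
    show "act (x \<oplus>\<^bsub>M\<^esub> y) v = act x v \<oplus>\<^bsub>V\<^esub> act y v"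
      using ab v act_add_left[of a b v] hom[of a b] by simp
    show "act (lbracket M x y) v = act x (act y v) \<ominus>\<^bsub>V\<^esub> act y (act x v)"
      using ab v act_lbracket[of a b v] hom[of a b] by simp
  next
    fix x v assume "x \<in> carrier M" and v: "v \<in> carrier V"
    then obtain a where a: "a \<in> carrier L" "x = f a" using surj by (metis imageE)
    show "act x v \<in> carrier V" using a v act_closed by simp
    show "act (c \<odot>\<^bsub>M\<^esub> x) v = c \<odot>\<^bsub>V\<^esub> act x v" for c
      using a v act_smult_left[of a v c] hom[of a a] by simp
    show "act x (c \<odot>\<^bsub>V\<^esub> v) = c \<odot>\<^bsub>V\<^esub> act x v" for c
      using a v act_smult_right[of a v c] by simp
    show "act x (v \<oplus>\<^bsub>V\<^esub> w) = act x v \<oplus>\<^bsub>V\<^esub> act x w" if "w \<in> carrier V" for w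
      using a v that act_add_right[of a v w] by simp
  qed (simp_all add: M V.vec_space_axioms)
qed

context lie_rep
begin

lemma linear_act: "x \<in> carrier L \<Longrightarrow> linear_mapping V V (act x)"
  by (rule linear_mappingI) (simp_all add: V.vec_space_axioms act_closed act_add_right act_smult_right)

lemma linear_act_left: "v \<in> carrier V \<Longrightarrow> linear_mapping L V (\<lambda>x. act x v)"
  by (rule linear_mappingI)
    (simp_all add: V.vec_space_axioms L.vec_space_axioms act_closed act_add_left act_smult_left)

lemma linear_word: "w \<in> lists (carrier L) \<Longrightarrow> linear_mapping V V (foldr act w)"
proof (induction w)
  case Nil
  then show ?case by (intro linear_mappingI) (simp_all add: V.vec_space_axioms)
next
  case (Cons x w)
  then show ?case using linear_mapping_compose[of V V "foldr act w" V "act x"] linear_act by (simp add: comp_def)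
qed

lemma word_closed: "\<lbrakk>w \<in> lists (carrier L); v \<in> carrier V\<rbrakk> \<Longrightarrow> foldr act w v \<in> carrier V"
  using linear_mapping.closed[OF linear_word] .

end

text \<open>The truncated algebras inherit the identities of a Lie algebra from the polynomials in this way.\<close>

lemma lie_algebra_image:
  assumes L: "lie_algebra L" and M: "vec_space M" and f: "lie_hom L M f" and surj: "f ` carrier L = carrier M"
  shows "lie_algebra M"
proof -
  interpret L: lie_algebra L by (rule L)
  have br: "lbracket M (f x) (f y) = f (lbracket L x y)" if "x \<in> carrier L" "y \<in> carrier L" for x y
    using f that by (auto simp: lie_hom_def)
  interpret f: linear_mapping L M f
    using f M L.vec_space_axioms by (simp add: linear_mapping_def linear_mapping_axioms_def lie_hom_def)
  note [simp] = L.lbracket_closed br f.add[symmetric] f.smult[symmetric]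
  show ?thesis
  proof (rule lie_algebraI[OF M])
    fix x assume "x \<in> carrier M"
    then obtain a where a: "a \<in> carrier L" "x = f a" using surj by (metis imageE)
    then show "lbracket M x x = \<zero>\<^bsub>M\<^esub>" by (simp add: L.lbracket_self f.zero)
    fix y assume "y \<in> carrier M"
    then obtain b where b: "b \<in> carrier L" "y = f b" using surj by (metis imageE)
    show "lbracket M x y \<in> carrier M" using a b by simp
    show "lbracket M (c \<odot>\<^bsub>M\<^esub> x) y = c \<odot>\<^bsub>M\<^esub> lbracket M x y" for c
      using a b by (simp add: L.lbracket_smult_left)
    show "lbracket M x (c \<odot>\<^bsub>M\<^esub> y) = c \<odot>\<^bsub>M\<^esub> lbracket M x y" for c
      using a b by (simp add: L.lbracket_smult_right)
    fix z assume "z \<in> carrier M"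
    then obtain d where d: "d \<in> carrier L" "z = f d" using surj by (metis imageE)
    show "lbracket M (x \<oplus>\<^bsub>M\<^esub> y) z = lbracket M x z \<oplus>\<^bsub>M\<^esub> lbracket M y z"
      using a b d by (simp add: L.lbracket_add_left)
    show "lbracket M x (y \<oplus>\<^bsub>M\<^esub> z) = lbracket M x y \<oplus>\<^bsub>M\<^esub> lbracket M x z"
      using a b d by (simp add: L.lbracket_add_right)
    show "lbracket M x (lbracket M y z) \<oplus>\<^bsub>M\<^esub> lbracket M y (lbracket M z x) \<oplus>\<^bsub>M\<^esub>
        lbracket M z (lbracket M x y) = \<zero>\<^bsub>M\<^esub>"
      using a b d by (simp add: L.jacobi f.zero)
  qed
qed

text \<open>The affine algebra inherits the identities of a Lie algebra from the power series in this way: an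
  injective map which preserves brackets reflects them.\<close>

lemma lie_algebra_pullback:
  assumes M: "lie_algebra M" and L: "vec_space L" and f: "lie_hom L M f"
    and closed: "\<And>x y. \<lbrakk>x \<in> carrier L; y \<in> carrier L\<rbrakk> \<Longrightarrow> lbracket L x y \<in> carrier L"
    and inj: "\<And>x. \<lbrakk>x \<in> carrier L; f x = \<zero>\<^bsub>M\<^esub>\<rbrakk> \<Longrightarrow> x = \<zero>\<^bsub>L\<^esub>"
  shows "lie_algebra L"
proof -
  interpret M: lie_algebra M by (rule M)
  interpret f: linear_mapping L M f
    using f L M.vec_space_axioms by (simp add: linear_mapping_def linear_mapping_axioms_def lie_hom_def)
  have br [simp]: "f (lbracket L x y) = lbracket M (f x) (f y)" if "x \<in> carrier L" "y \<in> carrier L" for x y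
    using f that by (auto simp: lie_hom_def)
  have eqI: "x = y" if "x \<in> carrier L" "y \<in> carrier L" "f x = f y" for x y
    using inj[of "x \<ominus>\<^bsub>L\<^esub> y"] that by (simp add: f.diff f.V.diff_eq_zero_iff)
  note [simp] = closed f.add f.smult
  show ?thesis
    by (rule lie_algebraI[OF L])
      (auto intro!: eqI inj simp: M.lbracket_add_left M.lbracket_add_right M.lbracket_smult_left
        M.lbracket_smult_right M.lbracket_self M.jacobi f.zero)
qed

lemma lie_rep_cong:
  assumes "lie_rep L V act" "\<And>x v. \<lbrakk>x \<in> carrier L; v \<in> carrier V\<rbrakk> \<Longrightarrow> act' x v = act x v"
  shows "lie_rep L V act'"
proof -
  interpret lie_rep L V act by fact
  show ?thesis
    by (rule lie_repI)
      (simp_all add: assms(2) L.lie_algebra_axioms V.vec_space_axioms act_closed act_add_left act_add_right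
        act_smult_left act_smult_right act_lbracket L.lbracket_closed)
qed

lemma lie_rep_invariant_subspace:
  assumes rep: "lie_rep L V act" and S: "submodule S KK V"
    and inv: "\<And>x v. \<lbrakk>x \<in> carrier L; v \<in> S\<rbrakk> \<Longrightarrow> act x v \<in> S"
  shows "lie_rep L (V\<lparr>carrier := S\<rparr>) act"
proof -
  interpret lie_rep L V act by (rule rep)
  interpret S: vec_space "V\<lparr>carrier := S\<rparr>" by (rule V.submodule_vec_space[OF S])
  have [simp]: "v \<in> S \<Longrightarrow> v \<in> carrier V" for v by (rule V.submodule_mem_carrier[OF S])
  have "u \<ominus>\<^bsub>V\<lparr>carrier := S\<rparr>\<^esub> v = u \<ominus>\<^bsub>V\<^esub> v" if "u \<in> S" "v \<in> S" for u v
    using that by (simp add: S.diff_eq_smult V.diff_eq_smult)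
  then show ?thesis
    by (intro lie_repI L.lie_algebra_axioms S.vec_space_axioms)
      (simp_all add: inv act_add_left act_add_right act_smult_left act_smult_right act_lbracket)
qed

lemma lie_rep_quotient:
  assumes rep: "lie_rep L V act" and S: "submodule S KK V"
    and inv: "\<And>x v. \<lbrakk>x \<in> carrier L; v \<in> S\<rbrakk> \<Longrightarrow> act x v \<in> S"
  shows "lie_rep L (mod_quot V S) (\<lambda>x Z. \<Union>v\<in>Z. S +>\<^bsub>V\<^esub> act x v)"
    and "\<lbrakk>x \<in> carrier L; v \<in> carrier V\<rbrakk> \<Longrightarrow> (\<Union>u\<in>S +>\<^bsub>V\<^esub> v. S +>\<^bsub>V\<^esub> act x u) = S +>\<^bsub>V\<^esub> act x v"
proof -
  interpret lie_rep L V act by (rule rep)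
  have *: "(\<Union>u\<in>S +>\<^bsub>V\<^esub> v. S +>\<^bsub>V\<^esub> act x u) = S +>\<^bsub>V\<^esub> act x v"
    if "x \<in> carrier L" "v \<in> carrier V" for x v
    using linear_mapping.UN_coset[OF linear_act[OF that(1)] S S _ that(2)] inv[OF that(1)] by blast
  then show "\<lbrakk>x \<in> carrier L; v \<in> carrier V\<rbrakk> \<Longrightarrow> (\<Union>u\<in>S +>\<^bsub>V\<^esub> v. S +>\<^bsub>V\<^esub> act x u) = S +>\<^bsub>V\<^esub> act x v" .
  interpret Q: vec_space "mod_quot V S" by (rule V.vec_space_mod_quot[OF S])
  interpret c: linear_mapping V "mod_quot V S" "\<lambda>v. S +>\<^bsub>V\<^esub> v" by (rule V.linear_mapping_coset[OF S])
  note [simp] = * c.add[symmetric] c.smult[symmetric] c.diff[symmetric] act_closed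
  show "lie_rep L (mod_quot V S) (\<lambda>x Z. \<Union>v\<in>Z. S +>\<^bsub>V\<^esub> act x v)"
  proof (rule lie_repI[OF L.lie_algebra_axioms Q.vec_space_axioms])
    fix x Z assume x: "x \<in> carrier L" and "Z \<in> carrier (mod_quot V S)"
    then obtain v where v: "v \<in> carrier V" "Z = S +>\<^bsub>V\<^esub> v" by (elim V.mod_quot_carrierE)
    show "(\<Union>v\<in>Z. S +>\<^bsub>V\<^esub> act x v) \<in> carrier (mod_quot V S)" using x v by simp
    show "(\<Union>v\<in>c \<odot>\<^bsub>mod_quot V S\<^esub> Z. S +>\<^bsub>V\<^esub> act x v) = c \<odot>\<^bsub>mod_quot V S\<^esub> (\<Union>v\<in>Z. S +>\<^bsub>V\<^esub> act x v)" for c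
      using x v by (simp add: act_smult_right)
    show "(\<Union>v\<in>Z. S +>\<^bsub>V\<^esub> act (c \<odot>\<^bsub>L\<^esub> x) v) = c \<odot>\<^bsub>mod_quot V S\<^esub> (\<Union>v\<in>Z. S +>\<^bsub>V\<^esub> act x v)" for c
      using x v by (simp add: act_smult_left)
    show "(\<Union>v\<in>Z \<oplus>\<^bsub>mod_quot V S\<^esub> Y. S +>\<^bsub>V\<^esub> act x v) =
        (\<Union>v\<in>Z. S +>\<^bsub>V\<^esub> act x v) \<oplus>\<^bsub>mod_quot V S\<^esub> (\<Union>v\<in>Y. S +>\<^bsub>V\<^esub> act x v)"
      if "Y \<in> carrier (mod_quot V S)" for Y
    proof -
      from that obtain u where "u \<in> carrier V" "Y = S +>\<^bsub>V\<^esub> u" by (elim V.mod_quot_carrierE)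
      then show ?thesis using x v by (simp add: act_add_right)
    qed
    fix y assume y: "y \<in> carrier L"
    show "(\<Union>v\<in>Z. S +>\<^bsub>V\<^esub> act (x \<oplus>\<^bsub>L\<^esub> y) v) =
        (\<Union>v\<in>Z. S +>\<^bsub>V\<^esub> act x v) \<oplus>\<^bsub>mod_quot V S\<^esub> (\<Union>v\<in>Z. S +>\<^bsub>V\<^esub> act y v)"
      using x y v by (simp add: act_add_left)
    show "(\<Union>v\<in>Z. S +>\<^bsub>V\<^esub> act (lbracket L x y) v) =
        (\<Union>v\<in>\<Union>v\<in>Z. S +>\<^bsub>V\<^esub> act y v. S +>\<^bsub>V\<^esub> act x v) \<ominus>\<^bsub>mod_quot V S\<^esub>
        (\<Union>v\<in>\<Union>v\<in>Z. S +>\<^bsub>V\<^esub> act x v. S +>\<^bsub>V\<^esub> act y v)"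
      using x y v by (simp add: act_lbracket L.lbracket_closed del: UN_simps UN_UN_flatten)
  qed
qed

lemma lie_rep_image:
  fixes M :: "('k::field, 'w, 'p) module_scheme"
  assumes rep: "lie_rep L V act" and \<psi>: "linear_mapping V M \<psi>" and inj: "inj_on \<psi> (carrier V)"
  defines "W \<equiv> M\<lparr>carrier := \<psi> ` carrier V\<rparr>" and "act' \<equiv> \<lambda>x w. \<psi> (act x (inv_into (carrier V) \<psi> w))"
  shows "lie_rep L W act'" and "linear_mapping V W \<psi>"
    and "v \<in> carrier V \<Longrightarrow> act' x (\<psi> v) = \<psi> (act x v)"
proof -
  interpret lie_rep L V act by (rule rep)
  interpret \<psi>: linear_mapping V M \<psi> by (rule \<psi>)
  have sub: "submodule (\<psi> ` carrier V) KK M" by (intro \<psi>.submodule_image V.subspaceI) auto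
  have W: "vec_space W" unfolding W_def by (rule \<psi>.W.submodule_vec_space[OF sub])
  show lin: "linear_mapping V W \<psi>"
    by (rule linear_mappingI) (simp_all add: W V.vec_space_axioms, simp_all add: W_def \<psi>.add \<psi>.smult)
  interpret \<psi>': linear_mapping V W \<psi> by (rule lin)
  show act': "act' x (\<psi> v) = \<psi> (act x v)" if "v \<in> carrier V" for x v
    using inj that by (simp add: act'_def)
  have E: "w \<in> carrier W \<Longrightarrow> \<exists>v\<in>carrier V. w = \<psi> v" for w by (auto simp: W_def)
  note [simp] = act' act_closed \<psi>'.add[symmetric] \<psi>'.smult[symmetric] \<psi>'.diff[symmetric]
  show "lie_rep L W act'"
  proof (rule lie_repI[OF L.lie_algebra_axioms W])
    fix x w assume x: "x \<in> carrier L" and "w \<in> carrier W"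
    then obtain v where v: "v \<in> carrier V" "w = \<psi> v" using E by blast
    show "act' x w \<in> carrier W" using x v by simp
    show "act' (c \<odot>\<^bsub>L\<^esub> x) w = c \<odot>\<^bsub>W\<^esub> act' x w" for c using x v by (simp add: act_smult_left)
    show "act' x (c \<odot>\<^bsub>W\<^esub> w) = c \<odot>\<^bsub>W\<^esub> act' x w" for c using x v by (simp add: act_smult_right)
    show "act' x (w \<oplus>\<^bsub>W\<^esub> u) = act' x w \<oplus>\<^bsub>W\<^esub> act' x u" if "u \<in> carrier W" for u
      using E[OF that] x v by (auto simp: act_add_right)
    fix y assume y: "y \<in> carrier L"
    show "act' (x \<oplus>\<^bsub>L\<^esub> y) w = act' x w \<oplus>\<^bsub>W\<^esub> act' y w" using x y v by (simp add: act_add_left)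
    show "act' (lbracket L x y) w = act' x (act' y w) \<ominus>\<^bsub>W\<^esub> act' y (act' x w)"
      using x y v by (simp add: act_lbracket)
  qed
qed

section \<open>Free associative algebras and enveloping algebras\<close>

lemma free_alg_simps:
  "carrier (free_alg S) = carrier (free_module (lists S))"
  "\<zero>\<^bsub>free_alg S\<^esub> = (\<lambda>_. 0)" "\<one>\<^bsub>free_alg S\<^esub> = single []"
  "p \<oplus>\<^bsub>free_alg S\<^esub> q = (\<lambda>x. p x + q x)" "c \<odot>\<^bsub>free_alg S\<^esub> p = (\<lambda>x. c * p x)"
  "p \<otimes>\<^bsub>free_alg S\<^esub> q = (\<lambda>w. \<Sum>i\<le>length w. p (take i w) * q (drop i w))"
  by (simp_all add: free_alg_def free_module_def)

lemma vec_space_free_alg: "vec_space (free_alg S)"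
proof -
  interpret F: vec_space "free_module (lists S)" by (rule vec_space_free_module)
  show ?thesis
    by (rule vec_spaceI)
      (use F.add.m_closed F.smult_closed F.zero_closed in \<open>auto simp: free_alg_simps algebra_simps\<close>)
qed

lemma linear_mapping_free_alg:
  "linear_mapping (free_module (lists S)) V f \<Longrightarrow> linear_mapping (free_alg S) V f"
  by (simp add: linear_mapping_def linear_mapping_axioms_def lin_map_def vec_space_free_alg free_alg_simps)

lemma lin_span_free_alg:
  "lin_span (free_alg S) (single ` lists S) = carrier (free_alg S :: ('k::field, 'a list \<Rightarrow> 'k) module)"
proof -
  have "finsum (free_alg S :: ('k, 'a list \<Rightarrow> 'k) module) f A = finsum (free_module (lists S)) f A"
    for f :: "('a list \<Rightarrow> 'k) \<Rightarrow> 'a list \<Rightarrow> 'k" and A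
    by (simp add: finsum_def free_alg_def)
  then show ?thesis using lin_span_single[of "lists S"] by (simp add: lin_span_def free_alg_simps)
qed

lemma free_alg_mult_closed:
  assumes p: "p \<in> carrier (free_alg S)" and q: "q \<in> carrier (free_alg S)"
  shows "p \<otimes>\<^bsub>free_alg S\<^esub> q \<in> carrier (free_alg S)"
proof -
  let ?U = "(\<lambda>(u, v). u @ v) ` ({u. p u \<noteq> 0} \<times> {v. q v \<noteq> 0})"
  have sub: "{w. (p \<otimes>\<^bsub>free_alg S\<^esub> q) w \<noteq> 0} \<subseteq> ?U"
  proof
    fix w assume "w \<in> {w. (p \<otimes>\<^bsub>free_alg S\<^esub> q) w \<noteq> 0}"
    then have "(\<Sum>i\<le>length w. p (take i w) * q (drop i w)) \<noteq> 0" by (simp add: free_alg_simps)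
    then obtain i where "p (take i w) * q (drop i w) \<noteq> 0"
      using sum.not_neutral_contains_not_neutral by blast
    then have "(take i w, drop i w) \<in> {u. p u \<noteq> 0} \<times> {v. q v \<noteq> 0}" by auto
    then have "(\<lambda>(u, v). u @ v) (take i w, drop i w) \<in> ?U" by (rule imageI)
    then show "w \<in> ?U" by simp
  qed
  moreover have "finite ?U" using p q by (auto simp: free_alg_simps)
  moreover have "?U \<subseteq> lists S" using p q by (auto simp: free_alg_simps subset_iff in_lists_conv_set)
  ultimately show ?thesis using finite_subset[OF sub] by (auto simp: free_alg_simps)
qed

lemma ring_free_alg: "ring (free_alg S :: ('k::field, 'a list \<Rightarrow> 'k) module)"
proof (rule ringI)
  let ?F = "free_alg S :: ('k, 'a list \<Rightarrow> 'k) module"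
  interpret F: vec_space ?F by (rule vec_space_free_alg)
  show "abelian_group ?F" by (rule F.abelian_group_axioms)
  show "Group.monoid ?F"
  proof (rule monoidI)
    show "\<And>x y. \<lbrakk>x \<in> carrier ?F; y \<in> carrier ?F\<rbrakk> \<Longrightarrow> x \<otimes>\<^bsub>?F\<^esub> y \<in> carrier ?F"
      by (rule free_alg_mult_closed)
    show "\<one>\<^bsub>?F\<^esub> \<in> carrier ?F" by (auto simp: free_alg_simps single_def split: if_splits)
    show "\<one>\<^bsub>?F\<^esub> \<otimes>\<^bsub>?F\<^esub> p = p" for p
    proof
      fix w
      have "(\<Sum>i\<le>length w. single [] (take i w) * p (drop i w)) =
          (\<Sum>i\<le>length w. if i = 0 then p w else 0)"
        by (rule sum.cong) (auto simp: single_def)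
      then show "(\<one>\<^bsub>?F\<^esub> \<otimes>\<^bsub>?F\<^esub> p) w = p w" by (simp add: free_alg_simps)
    qed
    show "p \<otimes>\<^bsub>?F\<^esub> \<one>\<^bsub>?F\<^esub> = p" for p
    proof
      fix w
      have "(\<Sum>i\<le>length w. p (take i w) * single [] (drop i w)) =
          (\<Sum>i\<le>length w. if i = length w then p w else 0)"
        by (rule sum.cong) (auto simp: single_def)
      then show "(p \<otimes>\<^bsub>?F\<^esub> \<one>\<^bsub>?F\<^esub>) w = p w" by (simp add: free_alg_simps)
    qed
    show "(p \<otimes>\<^bsub>?F\<^esub> q) \<otimes>\<^bsub>?F\<^esub> r = p \<otimes>\<^bsub>?F\<^esub> (q \<otimes>\<^bsub>?F\<^esub> r)" for p q r
    proof
      fix w :: "'a list"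
      let ?n = "length w"
      let ?f = "\<lambda>a b c. p (take a w) * q (take b (drop a w)) * r (drop (?n - c) w)"
      have "((p \<otimes>\<^bsub>?F\<^esub> q) \<otimes>\<^bsub>?F\<^esub> r) w = (\<Sum>i=0..?n. \<Sum>j=0..i. ?f j (i - j) (?n - i))"
        unfolding free_alg_simps sum_distrib_right atMost_atLeast0
        by (intro sum.cong refl) (auto simp: min_def drop_take intro!: sum.cong)
      also have "\<dots> = (\<Sum>j=0..?n. \<Sum>i=0..?n - j. ?f j i (?n - j - i))"
        by (rule fps_mult_assoc_lemma)
      also have "\<dots> = (p \<otimes>\<^bsub>?F\<^esub> (q \<otimes>\<^bsub>?F\<^esub> r)) w"
        unfolding free_alg_simps sum_distrib_left atMost_atLeast0
        by (intro sum.cong refl) (auto simp: mult.assoc add.commute)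
      finally show "((p \<otimes>\<^bsub>?F\<^esub> q) \<otimes>\<^bsub>?F\<^esub> r) w = (p \<otimes>\<^bsub>?F\<^esub> (q \<otimes>\<^bsub>?F\<^esub> r)) w" .
    qed
  qed
qed (simp_all add: free_alg_simps algebra_simps sum.distrib)

lemma free_alg_smult_mult:
  "(c \<odot>\<^bsub>free_alg S\<^esub> p) \<otimes>\<^bsub>free_alg S\<^esub> q = c \<odot>\<^bsub>free_alg S\<^esub> (p \<otimes>\<^bsub>free_alg S\<^esub> q)"
  "p \<otimes>\<^bsub>free_alg S\<^esub> (c \<odot>\<^bsub>free_alg S\<^esub> q) = c \<odot>\<^bsub>free_alg S\<^esub> (p \<otimes>\<^bsub>free_alg S\<^esub> q)"
  by (simp_all add: free_alg_simps sum_distrib_left mult_ac)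

lemma single_mult_single:
  "(single u :: 'a list \<Rightarrow> 'k::field) \<otimes>\<^bsub>free_alg S\<^esub> single v = single (u @ v)"
proof
  fix w :: "'a list"
  have "(single u (take i w) * single v (drop i w) :: 'k) = (if i = length u then single (u @ v) w else 0)"
    if "i \<in> {..length w}" for i
  proof (cases "i = length u")
    case True
    have "(take i w = u \<and> drop i w = v) \<longleftrightarrow> w = u @ v"
      using True by (metis append_eq_conv_conj)
    then show ?thesis using True by (auto simp: single_def)
  next
    case False
    then have "take i w \<noteq> u" using that by auto
    then show ?thesis using False by (simp add: single_def)
  qed
  then have "(\<Sum>i\<le>length w. single u (take i w) * single v (drop i w) :: 'k) =
      (\<Sum>i\<le>length w. if i = length u then single (u @ v) w else 0)"
    by (intro sum.cong) auto
  also have "\<dots> = single (u @ v) w"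
    by (auto simp: single_def)
  finally show "((single u :: 'a list \<Rightarrow> 'k) \<otimes>\<^bsub>free_alg S\<^esub> single v) w = single (u @ v) w"
    by (simp add: free_alg_simps)
qed

lemma single_in_free_alg: "w \<in> lists S \<Longrightarrow> single w \<in> carrier (free_alg S)"
  unfolding free_alg_simps by (rule single_in_free_module)

lemma linear_mult_left:
  assumes "q \<in> carrier (free_alg S)"
  shows "linear_mapping (free_alg S) (free_alg S) (\<lambda>p. p \<otimes>\<^bsub>free_alg S\<^esub> q)"
proof -
  interpret ring "free_alg S" by (rule ring_free_alg)
  show ?thesis
    using assms by (intro linear_mappingI vec_space_free_alg m_closed l_distr free_alg_smult_mult)
qed

lemma linear_mult_right:
  assumes "q \<in> carrier (free_alg S)"
  shows "linear_mapping (free_alg S) (free_alg S) (\<lambda>p. q \<otimes>\<^bsub>free_alg S\<^esub> p)"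
proof -
  interpret ring "free_alg S" by (rule ring_free_alg)
  show ?thesis
    using assms by (intro linear_mappingI vec_space_free_alg m_closed r_distr free_alg_smult_mult)
qed

lemma ideal_submodule:
  assumes "ideal J (free_alg S)"
  shows "submodule J KK (free_alg S)"
proof -
  interpret ideal J "free_alg S" by fact
  interpret F: vec_space "free_alg S" by (rule vec_space_free_alg)
  show ?thesis
  proof (rule F.subspaceI)
    fix c x assume x: "x \<in> J"
    then have xF: "x \<in> carrier (free_alg S)" by (rule a_Hcarr)
    have "(c \<odot>\<^bsub>free_alg S\<^esub> \<one>\<^bsub>free_alg S\<^esub>) \<otimes>\<^bsub>free_alg S\<^esub> x \<in> J"
      using x by (intro I_l_closed F.smult_closed one_closed) simp_all
    moreover have "(c \<odot>\<^bsub>free_alg S\<^esub> \<one>\<^bsub>free_alg S\<^esub>) \<otimes>\<^bsub>free_alg S\<^esub> x = c \<odot>\<^bsub>free_alg S\<^esub> x"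
      unfolding free_alg_smult_mult l_one[OF xF] ..
    ultimately show "c \<odot>\<^bsub>free_alg S\<^esub> x \<in> J" by (simp only:)
  qed (use a_subset a_closed additive_subgroup.zero_closed[OF is_additive_subgroup] in auto)
qed

text \<open>The generators of \<^const>\<open>env_ideal\<close>, named because ideals are shown to contain them in several
  places.\<close>
definition env_rel :: "('k::field, 'a, 'm) lie_scheme \<Rightarrow> ('a list \<Rightarrow> 'k) set" where
  "env_rel L = (let F = free_alg (carrier L) in
     {single [x \<oplus>\<^bsub>L\<^esub> y] \<ominus>\<^bsub>F\<^esub> (single [x] \<oplus>\<^bsub>F\<^esub> single [y]) | x y. x \<in> carrier L \<and> y \<in> carrier L} \<union>
      {single [c \<odot>\<^bsub>L\<^esub> x] \<ominus>\<^bsub>F\<^esub> c \<odot>\<^bsub>F\<^esub> single [x] | c x. x \<in> carrier L} \<union>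
      {single [lbracket L x y] \<ominus>\<^bsub>F\<^esub> (single [x, y] \<ominus>\<^bsub>F\<^esub> single [y, x]) | x y.
         x \<in> carrier L \<and> y \<in> carrier L})"

lemma env_relI:
  "\<lbrakk>x \<in> carrier L; y \<in> carrier L\<rbrakk> \<Longrightarrow> single [x \<oplus>\<^bsub>L\<^esub> y] \<ominus>\<^bsub>free_alg (carrier L)\<^esub>
      (single [x] \<oplus>\<^bsub>free_alg (carrier L)\<^esub> single [y]) \<in> env_rel L"
  "x \<in> carrier L \<Longrightarrow> single [c \<odot>\<^bsub>L\<^esub> x] \<ominus>\<^bsub>free_alg (carrier L)\<^esub>
      c \<odot>\<^bsub>free_alg (carrier L)\<^esub> single [x] \<in> env_rel L"
  "\<lbrakk>x \<in> carrier L; y \<in> carrier L\<rbrakk> \<Longrightarrow> single [lbracket L x y] \<ominus>\<^bsub>free_alg (carrier L)\<^esub>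
      (single [x, y] \<ominus>\<^bsub>free_alg (carrier L)\<^esub> single [y, x]) \<in> env_rel L"
  unfolding env_rel_def Let_def by blast+

lemma env_relE:
  assumes "q \<in> env_rel L"
  obtains x y where "x \<in> carrier L" "y \<in> carrier L" "q = single [x \<oplus>\<^bsub>L\<^esub> y] \<ominus>\<^bsub>free_alg (carrier L)\<^esub>
      (single [x] \<oplus>\<^bsub>free_alg (carrier L)\<^esub> single [y])"
  | c x where "x \<in> carrier L" "q = single [c \<odot>\<^bsub>L\<^esub> x] \<ominus>\<^bsub>free_alg (carrier L)\<^esub>
      c \<odot>\<^bsub>free_alg (carrier L)\<^esub> single [x]"
  | x y where "x \<in> carrier L" "y \<in> carrier L" "q = single [lbracket L x y] \<ominus>\<^bsub>free_alg (carrier L)\<^esub>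
      (single [x, y] \<ominus>\<^bsub>free_alg (carrier L)\<^esub> single [y, x])"
  using assms unfolding env_rel_def Let_def by blast

lemma env_ideal_eq: "env_ideal L = Idl\<^bsub>free_alg (carrier L)\<^esub> (env_rel L)"
  by (simp add: env_ideal_def env_rel_def Let_def)

context lie_algebra
begin

abbreviation F where "F \<equiv> free_alg (carrier L) :: ('k, 'a list \<Rightarrow> 'k) module"
abbreviation J where "J \<equiv> env_ideal L"

interpretation F: vec_space F by (rule vec_space_free_alg)
interpretation FR: ring F by (rule ring_free_alg)

lemma single_letters:
  "x \<in> carrier L \<Longrightarrow> single [x] \<in> carrier F"
  "\<lbrakk>x \<in> carrier L; y \<in> carrier L\<rbrakk> \<Longrightarrow> single [x, y] \<in> carrier F"
  by (rule single_in_free_alg; simp)+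

lemma env_rel_closed: "env_rel L \<subseteq> carrier F"
proof -
  have "single [x \<oplus> y] \<ominus>\<^bsub>F\<^esub> (single [x] \<oplus>\<^bsub>F\<^esub> single [y]) \<in> carrier F"
    "single [lbracket L x y] \<ominus>\<^bsub>F\<^esub> (single [x, y] \<ominus>\<^bsub>F\<^esub> single [y, x]) \<in> carrier F"
    "single [c \<odot> x] \<ominus>\<^bsub>F\<^esub> c \<odot>\<^bsub>F\<^esub> single [x] \<in> carrier F" if "x \<in> carrier L" "y \<in> carrier L" for x y c
    using that by (intro F.minus_closed F.add.m_closed F.smult_closed single_letters lbracket_closed
        smult_closed add.m_closed; simp)+
  then show ?thesis by (auto simp: env_rel_def Let_def)
qed

lemma ideal_env: "ideal J F"
  unfolding env_ideal_eq by (rule FR.genideal_ideal[OF env_rel_closed])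

lemma submodule_env: "submodule J KK F"
  by (rule ideal_submodule[OF ideal_env])

lemma env_rel_in_ideal: "p \<in> env_rel L \<Longrightarrow> p \<in> J"
  using FR.genideal_self[OF env_rel_closed] by (auto simp: env_ideal_eq)

lemma env_ideal_least: "\<lbrakk>ideal I F; env_rel L \<subseteq> I\<rbrakk> \<Longrightarrow> J \<subseteq> I"
  unfolding env_ideal_eq by (rule FR.genideal_minimal)

lemma env_simps:
  "carrier (env L) = carrier (mod_quot F J)" "\<zero>\<^bsub>env L\<^esub> = \<zero>\<^bsub>mod_quot F J\<^esub>"
  "Y \<oplus>\<^bsub>env L\<^esub> Z = Y \<oplus>\<^bsub>mod_quot F J\<^esub> Z" "c \<odot>\<^bsub>env L\<^esub> Z = c \<odot>\<^bsub>mod_quot F J\<^esub> Z"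
  "Y \<otimes>\<^bsub>env L\<^esub> Z = rcoset_mult F J Y Z" "\<one>\<^bsub>env L\<^esub> = J +>\<^bsub>F\<^esub> single []"
  by (simp_all add: env_def Let_def FactRing_def free_alg_simps)

lemma vec_space_env: "vec_space (env L)"
proof -
  interpret Q: vec_space "mod_quot F J" by (rule F.vec_space_mod_quot[OF submodule_env])
  show ?thesis
    by (rule vec_spaceI)
      (simp_all add: env_simps Q.a_ac Q.smult_add_left Q.smult_add_right Q.smult_smult)
qed

lemma linear_env_coset: "linear_mapping F (env L) (\<lambda>p. J +>\<^bsub>F\<^esub> p)"
  using F.linear_mapping_coset[OF submodule_env] vec_space_env
  by (simp add: linear_mapping_def linear_mapping_axioms_def lin_map_def env_simps)

lemma env_carrierE:
  assumes "Z \<in> carrier (env L)" obtains p where "p \<in> carrier F" "Z = J +>\<^bsub>F\<^esub> p"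
  using assms unfolding env_simps by (rule F.mod_quot_carrierE)

lemma env_coset_closed: "p \<in> carrier F \<Longrightarrow> J +>\<^bsub>F\<^esub> p \<in> carrier (env L)"
  by (rule linear_mapping.closed[OF linear_env_coset])

lemma env_mult_coset:
  "\<lbrakk>p \<in> carrier F; q \<in> carrier F\<rbrakk> \<Longrightarrow>
    (J +>\<^bsub>F\<^esub> p) \<otimes>\<^bsub>env L\<^esub> (J +>\<^bsub>F\<^esub> q) = J +>\<^bsub>F\<^esub> (p \<otimes>\<^bsub>F\<^esub> q)"
  unfolding env_simps by (rule ideal.rcoset_mult_add[OF ideal_env])

lemma env_mult_closed: "\<lbrakk>Y \<in> carrier (env L); Z \<in> carrier (env L)\<rbrakk> \<Longrightarrow> Y \<otimes>\<^bsub>env L\<^esub> Z \<in> carrier (env L)"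
  by (elim env_carrierE) (simp only: env_mult_coset env_coset_closed FR.m_closed)

lemma env_mult_assoc:
  "\<lbrakk>W \<in> carrier (env L); Y \<in> carrier (env L); Z \<in> carrier (env L)\<rbrakk> \<Longrightarrow>
    (W \<otimes>\<^bsub>env L\<^esub> Y) \<otimes>\<^bsub>env L\<^esub> Z = W \<otimes>\<^bsub>env L\<^esub> (Y \<otimes>\<^bsub>env L\<^esub> Z)"
  by (elim env_carrierE) (simp only: env_mult_coset FR.m_closed FR.m_assoc)

lemma linear_env_mult_right: "W \<in> carrier (env L) \<Longrightarrow> linear_mapping (env L) (env L) (\<lambda>Z. W \<otimes>\<^bsub>env L\<^esub> Z)"
proof (rule linear_mappingI)
  interpret c: linear_mapping F "env L" "\<lambda>p. J +>\<^bsub>F\<^esub> p" by (rule linear_env_coset)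
  assume W: "W \<in> carrier (env L)"
  then obtain p where p: "p \<in> carrier F" "W = J +>\<^bsub>F\<^esub> p" by (rule env_carrierE)
  fix Y assume Y: "Y \<in> carrier (env L)"
  then obtain q where q: "q \<in> carrier F" "Y = J +>\<^bsub>F\<^esub> q" by (rule env_carrierE)
  show "W \<otimes>\<^bsub>env L\<^esub> Y \<in> carrier (env L)" using W Y by (rule env_mult_closed)
  show "W \<otimes>\<^bsub>env L\<^esub> (c \<odot>\<^bsub>env L\<^esub> Y) = c \<odot>\<^bsub>env L\<^esub> (W \<otimes>\<^bsub>env L\<^esub> Y)" for c
    using p q by (simp only: c.smult[symmetric] env_mult_coset F.smult_closed KK_simps UNIV_I
        free_alg_smult_mult FR.m_closed)
  fix Z assume "Z \<in> carrier (env L)"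
  then obtain r where r: "r \<in> carrier F" "Z = J +>\<^bsub>F\<^esub> r" by (rule env_carrierE)
  show "W \<otimes>\<^bsub>env L\<^esub> (Y \<oplus>\<^bsub>env L\<^esub> Z) = W \<otimes>\<^bsub>env L\<^esub> Y \<oplus>\<^bsub>env L\<^esub> W \<otimes>\<^bsub>env L\<^esub> Z"
    using p q r by (simp only: c.add[symmetric] env_mult_coset F.add.m_closed FR.m_closed FR.r_distr)
qed (rule vec_space_env)+

lemma linear_env_mult_left: "W \<in> carrier (env L) \<Longrightarrow> linear_mapping (env L) (env L) (\<lambda>Z. Z \<otimes>\<^bsub>env L\<^esub> W)"
proof (rule linear_mappingI)
  interpret c: linear_mapping F "env L" "\<lambda>p. J +>\<^bsub>F\<^esub> p" by (rule linear_env_coset)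
  assume W: "W \<in> carrier (env L)"
  then obtain p where p: "p \<in> carrier F" "W = J +>\<^bsub>F\<^esub> p" by (rule env_carrierE)
  fix Y assume Y: "Y \<in> carrier (env L)"
  then obtain q where q: "q \<in> carrier F" "Y = J +>\<^bsub>F\<^esub> q" by (rule env_carrierE)
  show "Y \<otimes>\<^bsub>env L\<^esub> W \<in> carrier (env L)" using Y W by (rule env_mult_closed)
  show "(c \<odot>\<^bsub>env L\<^esub> Y) \<otimes>\<^bsub>env L\<^esub> W = c \<odot>\<^bsub>env L\<^esub> (Y \<otimes>\<^bsub>env L\<^esub> W)" for c
    using p q by (simp only: c.smult[symmetric] env_mult_coset F.smult_closed KK_simps UNIV_I
        free_alg_smult_mult FR.m_closed)
  fix Z assume "Z \<in> carrier (env L)"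
  then obtain r where r: "r \<in> carrier F" "Z = J +>\<^bsub>F\<^esub> r" by (rule env_carrierE)
  show "(Y \<oplus>\<^bsub>env L\<^esub> Z) \<otimes>\<^bsub>env L\<^esub> W = Y \<otimes>\<^bsub>env L\<^esub> W \<oplus>\<^bsub>env L\<^esub> Z \<otimes>\<^bsub>env L\<^esub> W"
    using p q r by (simp only: c.add[symmetric] env_mult_coset F.add.m_closed FR.m_closed FR.l_distr)
qed (rule vec_space_env)+

lemma env_word_closed: "w \<in> lists (carrier L) \<Longrightarrow> env_word L w \<in> carrier (env L)"
  unfolding env_word_def by (rule env_coset_closed[OF single_in_free_alg])

lemma env_word_append:
  "\<lbrakk>u \<in> lists (carrier L); v \<in> lists (carrier L)\<rbrakk> \<Longrightarrow>
    env_word L (u @ v) = env_word L u \<otimes>\<^bsub>env L\<^esub> env_word L v"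
  by (simp only: env_word_def env_mult_coset single_in_free_alg single_mult_single)

lemma env_one_closed: "\<one>\<^bsub>env L\<^esub> \<in> carrier (env L)"
  using env_word_closed[of "[]"] by (simp add: env_word_def env_simps)

lemma env_one_eq: "\<one>\<^bsub>env L\<^esub> = env_word L []"
  by (simp add: env_word_def env_simps)

lemma env_r_one: "W \<in> carrier (env L) \<Longrightarrow> W \<otimes>\<^bsub>env L\<^esub> \<one>\<^bsub>env L\<^esub> = W"
proof -
  assume "W \<in> carrier (env L)"
  then obtain p where p: "p \<in> carrier F" "W = J +>\<^bsub>F\<^esub> p" by (rule env_carrierE)
  have one: "\<one>\<^bsub>env L\<^esub> = J +>\<^bsub>F\<^esub> \<one>\<^bsub>F\<^esub>" by (simp add: env_simps free_alg_simps)
  have "W \<otimes>\<^bsub>env L\<^esub> \<one>\<^bsub>env L\<^esub> = J +>\<^bsub>F\<^esub> (p \<otimes>\<^bsub>F\<^esub> \<one>\<^bsub>F\<^esub>)"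
    unfolding one p(2) by (rule env_mult_coset[OF p(1) FR.one_closed])
  then show ?thesis using p by (simp add: FR.r_one)
qed

lemma env_l_one: "W \<in> carrier (env L) \<Longrightarrow> \<one>\<^bsub>env L\<^esub> \<otimes>\<^bsub>env L\<^esub> W = W"
proof -
  assume "W \<in> carrier (env L)"
  then obtain p where p: "p \<in> carrier F" "W = J +>\<^bsub>F\<^esub> p" by (rule env_carrierE)
  have one: "\<one>\<^bsub>env L\<^esub> = J +>\<^bsub>F\<^esub> \<one>\<^bsub>F\<^esub>" by (simp add: env_simps free_alg_simps)
  have "\<one>\<^bsub>env L\<^esub> \<otimes>\<^bsub>env L\<^esub> W = J +>\<^bsub>F\<^esub> (\<one>\<^bsub>F\<^esub> \<otimes>\<^bsub>F\<^esub> p)"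
    unfolding one p(2) by (rule env_mult_coset[OF FR.one_closed p(1)])
  then show ?thesis using p by (simp add: FR.l_one)
qed

lemma env_span: "lin_span (env L) (env_word L ` lists (carrier L)) = carrier (env L)"
proof -
  interpret c: linear_mapping F "env L" "\<lambda>p. J +>\<^bsub>F\<^esub> p" by (rule linear_env_coset)
  have "single ` lists (carrier L) \<subseteq> carrier F" by (intro image_subsetI single_in_free_alg)
  from c.image_lin_span[OF this]
  have "lin_span (env L) (env_word L ` lists (carrier L)) = (\<lambda>p. J +>\<^bsub>F\<^esub> p) ` carrier F"
    unfolding lin_span_free_alg by (simp add: image_image env_word_def)
  also have "\<dots> = carrier (env L)" by (simp only: env_simps carrier_mod_quot)
  finally show ?thesis .
qed

lemma env_word_add:
  assumes "x \<in> carrier L" "y \<in> carrier L"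
  shows "env_word L [x \<oplus> y] = env_word L [x] \<oplus>\<^bsub>env L\<^esub> env_word L [y]"
proof -
  interpret c: linear_mapping F "env L" "\<lambda>p. J +>\<^bsub>F\<^esub> p" by (rule linear_env_coset)
  have "single [x \<oplus> y] \<ominus>\<^bsub>F\<^esub> (single [x] \<oplus>\<^bsub>F\<^esub> single [y]) \<in> J"
    using assms by (intro env_rel_in_ideal env_relI)
  then show ?thesis
    unfolding env_word_def using assms
    by (simp only: c.add[symmetric] single_letters F.coset_eq_iff[OF submodule_env] F.add.m_closed add.m_closed)
qed

lemma env_word_smult:
  assumes "x \<in> carrier L"
  shows "env_word L [c \<odot> x] = c \<odot>\<^bsub>env L\<^esub> env_word L [x]"
proof -
  interpret c: linear_mapping F "env L" "\<lambda>p. J +>\<^bsub>F\<^esub> p" by (rule linear_env_coset)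
  have "single [c \<odot> x] \<ominus>\<^bsub>F\<^esub> c \<odot>\<^bsub>F\<^esub> single [x] \<in> J"
    using assms by (intro env_rel_in_ideal env_relI)
  then show ?thesis
    unfolding env_word_def using assms
    by (simp only: c.smult[symmetric] single_letters F.coset_eq_iff[OF submodule_env] F.smult_closed
        smult_closed KK_simps UNIV_I)
qed

lemma env_word_lbracket:
  assumes "x \<in> carrier L" "y \<in> carrier L"
  shows "env_word L [lbracket L x y] = env_word L [x, y] \<ominus>\<^bsub>env L\<^esub> env_word L [y, x]"
proof -
  interpret c: linear_mapping F "env L" "\<lambda>p. J +>\<^bsub>F\<^esub> p" by (rule linear_env_coset)
  have "single [lbracket L x y] \<ominus>\<^bsub>F\<^esub> (single [x, y] \<ominus>\<^bsub>F\<^esub> single [y, x]) \<in> J"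
    using assms by (intro env_rel_in_ideal env_relI)
  then show ?thesis
    unfolding env_word_def using assms
    by (simp only: c.diff[symmetric] single_letters F.coset_eq_iff[OF submodule_env] F.minus_closed lbracket_closed)
qed

text \<open>The relations of a subalgebra are among those of \<open>L\<close>. Hence its ideal lies in that of \<open>L\<close>, and is
  absorbed when the latter is added to a coset.\<close>

lemma env_incl_coset:
  assumes H: "lie_subalgebra L H" and p: "p \<in> carrier (free_alg H)"
  shows "env_incl L (env_ideal (L\<lparr>carrier := H\<rparr>) +>\<^bsub>free_alg H\<^esub> p) = J +>\<^bsub>F\<^esub> p" "p \<in> carrier F"
proof -
  let ?L = "L\<lparr>carrier := H\<rparr>"
  let ?E = "free_alg H :: ('k, 'a list \<Rightarrow> 'k) module"
  interpret H: lie_algebra ?L by (rule lie_algebra_restrict[OF H])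
  interpret J: ideal J F by (rule ideal_env)
  interpret E: vec_space ?E by (rule vec_space_free_alg)
  interpret ER: ring ?E by (rule ring_free_alg)
  have HL: "H \<subseteq> carrier L" using H submodule_subset by (auto simp: lie_subalgebra_def)
  have EF: "carrier ?E \<subseteq> carrier F"
  proof
    fix q assume "q \<in> carrier ?E"
    then have "finite {x. q x \<noteq> 0}" "{x. q x \<noteq> 0} \<subseteq> lists H" by (simp_all add: free_alg_simps)
    then show "q \<in> carrier F" using lists_mono[OF HL] by (simp add: free_alg_simps subset_trans)
  qed
  then show pF: "p \<in> carrier F" using p by auto
  have ops: "x \<oplus>\<^bsub>?E\<^esub> y = x \<oplus>\<^bsub>F\<^esub> y" "c \<odot>\<^bsub>?E\<^esub> x = c \<odot>\<^bsub>F\<^esub> x" "\<zero>\<^bsub>?E\<^esub> = \<zero>\<^bsub>F\<^esub>"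
    "x \<otimes>\<^bsub>?E\<^esub> y = x \<otimes>\<^bsub>F\<^esub> y" for x y c
    by (simp_all add: free_alg_simps)
  \<comment> \<open>Subtraction is defined through the carrier, so it needs membership.\<close>
  have minus: "x \<ominus>\<^bsub>?E\<^esub> y = x \<ominus>\<^bsub>F\<^esub> y" if xy: "x \<in> carrier ?E" "y \<in> carrier ?E" for x y
  proof -
    have "x \<in> carrier F" "y \<in> carrier F" using xy EF by blast+
    from F.diff_eq_smult[OF this] E.diff_eq_smult[OF xy] show ?thesis by (simp only: ops)
  qed
  have "ideal (J \<inter> carrier ?E) ?E"
  proof (rule idealI)
    show "ring ?E" by (rule ER.ring_axioms)
    have "submodule (J \<inter> carrier ?E) KK ?E"
    proof (rule E.subspaceI)
      show "\<zero>\<^bsub>?E\<^esub> \<in> J \<inter> carrier ?E" 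
        using additive_subgroup.zero_closed[OF J.is_additive_subgroup] E.zero_closed by (simp add: ops)
      show "x \<oplus>\<^bsub>?E\<^esub> y \<in> J \<inter> carrier ?E" if "x \<in> J \<inter> carrier ?E" "y \<in> J \<inter> carrier ?E" for x y
        using that J.a_closed[of x y] E.add.m_closed[of x y] by (simp add: ops)
      show "c \<odot>\<^bsub>?E\<^esub> x \<in> J \<inter> carrier ?E" if "x \<in> J \<inter> carrier ?E" for c x
        using that F.submodule_smult[OF submodule_env, of x c] E.smult_closed[of c x] by (simp add: ops)
    qed auto
    then show "subgroup (J \<inter> carrier ?E) (add_monoid ?E)" by (rule submodule.axioms(1))
    fix a x assume a: "a \<in> J \<inter> carrier ?E" and x: "x \<in> carrier ?E"
    then have "a \<in> J" "x \<in> carrier F" using EF by auto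
    from J.I_l_closed[OF this] ER.m_closed[OF x, of a] a
    show "x \<otimes>\<^bsub>?E\<^esub> a \<in> J \<inter> carrier ?E" by (simp add: ops)
    from J.I_r_closed[OF \<open>a \<in> J\<close> \<open>x \<in> carrier F\<close>] ER.m_closed[OF _ x, of a] a
    show "a \<otimes>\<^bsub>?E\<^esub> x \<in> J \<inter> carrier ?E" using x by (simp add: ops)
  qed
  moreover have "env_rel ?L \<subseteq> J \<inter> carrier ?E"
  proof
    fix q assume q: "q \<in> env_rel ?L"
    then have qE: "q \<in> carrier ?E" using H.env_rel_closed by auto
    have [simp]: "single [x] \<in> carrier ?E" "single [x, y] \<in> carrier ?E" if "x \<in> H" "y \<in> H" for x y
      using that by (intro single_in_free_alg; simp)+
    have cl: "x \<oplus> y \<in> H" "c \<odot> x \<in> H" "lbracket L x y \<in> H" if "x \<in> H" "y \<in> H" for x y c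
      using H that submodule_add submodule_smult by (auto simp: lie_subalgebra_def)
    have "q \<in> env_rel L"
    proof -
      from q show ?thesis
      proof (cases rule: env_relE[of q ?L, simplified, consumes 1])
        case (1 x y)
        have "q = single [x \<oplus> y] \<ominus>\<^bsub>F\<^esub> (single [x] \<oplus>\<^bsub>?E\<^esub> single [y])"
          unfolding 1(3) using 1 cl by (intro minus E.add.m_closed) simp_all
        also have "single [x] \<oplus>\<^bsub>?E\<^esub> single [y] = single [x] \<oplus>\<^bsub>F\<^esub> single [y]" by (rule ops)
        finally show ?thesis using 1 HL env_relI(1)[of x L y] by (simp add: subset_iff)
      next
        case (2 c x)
        have "q = single [c \<odot> x] \<ominus>\<^bsub>F\<^esub> (c \<odot>\<^bsub>?E\<^esub> single [x])"
          unfolding 2(2) using 2 cl[of x x] by (intro minus E.smult_closed) simp_all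
        also have "c \<odot>\<^bsub>?E\<^esub> single [x] = c \<odot>\<^bsub>F\<^esub> single [x]" by (rule ops)
        finally show ?thesis using 2 HL env_relI(2)[of x L c] by (simp add: subset_iff)
      next
        case (3 x y)
        have "q = single [lbracket L x y] \<ominus>\<^bsub>F\<^esub> (single [x, y] \<ominus>\<^bsub>?E\<^esub> single [y, x])"
          unfolding 3(3) using 3 cl by (intro minus E.minus_closed) simp_all
        also have "single [x, y] \<ominus>\<^bsub>?E\<^esub> single [y, x] = single [x, y] \<ominus>\<^bsub>F\<^esub> single [y, x]"
          using 3 by (intro minus) simp_all
        finally show ?thesis using 3 HL env_relI(3)[of x L y] by (simp add: subset_iff)
      qed
    qed
    then show "q \<in> J \<inter> carrier ?E" using env_rel_in_ideal qE by auto
  qed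
  ultimately have sub: "env_ideal ?L \<subseteq> J \<inter> carrier ?E" by (rule H.env_ideal_least[simplified])
  have zero: "\<zero>\<^bsub>F\<^esub> \<in> env_ideal ?L" using H.submodule_env E.submodule_zero by (simp add: ops)
  show "env_incl L (env_ideal ?L +>\<^bsub>?E\<^esub> p) = J +>\<^bsub>F\<^esub> p"
  proof
    show "env_incl L (env_ideal ?L +>\<^bsub>?E\<^esub> p) \<subseteq> J +>\<^bsub>F\<^esub> p"
    proof
      fix q assume "q \<in> env_incl L (env_ideal ?L +>\<^bsub>?E\<^esub> p)"
      then obtain i j where ij: "i \<in> J" "j \<in> env_ideal ?L" "q = i \<oplus>\<^bsub>F\<^esub> (j \<oplus>\<^bsub>?E\<^esub> p)"
        by (auto simp: env_incl_def set_add_def' a_r_coset_def')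
      have jJ: "j \<in> J" using ij sub by auto
      have "q = (i \<oplus>\<^bsub>F\<^esub> j) \<oplus>\<^bsub>F\<^esub> p"
        unfolding ij by (simp add: free_alg_simps add.assoc)
      moreover have "i \<oplus>\<^bsub>F\<^esub> j \<in> J" using ij jJ by (intro J.a_closed)
      ultimately show "q \<in> J +>\<^bsub>F\<^esub> p" by (auto simp: a_r_coset_def')
    qed
    show "J +>\<^bsub>F\<^esub> p \<subseteq> env_incl L (env_ideal ?L +>\<^bsub>?E\<^esub> p)"
    proof
      fix q assume "q \<in> J +>\<^bsub>F\<^esub> p"
      then obtain i where i: "i \<in> J" "q = i \<oplus>\<^bsub>F\<^esub> (\<zero>\<^bsub>F\<^esub> \<oplus>\<^bsub>?E\<^esub> p)"
        by (auto simp: a_r_coset_def' free_alg_simps)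
      then show "q \<in> env_incl L (env_ideal ?L +>\<^bsub>?E\<^esub> p)"
        using zero by (auto simp: env_incl_def set_add_def' a_r_coset_def')
    qed
  qed
qed

end

subsection \<open>The enveloping algebra acts on every representation\<close>

context lie_rep
begin

abbreviation F where "F \<equiv> free_alg (carrier L) :: ('k, 'a list \<Rightarrow> 'k) module"
abbreviation J where "J \<equiv> env_ideal L"

interpretation F: vec_space F by (rule vec_space_free_alg)
interpretation FR: ring F by (rule ring_free_alg)

abbreviation poly_act where "poly_act p v \<equiv> lin_ext V (\<lambda>w. foldr act w v) p"

lemma linear_poly_act: "v \<in> carrier V \<Longrightarrow> linear_mapping F V (\<lambda>p. poly_act p v)"
  using V.linear_mapping_lin_ext[of "lists (carrier L)" "\<lambda>w. foldr act w v"] word_closed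
  by (intro linear_mapping_free_alg) blast

lemma poly_act_single: "\<lbrakk>w \<in> lists (carrier L); v \<in> carrier V\<rbrakk> \<Longrightarrow> poly_act (single w) v = foldr act w v"
  by (simp add: word_closed)

lemma poly_act_closed: "\<lbrakk>p \<in> carrier F; v \<in> carrier V\<rbrakk> \<Longrightarrow> poly_act p v \<in> carrier V"
  using linear_mapping.closed[OF linear_poly_act] .

lemma linear_poly_act_right: "p \<in> carrier F \<Longrightarrow> linear_mapping V V (poly_act p)"
proof (rule linear_mappingI)
  assume p: "p \<in> carrier F"
  then have fin: "finite {w. p w \<noteq> 0}" and sup: "\<And>w. p w \<noteq> 0 \<Longrightarrow> w \<in> lists (carrier L)"
    by (auto simp: free_alg_simps subset_iff)
  fix v assume v: "v \<in> carrier V"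
  then show "poly_act p v \<in> carrier V" by (rule poly_act_closed[OF p])
  have [simp]: "\<And>w. p w \<noteq> 0 \<Longrightarrow> foldr act w v \<in> carrier V" if "v \<in> carrier V" for v
    using word_closed sup that by blast
  show "poly_act p (c \<odot>\<^bsub>V\<^esub> v) = c \<odot>\<^bsub>V\<^esub> poly_act p v" for c
  proof -
    have "poly_act p (c \<odot>\<^bsub>V\<^esub> v) = finsum V (\<lambda>w. c \<odot>\<^bsub>V\<^esub> (p w \<odot>\<^bsub>V\<^esub> foldr act w v)) {w. p w \<noteq> 0}"
      unfolding lin_ext_def using v
      by (intro V.finsum_cong')
        (auto simp: linear_mapping.smult[OF linear_word[OF sup]] V.smult_smult mult.commute)
    also have "\<dots> = c \<odot>\<^bsub>V\<^esub> poly_act p v"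
      unfolding lin_ext_def using v by (intro V.finsum_smult[symmetric]) auto
    finally show ?thesis .
  qed
  fix v' assume v': "v' \<in> carrier V"
  have "poly_act p (v \<oplus>\<^bsub>V\<^esub> v') =
      finsum V (\<lambda>w. p w \<odot>\<^bsub>V\<^esub> foldr act w v \<oplus>\<^bsub>V\<^esub> p w \<odot>\<^bsub>V\<^esub> foldr act w v') {w. p w \<noteq> 0}"
    unfolding lin_ext_def using v v'
    by (intro V.finsum_cong') (auto simp: linear_mapping.add[OF linear_word[OF sup]] V.smult_add_right)
  also have "\<dots> = poly_act p v \<oplus>\<^bsub>V\<^esub> poly_act p v'"
    unfolding lin_ext_def using v v' by (intro V.finsum_addf) auto
  finally show "poly_act p (v \<oplus>\<^bsub>V\<^esub> v') = poly_act p v \<oplus>\<^bsub>V\<^esub> poly_act p v'" .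
qed (simp_all add: V.vec_space_axioms)

lemma poly_act_mult:
  assumes p: "p \<in> carrier F" and q: "q \<in> carrier F" and v: "v \<in> carrier V"
  shows "poly_act (p \<otimes>\<^bsub>F\<^esub> q) v = poly_act p (poly_act q v)"
proof -
  have S: "single ` lists (carrier L) \<subseteq> carrier F" by (intro image_subsetI single_in_free_alg)
  have "poly_act (single u \<otimes>\<^bsub>F\<^esub> q) v = poly_act (single u) (poly_act q v)"
    if u: "u \<in> lists (carrier L)" for u
  proof (rule linear_mapping_eq_on_span[where S = "single ` lists (carrier L)" and x = q and V = F and W = V
        and f = "\<lambda>q. poly_act (single u \<otimes>\<^bsub>F\<^esub> q) v" and g = "\<lambda>q. poly_act (single u) (poly_act q v)"])
    show "linear_mapping F V (\<lambda>q. poly_act (single u \<otimes>\<^bsub>F\<^esub> q) v)"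
      by (rule linear_mapping_compose[OF linear_mult_right linear_poly_act[OF v]])
        (rule single_in_free_alg[OF u])
    show "linear_mapping F V (\<lambda>q. poly_act (single u) (poly_act q v))"
      by (rule linear_mapping_compose[OF linear_poly_act[OF v] linear_poly_act_right])
        (rule single_in_free_alg[OF u])
    show "q \<in> lin_span F (single ` lists (carrier L))" using q by (simp only: lin_span_free_alg)
    fix x :: "'a list \<Rightarrow> 'k" assume "x \<in> single ` lists (carrier L)"
    then obtain w where w: "w \<in> lists (carrier L)" "x = single w" by auto
    show "poly_act (single u \<otimes>\<^bsub>F\<^esub> x) v = poly_act (single u) (poly_act x v)"
      using u v w poly_act_single[of "u @ w" v] poly_act_single[of w v] poly_act_single[of u "foldr act w v"]
      by (simp add: single_mult_single word_closed del: V.lin_ext_single)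
  qed (rule S)
  then show ?thesis
    using p linear_mapping_eq_on_span[OF linear_mapping_compose[OF linear_mult_left[OF q] linear_poly_act[OF v]]
          linear_poly_act[OF poly_act_closed[OF q v]] S, of p]
    unfolding lin_span_free_alg by blast
qed

text \<open>The noncommutative polynomials acting by zero form an ideal, which contains the defining
  relations.\<close>

lemma env_ideal_acts_zero:
  assumes "p \<in> J" "v \<in> carrier V"
  shows "poly_act p v = \<zero>\<^bsub>V\<^esub>"
proof -
  let ?I = "{p \<in> carrier F. \<forall>v\<in>carrier V. poly_act p v = \<zero>\<^bsub>V\<^esub>}"
  have "ideal ?I F"
  proof (rule idealI)
    show "ring F" by (rule ring_free_alg)
    have "submodule ?I KK F"
    proof (rule F.subspaceI)
      show "\<zero>\<^bsub>F\<^esub> \<in> ?I" using linear_mapping.zero[OF linear_poly_act] F.zero_closed by blast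
      show "x \<oplus>\<^bsub>F\<^esub> y \<in> ?I" if "x \<in> ?I" "y \<in> ?I" for x y
        using that by (auto simp: linear_mapping.add[OF linear_poly_act])
      show "c \<odot>\<^bsub>F\<^esub> x \<in> ?I" if "x \<in> ?I" for c x
        using that by (auto simp: linear_mapping.smult[OF linear_poly_act])
    qed auto
    then show "subgroup ?I (add_monoid F)" by (rule submodule.axioms(1))
    fix a x assume a: "a \<in> ?I" and x: "x \<in> carrier F"
    show "x \<otimes>\<^bsub>F\<^esub> a \<in> ?I"
      using a x by (auto simp: poly_act_mult FR.m_closed linear_mapping.zero[OF linear_poly_act_right])
    show "a \<otimes>\<^bsub>F\<^esub> x \<in> ?I"
      using a x by (auto simp: poly_act_mult FR.m_closed poly_act_closed)
  qed
  moreover have "env_rel L \<subseteq> ?I"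
  proof
    fix q assume q: "q \<in> env_rel L"
    note [simp] = L.single_letters linear_mapping.diff[OF linear_poly_act] linear_mapping.add[OF linear_poly_act]
      linear_mapping.smult[OF linear_poly_act] poly_act_single act_closed L.lbracket_closed
    have "poly_act q v = \<zero>\<^bsub>V\<^esub>" if "v \<in> carrier V" for v
      using q that unfolding env_rel_def Let_def
      by (auto simp: act_add_left act_smult_left act_lbracket)
    then show "q \<in> ?I" using q L.env_rel_closed by auto
  qed
  ultimately have "J \<subseteq> ?I" by (rule L.env_ideal_least)
  then show ?thesis using assms by auto
qed

text \<open>Different representatives act alike because the ideal acts by zero.\<close>

lemma env_act_coset:
  assumes p: "p \<in> carrier F" and v: "v \<in> carrier V"
  shows "env_act V act (J +>\<^bsub>F\<^esub> p) v = poly_act p v"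
proof -
  define q where "q = (SOME q. q \<in> J +>\<^bsub>F\<^esub> p)"
  have "q \<in> J +>\<^bsub>F\<^esub> p"
    unfolding q_def by (rule someI[of "\<lambda>q. q \<in> J +>\<^bsub>F\<^esub> p", OF F.coset_self[OF L.submodule_env p]])
  then have q: "q \<in> carrier F" "q \<ominus>\<^bsub>F\<^esub> p \<in> J" using F.mem_coset_iff[OF L.submodule_env p] by auto
  then have "poly_act q v \<ominus>\<^bsub>V\<^esub> poly_act p v = \<zero>\<^bsub>V\<^esub>"
    using env_ideal_acts_zero[OF q(2) v] p v by (simp add: linear_mapping.diff[OF linear_poly_act])
  then have "poly_act q v = poly_act p v"
    using p q v by (simp only: V.diff_eq_zero_iff poly_act_closed)
  then show ?thesis by (simp add: env_act_def Let_def q_def lin_ext_def)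
qed

lemma linear_env_act_left:
  assumes v: "v \<in> carrier V"
  shows "linear_mapping (env L) V (\<lambda>Z. env_act V act Z v)"
proof -
  interpret c: linear_mapping F "env L" "\<lambda>p. J +>\<^bsub>F\<^esub> p" by (rule L.linear_env_coset)
  interpret a: linear_mapping F V "\<lambda>p. poly_act p v" by (rule linear_poly_act[OF v])
  show ?thesis
  proof (rule linear_mappingI)
    fix Y assume "Y \<in> carrier (env L)"
    then obtain q where q: "q \<in> carrier F" "Y = J +>\<^bsub>F\<^esub> q" by (rule L.env_carrierE)
    show "env_act V act Y v \<in> carrier V"
      using q v by (simp only: env_act_coset poly_act_closed)
    show "env_act V act (c \<odot>\<^bsub>env L\<^esub> Y) v = c \<odot>\<^bsub>V\<^esub> env_act V act Y v" for c
      using q v by (simp only: c.smult[symmetric] env_act_coset F.smult_closed KK_simps UNIV_I a.smult)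
    fix Z assume "Z \<in> carrier (env L)"
    then obtain r where r: "r \<in> carrier F" "Z = J +>\<^bsub>F\<^esub> r" by (rule L.env_carrierE)
    show "env_act V act (Y \<oplus>\<^bsub>env L\<^esub> Z) v = env_act V act Y v \<oplus>\<^bsub>V\<^esub> env_act V act Z v"
      using q r v by (simp only: c.add[symmetric] env_act_coset F.add.m_closed a.add)
  qed (simp_all add: L.vec_space_env V.vec_space_axioms)
qed

lemma linear_env_act_right: "Z \<in> carrier (env L) \<Longrightarrow> linear_mapping V V (env_act V act Z)"
proof -
  assume "Z \<in> carrier (env L)"
  then obtain p where p: "p \<in> carrier F" "Z = J +>\<^bsub>F\<^esub> p" by (rule L.env_carrierE)
  interpret a: linear_mapping V V "poly_act p" by (rule linear_poly_act_right[OF p(1)])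
  show ?thesis
    by (rule linear_mappingI)
      (simp_all only: p(2) env_act_coset[OF p(1)] a.add a.smult a.closed V.add.m_closed V.smult_closed
        KK_simps UNIV_I V.vec_space_axioms)
qed

lemma env_act_mult:
  "\<lbrakk>Y \<in> carrier (env L); Z \<in> carrier (env L); v \<in> carrier V\<rbrakk> \<Longrightarrow>
    env_act V act (Y \<otimes>\<^bsub>env L\<^esub> Z) v = env_act V act Y (env_act V act Z v)"
  by (elim L.env_carrierE)
    (simp only: L.env_mult_coset env_act_coset poly_act_mult poly_act_closed FR.m_closed)

lemma env_act_word:
  "\<lbrakk>w \<in> lists (carrier L); v \<in> carrier V\<rbrakk> \<Longrightarrow> env_act V act (env_word L w) v = foldr act w v"
  by (simp only: env_word_def env_act_coset single_in_free_alg poly_act_single)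

lemma env_act_closed: "\<lbrakk>Z \<in> carrier (env L); v \<in> carrier V\<rbrakk> \<Longrightarrow> env_act V act Z v \<in> carrier V"
  using linear_mapping.closed[OF linear_env_act_left] .

end

section \<open>Induced modules\<close>

locale lie_induction = L: lie_algebra L + rep: lie_rep "L\<lparr>carrier := H\<rparr>" V act
  for L :: "('k::field, 'a, 'm) lie_scheme" and H :: "'a set" and V :: "('k, 'v) module"
    and act :: "'a \<Rightarrow> 'v \<Rightarrow> 'v" +
  assumes subalgebra: "lie_subalgebra L H"
begin

abbreviation "U \<equiv> env L"
abbreviation "P \<equiv> pair_space L V"
abbreviation "Bal \<equiv> balance L H V act"
abbreviation "Ind \<equiv> induced L H V act"
abbreviation "ten \<equiv> tensor L H V act"
abbreviation "iact \<equiv> induced_act L H V act"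

interpretation P: vec_space P by (rule vec_space_free_module)
interpretation U: vec_space U by (rule L.vec_space_env)

lemma H_closed: "x \<in> H \<Longrightarrow> x \<in> carrier L"
  using subalgebra L.submodule_mem_carrier by (auto simp: lie_subalgebra_def)

lemma env_incl_closed: "b \<in> carrier (env (L\<lparr>carrier := H\<rparr>)) \<Longrightarrow> env_incl L b \<in> carrier U"
  by (erule rep.L.env_carrierE)
    (simp add: L.env_incl_coset[OF subalgebra] L.env_coset_closed)

definition bal_rel where
  "bal_rel =
     {single (r \<oplus>\<^bsub>U\<^esub> s, v) \<ominus>\<^bsub>P\<^esub> (single (r, v) \<oplus>\<^bsub>P\<^esub> single (s, v)) | r s v.
         r \<in> carrier U \<and> s \<in> carrier U \<and> v \<in> carrier V} \<union>
      {single (r, v \<oplus>\<^bsub>V\<^esub> w) \<ominus>\<^bsub>P\<^esub> (single (r, v) \<oplus>\<^bsub>P\<^esub> single (r, w)) | r v w.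
         r \<in> carrier U \<and> v \<in> carrier V \<and> w \<in> carrier V} \<union>
      {single (c \<odot>\<^bsub>U\<^esub> r, v) \<ominus>\<^bsub>P\<^esub> c \<odot>\<^bsub>P\<^esub> single (r, v) | c r v.
         r \<in> carrier U \<and> v \<in> carrier V} \<union>
      {single (r, c \<odot>\<^bsub>V\<^esub> v) \<ominus>\<^bsub>P\<^esub> c \<odot>\<^bsub>P\<^esub> single (r, v) | c r v.
         r \<in> carrier U \<and> v \<in> carrier V} \<union>
      {single (r \<otimes>\<^bsub>U\<^esub> env_incl L b, v) \<ominus>\<^bsub>P\<^esub> single (r, env_act V act b v) | r b v.
         r \<in> carrier U \<and> b \<in> carrier (env (L\<lparr>carrier := H\<rparr>)) \<and> v \<in> carrier V}"

lemma balance_eq: "Bal = lin_span P bal_rel"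
  by (simp add: balance_def bal_rel_def Let_def)

lemma bal_relI:
  "\<lbrakk>r \<in> carrier U; s \<in> carrier U; v \<in> carrier V\<rbrakk> \<Longrightarrow>
    single (r \<oplus>\<^bsub>U\<^esub> s, v) \<ominus>\<^bsub>P\<^esub> (single (r, v) \<oplus>\<^bsub>P\<^esub> single (s, v)) \<in> bal_rel"
  "\<lbrakk>r \<in> carrier U; v \<in> carrier V; w \<in> carrier V\<rbrakk> \<Longrightarrow>
    single (r, v \<oplus>\<^bsub>V\<^esub> w) \<ominus>\<^bsub>P\<^esub> (single (r, v) \<oplus>\<^bsub>P\<^esub> single (r, w)) \<in> bal_rel"
  "\<lbrakk>r \<in> carrier U; v \<in> carrier V\<rbrakk> \<Longrightarrow> single (c \<odot>\<^bsub>U\<^esub> r, v) \<ominus>\<^bsub>P\<^esub> c \<odot>\<^bsub>P\<^esub> single (r, v) \<in> bal_rel"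
  "\<lbrakk>r \<in> carrier U; v \<in> carrier V\<rbrakk> \<Longrightarrow> single (r, c \<odot>\<^bsub>V\<^esub> v) \<ominus>\<^bsub>P\<^esub> c \<odot>\<^bsub>P\<^esub> single (r, v) \<in> bal_rel"
  "\<lbrakk>r \<in> carrier U; b \<in> carrier (env (L\<lparr>carrier := H\<rparr>)); v \<in> carrier V\<rbrakk> \<Longrightarrow>
    single (r \<otimes>\<^bsub>U\<^esub> env_incl L b, v) \<ominus>\<^bsub>P\<^esub> single (r, env_act V act b v) \<in> bal_rel"
  unfolding bal_rel_def by blast+

lemma bal_rel_cases:
  assumes "q \<in> bal_rel"
  obtains (add_left) r s v where "r \<in> carrier U" "s \<in> carrier U" "v \<in> carrier V"
      "q = single (r \<oplus>\<^bsub>U\<^esub> s, v) \<ominus>\<^bsub>P\<^esub> (single (r, v) \<oplus>\<^bsub>P\<^esub> single (s, v))"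
  | (add_right) r v w where "r \<in> carrier U" "v \<in> carrier V" "w \<in> carrier V"
      "q = single (r, v \<oplus>\<^bsub>V\<^esub> w) \<ominus>\<^bsub>P\<^esub> (single (r, v) \<oplus>\<^bsub>P\<^esub> single (r, w))"
  | (smult_left) c r v where "r \<in> carrier U" "v \<in> carrier V"
      "q = single (c \<odot>\<^bsub>U\<^esub> r, v) \<ominus>\<^bsub>P\<^esub> c \<odot>\<^bsub>P\<^esub> single (r, v)"
  | (smult_right) c r v where "r \<in> carrier U" "v \<in> carrier V"
      "q = single (r, c \<odot>\<^bsub>V\<^esub> v) \<ominus>\<^bsub>P\<^esub> c \<odot>\<^bsub>P\<^esub> single (r, v)"
  | (balanced) r b v where "r \<in> carrier U" "b \<in> carrier (env (L\<lparr>carrier := H\<rparr>))" "v \<in> carrier V"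
      "q = single (r \<otimes>\<^bsub>U\<^esub> env_incl L b, v) \<ominus>\<^bsub>P\<^esub> single (r, env_act V act b v)"
  using assms unfolding bal_rel_def
  by (elim UnE CollectE exE conjE) (rule that; assumption)+

lemma single_pair: "\<lbrakk>r \<in> carrier U; v \<in> carrier V\<rbrakk> \<Longrightarrow> single (r, v) \<in> carrier P"
  by (rule single_in_free_module) simp

lemma bal_rel_closed: "bal_rel \<subseteq> carrier P"
proof
  fix q assume "q \<in> bal_rel"
  then show "q \<in> carrier P"
    by (cases rule: bal_rel_cases)
      (simp_all add: single_pair L.env_mult_closed env_incl_closed rep.env_act_closed del: free_module_simps)
qed

lemma submodule_balance: "submodule Bal KK P"
  unfolding balance_eq by (rule P.submodule_lin_span[OF bal_rel_closed])

lemma bal_rel_in_balance: "q \<in> bal_rel \<Longrightarrow> q \<in> Bal"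
  unfolding balance_eq by (rule P.lin_span_base[OF bal_rel_closed])

lemma vec_space_Ind: "vec_space Ind"
  unfolding induced_def by (rule P.vec_space_mod_quot[OF submodule_balance])

interpretation I: vec_space Ind by (rule vec_space_Ind)

lemma linear_coset_Ind: "linear_mapping P Ind (\<lambda>p. Bal +>\<^bsub>P\<^esub> p)"
  unfolding induced_def by (rule P.linear_mapping_coset[OF submodule_balance])

interpretation c: linear_mapping P Ind "\<lambda>p. Bal +>\<^bsub>P\<^esub> p" by (rule linear_coset_Ind)

lemma Ind_carrierE:
  assumes "Z \<in> carrier Ind" obtains p where "p \<in> carrier P" "Z = Bal +>\<^bsub>P\<^esub> p"
  using assms unfolding induced_def by (rule P.mod_quot_carrierE)

lemma tensor_closed: "\<lbrakk>r \<in> carrier U; v \<in> carrier V\<rbrakk> \<Longrightarrow> ten r v \<in> carrier Ind"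
  unfolding tensor_def by (rule c.closed[OF single_pair])

lemma linear_tensor_left: "v \<in> carrier V \<Longrightarrow> linear_mapping U Ind (\<lambda>r. ten r v)"
proof (rule linear_mappingI)
  assume v: "v \<in> carrier V"
  fix r assume r: "r \<in> carrier U"
  then show "ten r v \<in> carrier Ind" by (rule tensor_closed[OF _ v])
  show "ten (c \<odot>\<^bsub>U\<^esub> r) v = c \<odot>\<^bsub>Ind\<^esub> ten r v" for c
    unfolding tensor_def c.smult[OF single_pair[OF r v], symmetric] using r v
    by (subst P.coset_eq_iff[OF submodule_balance])
      (simp_all add: single_pair bal_rel_in_balance bal_relI del: free_module_simps)
  fix s assume s: "s \<in> carrier U"
  show "ten (r \<oplus>\<^bsub>U\<^esub> s) v = ten r v \<oplus>\<^bsub>Ind\<^esub> ten s v"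
    unfolding tensor_def c.add[OF single_pair[OF r v] single_pair[OF s v], symmetric] using r s v
    by (subst P.coset_eq_iff[OF submodule_balance])
      (simp_all add: single_pair bal_rel_in_balance bal_relI del: free_module_simps)
qed (simp_all add: L.vec_space_env vec_space_Ind)

lemma linear_tensor_right: "r \<in> carrier U \<Longrightarrow> linear_mapping V Ind (ten r)"
proof (rule linear_mappingI)
  assume r: "r \<in> carrier U"
  fix v assume v: "v \<in> carrier V"
  then show "ten r v \<in> carrier Ind" by (rule tensor_closed[OF r])
  show "ten r (c \<odot>\<^bsub>V\<^esub> v) = c \<odot>\<^bsub>Ind\<^esub> ten r v" for c
    unfolding tensor_def c.smult[OF single_pair[OF r v], symmetric] using r v
    by (subst P.coset_eq_iff[OF submodule_balance])
      (simp_all add: single_pair bal_rel_in_balance bal_relI del: free_module_simps)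
  fix w assume w: "w \<in> carrier V"
  show "ten r (v \<oplus>\<^bsub>V\<^esub> w) = ten r v \<oplus>\<^bsub>Ind\<^esub> ten r w"
    unfolding tensor_def c.add[OF single_pair[OF r v] single_pair[OF r w], symmetric] using r w v
    by (subst P.coset_eq_iff[OF submodule_balance])
      (simp_all add: single_pair bal_rel_in_balance bal_relI del: free_module_simps)
qed (simp_all add: rep.V.vec_space_axioms vec_space_Ind)

lemma tensor_balanced:
  "\<lbrakk>r \<in> carrier U; b \<in> carrier (env (L\<lparr>carrier := H\<rparr>)); v \<in> carrier V\<rbrakk> \<Longrightarrow>
    ten (r \<otimes>\<^bsub>U\<^esub> env_incl L b) v = ten r (env_act V act b v)"
  unfolding tensor_def
  by (subst P.coset_eq_iff[OF submodule_balance])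
    (simp_all add: single_pair L.env_mult_closed env_incl_closed rep.env_act_closed
      bal_rel_in_balance bal_relI del: free_module_simps)

lemma span_tensor: "lin_span Ind {ten r v | r v. r \<in> carrier U \<and> v \<in> carrier V} = carrier Ind"
proof -
  have "single ` (carrier U \<times> carrier V) \<subseteq> carrier P"
    by (intro image_subsetI single_in_free_module)
  from c.image_lin_span[OF this]
  have "lin_span Ind ((\<lambda>p. Bal +>\<^bsub>P\<^esub> p) ` single ` (carrier U \<times> carrier V)) =
      (\<lambda>p. Bal +>\<^bsub>P\<^esub> p) ` carrier P"
    by (simp only: lin_span_single)
  moreover have "(\<lambda>p. Bal +>\<^bsub>P\<^esub> p) ` single ` (carrier U \<times> carrier V) =
      {ten r v | r v. r \<in> carrier U \<and> v \<in> carrier V}"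
    unfolding tensor_def by (auto simp: image_image)
  ultimately show ?thesis by (simp only: induced_def carrier_mod_quot)
qed

lemma tensors_closed: "{ten r v | r v. r \<in> carrier U \<and> v \<in> carrier V} \<subseteq> carrier Ind"
  using tensor_closed by auto

text \<open>The universal property of the tensor product: the linear extension of \<open>\<beta>\<close> to the free space on
  pairs kills the relations, each of which expresses bilinearity or balancedness.\<close>

lemma ex_balanced_lift:
  fixes M :: "('k, 'w, 'p) module_scheme" and \<beta> :: "('a list \<Rightarrow> 'k) set \<Rightarrow> 'v \<Rightarrow> 'w"
  assumes left: "\<And>v. v \<in> carrier V \<Longrightarrow> linear_mapping U M (\<lambda>r. \<beta> r v)"
    and right: "\<And>r. r \<in> carrier U \<Longrightarrow> linear_mapping V M (\<beta> r)"
    and bal: "\<And>r b v. \<lbrakk>r \<in> carrier U; b \<in> carrier (env (L\<lparr>carrier := H\<rparr>)); v \<in> carrier V\<rbrakk> \<Longrightarrow>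
      \<beta> (r \<otimes>\<^bsub>U\<^esub> env_incl L b) v = \<beta> r (env_act V act b v)"
  shows "\<exists>\<Psi>. linear_mapping Ind M \<Psi> \<and> (\<forall>r\<in>carrier U. \<forall>v\<in>carrier V. \<Psi> (ten r v) = \<beta> r v)"
proof -
  interpret M: vec_space M using linear_mapping.axioms(2)[OF right[OF U.zero_closed]] .
  let ?g = "\<lambda>(r, v). \<beta> r v"
  have cl: "\<beta> r v \<in> carrier M" if "r \<in> carrier U" "v \<in> carrier V" for r v
    using linear_mapping.closed[OF right] that .
  interpret e: linear_mapping P M "lin_ext M ?g"
    by (rule M.linear_mapping_lin_ext) (auto simp: cl)
  have single: "lin_ext M ?g (single (r, v)) = \<beta> r v" if "r \<in> carrier U" "v \<in> carrier V" for r v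
    using M.lin_ext_single[of ?g "(r, v)"] cl[OF that] by simp
  have rel: "lin_ext M ?g q = \<zero>\<^bsub>M\<^esub>" if "q \<in> bal_rel" for q
    using that by (cases rule: bal_rel_cases)
      (simp_all add: single single_pair L.env_mult_closed env_incl_closed rep.env_act_closed cl e.diff e.add e.smult
        linear_mapping.add[OF left] linear_mapping.smult[OF left] linear_mapping.add[OF right]
        linear_mapping.smult[OF right] bal del: free_module_simps)
  have zero: "lin_ext M ?g q = \<zero>\<^bsub>M\<^esub>" if "q \<in> Bal" for q
    using e.zero_on_span[OF bal_rel_closed rel] that unfolding balance_eq by blast
  have "\<exists>\<Psi>. linear_mapping Ind M \<Psi> \<and> (\<forall>p\<in>carrier P. \<Psi> (Bal +>\<^bsub>P\<^esub> p) = lin_ext M ?g p)"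
    unfolding induced_def
  proof (rule e.ex_quotient_map[OF submodule_balance])
    show "lin_ext M ?g q = \<zero>\<^bsub>M\<^esub>" if "q \<in> Bal" for q by (rule zero[OF that])
  qed blast
  then obtain \<Psi> where "linear_mapping Ind M \<Psi>" "\<And>p. p \<in> carrier P \<Longrightarrow> \<Psi> (Bal +>\<^bsub>P\<^esub> p) = lin_ext M ?g p"
    by blast
  then show ?thesis using single single_pair by (intro exI[of _ \<Psi>]) (simp add: tensor_def del: free_module_simps)
qed

text \<open>The action is well defined because left multiplication preserves the relations.\<close>

lemma
  assumes x: "x \<in> carrier L"
  shows linear_iact: "linear_mapping Ind Ind (iact x)"
    and iact_tensor: "\<lbrakk>r \<in> carrier U; v \<in> carrier V\<rbrakk> \<Longrightarrow> iact x (ten r v) = ten (env_word L [x] \<otimes>\<^bsub>U\<^esub> r) v"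
proof -
  let ?x = "env_word L [x]"
  let ?g = "\<lambda>(r, v). single (?x \<otimes>\<^bsub>U\<^esub> r, v)"
  have xU: "?x \<in> carrier U" using x by (intro L.env_word_closed) simp
  interpret m: linear_mapping U U "\<lambda>r. ?x \<otimes>\<^bsub>U\<^esub> r" by (rule L.linear_env_mult_right[OF xU])
  interpret e: linear_mapping P P "lin_ext P ?g"
    by (rule P.linear_mapping_lin_ext) (auto simp: single_pair L.env_mult_closed[OF xU] simp del: free_module_simps)
  have single: "lin_ext P ?g (single (r, v)) = single (?x \<otimes>\<^bsub>U\<^esub> r, v)" if "r \<in> carrier U" "v \<in> carrier V" for r v
    using P.lin_ext_single[of ?g "(r, v)"] single_pair[OF L.env_mult_closed[OF xU that(1)] that(2)] by (simp del: free_module_simps)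
  have rel: "lin_ext P ?g q \<in> bal_rel" if "q \<in> bal_rel" for q
    using that
  proof (cases rule: bal_rel_cases)
    case (balanced r b v)
    then have "lin_ext P ?g q = single ((?x \<otimes>\<^bsub>U\<^esub> r) \<otimes>\<^bsub>U\<^esub> env_incl L b, v) \<ominus>\<^bsub>P\<^esub> single (?x \<otimes>\<^bsub>U\<^esub> r, env_act V act b v)"
      using xU by (simp add: single single_pair L.env_mult_closed env_incl_closed rep.env_act_closed e.diff
          L.env_mult_assoc del: free_module_simps)
    then show ?thesis using balanced xU bal_relI(5)[of "?x \<otimes>\<^bsub>U\<^esub> r" b v] by (simp add: L.env_mult_closed)
  qed (simp_all add: single single_pair L.env_mult_closed e.diff e.add e.smult
        m.add m.smult bal_relI xU del: free_module_simps)
  have "lin_ext P ?g q \<in> Bal" if "q \<in> Bal" for q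
    using e.maps_span[OF bal_rel_closed submodule_balance bal_rel_in_balance[OF rel]] that
    unfolding balance_eq by blast
  then have "lin_ext P ?g ` Bal \<subseteq> Bal" by blast
  from e.UN_coset[OF submodule_balance submodule_balance this]
  have act: "iact x (Bal +>\<^bsub>P\<^esub> p) = Bal +>\<^bsub>P\<^esub> lin_ext P ?g p" if "p \<in> carrier P" for p
    using that by (simp add: induced_act_def Let_def lin_ext_def case_prod_beta' del: free_module_simps)
  show "linear_mapping Ind Ind (iact x)"
  proof (rule linear_mappingI)
    fix Y assume "Y \<in> carrier Ind"
    then obtain p where p: "p \<in> carrier P" "Y = Bal +>\<^bsub>P\<^esub> p" by (rule Ind_carrierE)
    show "iact x Y \<in> carrier Ind" using p act c.closed e.closed by (simp del: free_module_simps)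
    show "iact x (c \<odot>\<^bsub>Ind\<^esub> Y) = c \<odot>\<^bsub>Ind\<^esub> iact x Y" for c
      using p act c.smult[symmetric] e.smult e.closed by (simp del: free_module_simps)
    fix Z assume "Z \<in> carrier Ind"
    then obtain q where q: "q \<in> carrier P" "Z = Bal +>\<^bsub>P\<^esub> q" by (rule Ind_carrierE)
    show "iact x (Y \<oplus>\<^bsub>Ind\<^esub> Z) = iact x Y \<oplus>\<^bsub>Ind\<^esub> iact x Z"
      using p q act c.add[symmetric] e.add e.closed by (simp del: free_module_simps)
  qed (rule vec_space_Ind)+
  show "iact x (ten r v) = ten (?x \<otimes>\<^bsub>U\<^esub> r) v" if "r \<in> carrier U" "v \<in> carrier V"
    unfolding tensor_def using act[OF single_pair[OF that]] single[OF that] by simp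
qed

lemma lie_rep_Ind: "lie_rep L Ind iact"
proof (rule lie_repI)
  fix x y Z assume x: "x \<in> carrier L" and y: "y \<in> carrier L" and Z: "Z \<in> carrier Ind"
  have Z': "Z \<in> lin_span Ind {ten r v | r v. r \<in> carrier U \<and> v \<in> carrier V}"
    using Z by (simp only: span_tensor)
  have w [simp]: "env_word L [x] \<in> carrier U" "env_word L [y] \<in> carrier U"
    using x y by (intro L.env_word_closed; simp)+
  show "iact (x \<oplus>\<^bsub>L\<^esub> y) Z = iact x Z \<oplus>\<^bsub>Ind\<^esub> iact y Z"
  proof (rule linear_mapping_eq_on_span[OF linear_iact linear_mapping_add[OF linear_iact linear_iact] tensors_closed _ Z'])
    fix T assume "T \<in> {ten r v | r v. r \<in> carrier U \<and> v \<in> carrier V}"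
    then obtain r v where T: "T = ten r v" "r \<in> carrier U" "v \<in> carrier V" by auto
    then show "iact (x \<oplus>\<^bsub>L\<^esub> y) T = iact x T \<oplus>\<^bsub>Ind\<^esub> iact y T"
      using x y by (simp add: iact_tensor L.env_word_add L.env_mult_closed
          linear_mapping.add[OF L.linear_env_mult_left] linear_mapping.add[OF linear_tensor_left])
  qed (use x y in simp_all)
  show "iact (lbracket L x y) Z = iact x (iact y Z) \<ominus>\<^bsub>Ind\<^esub> iact y (iact x Z)"
  proof (rule linear_mapping_eq_on_span[OF linear_iact linear_mapping_diff tensors_closed _ Z'])
    show "linear_mapping Ind Ind (\<lambda>T. iact x (iact y T))" "linear_mapping Ind Ind (\<lambda>T. iact y (iact x T))"
      using x y by (intro linear_mapping_compose[OF linear_iact linear_iact]; simp)+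
    fix T assume "T \<in> {ten r v | r v. r \<in> carrier U \<and> v \<in> carrier V}"
    then obtain r v where T: "T = ten r v" "r \<in> carrier U" "v \<in> carrier V" by auto
    have *: "env_word L [x, y] = env_word L [x] \<otimes>\<^bsub>U\<^esub> env_word L [y]"
      "env_word L [y, x] = env_word L [y] \<otimes>\<^bsub>U\<^esub> env_word L [x]"
      using L.env_word_append[of "[x]" "[y]"] L.env_word_append[of "[y]" "[x]"] x y by simp_all
    show "iact (lbracket L x y) T = iact x (iact y T) \<ominus>\<^bsub>Ind\<^esub> iact y (iact x T)"
      using T x y by (simp add: iact_tensor L.env_word_lbracket L.lbracket_closed L.env_mult_closed *
          linear_mapping.diff[OF L.linear_env_mult_left] linear_mapping.diff[OF linear_tensor_left]
          L.env_mult_assoc)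
  qed (use x y in \<open>simp_all add: L.lbracket_closed\<close>)
next
  fix c x Z assume x: "x \<in> carrier L" and Z: "Z \<in> carrier Ind"
  have Z': "Z \<in> lin_span Ind {ten r v | r v. r \<in> carrier U \<and> v \<in> carrier V}"
    using Z by (simp only: span_tensor)
  have w [simp]: "env_word L [x] \<in> carrier U" using x by (intro L.env_word_closed) simp
  show "iact (c \<odot>\<^bsub>L\<^esub> x) Z = c \<odot>\<^bsub>Ind\<^esub> iact x Z"
  proof (rule linear_mapping_eq_on_span[OF linear_iact linear_mapping_smult[OF linear_iact] tensors_closed _ Z'])
    fix T assume "T \<in> {ten r v | r v. r \<in> carrier U \<and> v \<in> carrier V}"
    then obtain r v where T: "T = ten r v" "r \<in> carrier U" "v \<in> carrier V" by auto
    then show "iact (c \<odot>\<^bsub>L\<^esub> x) T = c \<odot>\<^bsub>Ind\<^esub> iact x T"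
      using x by (simp add: iact_tensor L.env_word_smult L.env_mult_closed
          linear_mapping.smult[OF L.linear_env_mult_left] linear_mapping.smult[OF linear_tensor_left])
  qed (use x in simp_all)
qed (simp_all add: L.lie_algebra_axioms vec_space_Ind linear_mapping.closed[OF linear_iact]
    linear_mapping.add[OF linear_iact] linear_mapping.smult[OF linear_iact])

lemma foldr_iact_tensor:
  assumes "w \<in> lists (carrier L)" "r \<in> carrier U" "v \<in> carrier V"
  shows "foldr iact w (ten r v) = ten (env_word L w \<otimes>\<^bsub>U\<^esub> r) v"
  using assms(1)
proof (induction w)
  case Nil
  have "env_word L [] \<otimes>\<^bsub>U\<^esub> r = r"
    using assms(2) L.env_l_one by (simp add: L.env_one_eq)
  then show ?case by simp
next
  case (Cons x w)
  then have "env_word L (x # w) = env_word L [x] \<otimes>\<^bsub>U\<^esub> env_word L w"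
    using L.env_word_append[of "[x]" w] by simp
  then show ?case
    using Cons assms L.env_word_closed[of "[x]"] L.env_word_closed[of w]
    by (simp add: iact_tensor L.env_mult_closed L.env_mult_assoc)
qed

abbreviation "unit_tensor \<equiv> ten \<one>\<^bsub>U\<^esub>"

lemma unit_tensor_closed: "v \<in> carrier V \<Longrightarrow> unit_tensor v \<in> carrier Ind"
  by (rule tensor_closed[OF L.env_one_closed])

lemma linear_unit_tensor: "linear_mapping V Ind unit_tensor"
  by (rule linear_tensor_right[OF L.env_one_closed])

lemma tensor_env_word:
  assumes "w \<in> lists (carrier L)" "v \<in> carrier V"
  shows "ten (env_word L w) v = foldr iact w (unit_tensor v)"
  using foldr_iact_tensor[OF assms(1) L.env_one_closed assms(2)] L.env_r_one[OF L.env_word_closed[OF assms(1)]] by simp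

lemma words_closed: "{foldr iact w (unit_tensor v) | w v. w \<in> lists (carrier L) \<and> v \<in> carrier V} \<subseteq> carrier Ind"
  using lie_rep.word_closed[OF lie_rep_Ind] unit_tensor_closed by blast

text \<open>Words span the enveloping algebra, and \<open>w \<otimes> v\<close> is the word \<open>w\<close> applied to \<open>1 \<otimes> v\<close>.\<close>

lemma span_words:
  "lin_span Ind {foldr iact w (unit_tensor v) | w v. w \<in> lists (carrier L) \<and> v \<in> carrier V} = carrier Ind"
  (is "lin_span Ind ?W = _")
proof
  show "lin_span Ind ?W \<subseteq> carrier Ind" by (rule I.lin_span_closed[OF words_closed])
  have "{ten r v | r v. r \<in> carrier U \<and> v \<in> carrier V} \<subseteq> lin_span Ind ?W"
  proof clarify
    fix r v assume r: "r \<in> carrier U" and v: "v \<in> carrier V"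
    interpret t: linear_mapping U Ind "\<lambda>r. ten r v" by (rule linear_tensor_left[OF v])
    have W: "env_word L ` lists (carrier L) \<subseteq> carrier U" using L.env_word_closed by blast
    have "ten r v \<in> (\<lambda>r. ten r v) ` lin_span U (env_word L ` lists (carrier L))"
      using r by (simp add: L.env_span)
    also have "\<dots> = lin_span Ind ((\<lambda>r. ten r v) ` env_word L ` lists (carrier L))"
      by (rule t.image_lin_span[OF W])
    also have "\<dots> \<subseteq> lin_span Ind ?W"
    proof (intro I.lin_span_mono subsetI)
      fix T assume "T \<in> (\<lambda>r. ten r v) ` env_word L ` lists (carrier L)"
      then obtain w where w: "w \<in> lists (carrier L)" "T = ten (env_word L w) v" by blast
      then show "T \<in> ?W" using v tensor_env_word[OF w(1) v] by blast
    qed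
    finally show "ten r v \<in> lin_span Ind ?W" .
  qed
  then have "lin_span Ind {ten r v | r v. r \<in> carrier U \<and> v \<in> carrier V} \<subseteq> lin_span Ind ?W"
    by (rule I.lin_span_least[OF I.submodule_lin_span[OF words_closed]])
  then show "carrier Ind \<subseteq> lin_span Ind ?W" by (simp only: span_tensor)
qed

lemma iact_unit_tensor:
  assumes x: "x \<in> H" and v: "v \<in> carrier V"
  shows "iact x (unit_tensor v) = unit_tensor (act x v)"
proof -
  let ?b = "env_word (L\<lparr>carrier := H\<rparr>) [x]"
  have b: "?b \<in> carrier (env (L\<lparr>carrier := H\<rparr>))" using x by (intro rep.L.env_word_closed) simp
  have "env_incl L ?b = env_word L [x]"
    unfolding env_word_def using L.env_incl_coset(1)[OF subalgebra single_in_free_alg[of "[x]" H]] x by simp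
  moreover have xU: "env_word L [x] \<in> carrier U" using H_closed[OF x] by (intro L.env_word_closed) simp
  moreover have "env_act V act ?b v = act x v"
    using rep.env_act_word[of "[x]" v] x v by simp
  ultimately show ?thesis
    using tensor_balanced[OF L.env_one_closed b v] L.env_r_one[OF xU] L.env_l_one[OF xU]
    by (simp add: iact_tensor[OF H_closed[OF x] L.env_one_closed v])
qed

text \<open>The universal property: an equivariant map on \<open>V\<close> extends to the induced module, with
  \<open>r \<otimes> v\<close> sent to \<open>r \<phi> v\<close>. This is balanced because \<open>\<phi>\<close> commutes with letters in \<open>H\<close>, hence with the
  enveloping algebra of \<open>H\<close>.\<close>

lemma ex_equivariant_lift:
  fixes M :: "('k, 'w, 'p) module_scheme"
  assumes M: "lie_rep L M actM" and \<phi>: "linear_mapping V M \<phi>"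
    and equiv: "\<And>x v. \<lbrakk>x \<in> H; v \<in> carrier V\<rbrakk> \<Longrightarrow> \<phi> (act x v) = actM x (\<phi> v)"
  obtains \<Psi> where "linear_mapping Ind M \<Psi>" "\<And>v. v \<in> carrier V \<Longrightarrow> \<Psi> (unit_tensor v) = \<phi> v"
    "\<And>x Z. \<lbrakk>x \<in> carrier L; Z \<in> carrier Ind\<rbrakk> \<Longrightarrow> \<Psi> (iact x Z) = actM x (\<Psi> Z)"
proof -
  interpret M: lie_rep L M actM by (rule M)
  interpret \<phi>: linear_mapping V M \<phi> by (rule \<phi>)
  have word: "\<phi> (foldr act w v) = foldr actM w (\<phi> v)" if "w \<in> lists H" "v \<in> carrier V" for w v
    using that(1)
  proof (induction w)
    case (Cons x w)
    then show ?case using rep.word_closed[of w v] that(2) by (simp add: equiv)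
  qed simp
  have bal: "env_act M actM (env_incl L b) (\<phi> v) = \<phi> (env_act V act b v)"
    if b: "b \<in> carrier (env (L\<lparr>carrier := H\<rparr>))" and v: "v \<in> carrier V" for b v
  proof -
    from b obtain p where p: "p \<in> carrier (free_alg H)" "b = env_ideal (L\<lparr>carrier := H\<rparr>) +>\<^bsub>free_alg H\<^esub> p"
      by (rule rep.L.env_carrierE) simp
    have "env_act M actM (env_incl L b) (\<phi> v) = M.poly_act p (\<phi> v)"
      unfolding p(2) L.env_incl_coset(1)[OF subalgebra p(1)]
      using L.env_incl_coset(2)[OF subalgebra p(1)] v by (intro M.env_act_coset) simp_all
    also have "\<dots> = finsum M (\<lambda>w. \<phi> (p w \<odot>\<^bsub>V\<^esub> foldr act w v)) {w. p w \<noteq> 0}"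
      unfolding lin_ext_def
    proof (rule M.V.finsum_cong')
      fix w assume "w \<in> {w. p w \<noteq> 0}"
      then have "w \<in> lists H" using p(1) by (auto simp: free_alg_simps)
      then show "p w \<odot>\<^bsub>M\<^esub> foldr actM w (\<phi> v) = \<phi> (p w \<odot>\<^bsub>V\<^esub> foldr act w v)"
        using word[of w v] rep.word_closed[of w v] v by (simp add: \<phi>.smult)
    next
      show "(\<lambda>w. \<phi> (p w \<odot>\<^bsub>V\<^esub> foldr act w v)) \<in> {w. p w \<noteq> 0} \<rightarrow> carrier M"
      proof
        fix w assume "w \<in> {w. p w \<noteq> 0}"
        then have "w \<in> lists H" using p(1) by (auto simp: free_alg_simps)
        then show "\<phi> (p w \<odot>\<^bsub>V\<^esub> foldr act w v) \<in> carrier M"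
          using rep.word_closed[of w v] v by simp
      qed
    qed simp
    also have "\<dots> = \<phi> (rep.poly_act p v)"
      unfolding lin_ext_def
    proof (rule \<phi>.sum[symmetric])
      show "(\<lambda>w. p w \<odot>\<^bsub>V\<^esub> foldr act w v) \<in> {w. p w \<noteq> 0} \<rightarrow> carrier V"
      proof
        fix w assume "w \<in> {w. p w \<noteq> 0}"
        then have "w \<in> lists H" using p(1) by (auto simp: free_alg_simps)
        then show "p w \<odot>\<^bsub>V\<^esub> foldr act w v \<in> carrier V"
          using rep.word_closed[of w v] v by simp
      qed
    qed
    also have "rep.poly_act p v = env_act V act b v"
      unfolding p(2) using rep.env_act_coset[of p v] p(1) v by simp
    finally show ?thesis .
  qed
  have "linear_mapping U M (\<lambda>r. env_act M actM r (\<phi> v))" if "v \<in> carrier V" for v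
    using M.linear_env_act_left[OF \<phi>.closed[OF that]] .
  moreover have "linear_mapping V M (\<lambda>v. env_act M actM r (\<phi> v))" if "r \<in> carrier U" for r
    by (rule linear_mapping_compose[OF \<phi> M.linear_env_act_right[OF that]])
  moreover have "env_act M actM (r \<otimes>\<^bsub>U\<^esub> env_incl L b) (\<phi> v) = env_act M actM r (\<phi> (env_act V act b v))"
    if "r \<in> carrier U" "b \<in> carrier (env (L\<lparr>carrier := H\<rparr>))" "v \<in> carrier V" for r b v
    using that by (simp add: M.env_act_mult env_incl_closed bal)
  ultimately have "\<exists>\<Psi>. linear_mapping Ind M \<Psi> \<and>
      (\<forall>r\<in>carrier U. \<forall>v\<in>carrier V. \<Psi> (ten r v) = env_act M actM r (\<phi> v))"
    by (rule ex_balanced_lift)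
  then obtain \<Psi> where \<Psi>: "linear_mapping Ind M \<Psi>"
    and ten: "\<And>r v. \<lbrakk>r \<in> carrier U; v \<in> carrier V\<rbrakk> \<Longrightarrow> \<Psi> (ten r v) = env_act M actM r (\<phi> v)"
    by blast
  have unit: "\<Psi> (unit_tensor v) = \<phi> v" if "v \<in> carrier V" for v
    using ten[OF L.env_one_closed that] M.env_act_word[of "[]" "\<phi> v"] that by (simp add: L.env_one_eq)
  have "\<Psi> (iact x Z) = actM x (\<Psi> Z)" if x: "x \<in> carrier L" and Z: "Z \<in> carrier Ind" for x Z
  proof (rule linear_mapping_eq_on_span[OF linear_mapping_compose[OF linear_iact[OF x] \<Psi>]
        linear_mapping_compose[OF \<Psi> M.linear_act[OF x]] tensors_closed])
    show "Z \<in> lin_span Ind {ten r v | r v. r \<in> carrier U \<and> v \<in> carrier V}"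
      using Z by (simp only: span_tensor)
    fix T assume "T \<in> {ten r v | r v. r \<in> carrier U \<and> v \<in> carrier V}"
    then obtain r v where T: "T = ten r v" "r \<in> carrier U" "v \<in> carrier V" by auto
    have "env_word L [x] \<in> carrier U" using x by (intro L.env_word_closed) simp
    then show "\<Psi> (iact x T) = actM x (\<Psi> T)"
      using T x M.env_act_word[of "[x]"]
      by (simp add: iact_tensor ten L.env_mult_closed M.env_act_mult M.env_act_closed)
  qed
  then show ?thesis using that \<Psi> unit by blast
qed

end

section \<open>Twisted current algebras\<close>

text \<open>Matrices are functions of two indices together with the finite set over which products are
  summed. The rows and columns may then be indexed by a basis.\<close>
definition mat_mult :: "'i set \<Rightarrow> ('i \<Rightarrow> 'i \<Rightarrow> 'r::comm_ring_1) \<Rightarrow> ('i \<Rightarrow> 'i \<Rightarrow> 'r) \<Rightarrow> 'i \<Rightarrow> 'i \<Rightarrow> 'r" where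
  "mat_mult B M N a b = (\<Sum>c\<in>B. M a c * N c b)"

definition mat_comm :: "'i set \<Rightarrow> ('i \<Rightarrow> 'i \<Rightarrow> 'r::comm_ring_1) \<Rightarrow> ('i \<Rightarrow> 'i \<Rightarrow> 'r) \<Rightarrow> 'i \<Rightarrow> 'i \<Rightarrow> 'r" where
  "mat_comm B M N a b = mat_mult B M N a b - mat_mult B N M a b"

lemma mat_mult_assoc: "mat_mult B (mat_mult B L M) N = mat_mult B L (mat_mult B M N)"
proof (intro ext)
  fix a b
  have "mat_mult B (mat_mult B L M) N a b = (\<Sum>c\<in>B. \<Sum>d\<in>B. L a d * M d c * N c b)"
    by (simp add: mat_mult_def sum_distrib_right)
  also have "\<dots> = (\<Sum>d\<in>B. \<Sum>c\<in>B. L a d * M d c * N c b)" by (rule sum.swap)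
  also have "\<dots> = mat_mult B L (mat_mult B M N) a b"
    by (simp add: mat_mult_def sum_distrib_left mult.assoc)
  finally show "mat_mult B (mat_mult B L M) N a b = mat_mult B L (mat_mult B M N) a b" .
qed

lemma mat_mult_comm_left:
  "mat_mult B (mat_comm B L M) N a b = mat_mult B (mat_mult B L M) N a b - mat_mult B (mat_mult B M L) N a b"
  unfolding mat_comm_def mat_mult_def[of B _ N] by (simp add: left_diff_distrib sum_subtractf)

lemma mat_mult_comm_right:
  "mat_mult B N (mat_comm B L M) a b = mat_mult B N (mat_mult B L M) a b - mat_mult B N (mat_mult B M L) a b"
  unfolding mat_comm_def mat_mult_def[of B N] by (simp add: right_diff_distrib sum_subtractf)

lemma mat_jacobi:
  "mat_comm B L (mat_comm B M N) a b + mat_comm B M (mat_comm B N L) a b + mat_comm B N (mat_comm B L M) a b = 0"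
  unfolding mat_comm_def[of B L "mat_comm B M N"] mat_comm_def[of B M "mat_comm B N L"]
    mat_comm_def[of B N "mat_comm B L M"]
  by (simp add: mat_mult_comm_left mat_mult_comm_right mat_mult_assoc)

lemma lie_of_module_simps [simp]:
  "carrier (lie_of_module M br) = carrier M" "\<zero>\<^bsub>lie_of_module M br\<^esub> = \<zero>\<^bsub>M\<^esub>"
  "x \<oplus>\<^bsub>lie_of_module M br\<^esub> y = x \<oplus>\<^bsub>M\<^esub> y" "c \<odot>\<^bsub>lie_of_module M br\<^esub> x = c \<odot>\<^bsub>M\<^esub> x"
  "lbracket (lie_of_module M br) = br"
  by (simp_all add: lie_of_module_def)

lemma vec_space_lie_of_module: "vec_space M \<Longrightarrow> vec_space (lie_of_module M br)"
proof -
  assume "vec_space M"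
  then interpret vec_space M .
  show ?thesis
    by (rule vec_spaceI) (simp_all add: a_ac smult_add_left smult_add_right smult_smult)
qed

lemma family_module_simps [simp]:
  "carrier (family_module G) = {x. \<forall>m. x m \<in> carrier G}" "\<zero>\<^bsub>family_module G\<^esub> = (\<lambda>m. \<zero>\<^bsub>G\<^esub>)"
  "x \<oplus>\<^bsub>family_module G\<^esub> y = (\<lambda>m. x m \<oplus>\<^bsub>G\<^esub> y m)" "c \<odot>\<^bsub>family_module G\<^esub> x = (\<lambda>m. c \<odot>\<^bsub>G\<^esub> x m)"
  by (simp_all add: family_module_def)

text \<open>What is used of a split simple Lie algebra: a basis, the involution and the absence of a centre.\<close>
locale twisted_currents = lie_algebra G + dual_based_space G B l
  for G :: "('k::field, 'g) lie" (structure) and B :: "'g set" and l :: "'g \<Rightarrow> 'g \<Rightarrow> 'k" +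
  fixes \<theta> :: "'g \<Rightarrow> 'g"
  assumes theta_hom: "lie_hom G G \<theta>"
    and theta_theta: "x \<in> carrier G \<Longrightarrow> \<theta> (\<theta> x) = x"
    and centreless: "\<lbrakk>x \<in> carrier G; \<And>y. y \<in> carrier G \<Longrightarrow> lbracket G x y = \<zero>\<rbrakk> \<Longrightarrow> x = \<zero>"
    and two: "(2::'k) \<noteq> 0"
begin

sublocale \<theta>: linear_mapping G G \<theta>
  using theta_hom by (simp add: linear_mapping_def linear_mapping_axioms_def lie_hom_def vec_space_axioms)

lemma theta_bracket: "\<lbrakk>x \<in> carrier G; y \<in> carrier G\<rbrakk> \<Longrightarrow> \<theta> (lbracket G x y) = lbracket G (\<theta> x) (\<theta> y)"
  using theta_hom by (simp add: lie_hom_def)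

lemma vec_space_family: "vec_space (family_module G :: ('k, 'm \<Rightarrow> 'g) module)"
  unfolding family_module_def by (rule vec_space_pi_module) (auto simp: vec_space_axioms)

text \<open>The projections onto the two eigenspaces of the involution.\<close>
definition kpart :: "'g \<Rightarrow> 'g" where "kpart v = (1/2) \<odot> (v \<oplus> \<theta> v)"
definition ppart :: "'g \<Rightarrow> 'g" where "ppart v = (1/2) \<odot> (v \<ominus> \<theta> v)"

lemma kpart_closed [simp]: "v \<in> carrier G \<Longrightarrow> kpart v \<in> carrier G"
  and ppart_closed [simp]: "v \<in> carrier G \<Longrightarrow> ppart v \<in> carrier G"
  by (simp_all add: kpart_def ppart_def)

lemma linear_kpart: "linear_mapping G G kpart"
  by (rule linear_mappingI)
    (simp_all add: vec_space_axioms kpart_def \<theta>.add \<theta>.smult smult_add_right smult_smult a_ac mult.commute)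

lemma linear_ppart: "linear_mapping G G ppart"
  by (rule linear_mappingI)
    (simp_all add: vec_space_axioms ppart_def diff_eq_smult \<theta>.add \<theta>.smult smult_add_right smult_smult a_ac mult.commute)

lemma theta_kpart: "v \<in> carrier G \<Longrightarrow> \<theta> (kpart v) = kpart v"
  by (simp add: kpart_def \<theta>.smult \<theta>.add theta_theta a_comm)

lemma theta_ppart: "v \<in> carrier G \<Longrightarrow> \<theta> (ppart v) = \<ominus> ppart v"
proof -
  assume v: "v \<in> carrier G"
  have "\<theta> (ppart v) = (1/2) \<odot> (\<theta> v \<ominus> v)" using v by (simp add: ppart_def \<theta>.smult \<theta>.diff theta_theta)
  also have "\<theta> v \<ominus> v = \<ominus> (v \<ominus> \<theta> v)" using v by (simp add: minus_diff)
  finally show ?thesis using v by (simp add: ppart_def smult_minus_right)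
qed

lemma half_add_self: "v \<in> carrier G \<Longrightarrow> (1/2) \<odot> (v \<oplus> v) = v"
proof -
  assume v: "v \<in> carrier G"
  have "(1/2) \<odot> (v \<oplus> v) = (1/2) \<odot> v \<oplus> (1/2) \<odot> v" using v by (rule smult_add_right) (rule v)
  also have "\<dots> = (1/2 + 1/2) \<odot> v" using v by (rule smult_add_left[symmetric])
  also have "(1/2 + 1/2 :: 'k) = 1" using two by (metis add_divide_distrib divide_self one_add_one)
  finally show ?thesis using v by simp
qed

lemma kpart_fix: "\<lbrakk>v \<in> carrier G; \<theta> v = v\<rbrakk> \<Longrightarrow> kpart v = v"
  by (simp add: kpart_def half_add_self)

lemma kpart_anti: "\<lbrakk>v \<in> carrier G; \<theta> v = \<ominus> v\<rbrakk> \<Longrightarrow> kpart v = \<zero>"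
  by (simp add: kpart_def r_neg)

lemma ppart_anti: "\<lbrakk>v \<in> carrier G; \<theta> v = \<ominus> v\<rbrakk> \<Longrightarrow> ppart v = v"
  by (simp add: ppart_def minus_eq half_add_self)

lemma ppart_fix: "\<lbrakk>v \<in> carrier G; \<theta> v = v\<rbrakk> \<Longrightarrow> ppart v = \<zero>"
  by (simp add: ppart_def)

lemma kpart_idem: "v \<in> carrier G \<Longrightarrow> kpart (kpart v) = kpart v"
  by (simp add: kpart_fix theta_kpart)

lemma ppart_idem: "v \<in> carrier G \<Longrightarrow> ppart (ppart v) = ppart v"
  by (simp add: ppart_anti theta_ppart)

lemma kpart_add_ppart: "v \<in> carrier G \<Longrightarrow> kpart v \<oplus> ppart v = v"
proof -
  assume v: "v \<in> carrier G"
  have "kpart v \<oplus> ppart v = (1/2) \<odot> ((v \<oplus> \<theta> v) \<oplus> (v \<ominus> \<theta> v))"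
    using v by (simp add: kpart_def ppart_def smult_add_right)
  also have "(v \<oplus> \<theta> v) \<oplus> (v \<ominus> \<theta> v) = (v \<oplus> v) \<oplus> (\<theta> v \<oplus> \<ominus> \<theta> v)"
    using v by (simp add: minus_eq a_ac)
  also have "\<dots> = v \<oplus> v" using v by (simp add: r_neg)
  finally show ?thesis using v by (simp add: half_add_self)
qed

text \<open>This is the expansion of \<open>\<pi> (y m)\<close> in the basis, projected once more so that the second factors of
  the tensors lie in the eigenspace.\<close>

lemma family_expand:
  fixes y :: "'m \<Rightarrow> 'g"
  assumes \<pi>: "linear_mapping G G \<pi>" and idem: "\<And>v. v \<in> carrier G \<Longrightarrow> \<pi> (\<pi> v) = \<pi> v"
    and y: "\<And>m. y m \<in> carrier G"
  shows "(\<lambda>m. \<pi> (y m)) = finsum (family_module G) (\<lambda>b. pure G (\<lambda>m. l b (\<pi> (y m))) (\<pi> b)) B"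
proof
  fix m
  interpret \<pi>: linear_mapping G G \<pi> by (rule \<pi>)
  interpret F: vec_space "family_module G :: ('k, 'm \<Rightarrow> 'g) module" by (rule vec_space_family)
  have "linear_mapping (family_module G :: ('k, 'm \<Rightarrow> 'g) module) G (\<lambda>x. x m)"
    by (rule linear_mappingI) (simp_all add: vec_space_axioms F.vec_space_axioms)
  from linear_mapping.sum[OF this, of "\<lambda>b. pure G (\<lambda>m. l b (\<pi> (y m))) (\<pi> b)" B]
  have "finsum (family_module G) (\<lambda>b. pure G (\<lambda>m. l b (\<pi> (y m))) (\<pi> b)) B m =
      finsum G (\<lambda>b. l b (\<pi> (y m)) \<odot> \<pi> b) B"
    using basis_closed by (simp add: pure_def Pi_iff)
  also have "\<dots> = finsum G (\<lambda>b. \<pi> (l b (\<pi> (y m)) \<odot> b)) B"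
    using basis_closed by (intro finsum_cong') (auto simp: \<pi>.smult)
  also have "\<dots> = \<pi> (finsum G (\<lambda>b. l b (\<pi> (y m)) \<odot> b) B)"
    using basis_closed by (intro \<pi>.sum[symmetric]) auto
  also have "\<dots> = \<pi> (y m)" using y by (simp add: expand idem)
  finally show "\<pi> (y m) = finsum (family_module G) (\<lambda>b. pure G (\<lambda>m. l b (\<pi> (y m))) (\<pi> b)) B m" ..
qed

lemma pure_closed: "x \<in> carrier G \<Longrightarrow> pure G p x \<in> carrier (family_module G)"
  by (simp add: pure_def)

text \<open>Every family in \<open>C\<close> is the sum of its projections to the eigenspaces, whose coordinate families have
  to lie in \<open>Rp\<close> and \<open>Rm\<close>.\<close>

lemma twisted_eqI:
  fixes C :: "('m \<Rightarrow> 'g) set"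
  assumes C: "submodule C KK (family_module G)"
    and kC: "\<And>p x. \<lbrakk>p \<in> Rp; x \<in> carrier G; \<theta> x = x\<rbrakk> \<Longrightarrow> pure G p x \<in> C"
    and pC: "\<And>p x. \<lbrakk>p \<in> Rm; x \<in> carrier G; \<theta> x = \<ominus> x\<rbrakk> \<Longrightarrow> pure G p x \<in> C"
    and kR: "\<And>y b. y \<in> C \<Longrightarrow> (\<lambda>m. l b (kpart (y m))) \<in> Rp"
    and pR: "\<And>y b. y \<in> C \<Longrightarrow> (\<lambda>m. l b (ppart (y m))) \<in> Rm"
  shows "twisted G \<theta> Rp Rm br = (lie_of_module (family_module G) br)\<lparr>carrier := C\<rparr>"
proof -
  let ?F = "family_module G :: ('k, 'm \<Rightarrow> 'g) module"
  interpret F: vec_space ?F by (rule vec_space_family)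
  let ?K = "{pure G p x | p x. p \<in> Rp \<and> x \<in> fix_space G \<theta>}"
  let ?P = "{pure G p x | p x. p \<in> Rm \<and> x \<in> anti_space G \<theta>}"
  have K: "?K \<subseteq> carrier ?F" and P: "?P \<subseteq> carrier ?F"
    using pure_closed by (auto simp: fix_space_def anti_space_def simp del: family_module_simps)
  have "lin_span ?F ?K <+>\<^bsub>?F\<^esub> lin_span ?F ?P = C"
  proof
    have "lin_span ?F ?K \<subseteq> C" "lin_span ?F ?P \<subseteq> C"
      using kC pC by (intro F.lin_span_least[OF C]; auto simp: fix_space_def anti_space_def)+
    then show "lin_span ?F ?K <+>\<^bsub>?F\<^esub> lin_span ?F ?P \<subseteq> C"
      using F.submodule_add[OF C] by (auto simp: set_add_def')
    show "C \<subseteq> lin_span ?F ?K <+>\<^bsub>?F\<^esub> lin_span ?F ?P"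
    proof
      fix y assume y: "y \<in> C"
      then have yG: "\<And>m. y m \<in> carrier G" using F.submodule_subset[OF C] by auto
      have "(\<lambda>m. kpart (y m)) \<in> lin_span ?F ?K"
      proof (subst family_expand[OF linear_kpart kpart_idem yG], assumption, rule F.submodule_finsum[OF F.submodule_lin_span[OF K]], rule F.lin_span_base[OF K],
          intro CollectI exI conjI refl)
        fix b assume "b \<in> B"
        then show "kpart b \<in> fix_space G \<theta>" using basis_closed theta_kpart by (simp add: fix_space_def)
      qed (rule refl kR[OF y])+
      moreover have "(\<lambda>m. ppart (y m)) \<in> lin_span ?F ?P"
      proof (subst family_expand[OF linear_ppart ppart_idem yG], assumption, rule F.submodule_finsum[OF F.submodule_lin_span[OF P]], rule F.lin_span_base[OF P],
          intro CollectI exI conjI refl)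
        fix b assume "b \<in> B"
        then show "ppart b \<in> anti_space G \<theta>" using basis_closed theta_ppart by (simp add: anti_space_def)
      qed (rule refl pR[OF y])+
      moreover have "y = (\<lambda>m. kpart (y m)) \<oplus>\<^bsub>?F\<^esub> (\<lambda>m. ppart (y m))"
        using yG by (simp add: kpart_add_ppart)
      ultimately show "y \<in> lin_span ?F ?K <+>\<^bsub>?F\<^esub> lin_span ?F ?P"
        unfolding set_add_def' by blast
    qed
  qed
  then show ?thesis by (simp add: twisted_def lie_of_module_def)
qed

subsection \<open>Power series\<close>

lemma eq_uminus_iff: "x = - x \<longleftrightarrow> x = 0" and uminus_eq_iff: "- x = x \<longleftrightarrow> x = 0" for x :: 'k
proof -
  have "x = - x \<longleftrightarrow> 2 * x = 0" by (metis add_eq_0_iff mult_2)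
  then show "x = - x \<longleftrightarrow> x = 0" using two by simp
  then show "- x = x \<longleftrightarrow> x = 0" by auto
qed

text \<open>Changing the sign of the variable multiplies the coefficient of degree \<open>n\<close> by \<open>(-1)^n\<close>.\<close>

lemma even_part_iff: "(c :: nat \<Rightarrow> 'k) \<in> even_part R \<longleftrightarrow> Abs_fps c \<in> R \<and> (\<forall>n. odd n \<longrightarrow> c n = 0)"
proof -
  have "(-1) ^ n * x =  x \<longleftrightarrow> (odd n \<longrightarrow> x = 0)" for n and x :: 'k
    by (cases "even n") (auto simp: eq_uminus_iff uminus_eq_iff)
  then have *: "fps_compose p (- fps_X) =  p \<longleftrightarrow> (\<forall>n. odd n \<longrightarrow> fps_nth p n = 0)" for p :: "'k fps"
    by (simp add: fps_compose_uminus' fps_eq_iff)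
  show ?thesis
  proof
    assume "c \<in> even_part R"
    then obtain p where "p \<in> R" "fps_compose p (- fps_X) =  p" "c = fps_nth p"
      by (auto simp: even_part_def)
    then show "Abs_fps c \<in> R \<and> (\<forall>n. odd n \<longrightarrow> c n = 0)" using *[of p] by (simp add: fps_nth_inverse)
  next
    assume "Abs_fps c \<in> R \<and> (\<forall>n. odd n \<longrightarrow> c n = 0)"
    then have "Abs_fps c \<in> {p \<in> R. fps_compose p (- fps_X) =  p}" by (simp add: *)
    then have "fps_nth (Abs_fps c) \<in> even_part R" unfolding even_part_def by (rule imageI)
    then show "c \<in> even_part R" by (simp add: Abs_fps_inverse)
  qed
qed

lemma odd_part_iff: "(c :: nat \<Rightarrow> 'k) \<in> odd_part R \<longleftrightarrow> Abs_fps c \<in> R \<and> (\<forall>n. even n \<longrightarrow> c n = 0)"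
proof -
  have "(-1) ^ n * x = - x \<longleftrightarrow> (even n \<longrightarrow> x = 0)" for n and x :: 'k
    by (cases "even n") (auto simp: eq_uminus_iff uminus_eq_iff)
  then have *: "fps_compose p (- fps_X) = - p \<longleftrightarrow> (\<forall>n. even n \<longrightarrow> fps_nth p n = 0)" for p :: "'k fps"
    by (simp add: fps_compose_uminus' fps_eq_iff)
  show ?thesis
  proof
    assume "c \<in> odd_part R"
    then obtain p where "p \<in> R" "fps_compose p (- fps_X) = - p" "c = fps_nth p"
      by (auto simp: odd_part_def)
    then show "Abs_fps c \<in> R \<and> (\<forall>n. even n \<longrightarrow> c n = 0)" using *[of p] by (simp add: fps_nth_inverse)
  next
    assume "Abs_fps c \<in> R \<and> (\<forall>n. even n \<longrightarrow> c n = 0)"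
    then have "Abs_fps c \<in> {p \<in> R. fps_compose p (- fps_X) = - p}" by (simp add: *)
    then have "fps_nth (Abs_fps c) \<in> odd_part R" unfolding odd_part_def by (rule imageI)
    then show "c \<in> odd_part R" by (simp add: Abs_fps_inverse)
  qed
qed

lemma Abs_fps_in_polys: "Abs_fps c \<in> range fps_of_poly \<longleftrightarrow> finite {n. c n \<noteq> (0::'k)}"
proof
  assume "Abs_fps c \<in> range fps_of_poly"
  then obtain p where "Abs_fps c = fps_of_poly p" by auto
  then have "c n = Polynomial.coeff p n" for n by (metis fps_nth_Abs_fps fps_of_poly_nth)
  then have "{n. c n \<noteq> 0} \<subseteq> {..Polynomial.degree p}" using le_degree[of p] by auto
  then show "finite {n. c n \<noteq> 0}" by (rule finite_subset) simp
next
  assume fin: "finite {n. c n \<noteq> 0}"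
  have "\<forall>\<^sub>\<infinity>n. c n = 0" using fin by (simp add: MOST_iff_cofinite)
  then have "Abs_fps c = fps_of_poly (Abs_poly c)" by (simp add: fps_eq_iff Abs_poly_inverse)
  then show "Abs_fps c \<in> range fps_of_poly" by blast
qed

lemma Abs_fps_in_truncated: "Abs_fps c \<in> range (fps_cutoff (Suc N)) \<longleftrightarrow> (\<forall>n>N. c n = (0::'k))"
proof
  assume "Abs_fps c \<in> range (fps_cutoff (Suc N))"
  then obtain p where "Abs_fps c = fps_cutoff (Suc N) p" by auto
  then have "c n = fps_nth (fps_cutoff (Suc N) p) n" for n by (metis fps_nth_Abs_fps)
  then show "\<forall>n>N. c n = 0" by simp
next
  assume "\<forall>n>N. c n = 0"
  then have "Abs_fps c = fps_cutoff (Suc N) (Abs_fps c)" by (auto simp: fps_eq_iff)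
  then show "Abs_fps c \<in> range (fps_cutoff (Suc N))" by blast
qed

text \<open>The component in which the coefficient of degree \<open>m\<close> lies.\<close>

definition comp :: "nat \<Rightarrow> 'g set" where
  "comp m = (if even m then fix_space G \<theta> else anti_space G \<theta>)"

lemma comp_iff: "x \<in> comp m \<longleftrightarrow> x \<in> carrier G \<and> \<theta> x = (-1) ^ m \<odot> x"
  by (auto simp: comp_def fix_space_def anti_space_def minus_eq_smult)

lemma comp_closed: "x \<in> comp m \<Longrightarrow> x \<in> carrier G"
  by (simp add: comp_iff)

lemma submodule_comp: "submodule (comp m) KK G"
  by (rule subspaceI)
    (auto simp: comp_iff \<theta>.zero \<theta>.add \<theta>.smult smult_add_right smult_smult mult.commute)

lemma comp_bracket: "\<lbrakk>x \<in> comp i; y \<in> comp j\<rbrakk> \<Longrightarrow> lbracket G x y \<in> comp (i + j)"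
  by (simp add: comp_iff lbracket_closed theta_bracket lbracket_smult_left lbracket_smult_right smult_smult power_add mult.commute)

definition series :: "(nat \<Rightarrow> 'g) set" where
  "series = {x. \<forall>m. x m \<in> comp m}"

definition polys :: "(nat \<Rightarrow> 'g) set" where
  "polys = {x \<in> series. finite {m. x m \<noteq> \<zero>}}"

definition truncated :: "nat \<Rightarrow> (nat \<Rightarrow> 'g) set" where
  "truncated N = {x \<in> series. \<forall>m>N. x m = \<zero>}"

lemma truncated_subset: "truncated N \<subseteq> polys"
proof
  fix x assume x: "x \<in> truncated N"
  then have "{m. x m \<noteq> \<zero>} \<subseteq> {..N}" by (force simp: truncated_def not_less)
  then show "x \<in> polys" using x finite_subset[of _ "{..N}"] by (auto simp: truncated_def polys_def)
qed

lemma series_comp: "x \<in> series \<Longrightarrow> x m \<in> comp m"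
  by (simp add: series_def)

lemma series_closed: "x \<in> series \<Longrightarrow> x m \<in> carrier G"
  by (rule comp_closed[OF series_comp])

lemma submodule_series: "submodule series KK (family_module G)"
proof -
  interpret F: vec_space "family_module G :: ('k, nat \<Rightarrow> 'g) module" by (rule vec_space_family)
  have "series \<subseteq> carrier (family_module G)" using series_closed by auto
  then show ?thesis
    by (intro F.subspaceI)
      (auto simp: series_def submodule_zero[OF submodule_comp] submodule_add[OF submodule_comp]
        submodule_smult[OF submodule_comp])
qed

lemma submodule_polys: "submodule polys KK (family_module G)"
proof -
  interpret F: vec_space "family_module G :: ('k, nat \<Rightarrow> 'g) module" by (rule vec_space_family)
  show ?thesis
  proof (rule F.subspaceI)
    show "polys \<subseteq> carrier (family_module G)" using F.submodule_subset[OF submodule_series] by (auto simp: polys_def)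
    show "\<zero>\<^bsub>family_module G\<^esub> \<in> polys" using F.submodule_zero[OF submodule_series] by (simp add: polys_def)
  next
    fix x y assume x: "x \<in> polys" and y: "y \<in> polys"
    have "{m. x m \<oplus> y m \<noteq> \<zero>} \<subseteq> {m. x m \<noteq> \<zero>} \<union> {m. y m \<noteq> \<zero>}" by auto
    then have "finite {m. x m \<oplus> y m \<noteq> \<zero>}" using x y finite_subset by (fastforce simp: polys_def)
    then show "x \<oplus>\<^bsub>family_module G\<^esub> y \<in> polys"
      using x y F.submodule_add[OF submodule_series, of x y] by (auto simp: polys_def)
  next
    fix c x assume x: "x \<in> polys"
    have "{m. c \<odot> x m \<noteq> \<zero>} \<subseteq> {m. x m \<noteq> \<zero>}" by auto
    then have "finite {m. c \<odot> x m \<noteq> \<zero>}" using x finite_subset by (fastforce simp: polys_def)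
    then show "c \<odot>\<^bsub>family_module G\<^esub> x \<in> polys"
      using x F.submodule_smult[OF submodule_series, of x c] by (auto simp: polys_def)
  qed
qed

lemma submodule_truncated: "submodule (truncated N) KK (family_module G)"
proof -
  interpret F: vec_space "family_module G :: ('k, nat \<Rightarrow> 'g) module" by (rule vec_space_family)
  show ?thesis
  proof (rule F.subspaceI)
    show "truncated N \<subseteq> carrier (family_module G)" using F.submodule_subset[OF submodule_series] by (auto simp: truncated_def)
    show "\<zero>\<^bsub>family_module G\<^esub> \<in> truncated N" using F.submodule_zero[OF submodule_series] by (simp add: truncated_def)
    show "x \<oplus>\<^bsub>family_module G\<^esub> y \<in> truncated N" if "x \<in> truncated N" "y \<in> truncated N" for x y
      using that F.submodule_add[OF submodule_series, of x y] by (auto simp: truncated_def)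
    show "c \<odot>\<^bsub>family_module G\<^esub> x \<in> truncated N" if "x \<in> truncated N" for c x
      using that F.submodule_smult[OF submodule_series, of x c] by (auto simp: truncated_def)
  qed
qed

definition current_algebra :: "('k, nat \<Rightarrow> 'g) lie" where
  "current_algebra = lie_of_module (family_module G) (current_bracket G)"

lemma pure_series:
  assumes x: "x \<in> carrier G" and "\<theta> x = (-1) ^ e \<odot> x" and "\<And>m. odd (m + e) \<Longrightarrow> p m = 0"
  shows "pure G p x \<in> series"
proof -
  have "p m \<odot> x \<in> comp m" for m
  proof (cases "even (m + e)")
    case True
    then have "(-1) ^ e = ((-1) ^ m :: 'k)" by (auto simp: minus_one_power_iff)
    then have "x \<in> comp m" using assms by (simp add: comp_iff)
    then show ?thesis by (rule submodule_smult[OF submodule_comp])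
  next
    case False
    then show ?thesis using assms submodule_zero[OF submodule_comp] by simp
  qed
  then show ?thesis by (simp add: series_def pure_def)
qed

lemma kpart_series: "\<lbrakk>y \<in> series; odd m\<rbrakk> \<Longrightarrow> kpart (y m) = \<zero>"
  by (rule kpart_anti) (auto simp: series_def comp_def anti_space_def dest: spec[of _ m])

lemma ppart_series: "\<lbrakk>y \<in> series; even m\<rbrakk> \<Longrightarrow> ppart (y m) = \<zero>"
  by (rule ppart_fix) (auto simp: series_def comp_def fix_space_def dest: spec[of _ m])

lemma N_series_eq: "N_series G \<theta> = current_algebra\<lparr>carrier := series\<rparr>"
  unfolding N_series_def current_algebra_def
  by (rule twisted_eqI[OF submodule_series])
    (auto simp: even_part_iff odd_part_iff kpart_series ppart_series coord_zero
      minus_eq_smult intro: pure_series[where e = 0] pure_series[where e = 1])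

lemma kpart_zero: "kpart \<zero> = \<zero>" and ppart_zero: "ppart \<zero> = \<zero>"
  by (rule linear_mapping.zero[OF linear_kpart] linear_mapping.zero[OF linear_ppart])+

lemma N_poly_eq: "N_poly G \<theta> = current_algebra\<lparr>carrier := polys\<rparr>"
proof -
  have "finite {m. p m \<odot> x \<noteq> \<zero>}" if "finite {m. p m \<noteq> 0}" "x \<in> carrier G" for p :: "nat \<Rightarrow> 'k" and x
    by (rule finite_subset[OF _ that(1)]) (use that in auto)
  moreover have "finite {m. l b (kpart (y m)) \<noteq> 0}" "finite {m. l b (ppart (y m)) \<noteq> 0}" if "y \<in> polys" for y b
    using that by (auto simp: polys_def coord_zero kpart_zero ppart_zero elim!: rev_finite_subset)
  ultimately show ?thesis
    unfolding N_poly_def current_algebra_def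
    by (intro twisted_eqI[OF submodule_polys])
      (auto simp: even_part_iff odd_part_iff kpart_series ppart_series coord_zero Abs_fps_in_polys polys_def
      minus_eq_smult pure_def intro: pure_series[where e = 0, unfolded pure_def] pure_series[where e = 1, unfolded pure_def])
qed

lemma N_trunc_eq: "N_trunc G \<theta> N =
    (lie_of_module (family_module G) (\<lambda>x y. cut_at G N (current_bracket G x y)))\<lparr>carrier := truncated N\<rparr>"
  unfolding N_trunc_def
  by (intro twisted_eqI[OF submodule_truncated])
    (auto simp: even_part_iff odd_part_iff kpart_series ppart_series coord_zero Abs_fps_in_truncated truncated_def
      minus_eq_smult pure_def kpart_zero ppart_zero
      intro: pure_series[where e = 0, unfolded pure_def] pure_series[where e = 1, unfolded pure_def])

subsection \<open>The adjoint matrices\<close>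

text \<open>The matrix of the bracket with \<open>x\<close>, with entries in the power series. As \<open>G\<close> has no centre,
  it determines \<open>x\<close>, and so the Lie algebra identities of the current algebra follow from those of
  matrix commutators.\<close>

definition ad_matrix :: "(nat \<Rightarrow> 'g) \<Rightarrow> 'g \<Rightarrow> 'g \<Rightarrow> 'k fps" where
  "ad_matrix x a b = Abs_fps (\<lambda>m. l a (lbracket G (x m) b))"

lemma eq_zero_if_brackets_zero:
  assumes x: "x \<in> carrier G" and zero: "\<And>a b. \<lbrakk>a \<in> B; b \<in> B\<rbrakk> \<Longrightarrow> l a (lbracket G x b) = 0"
  shows "x = \<zero>"
proof (rule centreless[OF x])
  fix y assume y: "y \<in> carrier G"
  interpret r: linear_mapping G G "lbracket G x" by (rule linear_lbracket_right[OF x])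
  have "lbracket G x y = lbracket G x (finsum G (\<lambda>b. l b y \<odot> b) B)" using y by (simp add: expand)
  also have "\<dots> = finsum G (\<lambda>b. lbracket G x (l b y \<odot> b)) B"
    using basis_closed by (intro r.sum) auto
  also have "\<dots> = finsum G (\<lambda>b. \<zero>) B"
  proof (rule finsum_cong')
    fix b assume b: "b \<in> B"
    have "lbracket G x b = \<zero>"
      using b zero basis_closed[OF b] x by (intro eqI) (auto simp: lbracket_closed coord_zero)
    then show "lbracket G x (l b y \<odot> b) = \<zero>" using basis_closed[OF b] by (simp add: r.smult)
  qed auto
  finally show "lbracket G x y = \<zero>" by (simp add: finsum_zero)
qed

lemma current_bracket_closed:
  assumes "\<And>m. x m \<in> carrier G" "\<And>m. y m \<in> carrier G"
  shows "current_bracket G x y m \<in> carrier G"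
  unfolding current_bracket_def using assms by (auto intro!: finsum_closed simp: lbracket_closed)

lemma functional_bracket_left: "y \<in> carrier G \<Longrightarrow> functional G (\<lambda>x. l a (lbracket G x y))"
  and functional_bracket_right: "x \<in> carrier G \<Longrightarrow> functional G (\<lambda>y. l a (lbracket G x y))"
  by (simp_all add: functional_def lbracket_add_left lbracket_add_right lbracket_smult_left lbracket_smult_right
      lbracket_closed coord_add coord_smult)

lemma bracket_bracket:
  assumes "x \<in> carrier G" "y \<in> carrier G" "z \<in> carrier G"
  shows "lbracket G (lbracket G x y) z = lbracket G x (lbracket G y z) \<ominus> lbracket G y (lbracket G x z)"
proof -
  have "lbracket G x (lbracket G y z) \<oplus> lbracket G y (lbracket G z x) = \<ominus> lbracket G z (lbracket G x y)"
    using jacobi[OF assms] assms by (metis lbracket_closed a_closed minus_equality minus_minus)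
  moreover have "\<ominus> lbracket G z (lbracket G x y) = lbracket G (lbracket G x y) z"
    using assms lbracket_flip[of z "lbracket G x y"] by (simp add: lbracket_closed)
  moreover have "lbracket G y (lbracket G z x) = \<ominus> lbracket G y (lbracket G x z)"
    using assms lbracket_flip[of x z] by (simp add: lbracket_closed lbracket_minus_right)
  ultimately show ?thesis by (simp add: minus_eq)
qed

lemma coord_bracket_bracket:
  assumes "x \<in> carrier G" "y \<in> carrier G" "z \<in> carrier G"
  shows "l a (lbracket G x (lbracket G y z)) = (\<Sum>c\<in>B. l a (lbracket G x c) * l c (lbracket G y z))"
  using functional_expand[OF functional_bracket_right[OF assms(1)], of "lbracket G y z" a] assms
  by (simp add: lbracket_closed mult.commute)

text \<open>The convolution of the coefficients is the multiplication of power series, so that this is the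
  adjoint representation over the ring of power series.\<close>

lemma ad_matrix_bracket:
  assumes x: "\<And>m. x m \<in> carrier G" and y: "\<And>m. y m \<in> carrier G" and b: "b \<in> B"
  shows "ad_matrix (current_bracket G x y) a b = mat_comm B (ad_matrix x) (ad_matrix y) a b"
proof (rule fps_ext)
  fix m
  have bG: "b \<in> carrier G" by (rule basis_closed[OF b])
  have "fps_nth (ad_matrix (current_bracket G x y) a b) m =
      (\<Sum>i\<le>m. l a (lbracket G (lbracket G (x i) (y (m - i))) b))"
    unfolding ad_matrix_def current_bracket_def fps_nth_Abs_fps
    using x y functional_finsum[OF functional_bracket_left[OF bG], of "\<lambda>i. lbracket G (x i) (y (m - i))" "{..m}"]
    by (simp add: lbracket_closed Pi_iff)
  also have "\<dots> = (\<Sum>i\<le>m. (\<Sum>c\<in>B. l a (lbracket G (x i) c) * l c (lbracket G (y (m - i)) b)) -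
      (\<Sum>c\<in>B. l a (lbracket G (y (m - i)) c) * l c (lbracket G (x i) b)))"
    using x y bG by (simp add: bracket_bracket coord_diff lbracket_closed coord_bracket_bracket)
  also have "\<dots> = (\<Sum>c\<in>B. \<Sum>i\<le>m. l a (lbracket G (x i) c) * l c (lbracket G (y (m - i)) b)) -
      (\<Sum>c\<in>B. \<Sum>i\<le>m. l c (lbracket G (x i) b) * l a (lbracket G (y (m - i)) c))"
    by (subst (1 2) sum.swap) (simp add: sum_subtractf mult.commute)
  also have "\<dots> = fps_nth (mat_comm B (ad_matrix x) (ad_matrix y) a b) m"
    unfolding mat_comm_def mat_mult_def mult.commute[of "ad_matrix y _ _" "ad_matrix x _ _"]
    by (simp add: fps_sum_nth fps_mult_nth ad_matrix_def atMost_atLeast0)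
  finally show "fps_nth (ad_matrix (current_bracket G x y) a b) m = \<dots>" .
qed

lemma ad_matrix_inject:
  assumes x: "\<And>m. x m \<in> carrier G" and zero: "\<And>a b. \<lbrakk>a \<in> B; b \<in> B\<rbrakk> \<Longrightarrow> ad_matrix x a b = 0"
  shows "x = (\<lambda>m. \<zero>)"
proof
  fix m
  have "fps_nth (ad_matrix x a b) m = 0" if "a \<in> B" "b \<in> B" for a b using zero[OF that] by simp
  then show "x m = \<zero>" using x by (intro eq_zero_if_brackets_zero) (simp_all add: ad_matrix_def)
qed

lemma ad_matrix_add:
  "\<lbrakk>\<And>m. x m \<in> carrier G; \<And>m. y m \<in> carrier G; b \<in> B\<rbrakk> \<Longrightarrow>
    ad_matrix (\<lambda>m. x m \<oplus> y m) a b = ad_matrix x a b + ad_matrix y a b"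
  by (simp add: ad_matrix_def fps_eq_iff lbracket_add_left basis_closed coord_add lbracket_closed)

lemma mat_comm_cong:
  assumes "\<And>a b. \<lbrakk>a \<in> C; b \<in> C\<rbrakk> \<Longrightarrow> N a b = N' a b" "a \<in> C" "b \<in> C"
  shows "mat_comm C M N a b = mat_comm C M N' a b"
  using assms by (simp add: mat_comm_def mat_mult_def)

lemma lie_algebra_current: "lie_algebra current_algebra"
proof -
  have cl: "\<And>m. current_bracket G x y m \<in> carrier G" if "\<And>m. x m \<in> carrier G" "\<And>m. y m \<in> carrier G" for x y
    using current_bracket_closed that .
  show ?thesis
    unfolding current_algebra_def
  proof (rule lie_algebraI[OF vec_space_lie_of_module[OF vec_space_family]];
      simp only: lie_of_module_simps family_module_simps mem_Collect_eq)
    fix x y z :: "nat \<Rightarrow> 'g"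
    assume x: "\<forall>m. x m \<in> carrier G" and y: "\<forall>m. y m \<in> carrier G"
    show "\<forall>m. current_bracket G x y m \<in> carrier G" using cl x y by blast
    have fs: "(\<lambda>i. lbracket G (u i) (v (m - i))) \<in> {..m} \<rightarrow> carrier G"
      if "\<forall>m. u m \<in> carrier G" "\<forall>m. v m \<in> carrier G" for u v and m :: nat
      using that by (auto simp: lbracket_closed)
    show "current_bracket G (\<lambda>m. c \<odot> x m) y = (\<lambda>m. c \<odot> current_bracket G x y m)" for c
      unfolding current_bracket_def using x y
      by (subst finsum_smult[OF fs]) (auto simp: lbracket_smult_left)
    show "current_bracket G x (\<lambda>m. c \<odot> y m) = (\<lambda>m. c \<odot> current_bracket G x y m)" for c
      unfolding current_bracket_def using x y
      by (subst finsum_smult[OF fs]) (auto simp: lbracket_smult_right)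
    assume z: "\<forall>m. z m \<in> carrier G"
    show "current_bracket G (\<lambda>m. x m \<oplus> y m) z = (\<lambda>m. current_bracket G x z m \<oplus> current_bracket G y z m)"
      unfolding current_bracket_def using x y z
      by (subst finsum_addf[OF fs fs, symmetric]) (auto simp: lbracket_add_left)
    show "current_bracket G x (\<lambda>m. y m \<oplus> z m) = (\<lambda>m. current_bracket G x y m \<oplus> current_bracket G x z m)"
      unfolding current_bracket_def using x y z
      by (subst finsum_addf[OF fs fs, symmetric]) (auto simp: lbracket_add_right)
    have jac: "ad_matrix (current_bracket G u (current_bracket G v w)) a b =
        mat_comm B (ad_matrix u) (mat_comm B (ad_matrix v) (ad_matrix w)) a b"
      if "\<forall>m. u m \<in> carrier G" "\<forall>m. v m \<in> carrier G" "\<forall>m. w m \<in> carrier G" "a \<in> B" "b \<in> B" for u v w a b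
    proof -
      have "ad_matrix (current_bracket G u (current_bracket G v w)) a b =
          mat_comm B (ad_matrix u) (ad_matrix (current_bracket G v w)) a b"
        using that cl[of v w] by (intro ad_matrix_bracket) auto
      also have "\<dots> = mat_comm B (ad_matrix u) (mat_comm B (ad_matrix v) (ad_matrix w)) a b"
        using that by (intro mat_comm_cong ad_matrix_bracket) auto
      finally show ?thesis .
    qed
    show "(\<lambda>m. current_bracket G x (current_bracket G y z) m \<oplus> current_bracket G y (current_bracket G z x) m \<oplus>
        current_bracket G z (current_bracket G x y) m) = (\<lambda>m. \<zero>)"
    proof (rule ad_matrix_inject)
      fix a b assume ab: "a \<in> B" "b \<in> B"
      show "ad_matrix (\<lambda>m. current_bracket G x (current_bracket G y z) m \<oplus> current_bracket G y (current_bracket G z x) m \<oplus>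
        current_bracket G z (current_bracket G x y) m) a b = 0"
        using x y z ab cl by (simp add: ad_matrix_add jac mat_jacobi)
    qed (use x y z cl in auto)
  next
    fix x :: "nat \<Rightarrow> 'g" assume x: "\<forall>m. x m \<in> carrier G"
    show "current_bracket G x x = (\<lambda>m. \<zero>)"
      using x cl[of x x] by (intro ad_matrix_inject) (auto simp: ad_matrix_bracket mat_comm_def)
  qed
qed

lemma current_algebra_simps [simp]:
  "carrier current_algebra = {x. \<forall>m. x m \<in> carrier G}" "\<zero>\<^bsub>current_algebra\<^esub> = (\<lambda>m. \<zero>)"
  "x \<oplus>\<^bsub>current_algebra\<^esub> y = (\<lambda>m. x m \<oplus> y m)" "c \<odot>\<^bsub>current_algebra\<^esub> x = (\<lambda>m. c \<odot> x m)"
  "lbracket current_algebra = current_bracket G"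
  by (simp_all add: current_algebra_def)

lemma submodule_current: "submodule C KK (family_module G) \<Longrightarrow> submodule C KK current_algebra"
  by (simp add: submodule_def submodule_axioms_def subgroup_def m_inv_def current_algebra_def)

lemma series_bracket:
  assumes "x \<in> series" "y \<in> series"
  shows "current_bracket G x y \<in> series"
proof -
  have "lbracket G (x i) (y (m - i)) \<in> comp m" if "i \<le> m" for i m
    using comp_bracket[of "x i" i "y (m - i)" "m - i"] assms that by (simp add: series_def)
  then show ?thesis
    unfolding current_bracket_def series_def by (auto intro!: submodule_finsum[OF submodule_comp])
qed

lemma current_bracket_eq_zero:
  assumes "x \<in> series" "y \<in> series" "\<And>i. i \<le> m \<Longrightarrow> x i = \<zero> \<or> y (m - i) = \<zero>"
  shows "current_bracket G x y m = \<zero>"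
proof -
  have "current_bracket G x y m = finsum G (\<lambda>i. \<zero>) {..m}"
    unfolding current_bracket_def using assms series_closed
    by (intro finsum_cong') (auto dest!: assms(3))
  then show ?thesis by (simp add: finsum_zero)
qed

lemma polys_bracket:
  assumes x: "x \<in> polys" and y: "y \<in> polys"
  shows "current_bracket G x y \<in> polys"
proof -
  have s: "x \<in> series" "y \<in> series" using x y by (auto simp: polys_def)
  let ?S = "(\<lambda>(i, j). i + j) ` ({m. x m \<noteq> \<zero>} \<times> {m. y m \<noteq> \<zero>})"
  have "{m. current_bracket G x y m \<noteq> \<zero>} \<subseteq> ?S"
  proof
    fix m assume "m \<in> {m. current_bracket G x y m \<noteq> \<zero>}"
    then obtain i where "i \<le> m" "x i \<noteq> \<zero>" "y (m - i) \<noteq> \<zero>"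
      using current_bracket_eq_zero[OF s, of m] by auto
    then show "m \<in> ?S" by (auto intro!: image_eqI[of _ _ "(i, m - i)"])
  qed
  moreover have "finite ?S" using x y by (auto simp: polys_def)
  ultimately show ?thesis using series_bracket[OF s] finite_subset by (auto simp: polys_def)
qed

lemma lie_subalgebra_series: "lie_subalgebra current_algebra series"
  by (simp add: lie_subalgebra_def submodule_current[OF submodule_series] series_bracket)

lemma lie_subalgebra_polys: "lie_subalgebra current_algebra polys"
  by (simp add: lie_subalgebra_def submodule_current[OF submodule_polys] polys_bracket)

lemma lie_algebra_N_series: "lie_algebra (N_series G \<theta>)"
  unfolding N_series_eq by (rule lie_algebra.lie_algebra_restrict[OF lie_algebra_current lie_subalgebra_series])

lemma lie_algebra_N_poly: "lie_algebra (N_poly G \<theta>)"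
  unfolding N_poly_eq by (rule lie_algebra.lie_algebra_restrict[OF lie_algebra_current lie_subalgebra_polys])

lemma N_simps [simp]:
  "carrier (N_series G \<theta>) = series" "carrier (N_poly G \<theta>) = polys" "carrier (N_trunc G \<theta> N) = truncated N"
  "\<zero>\<^bsub>N_series G \<theta>\<^esub> = (\<lambda>m. \<zero>)" "\<zero>\<^bsub>N_poly G \<theta>\<^esub> = (\<lambda>m. \<zero>)" "\<zero>\<^bsub>N_trunc G \<theta> N\<^esub> = (\<lambda>m. \<zero>)"
  "x \<oplus>\<^bsub>N_series G \<theta>\<^esub> y = (\<lambda>m. x m \<oplus> y m)" "x \<oplus>\<^bsub>N_poly G \<theta>\<^esub> y = (\<lambda>m. x m \<oplus> y m)"
  "x \<oplus>\<^bsub>N_trunc G \<theta> N\<^esub> y = (\<lambda>m. x m \<oplus> y m)"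
  "c \<odot>\<^bsub>N_series G \<theta>\<^esub> x = (\<lambda>m. c \<odot> x m)" "c \<odot>\<^bsub>N_poly G \<theta>\<^esub> x = (\<lambda>m. c \<odot> x m)"
  "c \<odot>\<^bsub>N_trunc G \<theta> N\<^esub> x = (\<lambda>m. c \<odot> x m)"
  "lbracket (N_series G \<theta>) = current_bracket G" "lbracket (N_poly G \<theta>) = current_bracket G"
  "lbracket (N_trunc G \<theta> N) = (\<lambda>x y. cut_at G N (current_bracket G x y))"
  by (simp_all add: N_series_eq N_poly_eq N_trunc_eq)

lemma cut_at_truncated: "x \<in> series \<Longrightarrow> cut_at G N x \<in> truncated N"
  by (auto simp: truncated_def series_def cut_at_def submodule_zero[OF submodule_comp])

lemma cut_at_id: "x \<in> truncated N \<Longrightarrow> cut_at G N x = x"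
  by (auto simp: truncated_def cut_at_def)

lemma cut_at_bracket:
  assumes "x \<in> series" "y \<in> series"
  shows "cut_at G N (current_bracket G x y) = cut_at G N (current_bracket G (cut_at G N x) (cut_at G N y))"
proof -
  have "m - i \<le> N" if "m \<le> N" for m i using that by simp
  then show ?thesis
    using series_closed[OF assms(1)] series_closed[OF assms(2)]
    by (auto simp: cut_at_def current_bracket_def lbracket_closed simp del: le_diff_conv intro!: ext finsum_cong')
qed

lemma cut_at_linear:
  "cut_at G N (\<lambda>m. x m \<oplus> y m) = (\<lambda>m. cut_at G N x m \<oplus> cut_at G N y m)"
  "cut_at G N (\<lambda>m. c \<odot> x m) = (\<lambda>m. c \<odot> cut_at G N x m)"
  by (auto simp: cut_at_def)

lemma lie_hom_cut_at_series: "lie_hom (N_series G \<theta>) (N_trunc G \<theta> N) (cut_at G N)"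
  using cut_at_bracket by (simp add: lie_hom_def lin_map_def cut_at_truncated cut_at_linear)

lemma lie_hom_cut_at: "lie_hom (N_poly G \<theta>) (N_trunc G \<theta> N) (cut_at G N)"
  using lie_hom_cut_at_series by (simp add: lie_hom_def lin_map_def polys_def Pi_iff)

lemma cut_at_surj: "cut_at G N ` polys = truncated N"
proof
  show "cut_at G N ` polys \<subseteq> truncated N" using cut_at_truncated by (auto simp: polys_def)
  show "truncated N \<subseteq> cut_at G N ` polys"
  proof
    fix x assume x: "x \<in> truncated N"
    then show "x \<in> cut_at G N ` polys"
      using cut_at_id[OF x] truncated_subset by (intro image_eqI[of _ _ x]) auto
  qed
qed

lemma lie_algebra_N_trunc: "lie_algebra (N_trunc G \<theta> N)"
proof (rule lie_algebra_image[OF lie_algebra_N_poly _ lie_hom_cut_at])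
  show "vec_space (N_trunc G \<theta> N)"
    unfolding N_trunc_eq
    by (rule vec_space.submodule_vec_space[OF vec_space_lie_of_module[OF vec_space_family]])
      (use submodule_truncated in \<open>simp add: submodule_def submodule_axioms_def subgroup_def m_inv_def\<close>)
qed (simp add: cut_at_surj)

end

section \<open>The substitution homomorphisms\<close>

text \<open>Power series do not form a field, but the law of exponents holds for a unit.\<close>

lemma fps_powi_add:
  fixes t :: "'k::field fps"
  assumes "t * inverse t = 1"
  shows "t powi (i + j) = t powi i * t powi j"
proof -
  have step: "t powi (i + 1) = t powi i * t" for i
  proof (cases "i \<ge> 0")
    case True
    then show ?thesis by (simp add: power_int_def nat_add_distrib)
  next
    case False
    define k where "k = nat (- i - 1)"
    have k: "i = - 1 - int k" using False by (simp add: k_def)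
    have "inverse t * t = 1" using assms by (simp add: mult.commute)
    have "t powi (i + 1) = inverse t ^ k"
      by (cases "k = 0") (simp_all add: k power_int_def)
    moreover have "nat (- i) = Suc k" "\<not> i \<ge> 0" using k by auto
    then have "t powi i = inverse t ^ Suc k" by (simp only: power_int_def if_False)
    ultimately show ?thesis using \<open>inverse t * t = 1\<close> by (simp add: mult.assoc mult.left_commute)
  qed
  show ?thesis
  proof (induction j rule: int_induct[where k = 0])
    case (step1 j)
    then show ?case using step[of "i + j"] step[of j] by (simp add: add.assoc mult.assoc)
  next
    case (step2 j)
    have "t powi (i + (j - 1)) = t powi (i + (j - 1)) * t * inverse t" using assms by (simp add: mult.assoc)
    also have "t powi (i + (j - 1)) * t = t powi i * t powi j"
      using step[of "i + (j - 1)"] step2 by (simp add: algebra_simps)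
    also have "t powi j = t powi (j - 1) * t" using step[of "j - 1"] by simp
    finally show ?case using assms by (simp add: mult.assoc)
  qed simp
qed

text \<open>The parameter \<open>s (1 - u) / (1 + u)\<close> is inverted by changing the sign of \<open>u\<close> if the square of
  \<open>s\<close> is \<open>1\<close>.\<close>

definition cayley :: "'k::field \<Rightarrow> 'k fps" where
  "cayley s = fps_const s * ((1 - fps_X) / (1 + fps_X))"

lemma cayley_mult: "cayley s * (1 + fps_X) = fps_const s * (1 - fps_X :: 'k::field fps)"
proof -
  have "(1 + fps_X :: 'k fps) $ 0 \<noteq> 0" by simp
  then have "(1 - fps_X) / (1 + fps_X) * (1 + fps_X :: 'k fps) = 1 - fps_X"
    by (simp add: fps_divide_unit mult.assoc inverse_mult_eq_1)
  then show ?thesis by (simp add: cayley_def mult.assoc)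
qed

lemma
  fixes s :: "'k::field"
  assumes s: "s * s = 1"
  shows cayley_compose: "fps_compose (cayley s) (- fps_X) = inverse (cayley s)"
    and cayley_unit: "cayley s * inverse (cayley s) = 1"
    and cayley_inverse_compose: "fps_compose (inverse (cayley s)) (- fps_X) = cayley s"
proof -
  let ?\<sigma> = "\<lambda>f :: 'k fps. fps_compose f (- fps_X)"
  have mult: "?\<sigma> (f * g) = ?\<sigma> f * ?\<sigma> g" for f g by (simp add: fps_compose_mult_distrib)
  have "?\<sigma> (1 + fps_X) = 1 - fps_X" "?\<sigma> (1 - fps_X) = 1 + fps_X"
    by (simp_all add: fps_compose_add_distrib fps_compose_sub_distrib)
  moreover have "?\<sigma> (fps_const s) = fps_const s" by simp
  ultimately have *: "?\<sigma> (cayley s) * (1 - fps_X) = fps_const s * (1 + fps_X)"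
    using arg_cong[OF cayley_mult[of s], of ?\<sigma>] by (simp only: mult)
  have "(cayley s * ?\<sigma> (cayley s)) * ((1 + fps_X) * (1 - fps_X)) =
      (cayley s * (1 + fps_X)) * (?\<sigma> (cayley s) * (1 - fps_X))"
    by (simp only: mult_ac)
  also have "\<dots> = (fps_const s * (1 - fps_X)) * (fps_const s * (1 + fps_X))"
    by (simp only: * cayley_mult)
  also have "\<dots> = (fps_const s * fps_const s) * ((1 + fps_X) * (1 - fps_X))"
    by (simp only: mult_ac)
  also have "fps_const s * fps_const s = 1" using s by simp
  finally have "(cayley s * ?\<sigma> (cayley s)) * ((1 + fps_X) * (1 - fps_X)) = 1 * ((1 + fps_X) * (1 - fps_X))" .
  moreover have "((1 + fps_X) * (1 - fps_X) :: 'k fps) $ 0 \<noteq> 0" by (simp add: fps_mult_nth)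
  then have "((1 + fps_X) * (1 - fps_X) :: 'k fps) \<noteq> 0" by auto
  ultimately have inv: "cayley s * ?\<sigma> (cayley s) = 1" by (simp only: mult_cancel_right simp_thms)
  then show c: "?\<sigma> (cayley s) = inverse (cayley s)" using fps_inverse_unique by metis
  then show unit: "cayley s * inverse (cayley s) = 1" using inv by simp
  have "inverse (cayley s) * ?\<sigma> (inverse (cayley s)) = 1"
    using arg_cong[OF unit, of ?\<sigma>] by (simp add: mult c)
  then have "inverse (inverse (cayley s)) = ?\<sigma> (inverse (cayley s))" by (rule fps_inverse_unique)
  moreover have "inverse (inverse (cayley s)) = cayley s"
    using unit by (intro fps_inverse_unique) (simp add: mult.commute)
  ultimately show "?\<sigma> (inverse (cayley s)) = cayley s" by simp
qed

lemma cayley_powi_sign: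
  fixes s :: "'k::field"
  assumes "s * s = 1"
  shows "(cayley s powi (- i)) $ m = (-1) ^ m * (cayley s powi i) $ m"
proof -
  have "fps_compose (cayley s powi i) (- fps_X) = cayley s powi (- i)"
    using cayley_compose[OF assms] cayley_inverse_compose[OF assms]
    by (auto simp: power_int_def fps_compose_power[symmetric])
  then show ?thesis by (metis fps_compose_uminus' fps_nth_Abs_fps)
qed

text \<open>The integral powers of \<open>(1 - u) / (1 + u)\<close> are linearly independent: clearing denominators
  turns a relation into one between polynomials, and evaluation at \<open>u = 1\<close> isolates the lowest
  coefficient.\<close>

lemma cayley_powi_independent:
  fixes c :: "int \<Rightarrow> 'k::field"
  assumes two: "(2::'k) \<noteq> 0" and A: "finite A" and rel: "(\<Sum>i\<in>A. fps_const (c i) * cayley 1 powi i) = 0"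
    and i: "i \<in> A"
  shows "c i = 0"
proof (rule ccontr)
  assume "c i \<noteq> 0"
  define S where "S = {i \<in> A. c i \<noteq> 0}"
  have S: "finite S" "S \<noteq> {}" using A i \<open>c i \<noteq> 0\<close> by (auto simp: S_def)
  \<comment> \<open>Multiplication by the power \<open>- m\<close> of the parameter and by \<open>(1 + u)\<^sup>K\<close> leaves polynomials.\<close>
  define m where "m = Min S"
  define K where "K = nat (Max S - m)"
  have m: "m \<in> S" "\<And>j. j \<in> S \<Longrightarrow> m \<le> j" using S by (auto simp: m_def)
  have K: "nat (j - m) \<le> K" if "j \<in> S" for j
    using Max_ge[OF S(1) that] by (auto simp: K_def)
  let ?t = "cayley 1 :: 'k fps"
  have unit: "?t * inverse ?t = 1" by (rule cayley_unit) simp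
  have pow: "?t powi j * ?t powi (- m) = ?t ^ nat (j - m)" if "j \<in> S" for j
    using fps_powi_add[OF unit, of j "- m"] m(2)[OF that] by (simp add: power_int_def)
  have clear: "?t ^ n * (1 + fps_X) ^ K = (1 - fps_X) ^ n * (1 + fps_X) ^ (K - n)" if "n \<le> K" for n
  proof -
    have "(1 + fps_X :: 'k fps) ^ K = (1 + fps_X) ^ n * (1 + fps_X) ^ (K - n)"
      using that by (metis power_add le_add_diff_inverse)
    then have "?t ^ n * (1 + fps_X) ^ K = (?t * (1 + fps_X)) ^ n * (1 + fps_X) ^ (K - n)"
      by (simp add: power_mult_distrib mult.assoc)
    then show ?thesis by (simp add: cayley_mult)
  qed
  let ?q = "\<Sum>j\<in>S. Polynomial.smult (c j) ([:1, -1:] ^ nat (j - m) * [:1, 1:] ^ (K - nat (j - m)))"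
  have lin: "fps_of_poly [:1, -1 :: 'k:] = 1 - fps_X" "fps_of_poly [:1, 1 :: 'k:] = 1 + fps_X"
    by (simp_all add: fps_of_poly_linear')
  have "fps_of_poly ?q = (\<Sum>j\<in>S. fps_const (c j) * ((1 - fps_X) ^ nat (j - m) * (1 + fps_X) ^ (K - nat (j - m))))"
    by (simp add: fps_of_poly_sum fps_of_poly_smult fps_of_poly_mult fps_of_poly_power lin)
  also have "\<dots> = (\<Sum>j\<in>S. fps_const (c j) * ?t powi j) * (?t powi (- m) * (1 + fps_X) ^ K)"
    unfolding sum_distrib_right
  proof (rule sum.cong[OF refl])
    fix j assume j: "j \<in> S"
    have "fps_const (c j) * ?t powi j * (?t powi (- m) * (1 + fps_X) ^ K) =
        fps_const (c j) * ((?t powi j * ?t powi (- m)) * (1 + fps_X) ^ K)"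
      by (simp only: mult.assoc)
    also have "\<dots> = fps_const (c j) * ((1 - fps_X) ^ nat (j - m) * (1 + fps_X) ^ (K - nat (j - m)))"
      by (simp only: pow[OF j] clear[OF K[OF j]])
    finally show "fps_const (c j) * ((1 - fps_X) ^ nat (j - m) * (1 + fps_X) ^ (K - nat (j - m))) =
        fps_const (c j) * ?t powi j * (?t powi (- m) * (1 + fps_X) ^ K)" by (rule sym)
  qed
  also have "(\<Sum>j\<in>S. fps_const (c j) * ?t powi j) = (\<Sum>i\<in>A. fps_const (c i) * ?t powi i)"
    using A by (intro sum.mono_neutral_left) (auto simp: S_def)
  finally have "fps_of_poly ?q = fps_of_poly 0" using rel by simp
  then have q: "?q = 0" by (simp only: fps_of_poly_eq_iff)
  \<comment> \<open>At \<open>u = 1\<close> every positive power of \<open>1 - u\<close> vanishes.\<close>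
  have "poly ?q 1 = (\<Sum>j\<in>S. if j = m then c m * 2 ^ K else 0)"
    unfolding poly_sum
  proof (rule sum.cong[OF refl])
    fix j assume j: "j \<in> S"
    have "j \<noteq> m \<Longrightarrow> nat (j - m) \<noteq> 0" using m(2)[OF j] by auto
    then show "poly (Polynomial.smult (c j) ([:1, -1:] ^ nat (j - m) * [:1, 1:] ^ (K - nat (j - m)))) 1 =
        (if j = m then c m * 2 ^ K else 0)"
      by (cases "j = m") simp_all
  qed
  also have "\<dots> = c m * 2 ^ K" using S m by simp
  finally have "c m * 2 ^ K = 0" by (simp only: q poly_0)
  then show False using m(1) two by (auto simp: S_def)
qed

context twisted_currents
begin

text \<open>A family is read as a Laurent series with coefficients in \<open>G\<close>. In both summands of the affine
  algebra the substitution of the inverse of \<open>t\<close> amounts to applying \<open>\<theta>\<close> to the coefficients.\<close>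
definition loops :: "(int \<Rightarrow> 'g) set" where
  "loops = {x. (\<forall>m. x m \<in> carrier G) \<and> finite {m. x m \<noteq> \<zero>} \<and> (\<forall>m. \<theta> (x m) = x (- m))}"

lemma loops_closed: "x \<in> loops \<Longrightarrow> x m \<in> carrier G"
  and loops_finite: "x \<in> loops \<Longrightarrow> finite {m. x m \<noteq> \<zero>}"
  and loops_theta: "x \<in> loops \<Longrightarrow> \<theta> (x m) = x (- m)"
  by (simp_all add: loops_def)

lemma loops_support_uminus:
  assumes "x \<in> loops"
  shows "uminus ` {m. x m \<noteq> \<zero>} = {m. x m \<noteq> \<zero>}"
proof -
  have "x (- m) = \<zero> \<longleftrightarrow> x m = \<zero>" for m
    using loops_theta[OF assms, of m] loops_theta[OF assms, of "- m"] by (auto simp: \<theta>.zero)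
  then have "uminus ` {m. x m \<noteq> \<zero>} \<subseteq> {m. x m \<noteq> \<zero>}"
    and "\<And>m. x m \<noteq> \<zero> \<Longrightarrow> - (- m) \<in> uminus ` {m. x m \<noteq> \<zero>}"
    by blast+
  then show ?thesis by auto
qed

lemma submodule_loops: "submodule loops KK (family_module G)"
proof -
  interpret F: vec_space "family_module G :: ('k, int \<Rightarrow> 'g) module" by (rule vec_space_family)
  show ?thesis
  proof (rule F.subspaceI)
    fix x y assume x: "x \<in> loops" and y: "y \<in> loops"
    have "{m. x m \<oplus> y m \<noteq> \<zero>} \<subseteq> {m. x m \<noteq> \<zero>} \<union> {m. y m \<noteq> \<zero>}" by auto
    then have "finite {m. x m \<oplus> y m \<noteq> \<zero>}"
      by (rule finite_subset) (simp add: loops_finite x y)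
    then show "x \<oplus>\<^bsub>family_module G\<^esub> y \<in> loops"
      using x y by (simp add: loops_def \<theta>.add)
  next
    fix c x assume x: "x \<in> loops"
    have "finite {m. c \<odot> x m \<noteq> \<zero>}"
      by (rule finite_subset[OF _ loops_finite[OF x]]) auto
    then show "c \<odot>\<^bsub>family_module G\<^esub> x \<in> loops" using x by (simp add: loops_def \<theta>.smult)
  qed (auto simp: loops_def \<theta>.zero)
qed

lemma laurent_iff:
  fixes c :: "int \<Rightarrow> 'k"
  shows "c \<in> laurent_plus \<longleftrightarrow> finite {m. c m \<noteq> 0} \<and> (\<forall>m. c (- m) = c m)"
    and "c \<in> laurent_minus \<longleftrightarrow> finite {m. c m \<noteq> 0} \<and> (\<forall>m. c (- m) = - c m)"
proof -
  have key: "Poly_Mapping.lookup (Poly_Mapping.map_key uminus P) m = Poly_Mapping.lookup P (- m)"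
    for P :: "int \<Rightarrow>\<^sub>0 'k" and m
    by (simp add: map_key.rep_eq)
  have fin: "finite {m. Poly_Mapping.lookup P m \<noteq> 0}" for P :: "int \<Rightarrow>\<^sub>0 'k"
    by (rule finite_lookup)
  have plus: "Poly_Mapping.map_key uminus P = P \<longleftrightarrow> (\<forall>m. Poly_Mapping.lookup P (- m) = Poly_Mapping.lookup P m)"
    and minus: "Poly_Mapping.map_key uminus P = - P \<longleftrightarrow> (\<forall>m. Poly_Mapping.lookup P (- m) = - Poly_Mapping.lookup P m)"
    for P :: "int \<Rightarrow>\<^sub>0 'k"
    by (simp_all add: poly_mapping_eq_iff fun_eq_iff key)
  show "c \<in> laurent_plus \<longleftrightarrow> finite {m. c m \<noteq> 0} \<and> (\<forall>m. c (- m) = c m)"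
  proof
    assume "c \<in> laurent_plus"
    then obtain P where "Poly_Mapping.map_key uminus P = P" "c = Poly_Mapping.lookup P"
      unfolding laurent_plus_def by blast
    then show "finite {m. c m \<noteq> 0} \<and> (\<forall>m. c (- m) = c m)" using fin plus by simp
  next
    assume c: "finite {m. c m \<noteq> 0} \<and> (\<forall>m. c (- m) = c m)"
    then have "Poly_Mapping.lookup (Abs_poly_mapping c) = c" by (simp add: Abs_poly_mapping_inverse)
    moreover from this have "Poly_Mapping.map_key uminus (Abs_poly_mapping c) = Abs_poly_mapping c"
      using c plus by simp
    then have "Poly_Mapping.lookup (Abs_poly_mapping c) \<in> laurent_plus" unfolding laurent_plus_def by blast
    ultimately show "c \<in> laurent_plus" by simp
  qed
  show "c \<in> laurent_minus \<longleftrightarrow> finite {m. c m \<noteq> 0} \<and> (\<forall>m. c (- m) = - c m)"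
  proof
    assume "c \<in> laurent_minus"
    then obtain P where "Poly_Mapping.map_key uminus P = - P" "c = Poly_Mapping.lookup P"
      unfolding laurent_minus_def by blast
    then show "finite {m. c m \<noteq> 0} \<and> (\<forall>m. c (- m) = - c m)" using fin minus by simp
  next
    assume c: "finite {m. c m \<noteq> 0} \<and> (\<forall>m. c (- m) = - c m)"
    then have "Poly_Mapping.lookup (Abs_poly_mapping c) = c" by (simp add: Abs_poly_mapping_inverse)
    moreover from this have "Poly_Mapping.map_key uminus (Abs_poly_mapping c) = - Abs_poly_mapping c"
      using c minus by simp
    then have "Poly_Mapping.lookup (Abs_poly_mapping c) \<in> laurent_minus" unfolding laurent_minus_def by blast
    ultimately show "c \<in> laurent_minus" by simp
  qed
qed

lemma k_aff_eq: "k_aff G \<theta> = (lie_of_module (family_module G) (laurent_bracket G))\<lparr>carrier := loops\<rparr>"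
  unfolding k_aff_def
proof (rule twisted_eqI[OF submodule_loops])
  fix p :: "int \<Rightarrow> 'k" and x
  assume p: "p \<in> laurent_plus" and x: "x \<in> carrier G" "\<theta> x = x"
  have "finite {m. p m \<odot> x \<noteq> \<zero>}" by (rule finite_subset[of _ "{m. p m \<noteq> 0}"]) (use p x in \<open>auto simp: laurent_iff\<close>)
  then show "pure G p x \<in> loops" using p x by (simp add: loops_def pure_def laurent_iff \<theta>.smult)
next
  fix p :: "int \<Rightarrow> 'k" and x
  assume p: "p \<in> laurent_minus" and x: "x \<in> carrier G" "\<theta> x = \<ominus> x"
  have "finite {m. p m \<odot> x \<noteq> \<zero>}" by (rule finite_subset[of _ "{m. p m \<noteq> 0}"]) (use p x in \<open>auto simp: laurent_iff\<close>)
  then show "pure G p x \<in> loops"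
    using p x by (simp add: loops_def pure_def laurent_iff \<theta>.smult smult_minus_right smult_minus_left)
next
  fix y b assume y: "y \<in> loops"
  have "finite {m. l b (kpart (y m)) \<noteq> 0}"
    by (rule finite_subset[OF _ loops_finite[OF y]]) (auto simp: kpart_zero coord_zero)
  moreover have "kpart (y (- m)) = kpart (y m)" for m
    using loops_closed[OF y] by (simp add: loops_theta[OF y, symmetric] kpart_def theta_theta a_comm)
  ultimately show "(\<lambda>m. l b (kpart (y m))) \<in> laurent_plus" by (simp add: laurent_iff)
next
  fix y b assume y: "y \<in> loops"
  have "finite {m. l b (ppart (y m)) \<noteq> 0}"
    by (rule finite_subset[OF _ loops_finite[OF y]]) (auto simp: ppart_zero coord_zero)
  moreover have "ppart (y (- m)) = \<ominus> ppart (y m)" for m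
    using loops_closed[OF y]
    by (simp add: loops_theta[OF y, symmetric] ppart_def theta_theta smult_minus_right[symmetric] minus_diff)
  ultimately show "(\<lambda>m. l b (ppart (y m))) \<in> laurent_minus"
    using loops_closed[OF y] by (simp add: laurent_iff coord_minus)
qed

lemma k_aff_simps [simp]:
  "carrier (k_aff G \<theta>) = loops" "\<zero>\<^bsub>k_aff G \<theta>\<^esub> = (\<lambda>m. \<zero>)"
  "x \<oplus>\<^bsub>k_aff G \<theta>\<^esub> y = (\<lambda>m. x m \<oplus> y m)" "c \<odot>\<^bsub>k_aff G \<theta>\<^esub> x = (\<lambda>m. c \<odot> x m)"
  "lbracket (k_aff G \<theta>) = laurent_bracket G"
  by (simp_all add: k_aff_eq)

lemma vec_space_k_aff: "vec_space (k_aff G \<theta>)"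
  unfolding k_aff_eq
  by (rule vec_space.submodule_vec_space[OF vec_space_lie_of_module[OF vec_space_family]])
    (use submodule_loops in \<open>simp add: submodule_def submodule_axioms_def subgroup_def m_inv_def\<close>)

lemma loops_bracket:
  assumes x: "x \<in> loops" and y: "y \<in> loops"
  shows "laurent_bracket G x y \<in> loops"
proof -
  have cl: "lbracket G (x i) (y j) \<in> carrier G" for i j using x y by (simp add: loops_closed lbracket_closed)
  have "{m. laurent_bracket G x y m \<noteq> \<zero>} \<subseteq> (\<lambda>(i, j). i + j) ` ({m. x m \<noteq> \<zero>} \<times> {m. y m \<noteq> \<zero>})"
  proof
    fix m assume m: "m \<in> {m. laurent_bracket G x y m \<noteq> \<zero>}"
    have "\<exists>i. x i \<noteq> \<zero> \<and> y (m - i) \<noteq> \<zero>"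
    proof (rule ccontr)
      assume "\<nexists>i. x i \<noteq> \<zero> \<and> y (m - i) \<noteq> \<zero>"
      then have "laurent_bracket G x y m = finsum G (\<lambda>i. \<zero>) {i. x i \<noteq> \<zero>}"
        unfolding laurent_bracket_def using loops_closed[OF x] by (intro finsum_cong') auto
      then show False using m by (simp add: finsum_zero)
    qed
    then obtain i where "x i \<noteq> \<zero>" "y (m - i) \<noteq> \<zero>" by blast
    then show "m \<in> (\<lambda>(i, j). i + j) ` ({m. x m \<noteq> \<zero>} \<times> {m. y m \<noteq> \<zero>})"
      by (auto intro!: image_eqI[of _ _ "(i, m - i)"])
  qed
  then have "finite {m. laurent_bracket G x y m \<noteq> \<zero>}"
    by (rule finite_subset) (simp add: loops_finite x y)
  moreover have "\<theta> (laurent_bracket G x y m) = laurent_bracket G x y (- m)" for m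
  proof -
    let ?A = "{i. x i \<noteq> \<zero>}"
    have "\<theta> (laurent_bracket G x y m) = finsum G (\<lambda>i. \<theta> (lbracket G (x i) (y (m - i)))) ?A"
      unfolding laurent_bracket_def using cl by (intro \<theta>.sum) auto
    also have "\<dots> = finsum G (\<lambda>i. lbracket G (x (- i)) (y (- m - (- i)))) ?A"
      using x y cl by (intro finsum_cong') (auto simp: theta_bracket loops_closed loops_theta)
    also have "\<dots> = finsum G (\<lambda>i. lbracket G (x i) (y (- m - i))) (uminus ` ?A)"
      using cl by (intro finsum_reindex[symmetric]) auto
    finally show ?thesis unfolding loops_support_uminus[OF x] laurent_bracket_def .
  qed
  moreover have "laurent_bracket G x y m \<in> carrier G" for m
    unfolding laurent_bracket_def using cl by (intro finsum_closed) auto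
  ultimately show ?thesis by (simp add: loops_def)
qed

text \<open>The substitution before it is truncated.\<close>
definition rho_series :: "'k \<Rightarrow> (int \<Rightarrow> 'g) \<Rightarrow> nat \<Rightarrow> 'g" where
  "rho_series s x m = finsum G (\<lambda>i. (cayley s powi i) $ m \<odot> x i) {i. x i \<noteq> \<zero>}"

lemma rho_eq: "rho G s N x = cut_at G N (rho_series s x)"
  by (simp add: rho_def rho_series_def cayley_def fun_eq_iff cut_at_def)

lemma rho_series_superset:
  assumes "x \<in> loops" "finite A" "{i. x i \<noteq> \<zero>} \<subseteq> A"
  shows "rho_series s x m = finsum G (\<lambda>i. (cayley s powi i) $ m \<odot> x i) A"
  unfolding rho_series_def using assms loops_closed by (intro finsum_mono_neutral) auto

lemma rho_series_closed: "x \<in> loops \<Longrightarrow> rho_series s x m \<in> carrier G"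
  unfolding rho_series_def using loops_closed by (intro finsum_closed) auto

lemma coord_rho_series:
  assumes "x \<in> loops" "finite A" "{i. x i \<noteq> \<zero>} \<subseteq> A"
  shows "l a (rho_series s x m) = (\<Sum>i\<in>A. (cayley s powi i) $ m * l a (x i))"
  unfolding rho_series_superset[OF assms] using loops_closed[OF assms(1)]
  by (subst coord_finsum) (auto simp: coord_smult)

text \<open>Changing the sign of \<open>u\<close> inverts the parameter, so it negates the exponents, and this is the action
  of \<open>\<theta>\<close> on the coefficients.\<close>

lemma rho_series_in_series:
  assumes x: "x \<in> loops" and s: "s * s = 1"
  shows "rho_series s x \<in> series"
proof -
  let ?A = "{i. x i \<noteq> \<zero>}"
  have "\<theta> (rho_series s x m) = (-1) ^ m \<odot> rho_series s x m" for m
  proof -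
    have "\<theta> (rho_series s x m) = finsum G (\<lambda>i. \<theta> ((cayley s powi i) $ m \<odot> x i)) ?A"
      unfolding rho_series_def using loops_closed[OF x] by (intro \<theta>.sum) auto
    also have "\<dots> = finsum G (\<lambda>i. ((-1) ^ m * (cayley s powi (- i)) $ m) \<odot> x (- i)) ?A"
    proof (rule finsum_cong')
      fix i
      have "(-1) ^ m * ((-1) ^ m * c) = c" for c :: 'k by (cases "even m") simp_all
      then show "\<theta> ((cayley s powi i) $ m \<odot> x i) = ((-1) ^ m * (cayley s powi (- i)) $ m) \<odot> x (- i)"
        using loops_closed[OF x] by (simp add: \<theta>.smult loops_theta[OF x] cayley_powi_sign[OF s])
    qed (use loops_closed[OF x] in auto)
    also have "\<dots> = finsum G (\<lambda>i. ((-1) ^ m * (cayley s powi i) $ m) \<odot> x i) (uminus ` ?A)"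
      using loops_closed[OF x] by (intro finsum_reindex[symmetric]) auto
    also have "\<dots> = finsum G (\<lambda>i. (-1) ^ m \<odot> ((cayley s powi i) $ m \<odot> x i)) ?A"
      unfolding loops_support_uminus[OF x] using loops_closed[OF x]
      by (intro finsum_cong') (auto simp: smult_smult)
    also have "\<dots> = (-1) ^ m \<odot> rho_series s x m"
      unfolding rho_series_def using loops_closed[OF x] by (intro finsum_smult[symmetric]) auto
    finally show ?thesis .
  qed
  then show ?thesis using rho_series_closed[OF x] by (simp add: series_def comp_iff)
qed

lemma rho_series_add:
  assumes x: "x \<in> loops" and y: "y \<in> loops"
  shows "rho_series s (\<lambda>m. x m \<oplus> y m) = (\<lambda>m. rho_series s x m \<oplus> rho_series s y m)"
proof
  fix m
  let ?A = "{i. x i \<noteq> \<zero>} \<union> {i. y i \<noteq> \<zero>}"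
  have A: "finite ?A" using loops_finite x y by auto
  interpret F: vec_space "family_module G :: ('k, int \<Rightarrow> 'g) module" by (rule vec_space_family)
  have xy: "(\<lambda>m. x m \<oplus> y m) \<in> loops" using F.submodule_add[OF submodule_loops x y] by simp
  have "rho_series s (\<lambda>m. x m \<oplus> y m) m = finsum G (\<lambda>i. (cayley s powi i) $ m \<odot> (x i \<oplus> y i)) ?A"
    by (rule rho_series_superset[OF xy A]) auto
  also have "\<dots> = finsum G (\<lambda>i. (cayley s powi i) $ m \<odot> x i \<oplus> (cayley s powi i) $ m \<odot> y i) ?A"
    using loops_closed x y by (intro finsum_cong') (auto simp: smult_add_right)
  also have "\<dots> = rho_series s x m \<oplus> rho_series s y m"
    using loops_closed x y A
    by (subst (1 2) rho_series_superset[of _ ?A]) (auto intro!: finsum_addf)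
  finally show "rho_series s (\<lambda>m. x m \<oplus> y m) m = rho_series s x m \<oplus> rho_series s y m" .
qed

lemma rho_series_smult:
  assumes x: "x \<in> loops"
  shows "rho_series s (\<lambda>m. c \<odot> x m) = (\<lambda>m. c \<odot> rho_series s x m)"
proof
  fix m
  interpret F: vec_space "family_module G :: ('k, int \<Rightarrow> 'g) module" by (rule vec_space_family)
  have cx: "(\<lambda>m. c \<odot> x m) \<in> loops" using F.submodule_smult[OF submodule_loops x, of c] by simp
  have "rho_series s (\<lambda>m. c \<odot> x m) m = finsum G (\<lambda>i. (cayley s powi i) $ m \<odot> (c \<odot> x i)) {i. x i \<noteq> \<zero>}"
    by (rule rho_series_superset[OF cx loops_finite[OF x]]) auto
  also have "\<dots> = finsum G (\<lambda>i. c \<odot> ((cayley s powi i) $ m \<odot> x i)) {i. x i \<noteq> \<zero>}"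
    using loops_closed x by (intro finsum_cong') (auto simp: smult_smult mult.commute)
  also have "\<dots> = c \<odot> rho_series s x m"
    unfolding rho_series_def using loops_closed x by (intro finsum_smult[symmetric]) auto
  finally show "rho_series s (\<lambda>m. c \<odot> x m) m = c \<odot> rho_series s x m" .
qed

lemma bracket_expand:
  assumes "finite I" "finite J'" "\<And>i. i \<in> I \<Longrightarrow> x i \<in> carrier G" "\<And>j. j \<in> J' \<Longrightarrow> y j \<in> carrier G"
  shows "l a (lbracket G (finsum G (\<lambda>i. p i \<odot> x i) I) (finsum G (\<lambda>j. q j \<odot> y j) J')) =
    (\<Sum>i\<in>I. \<Sum>j\<in>J'. p i * q j * l a (lbracket G (x i) (y j)))"
proof -
  have y: "finsum G (\<lambda>j. q j \<odot> y j) J' \<in> carrier G" using assms by (intro finsum_closed) auto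
  have "l a (lbracket G (finsum G (\<lambda>i. p i \<odot> x i) I) (finsum G (\<lambda>j. q j \<odot> y j) J')) =
      (\<Sum>i\<in>I. l a (lbracket G (p i \<odot> x i) (finsum G (\<lambda>j. q j \<odot> y j) J')))"
    using assms by (intro functional_finsum[OF functional_bracket_left[OF y]]) auto
  also have "\<dots> = (\<Sum>i\<in>I. \<Sum>j\<in>J'. l a (lbracket G (p i \<odot> x i) (q j \<odot> y j)))"
    using assms by (intro sum.cong refl functional_finsum[OF functional_bracket_right]) auto
  also have "\<dots> = (\<Sum>i\<in>I. \<Sum>j\<in>J'. p i * q j * l a (lbracket G (x i) (y j)))"
    using assms by (intro sum.cong refl)
      (simp add: lbracket_smult_left lbracket_smult_right lbracket_closed coord_smult)
  finally show ?thesis .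
qed

text \<open>Both sides are sums of \<open>t\<^sup>i t\<^sup>j [x\<^sub>i, y\<^sub>j]\<close> over all \<open>i\<close> and \<open>j\<close>.\<close>

lemma rho_series_bracket:
  assumes x: "x \<in> loops" and y: "y \<in> loops" and s: "s * s = 1"
  shows "rho_series s (laurent_bracket G x y) = current_bracket G (rho_series s x) (rho_series s y)"
proof
  fix m
  let ?t = "cayley s"
  let ?X = "{i. x i \<noteq> \<zero>}" and ?Y = "{j. y j \<noteq> \<zero>}"
  \<comment> \<open>A finite set of exponents that serves for both sides.\<close>
  define S where "S = (\<lambda>(i, j). i + j) ` (?X \<times> ?Y) \<union> {k. laurent_bracket G x y k \<noteq> \<zero>}"
  have fin: "finite ?X" "finite ?Y" "finite S"
    using loops_finite[OF x] loops_finite[OF y] loops_finite[OF loops_bracket[OF x y]] by (auto simp: S_def)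
  have cl: "lbracket G (x i) (y j) \<in> carrier G" for i j using x y by (simp add: loops_closed lbracket_closed)
  have br0: "l a (lbracket G (x i) (y j)) = 0" if "y j = \<zero>" for a i j
    using that x by (simp add: loops_closed coord_zero)
  show "rho_series s (laurent_bracket G x y) m = current_bracket G (rho_series s x) (rho_series s y) m"
  proof (rule eqI)
    fix a
    have "l a (rho_series s (laurent_bracket G x y) m) =
        (\<Sum>k\<in>S. (?t powi k) $ m * l a (laurent_bracket G x y k))"
      using fin by (intro coord_rho_series[OF loops_bracket[OF x y]]) (auto simp: S_def)
    also have "\<dots> = (\<Sum>k\<in>S. \<Sum>i\<in>?X. (?t powi k) $ m * l a (lbracket G (x i) (y (k - i))))"
      unfolding laurent_bracket_def using cl
      by (subst coord_finsum) (auto simp: sum_distrib_left)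
    also have "\<dots> = (\<Sum>i\<in>?X. \<Sum>k\<in>S. (?t powi k) $ m * l a (lbracket G (x i) (y (k - i))))"
      by (rule sum.swap)
    also have "\<dots> = (\<Sum>i\<in>?X. \<Sum>j\<in>?Y. (?t powi (i + j)) $ m * l a (lbracket G (x i) (y j)))"
    proof (rule sum.cong[OF refl])
      fix i assume i: "i \<in> ?X"
      have "(\<Sum>j\<in>?Y. (?t powi (i + j)) $ m * l a (lbracket G (x i) (y j))) =
          (\<Sum>k\<in>(+) i ` ?Y. (?t powi k) $ m * l a (lbracket G (x i) (y (k - i))))"
        by (subst sum.reindex) (auto simp: inj_on_def)
      also have "\<dots> = (\<Sum>k\<in>S. (?t powi k) $ m * l a (lbracket G (x i) (y (k - i))))"
      proof (rule sum.mono_neutral_left[OF fin(3)])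
        show "(+) i ` ?Y \<subseteq> S" using i by (force simp: S_def)
        show "\<forall>k\<in>S - (+) i ` ?Y. (?t powi k) $ m * l a (lbracket G (x i) (y (k - i))) = 0"
        proof
          fix k assume k: "k \<in> S - (+) i ` ?Y"
          have "y (k - i) = \<zero>"
          proof (rule ccontr)
            assume "y (k - i) \<noteq> \<zero>"
            then have "i + (k - i) \<in> (+) i ` ?Y" by blast
            then show False using k by simp
          qed
          then show "(?t powi k) $ m * l a (lbracket G (x i) (y (k - i))) = 0" using br0 by simp
        qed
      qed
      finally show "(\<Sum>k\<in>S. (?t powi k) $ m * l a (lbracket G (x i) (y (k - i)))) =
          (\<Sum>j\<in>?Y. (?t powi (i + j)) $ m * l a (lbracket G (x i) (y j)))" ..
    qed
    also have "\<dots> = (\<Sum>i\<in>?X. \<Sum>j\<in>?Y. \<Sum>p\<le>m. (?t powi i) $ p * (?t powi j) $ (m - p) * l a (lbracket G (x i) (y j)))"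
      by (simp add: fps_powi_add[OF cayley_unit[OF s]] fps_mult_nth atMost_atLeast0 sum_distrib_right)
    also have "\<dots> = (\<Sum>p\<le>m. \<Sum>i\<in>?X. \<Sum>j\<in>?Y. (?t powi i) $ p * (?t powi j) $ (m - p) * l a (lbracket G (x i) (y j)))"
      by (simp add: sum.swap[of _ "{..m}"])
    also have "\<dots> = (\<Sum>p\<le>m. l a (lbracket G (rho_series s x p) (rho_series s y (m - p))))"
      unfolding rho_series_def using x y fin by (simp add: bracket_expand loops_closed)
    also have "\<dots> = l a (current_bracket G (rho_series s x) (rho_series s y) m)"
      unfolding current_bracket_def using x y
      by (subst coord_finsum) (auto simp: rho_series_closed lbracket_closed)
    finally show "l a (rho_series s (laurent_bracket G x y) m) =
        l a (current_bracket G (rho_series s x) (rho_series s y) m)" .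
  qed (simp_all add: rho_series_closed loops_bracket x y current_bracket_closed)
qed

lemma lie_hom_rho_series: "s * s = 1 \<Longrightarrow> lie_hom (k_aff G \<theta>) (N_series G \<theta>) (rho_series s)"
  by (simp add: lie_hom_def lin_map_def rho_series_in_series rho_series_add rho_series_smult rho_series_bracket)

text \<open>The powers of the parameter are independent, and the relation may be read in each coordinate.\<close>

lemma rho_series_inject:
  assumes x: "x \<in> loops" and zero: "rho_series 1 x = (\<lambda>m. \<zero>)"
  shows "x = (\<lambda>m. \<zero>)"
proof
  fix i
  show "x i = \<zero>"
  proof (cases "i \<in> {i. x i \<noteq> \<zero>}")
    case True
    have "(\<Sum>i | x i \<noteq> \<zero>. fps_const (l a (x i)) * cayley 1 powi i) = 0" for a
    proof (rule fps_ext)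
      fix m
      have "(\<Sum>i | x i \<noteq> \<zero>. (cayley 1 powi i) $ m * l a (x i)) = 0"
        using coord_rho_series[OF x loops_finite[OF x], of a 1 m] zero by (simp add: coord_zero)
      then show "(\<Sum>i | x i \<noteq> \<zero>. fps_const (l a (x i)) * cayley 1 powi i) $ m = 0 $ m"
        by (simp add: fps_sum_nth mult.commute)
    qed
    then have "l a (x i) = 0" for a
      by (rule cayley_powi_independent[where c = "\<lambda>i. l a (x i)", OF two loops_finite[OF x] _ True])
    then show ?thesis using loops_closed[OF x] by (intro eqI) (simp_all add: coord_zero)
  qed simp
qed

lemma lie_algebra_k_aff: "lie_algebra (k_aff G \<theta>)"
  by (rule lie_algebra_pullback[OF lie_algebra_N_series vec_space_k_aff lie_hom_rho_series[of 1]])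
    (simp_all add: loops_bracket rho_series_inject)

lemma lie_hom_rho:
  assumes "s * s = 1"
  shows "lie_hom (k_aff G \<theta>) (N_trunc G \<theta> N) (rho G s N)"
proof -
  have "rho G s N = (\<lambda>x. cut_at G N (rho_series s x))" by (simp add: rho_eq fun_eq_iff)
  then show ?thesis
    using lie_hom_rho_series[OF assms] lie_hom_cut_at_series[of N] by (simp add: lie_hom_def lin_map_def Pi_iff)
qed

end

section \<open>The induced module and its grading\<close>

locale current_module = twisted_currents G B l \<theta> + current_induction G \<theta> V act
  for G :: "('k::field, 'g) lie" (structure) and B :: "'g set" and l :: "'g \<Rightarrow> 'g \<Rightarrow> 'k" and \<theta> :: "'g \<Rightarrow> 'g"
    and V :: "('k, 'v) module" and act :: "'g \<Rightarrow> 'v \<Rightarrow> 'v" +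
  assumes rep: "lie_rep (k_fin G \<theta>) V act"
begin

sublocale V: vec_space V
  using rep by (simp add: lie_rep_def vec_space_def)

lemma comp_zero: "\<zero> \<in> comp m"
  by (rule submodule_zero[OF submodule_comp])

lemma mono_polys: "x \<in> comp k \<Longrightarrow> mono G k x \<in> polys"
proof -
  assume x: "x \<in> comp k"
  have "{m. mono G k x m \<noteq> \<zero>} \<subseteq> {k}" by (auto simp: mono_def)
  then have "finite {m. mono G k x m \<noteq> \<zero>}" by (rule finite_subset) simp
  then show ?thesis using x comp_zero by (simp add: polys_def series_def mono_def)
qed

lemma N_deg_eq: "N_deg G \<theta> k = mono G k ` comp k"
  by (simp add: N_deg_def comp_def)

lemma N_deg_polys: "x \<in> N_deg G \<theta> k \<Longrightarrow> x \<in> polys"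
  using mono_polys by (auto simp: N_deg_eq)

lemma mono_bracket:
  assumes "x \<in> carrier G" "y \<in> carrier G"
  shows "current_bracket G (mono G j x) (mono G k y) = mono G (j + k) (lbracket G x y)"
proof
  fix m
  let ?f = "\<lambda>i. lbracket G (mono G j x i) (mono G k y (m - i))"
  show "current_bracket G (mono G j x) (mono G k y) m = mono G (j + k) (lbracket G x y) m"
  proof (cases "m = j + k")
    case True
    then have "finsum G ?f {..m} = ?f j"
      using assms by (intro finsum_in_single) (auto simp: mono_def lbracket_closed)
    then show ?thesis using True by (simp add: current_bracket_def mono_def)
  next
    case False
    have "finsum G ?f {..m} = finsum G (\<lambda>i. \<zero>) {..m}"
      using assms False by (intro finsum_cong') (auto simp: mono_def)
    then show ?thesis using False by (simp add: current_bracket_def mono_def finsum_zero)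
  qed
qed

lemma mono_linear:
  "x \<in> carrier G \<Longrightarrow> y \<in> carrier G \<Longrightarrow> mono G k (x \<oplus> y) = (\<lambda>m. mono G k x m \<oplus> mono G k y m)"
  "mono G k (c \<odot> x) = (\<lambda>m. c \<odot> mono G k x m)"
  by (auto simp: mono_def)

lemma lie_subalgebra_N_deg_0: "lie_subalgebra (N_poly G \<theta>) (N_deg G \<theta> 0)"
proof -
  interpret L: lie_algebra "N_poly G \<theta>" by (rule lie_algebra_N_poly)
  have 0: "mono G 0 \<zero> = (\<lambda>m. \<zero>)" by (auto simp: mono_def)
  have "submodule (N_deg G \<theta> 0) KK (N_poly G \<theta>)"
  proof (rule L.subspaceI)
    show "N_deg G \<theta> 0 \<subseteq> carrier (N_poly G \<theta>)" using N_deg_polys by auto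
    show "\<zero>\<^bsub>N_poly G \<theta>\<^esub> \<in> N_deg G \<theta> 0"
      using comp_zero[of 0] by (auto simp: N_deg_eq 0[symmetric])
  next
    fix x y assume "x \<in> N_deg G \<theta> 0" "y \<in> N_deg G \<theta> 0"
    then obtain a b where "a \<in> comp 0" "b \<in> comp 0" "x = mono G 0 a" "y = mono G 0 b"
      by (auto simp: N_deg_eq)
    then show "x \<oplus>\<^bsub>N_poly G \<theta>\<^esub> y \<in> N_deg G \<theta> 0"
      using mono_linear(1)[of a b 0] submodule_add[OF submodule_comp[of 0], of a b]
      by (simp add: N_deg_eq comp_closed image_iff) (metis comp_closed)
  next
    fix c x assume "x \<in> N_deg G \<theta> 0"
    then obtain a where "a \<in> comp 0" "x = mono G 0 a" by (auto simp: N_deg_eq)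
    then show "c \<odot>\<^bsub>N_poly G \<theta>\<^esub> x \<in> N_deg G \<theta> 0"
      using mono_linear(2)[of 0 c a] submodule_smult[OF submodule_comp[of 0], of a c]
      by (simp add: N_deg_eq image_iff) metis
  qed
  moreover have "lbracket (N_poly G \<theta>) x y \<in> N_deg G \<theta> 0" if "x \<in> N_deg G \<theta> 0" "y \<in> N_deg G \<theta> 0" for x y
  proof -
    from that obtain a b where ab: "a \<in> comp 0" "b \<in> comp 0" "x = mono G 0 a" "y = mono G 0 b"
      by (auto simp: N_deg_eq)
    then show ?thesis
      using mono_bracket[of a b 0 0] comp_bracket[of a 0 b 0] by (simp add: N_deg_eq comp_closed)
  qed
  ultimately show ?thesis by (simp add: lie_subalgebra_def)
qed

lemma lie_rep_degree_0: "lie_rep ((N_poly G \<theta>)\<lparr>carrier := N_deg G \<theta> 0\<rparr>) V (\<lambda>x. act (x 0))"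
proof (rule lie_rep_pullback[OF rep])
  show "lie_algebra ((N_poly G \<theta>)\<lparr>carrier := N_deg G \<theta> 0\<rparr>)"
    by (rule lie_algebra.lie_algebra_restrict[OF lie_algebra_N_poly lie_subalgebra_N_deg_0])
  show "lie_hom ((N_poly G \<theta>)\<lparr>carrier := N_deg G \<theta> 0\<rparr>) (k_fin G \<theta>) (\<lambda>x. x 0)"
    by (auto simp: lie_hom_def lin_map_def N_deg_def mono_def k_fin_def current_bracket_def fix_space_def
        lbracket_closed finsum_insert)
qed

sublocale I: lie_induction "N_poly G \<theta>" "N_deg G \<theta> 0" V "\<lambda>x. act (x 0)"
  by (intro lie_induction.intro lie_induction_axioms.intro lie_algebra_N_poly lie_rep_degree_0 lie_subalgebra_N_deg_0)

abbreviation unit where "unit \<equiv> I.unit_tensor"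

lemma lie_rep_ind: "lie_rep (N_poly G \<theta>) ind ind_act"
  unfolding ind_def ind_act_def by (rule I.lie_rep_Ind)

sublocale R: lie_rep "N_poly G \<theta>" ind ind_act
  by (rule lie_rep_ind)

lemma vec_space_ind: "vec_space ind"
  by (rule R.V.vec_space_axioms)

lemma ind_act_closed: "\<lbrakk>x \<in> polys; z \<in> carrier ind\<rbrakk> \<Longrightarrow> ind_act x z \<in> carrier ind"
  using R.act_closed[of x z] by simp

lemma linear_ind_act: "x \<in> polys \<Longrightarrow> linear_mapping ind ind (ind_act x)"
  using R.linear_act[of x] by simp

lemma unit_closed: "v \<in> carrier V \<Longrightarrow> unit v \<in> carrier ind"
  unfolding ind_def by (rule I.unit_tensor_closed)

lemma linear_unit: "linear_mapping V ind unit"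
  unfolding ind_def by (rule I.linear_unit_tensor)

lemma ind_act_unit: "\<lbrakk>y \<in> comp 0; v \<in> carrier V\<rbrakk> \<Longrightarrow> ind_act (mono G 0 y) (unit v) = unit (act y v)"
  using I.iact_unit_tensor[of "mono G 0 y" v] by (simp add: ind_act_def N_deg_eq mono_def)

lemma mono_zero: "mono G k \<zero> = (\<lambda>m. \<zero>)"
  by (auto simp: mono_def)

lemma ind_act_zero: "z \<in> carrier ind \<Longrightarrow> ind_act (\<lambda>m. \<zero>) z = \<zero>\<^bsub>ind\<^esub>"
  using linear_mapping.zero[OF R.linear_act_left, of z] by simp

inductive_set hom_words :: "nat \<Rightarrow> (nat \<Rightarrow> 'g) list set" for i :: nat where
  hom_wordsI: "\<lbrakk>list_all2 (\<lambda>x j. x \<in> N_deg G \<theta> j) w ks; sum_list ks = i\<rbrakk> \<Longrightarrow> w \<in> hom_words i"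

lemma hom_words_Nil_iff: "[] \<in> hom_words i \<longleftrightarrow> i = 0"
  by (auto simp: hom_words.simps)

lemma hom_words_Cons_iff: "x # w \<in> hom_words i \<longleftrightarrow> (\<exists>k\<le>i. x \<in> N_deg G \<theta> k \<and> w \<in> hom_words (i - k))"
proof
  assume "x # w \<in> hom_words i"
  then obtain ks where "list_all2 (\<lambda>x j. x \<in> N_deg G \<theta> j) (x # w) ks" "sum_list ks = i"
    by (auto simp: hom_words.simps)
  then obtain k ks' where "ks = k # ks'" "x \<in> N_deg G \<theta> k" "list_all2 (\<lambda>x j. x \<in> N_deg G \<theta> j) w ks'" "k + sum_list ks' = i"
    by (auto simp: list_all2_Cons1)
  then show "\<exists>k\<le>i. x \<in> N_deg G \<theta> k \<and> w \<in> hom_words (i - k)"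
    by (intro exI[of _ k]) (auto simp: hom_words.simps)
next
  assume "\<exists>k\<le>i. x \<in> N_deg G \<theta> k \<and> w \<in> hom_words (i - k)"
  then obtain k ks where "k \<le> i" "x \<in> N_deg G \<theta> k" "list_all2 (\<lambda>x j. x \<in> N_deg G \<theta> j) w ks" "sum_list ks = i - k"
    by (auto simp: hom_words.simps)
  then show "x # w \<in> hom_words i" by (intro hom_wordsI[of _ "k # ks"]) auto
qed

lemma hom_words_lists: "w \<in> hom_words i \<Longrightarrow> w \<in> lists polys"
  by (induction w arbitrary: i) (auto simp: hom_words_Cons_iff N_deg_polys)

abbreviation word_vectors where
  "word_vectors i \<equiv> {foldr ind_act w (unit v) | w v. w \<in> hom_words i \<and> v \<in> carrier V}"

lemma word_closed: "\<lbrakk>w \<in> lists polys; v \<in> carrier V\<rbrakk> \<Longrightarrow> foldr ind_act w (unit v) \<in> carrier ind"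
  using R.word_closed[of w "unit v"] unit_closed by simp

lemma word_vectors_closed: "word_vectors i \<subseteq> carrier ind"
  using word_closed hom_words_lists by blast

text \<open>The degree of a tensor is that of its first factor, and in degree \<open>i\<close> the enveloping algebra is spanned
  by words with homogeneous letters of total degree \<open>i\<close>.\<close>

lemma ind_deg_eq: "ind_deg i = lin_span ind (word_vectors i)"
proof
  let ?L = "N_poly G \<theta>"
  let ?ten = "tensor ?L (N_deg G \<theta> 0) V (\<lambda>x. act (x 0))"
  let ?D = "env_deg ?L (N_deg G \<theta>) i"
  interpret U: vec_space "env ?L" by (rule I.L.vec_space_env)
  have hw: "w \<in> hom_words i \<longleftrightarrow> (\<exists>ks. list_all2 (\<lambda>x j. x \<in> N_deg G \<theta> j) w ks \<and> sum_list ks = i)" for w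
    by (auto simp: hom_words.simps)
  have words: "{env_word ?L w | w ks. list_all2 (\<lambda>x j. x \<in> N_deg G \<theta> j) w ks \<and> sum_list ks = i} =
      env_word ?L ` hom_words i"
    using hw by blast
  have sub: "env_word ?L ` hom_words i \<subseteq> carrier (env ?L)"
  proof (rule image_subsetI)
    fix w assume "w \<in> hom_words i"
    then show "env_word ?L w \<in> carrier (env ?L)" using I.L.env_word_closed[of w] hom_words_lists by simp
  qed
  have D: "?D = lin_span (env ?L) (env_word ?L ` hom_words i)" by (simp only: env_deg_def words)
  have ten: "?ten (env_word ?L w) v = foldr ind_act w (unit v)" if "w \<in> hom_words i" "v \<in> carrier V" for w v
    using I.tensor_env_word[of w v] hom_words_lists[OF that(1)] that(2) by (simp add: ind_act_def)
  have gen: "{?ten r v | r v. r \<in> ?D \<and> v \<in> carrier V} \<subseteq> lin_span ind (word_vectors i)"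
  proof clarify
    fix r v assume r: "r \<in> ?D" and v: "v \<in> carrier V"
    interpret t: linear_mapping "env ?L" ind "\<lambda>r. ?ten r v"
      unfolding ind_def by (rule I.linear_tensor_left[OF v])
    have "?ten r v \<in> (\<lambda>r. ?ten r v) ` lin_span (env ?L) (env_word ?L ` hom_words i)"
      using r D by blast
    also have "\<dots> = lin_span ind ((\<lambda>r. ?ten r v) ` env_word ?L ` hom_words i)"
      by (rule t.image_lin_span[OF sub])
    also have "\<dots> \<subseteq> lin_span ind (word_vectors i)"
    proof (rule R.V.lin_span_mono, rule subsetI)
      fix z assume "z \<in> (\<lambda>r. ?ten r v) ` env_word ?L ` hom_words i"
      then obtain w where "w \<in> hom_words i" "z = ?ten (env_word ?L w) v" by blast
      then show "z \<in> word_vectors i" using ten v by blast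
    qed
    finally show "?ten r v \<in> lin_span ind (word_vectors i)" .
  qed
  then show "ind_deg i \<subseteq> lin_span ind (word_vectors i)"
    unfolding ind_deg_def by (rule R.V.lin_span_least[OF R.V.submodule_lin_span[OF word_vectors_closed]])
  show "lin_span ind (word_vectors i) \<subseteq> ind_deg i"
    unfolding ind_deg_def
  proof (rule R.V.lin_span_mono, rule subsetI)
    fix z assume "z \<in> word_vectors i"
    then obtain w v where wv: "w \<in> hom_words i" "v \<in> carrier V" "z = foldr ind_act w (unit v)" by blast
    then have "z = ?ten (env_word ?L w) v" using ten by simp
    moreover have "env_word ?L w \<in> ?D" unfolding D using wv by (intro U.lin_span_base[OF sub] imageI)
    ultimately show "z \<in> {?ten r v | r v. r \<in> ?D \<and> v \<in> carrier V}" using wv(2) by blast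
  qed
qed

lemma submodule_ind_deg: "submodule (ind_deg i) KK ind"
  unfolding ind_deg_eq by (rule R.V.submodule_lin_span[OF word_vectors_closed])

lemma ind_deg_closed: "z \<in> ind_deg i \<Longrightarrow> z \<in> carrier ind"
  using R.V.submodule_subset[OF submodule_ind_deg] by auto

lemma word_in_ind_deg: "\<lbrakk>w \<in> hom_words i; v \<in> carrier V\<rbrakk> \<Longrightarrow> foldr ind_act w (unit v) \<in> ind_deg i"
  unfolding ind_deg_eq by (rule R.V.lin_span_base[OF word_vectors_closed]) blast

lemma unit_in_ind_deg: "v \<in> carrier V \<Longrightarrow> unit v \<in> ind_deg 0"
  using word_in_ind_deg[of "[]" 0 v] by (simp add: hom_words_Nil_iff)

lemma ind_act_deg:
  assumes x: "x \<in> N_deg G \<theta> k" and z: "z \<in> ind_deg i"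
  shows "ind_act x z \<in> ind_deg (k + i)"
proof (rule linear_mapping.maps_span[OF linear_ind_act[OF N_deg_polys[OF x]] word_vectors_closed submodule_ind_deg])
  show "z \<in> lin_span ind (word_vectors i)" using z by (simp only: ind_deg_eq)
  fix u assume "u \<in> word_vectors i"
  then obtain w v where "w \<in> hom_words i" "v \<in> carrier V" "u = foldr ind_act w (unit v)" by blast
  moreover from this have "x # w \<in> hom_words (k + i)"
    unfolding hom_words_Cons_iff using x by (intro exI[of _ k]) simp
  ultimately show "ind_act x u \<in> ind_deg (k + i)"
    using word_in_ind_deg[of "x # w" "k + i" v] by simp
qed

lemma mono_N_deg: "x \<in> series \<Longrightarrow> mono G j (x j) \<in> N_deg G \<theta> j"
  by (simp add: N_deg_eq series_comp)

lemma mono_series_polys: "x \<in> series \<Longrightarrow> mono G j (x j) \<in> polys"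
  by (rule N_deg_polys[OF mono_N_deg])

lemma ind_act_mono_finsum:
  assumes "finite A" "\<And>i. i \<in> A \<Longrightarrow> f i \<in> comp m" "z \<in> carrier ind"
  shows "ind_act (mono G m (finsum G f A)) z = finsum ind (\<lambda>i. ind_act (mono G m (f i)) z) A"
  using assms(1,2)
proof (induction A)
  case empty
  then show ?case using assms(3) by (simp add: mono_zero ind_act_zero)
next
  case (insert a A)
  have f: "f \<in> A \<rightarrow> carrier G" "f a \<in> carrier G" using insert comp_closed by auto
  have sum: "finsum G f A \<in> comp m" using insert by (intro submodule_finsum[OF submodule_comp]) auto
  have "ind_act (mono G m (finsum G f (insert a A))) z = ind_act (mono G m (f a \<oplus> finsum G f A)) z"
    using insert f by (simp add: finsum_insert)
  also have "\<dots> = ind_act (mono G m (f a)) z \<oplus>\<^bsub>ind\<^esub> ind_act (mono G m (finsum G f A)) z"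
    using R.act_add_left[of "mono G m (f a)" "mono G m (finsum G f A)" z] mono_polys sum insert assms(3) f
    by (simp add: mono_linear)
  also have "\<dots> = ind_act (mono G m (f a)) z \<oplus>\<^bsub>ind\<^esub> finsum ind (\<lambda>i. ind_act (mono G m (f i)) z) A"
    using insert by simp
  also have "\<dots> = finsum ind (\<lambda>i. ind_act (mono G m (f i)) z) (insert a A)"
    using insert assms(3) mono_polys ind_act_closed by (intro R.V.finsum_insert[symmetric]) auto
  finally show ?case .
qed

text \<open>This reduces polynomials to monomials, on which degrees are additive.\<close>

lemma poly_expand:
  assumes x: "x \<in> polys" and z: "z \<in> carrier ind" and n: "\<And>j. j > n \<Longrightarrow> x j = \<zero>"
  shows "ind_act x z = finsum ind (\<lambda>j. ind_act (mono G j (x j)) z) {..n}"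
proof -
  have xs: "x \<in> series" using x by (simp add: polys_def)
  have "finsum ind (\<lambda>j. ind_act (mono G j (x j)) z) {..n} = ind_act (\<lambda>m. if m \<le> n then x m else \<zero>) z" for n
  proof (induction n)
    case 0
    have "(\<lambda>m. if m \<le> 0 then x m else \<zero>) = mono G 0 (x 0)" by (auto simp: mono_def)
    then show ?case using ind_act_closed[OF mono_series_polys[OF xs] z] by simp
  next
    case (Suc n)
    let ?y = "\<lambda>m. if m \<le> n then x m else \<zero>"
    have y: "?y \<in> polys" using cut_at_truncated[OF xs, of n] truncated_subset by (auto simp: cut_at_def)
    have "(\<lambda>m. if m \<le> Suc n then x m else \<zero>) = (\<lambda>m. mono G (Suc n) (x (Suc n)) m \<oplus> ?y m)"
      using series_closed[OF xs] by (auto simp: mono_def fun_eq_iff le_Suc_eq)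
    then have "ind_act (\<lambda>m. if m \<le> Suc n then x m else \<zero>) z =
        ind_act (mono G (Suc n) (x (Suc n))) z \<oplus>\<^bsub>ind\<^esub> ind_act ?y z"
      using R.act_add_left[of "mono G (Suc n) (x (Suc n))" ?y z] y z mono_series_polys[OF xs] by simp
    also have "\<dots> = finsum ind (\<lambda>j. ind_act (mono G j (x j)) z) {..Suc n}"
      using ind_act_closed[OF mono_series_polys[OF xs] z] by (subst R.V.finsum_Suc) (auto simp: Suc)
    finally show ?case ..
  qed
  moreover have "(\<lambda>m. if m \<le> n then x m else \<zero>) = x" using n by (auto simp: not_le)
  ultimately show ?thesis by metis
qed

lemma poly_bound: "x \<in> polys \<Longrightarrow> \<exists>n. \<forall>j>n. x j = \<zero>"
proof -
  assume "x \<in> polys"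
  then have "finite {m. x m \<noteq> \<zero>}" by (simp add: polys_def)
  then obtain n where "\<forall>m\<in>{m. x m \<noteq> \<zero>}. m \<le> n" using finite_nat_set_iff_bounded_le by blast
  then show ?thesis by (metis mem_Collect_eq not_le)
qed

lemma degs_closed: "(\<Union>i\<in>A. ind_deg i) \<subseteq> carrier ind"
  using ind_deg_closed by blast

text \<open>The span contains \<open>V\<close> in degree \<open>0\<close>, and it is invariant since a polynomial is the sum of its monomials.\<close>

lemma ind_degs_span: "lin_span ind (\<Union>i. ind_deg i) = carrier ind"
proof
  let ?D = "lin_span ind (\<Union>i. ind_deg i)"
  have D: "submodule ?D KK ind" by (rule R.V.submodule_lin_span[OF degs_closed])
  show "?D \<subseteq> carrier ind" by (rule R.V.submodule_subset[OF D])
  have inD: "z \<in> ?D" if "z \<in> ind_deg i" for z i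
    using that by (intro R.V.lin_span_base[OF degs_closed]) blast
  have act: "ind_act x z \<in> ?D" if x: "x \<in> polys" and z: "z \<in> ?D" for x z
  proof (rule linear_mapping.maps_span[OF linear_ind_act[OF x] degs_closed D _ z])
    fix u assume "u \<in> (\<Union>i. ind_deg i)"
    then obtain i where u: "u \<in> ind_deg i" by blast
    from poly_bound[OF x] obtain n where n: "\<And>j. j > n \<Longrightarrow> x j = \<zero>" by blast
    have "x \<in> series" using x by (simp add: polys_def)
    then have "ind_act (mono G j (x j)) u \<in> ?D" for j
      using ind_act_deg[OF mono_N_deg u] inD by blast
    then show "ind_act x u \<in> ?D"
      using poly_expand[OF x ind_deg_closed[OF u] n] by (simp add: R.V.submodule_finsum[OF D])
  qed
  have "foldr ind_act w (unit v) \<in> ?D" if "w \<in> lists polys" "v \<in> carrier V" for w v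
    using that by (induction w) (auto intro: act inD unit_in_ind_deg)
  then have "{foldr ind_act w (unit v) | w v. w \<in> lists polys \<and> v \<in> carrier V} \<subseteq> ?D" by blast
  then have "lin_span ind {foldr ind_act w (unit v) | w v. w \<in> lists polys \<and> v \<in> carrier V} \<subseteq> ?D"
    by (rule R.V.lin_span_least[OF D])
  then show "carrier ind \<subseteq> ?D"
    using I.span_words by (simp add: ind_def[symmetric] ind_act_def[symmetric])
qed

subsection \<open>The action on families\<close>

abbreviation term_act :: "(nat \<Rightarrow> 'g) \<Rightarrow> nat \<Rightarrow> ('k, 'g, 'v) ind \<Rightarrow> ('k, 'g, 'v) ind" where
  "term_act x j \<equiv> ind_act (mono G j (x j))"

lemma term_act_closed: "\<lbrakk>x \<in> series; z \<in> carrier ind\<rbrakk> \<Longrightarrow> term_act x j z \<in> carrier ind"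
  by (rule ind_act_closed[OF mono_series_polys])

lemma linear_term_act: "x \<in> series \<Longrightarrow> linear_mapping ind ind (term_act x j)"
  by (rule linear_ind_act[OF mono_series_polys])

lemma term_act_linear:
  assumes "x \<in> series" "y \<in> series" "z \<in> carrier ind"
  shows "term_act (\<lambda>m. x m \<oplus> y m) j z = term_act x j z \<oplus>\<^bsub>ind\<^esub> term_act y j z"
    and "term_act (\<lambda>m. c \<odot> x m) j z = c \<odot>\<^bsub>ind\<^esub> term_act x j z"
  using assms R.act_add_left[of "mono G j (x j)" "mono G j (y j)" z] R.act_smult_left[of "mono G j (x j)" z c]
  by (simp_all add: mono_linear series_closed mono_series_polys)

lemma term_act_bracket:
  assumes x: "x \<in> series" and y: "y \<in> series" and z: "z \<in> carrier ind"
  shows "term_act (current_bracket G x y) m z =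
    finsum ind (\<lambda>j. term_act x j (term_act y (m - j) z) \<ominus>\<^bsub>ind\<^esub> term_act y (m - j) (term_act x j z)) {..m}"
proof -
  have "lbracket G (x j) (y (m - j)) \<in> comp m" if "j \<le> m" for j
    using comp_bracket[OF series_comp[OF x, of j] series_comp[OF y, of "m - j"]] that by simp
  then have "term_act (current_bracket G x y) m z =
      finsum ind (\<lambda>j. ind_act (mono G m (lbracket G (x j) (y (m - j)))) z) {..m}"
    unfolding current_bracket_def using z by (intro ind_act_mono_finsum) auto
  also have "\<dots> = finsum ind (\<lambda>j. term_act x j (term_act y (m - j) z) \<ominus>\<^bsub>ind\<^esub> term_act y (m - j) (term_act x j z)) {..m}"
  proof (rule R.V.finsum_cong')
    fix j assume "j \<in> {..m}"
    then have "mono G m (lbracket G (x j) (y (m - j))) = current_bracket G (mono G j (x j)) (mono G (m - j) (y (m - j)))"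
      using x y by (simp add: mono_bracket series_closed)
    then show "ind_act (mono G m (lbracket G (x j) (y (m - j)))) z =
        term_act x j (term_act y (m - j) z) \<ominus>\<^bsub>ind\<^esub> term_act y (m - j) (term_act x j z)"
      using R.act_lbracket[of "mono G j (x j)" "mono G (m - j) (y (m - j))" z] x y z mono_series_polys by simp
  qed (use x y z term_act_closed in auto)
  finally show ?thesis .
qed

text \<open>All families are admitted, not only those with the \<open>i\<close>-th member in degree \<open>i\<close>. For the universal
  property only the convolution action matters; the degrees of the members come out afterwards.\<close>
definition families :: "('k, nat \<Rightarrow> ('k, 'g, 'v) ind) module" where
  "families = pi_module (\<lambda>_. ind) {v. \<forall>i. v i \<in> carrier ind}"

lemma families_simps [simp]:
  "carrier families = {v. \<forall>i. v i \<in> carrier ind}" "\<zero>\<^bsub>families\<^esub> = (\<lambda>i. \<zero>\<^bsub>ind\<^esub>)"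
  "v \<oplus>\<^bsub>families\<^esub> w = (\<lambda>i. v i \<oplus>\<^bsub>ind\<^esub> w i)" "c \<odot>\<^bsub>families\<^esub> v = (\<lambda>i. c \<odot>\<^bsub>ind\<^esub> v i)"
  by (simp_all add: families_def)

lemma vec_space_families: "vec_space families"
  unfolding families_def by (rule vec_space_pi_module) (auto simp: vec_space_ind)

lemma families_diff:
  assumes "\<And>i. v i \<in> carrier ind" "\<And>i. w i \<in> carrier ind"
  shows "v \<ominus>\<^bsub>families\<^esub> w = (\<lambda>i. v i \<ominus>\<^bsub>ind\<^esub> w i)"
proof -
  interpret F: vec_space families by (rule vec_space_families)
  show ?thesis using assms by (simp add: F.diff_eq_smult R.V.diff_eq_smult)
qed

lemma completion_act_closed:
  "\<lbrakk>x \<in> series; \<And>i. v i \<in> carrier ind\<rbrakk> \<Longrightarrow> completion_act x v i \<in> carrier ind"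
  unfolding completion_act_def by (intro R.V.finsum_closed) (auto intro!: term_act_closed)

text \<open>Both iterated actions are double sums over a triangle; collecting them along the diagonals
  \<open>j + k = m\<close> gives the terms by which the coefficient of degree \<open>m\<close> of a bracket acts.\<close>

lemma completion_act_act:
  assumes x: "x \<in> series" and y: "y \<in> series" and v: "\<And>i. v i \<in> carrier ind"
  shows "completion_act x (completion_act y v) i =
    finsum ind (\<lambda>m. finsum ind (\<lambda>j. term_act x j (term_act y (m - j) (v (i - m)))) {..m}) {..i}"
proof -
  define f where "f j k = term_act x j (term_act y k (v (i - (j + k))))" for j k
  have f: "f j k \<in> carrier ind" for j k using x y v by (simp add: f_def term_act_closed)
  have "completion_act x (completion_act y v) i = finsum ind (\<lambda>j. finsum ind (f j) {..i - j}) {..i}"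
    unfolding completion_act_def
  proof (rule R.V.finsum_cong')
    fix j
    show "term_act x j (finsum ind (\<lambda>k. term_act y k (v (i - j - k))) {..i - j}) = finsum ind (f j) {..i - j}"
      using y v by (subst linear_mapping.sum[OF linear_term_act[OF x]]) (auto simp: f_def[abs_def] term_act_closed)
  qed (use f in \<open>auto intro!: R.V.finsum_closed\<close>)
  also have "\<dots> = finsum ind (\<lambda>m. finsum ind (\<lambda>j. f j (m - j)) {..m}) {..i}"
    using f by (rule R.V.finsum_triangle)
  also have "\<dots> = finsum ind (\<lambda>m. finsum ind (\<lambda>j. term_act x j (term_act y (m - j) (v (i - m)))) {..m}) {..i}"
    using x y v by (intro R.V.finsum_cong') (auto simp: f_def term_act_closed intro!: R.V.finsum_closed)
  finally show ?thesis .
qed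

lemma completion_act_bracket:
  assumes x: "x \<in> series" and y: "y \<in> series" and v: "\<And>i. v i \<in> carrier ind"
  shows "completion_act (current_bracket G x y) v i =
    completion_act x (completion_act y v) i \<ominus>\<^bsub>ind\<^esub> completion_act y (completion_act x v) i"
proof -
  define f where "f m j = term_act x j (term_act y (m - j) (v (i - m)))" for m j
  define g where "g m j = term_act y j (term_act x (m - j) (v (i - m)))" for m j
  have f: "f m \<in> A \<rightarrow> carrier ind" and g: "g m \<in> A \<rightarrow> carrier ind" "(\<lambda>j. g m (m - j)) \<in> A \<rightarrow> carrier ind" for m A
    using x y v by (simp_all add: f_def g_def term_act_closed)
  have "completion_act (current_bracket G x y) v i =
      finsum ind (\<lambda>m. finsum ind (f m) {..m} \<ominus>\<^bsub>ind\<^esub> finsum ind (g m) {..m}) {..i}"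
    unfolding completion_act_def
  proof (rule R.V.finsum_cong')
    fix m
    have "term_act (current_bracket G x y) m (v (i - m)) = finsum ind (\<lambda>j. f m j \<ominus>\<^bsub>ind\<^esub> g m (m - j)) {..m}"
      unfolding term_act_bracket[OF x y v] using f g
      by (intro R.V.finsum_cong')
        (auto simp: f_def g_def term_act_closed x y v intro!: R.V.minus_closed)
    also have "\<dots> = finsum ind (f m) {..m} \<ominus>\<^bsub>ind\<^esub> finsum ind (g m) {..m}"
      using f g by (simp add: R.V.finsum_diff R.V.finsum_reflect)
    finally show "term_act (current_bracket G x y) m (v (i - m)) = \<dots>" .
  qed (use f g in \<open>auto intro!: R.V.finsum_closed R.V.minus_closed\<close>)
  also have "\<dots> = finsum ind (\<lambda>m. finsum ind (f m) {..m}) {..i} \<ominus>\<^bsub>ind\<^esub> finsum ind (\<lambda>m. finsum ind (g m) {..m}) {..i}"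
    using f g by (intro R.V.finsum_diff) (auto intro!: R.V.finsum_closed)
  finally show ?thesis
    unfolding completion_act_act[OF x y v] completion_act_act[OF y x v] by (simp add: f_def[abs_def] g_def[abs_def])
qed

lemma completion_act_linear:
  assumes x: "x \<in> series" and y: "y \<in> series" and v: "\<And>i. v i \<in> carrier ind" and w: "\<And>i. w i \<in> carrier ind"
  shows "completion_act (\<lambda>m. x m \<oplus> y m) v i = completion_act x v i \<oplus>\<^bsub>ind\<^esub> completion_act y v i"
    and "completion_act x (\<lambda>i. v i \<oplus>\<^bsub>ind\<^esub> w i) i = completion_act x v i \<oplus>\<^bsub>ind\<^esub> completion_act x w i"
    and "completion_act (\<lambda>m. c \<odot> x m) v i = c \<odot>\<^bsub>ind\<^esub> completion_act x v i"
    and "completion_act x (\<lambda>i. c \<odot>\<^bsub>ind\<^esub> v i) i = c \<odot>\<^bsub>ind\<^esub> completion_act x v i"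
proof -
  have xv: "(\<lambda>j. term_act x j (v (i - j))) \<in> A \<rightarrow> carrier ind" "(\<lambda>j. term_act y j (v (i - j))) \<in> A \<rightarrow> carrier ind"
    "(\<lambda>j. term_act x j (w (i - j))) \<in> A \<rightarrow> carrier ind" for A
    using term_act_closed x y v w by auto
  show "completion_act (\<lambda>m. x m \<oplus> y m) v i = completion_act x v i \<oplus>\<^bsub>ind\<^esub> completion_act y v i"
    unfolding completion_act_def R.V.finsum_addf[OF xv(1,2), symmetric]
    using x y v by (intro R.V.finsum_cong') (auto simp: term_act_linear term_act_closed)
  show "completion_act x (\<lambda>i. v i \<oplus>\<^bsub>ind\<^esub> w i) i = completion_act x v i \<oplus>\<^bsub>ind\<^esub> completion_act x w i"
    unfolding completion_act_def R.V.finsum_addf[OF xv(1,3), symmetric]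
    using x v w by (intro R.V.finsum_cong') (auto simp: linear_mapping.add[OF linear_term_act] term_act_closed)
  show "completion_act (\<lambda>m. c \<odot> x m) v i = c \<odot>\<^bsub>ind\<^esub> completion_act x v i"
    unfolding completion_act_def R.V.finsum_smult[OF xv(1)]
    using x v by (intro R.V.finsum_cong') (auto simp: term_act_linear(2)[OF x x] term_act_closed)
  show "completion_act x (\<lambda>i. c \<odot>\<^bsub>ind\<^esub> v i) i = c \<odot>\<^bsub>ind\<^esub> completion_act x v i"
    unfolding completion_act_def R.V.finsum_smult[OF xv(1)]
    using x v by (intro R.V.finsum_cong') (auto simp: linear_mapping.smult[OF linear_term_act] term_act_closed)
qed

lemma lie_rep_families: "lie_rep (N_series G \<theta>) families completion_act"
proof (rule lie_repI[OF lie_algebra_N_series vec_space_families];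
    simp only: families_simps N_simps mem_Collect_eq fun_eq_iff; intro allI)
  fix x y and v w :: "nat \<Rightarrow> ('k, 'g, 'v) ind" and c i
  assume x: "x \<in> series" and v: "\<forall>i. v i \<in> carrier ind"
  show "completion_act x v i \<in> carrier ind" using x v by (intro completion_act_closed) auto
  show "completion_act (\<lambda>m. c \<odot> x m) v i = c \<odot>\<^bsub>ind\<^esub> completion_act x v i"
    "completion_act x (\<lambda>i. c \<odot>\<^bsub>ind\<^esub> v i) i = c \<odot>\<^bsub>ind\<^esub> completion_act x v i"
    using completion_act_linear(3,4)[OF x x, of v v] v by blast+
  show "completion_act x (\<lambda>i. v i \<oplus>\<^bsub>ind\<^esub> w i) i = completion_act x v i \<oplus>\<^bsub>ind\<^esub> completion_act x w i"
    if "\<forall>i. w i \<in> carrier ind"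
    using completion_act_linear(2)[OF x x, of v w i] v that by auto
  assume y: "y \<in> series"
  show "completion_act (\<lambda>m. x m \<oplus> y m) v i = completion_act x v i \<oplus>\<^bsub>ind\<^esub> completion_act y v i"
    using completion_act_linear(1)[OF x y, of v v i] v by auto
  show "completion_act (current_bracket G x y) v i =
      (completion_act x (completion_act y v) \<ominus>\<^bsub>families\<^esub> completion_act y (completion_act x v)) i"
    using completion_act_bracket[OF x y, of v i] x y v by (simp add: families_diff completion_act_closed)
qed

lemma lie_rep_families_poly: "lie_rep (N_poly G \<theta>) families completion_act"
proof -
  have "lie_hom (N_poly G \<theta>) (N_series G \<theta>) (\<lambda>x. x)" by (auto simp: lie_hom_def lin_map_def polys_def)
  from lie_rep_pullback[OF lie_rep_families lie_algebra_N_poly this] show ?thesis .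
qed

subsection \<open>Homogeneous components\<close>

definition at_degree :: "nat \<Rightarrow> ('k, 'g, 'v) ind \<Rightarrow> nat \<Rightarrow> ('k, 'g, 'v) ind" where
  "at_degree k z = (\<lambda>i. if i = k then z else \<zero>\<^bsub>ind\<^esub>)"

lemma completion_act_at_degree:
  assumes y: "y \<in> comp j" and z: "z \<in> carrier ind"
  shows "completion_act (mono G j y) (at_degree k z) = at_degree (j + k) (ind_act (mono G j y) z)"
proof
  fix i
  let ?x = "mono G j y"
  have x: "?x \<in> series" using mono_polys[OF y] by (simp add: polys_def)
  have cl: "term_act ?x p u \<in> carrier ind" if "u \<in> carrier ind" for p u by (rule term_act_closed[OF x that])
  have xp: "?x p = (if p = j then y else \<zero>)" for p by (simp add: mono_def)
  have off: "term_act ?x p u = \<zero>\<^bsub>ind\<^esub>" if "p \<noteq> j" "u \<in> carrier ind" for p u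
    using that by (simp add: xp mono_zero ind_act_zero)
  have zero: "term_act ?x p \<zero>\<^bsub>ind\<^esub> = \<zero>\<^bsub>ind\<^esub>" for p by (rule linear_mapping.zero[OF linear_term_act[OF x]])
  have at: "at_degree k z i \<in> carrier ind" for i using z by (simp add: at_degree_def)
  show "completion_act ?x (at_degree k z) i = at_degree (j + k) (ind_act ?x z) i"
  proof (cases "i = j + k")
    case True
    have "completion_act ?x (at_degree k z) i = term_act ?x j (at_degree k z (i - j))"
      unfolding completion_act_def using True off at cl by (intro R.V.finsum_in_single) auto
    then show ?thesis using True by (simp add: at_degree_def xp)
  next
    case False
    have "completion_act ?x (at_degree k z) i = finsum ind (\<lambda>p. \<zero>\<^bsub>ind\<^esub>) {..i}"
      unfolding completion_act_def
    proof (rule R.V.finsum_cong')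
      fix p assume p: "p \<in> {..i}"
      show "term_act ?x p (at_degree k z (i - p)) = \<zero>\<^bsub>ind\<^esub>"
      proof (cases "p = j")
        case True
        then have "at_degree k z (i - p) = \<zero>\<^bsub>ind\<^esub>" using False p by (auto simp: at_degree_def)
        then show ?thesis by (simp only: zero)
      qed (rule off[OF _ at])
    qed auto
    then show ?thesis using False by (simp add: at_degree_def R.V.finsum_zero)
  qed
qed

text \<open>By the universal property, placing \<open>V\<close> in degree \<open>0\<close> extends to an equivariant map into the
  families. It sends a vector to the family of its homogeneous components, which makes these
  well defined.\<close>

lemma ex_components:
  "\<exists>\<Delta>. linear_mapping ind families \<Delta> \<and> (\<forall>v\<in>carrier V. \<Delta> (unit v) = at_degree 0 (unit v)) \<and>
    (\<forall>x\<in>polys. \<forall>z\<in>carrier ind. \<Delta> (ind_act x z) = completion_act x (\<Delta> z))"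
proof (rule I.ex_equivariant_lift[OF lie_rep_families_poly, folded ind_def ind_act_def])
  interpret u: linear_mapping V ind unit by (rule linear_unit)
  show "linear_mapping V families (\<lambda>v. at_degree 0 (unit v))"
    by (rule linear_mappingI)
      (auto simp: V.vec_space_axioms vec_space_families at_degree_def u.add u.smult fun_eq_iff)
  fix x v assume x: "x \<in> N_deg G \<theta> 0" and v: "v \<in> carrier V"
  then obtain y where y: "y \<in> comp 0" "x = mono G 0 y" by (auto simp: N_deg_eq)
  then show "at_degree 0 (unit (act (x 0) v)) = completion_act x (at_degree 0 (unit v))"
    using completion_act_at_degree[OF y(1) unit_closed[OF v], of 0] ind_act_unit[OF y(1) v]
    by (simp add: mono_def)
qed auto

definition components :: "('k, 'g, 'v) ind \<Rightarrow> nat \<Rightarrow> ('k, 'g, 'v) ind" where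
  "components = (SOME \<Delta>. linear_mapping ind families \<Delta> \<and> (\<forall>v\<in>carrier V. \<Delta> (unit v) = at_degree 0 (unit v)) \<and>
    (\<forall>x\<in>polys. \<forall>z\<in>carrier ind. \<Delta> (ind_act x z) = completion_act x (\<Delta> z)))"

lemma linear_components: "linear_mapping ind families components"
  and components_unit: "v \<in> carrier V \<Longrightarrow> components (unit v) = at_degree 0 (unit v)"
  and components_act: "\<lbrakk>x \<in> polys; z \<in> carrier ind\<rbrakk> \<Longrightarrow> components (ind_act x z) = completion_act x (components z)"
  using someI_ex[OF ex_components] unfolding components_def[symmetric] by blast+

lemma components_closed: "z \<in> carrier ind \<Longrightarrow> components z i \<in> carrier ind"
  using linear_mapping.closed[OF linear_components] by auto

lemma linear_at_degree: "linear_mapping ind families (at_degree k)"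
  by (rule linear_mappingI) (auto simp: vec_space_ind vec_space_families at_degree_def fun_eq_iff)

text \<open>On a homogeneous word this follows by induction on its length, since letters of degree \<open>j\<close> move families
  concentrated in degree \<open>k\<close> to degree \<open>j + k\<close>.\<close>

lemma components_deg:
  assumes z: "z \<in> ind_deg k"
  shows "components z = at_degree k z"
proof (rule linear_mapping_eq_on_span[OF linear_components linear_at_degree word_vectors_closed])
  show "z \<in> lin_span ind (word_vectors k)" using z by (simp only: ind_deg_eq)
  fix u assume "u \<in> word_vectors k"
  then obtain w v where u: "w \<in> hom_words k" "u = foldr ind_act w (unit v)" and v: "v \<in> carrier V" by blast
  have "components (foldr ind_act w (unit v)) = at_degree k (foldr ind_act w (unit v))" using u(1)
  proof (induction w arbitrary: k rule: list.induct)
    case Nil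
    then show ?case using v by (simp add: hom_words_Nil_iff components_unit)
  next
    case (Cons x w)
    then obtain j where j: "j \<le> k" "x \<in> N_deg G \<theta> j" "w \<in> hom_words (k - j)"
      by (auto simp: hom_words_Cons_iff)
    then obtain y where y: "y \<in> comp j" "x = mono G j y" by (auto simp: N_deg_eq)
    have w: "foldr ind_act w (unit v) \<in> carrier ind" by (rule word_closed[OF hom_words_lists[OF j(3)] v])
    have "components (ind_act x (foldr ind_act w (unit v))) = completion_act x (components (foldr ind_act w (unit v)))"
      by (rule components_act[OF N_deg_polys[OF j(2)] w])
    also have "\<dots> = completion_act x (at_degree (k - j) (foldr ind_act w (unit v)))"
      by (simp only: Cons.IH[OF j(3)])
    also have "\<dots> = at_degree k (ind_act x (foldr ind_act w (unit v)))"
      unfolding y(2) using completion_act_at_degree[OF y(1) w, of "k - j"] j(1) by simp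
    finally show ?case by simp
  qed
  then show "components u = at_degree k u" by (simp only: u)
qed

lemma components_finsum:
  assumes s: "\<And>i. s i \<in> ind_deg i" and A: "finite A"
  shows "components (finsum ind s A) k = (if k \<in> A then s k else \<zero>\<^bsub>ind\<^esub>)"
proof -
  have sc: "\<And>i. s i \<in> carrier ind" using s ind_deg_closed by blast
  have "linear_mapping families ind (\<lambda>f. f k)"
    by (rule linear_mappingI) (simp_all add: vec_space_ind vec_space_families)
  from linear_mapping_compose[OF linear_components this]
  interpret c: linear_mapping ind ind "\<lambda>z. components z k" .
  have "components (finsum ind s A) k = finsum ind (\<lambda>i. components (s i) k) A"
    using sc by (intro c.sum) auto
  also have "\<dots> = finsum ind (\<lambda>i. if i = k then s i else \<zero>\<^bsub>ind\<^esub>) A"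
    using sc s by (intro R.V.finsum_cong') (auto simp: components_deg[OF s] at_degree_def)
  also have "\<dots> = (if k \<in> A then s k else \<zero>\<^bsub>ind\<^esub>)"
  proof (cases "k \<in> A")
    case True
    then have "finsum ind (\<lambda>i. if i = k then s i else \<zero>\<^bsub>ind\<^esub>) A = (if k = k then s k else \<zero>\<^bsub>ind\<^esub>)"
      using A sc by (intro R.V.finsum_in_single) auto
    then show ?thesis using True by simp
  next
    case False
    then have "finsum ind (\<lambda>i. if i = k then s i else \<zero>\<^bsub>ind\<^esub>) A = finsum ind (\<lambda>i. \<zero>\<^bsub>ind\<^esub>) A"
      using sc by (intro R.V.finsum_cong') auto
    then show ?thesis using False by (simp add: R.V.finsum_zero)
  qed
  finally show ?thesis .
qed

lemma ex_decomposition: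
  assumes "z \<in> carrier ind"
  shows "\<exists>s n. (\<forall>i. s i \<in> ind_deg i) \<and> (\<forall>i\<ge>n. s i = \<zero>\<^bsub>ind\<^esub>) \<and> z = finsum ind s {..<n::nat}"
proof -
  have "z \<in> lin_span ind (\<Union>i. ind_deg i)" using assms by (simp only: ind_degs_span)
  then show ?thesis using degs_closed
  proof (induction rule: R.V.lin_span_induct)
    case zero
    show ?case
      by (rule exI[of _ "\<lambda>i. \<zero>\<^bsub>ind\<^esub>"], rule exI[of _ 0]) (simp add: R.V.submodule_zero[OF submodule_ind_deg])
  next
    case (add x y)
    then obtain s n t m where s: "\<forall>i. s i \<in> ind_deg i" "\<forall>i\<ge>n. s i = \<zero>\<^bsub>ind\<^esub>" "x = finsum ind s {..<n}"
      and t: "\<forall>i. t i \<in> ind_deg i" "\<forall>i\<ge>m. t i = \<zero>\<^bsub>ind\<^esub>" "y = finsum ind t {..<m}" by blast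
    have sc: "\<And>i. s i \<in> carrier ind" "\<And>i. t i \<in> carrier ind" using s(1) t(1) ind_deg_closed by blast+
    let ?k = "max n m"
    have "x = finsum ind s {..<?k}" unfolding s(3) using s sc by (intro R.V.finsum_mono_neutral) auto
    moreover have "y = finsum ind t {..<?k}" unfolding t(3) using t sc by (intro R.V.finsum_mono_neutral) auto
    ultimately have "x \<oplus>\<^bsub>ind\<^esub> y = finsum ind (\<lambda>i. s i \<oplus>\<^bsub>ind\<^esub> t i) {..<?k}"
      using sc by (simp add: R.V.finsum_addf Pi_iff)
    then show ?case
      using s t by (intro exI[of _ "\<lambda>i. s i \<oplus>\<^bsub>ind\<^esub> t i"] exI[of _ ?k])
        (simp add: R.V.submodule_add[OF submodule_ind_deg])
  next
    case (smult c x)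
    then obtain s n where s: "\<forall>i. s i \<in> ind_deg i" "\<forall>i\<ge>n. s i = \<zero>\<^bsub>ind\<^esub>" "x = finsum ind s {..<n}" by blast
    have sc: "\<And>i. s i \<in> carrier ind" using s(1) ind_deg_closed by blast
    have "c \<odot>\<^bsub>ind\<^esub> x = finsum ind (\<lambda>i. c \<odot>\<^bsub>ind\<^esub> s i) {..<n}"
      unfolding s(3) using sc by (intro R.V.finsum_smult) auto
    then show ?case
      using s by (intro exI[of _ "\<lambda>i. c \<odot>\<^bsub>ind\<^esub> s i"] exI[of _ n])
        (simp add: R.V.submodule_smult[OF submodule_ind_deg])
  next
    case (base x)
    then obtain k where k: "x \<in> ind_deg k" by blast
    have "finsum ind (at_degree k x) {..<Suc k} = at_degree k x k"
      using ind_deg_closed[OF k] by (intro R.V.finsum_in_single) (auto simp: at_degree_def)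
    then show ?case
      using k by (intro exI[of _ "at_degree k x"] exI[of _ "Suc k"])
        (auto simp: at_degree_def R.V.submodule_zero[OF submodule_ind_deg])
  qed
qed

lemma decomposition:
  assumes z: "z \<in> carrier ind"
  shows "components z i \<in> ind_deg i"
    and "\<exists>n. (\<forall>i\<ge>n. components z i = \<zero>\<^bsub>ind\<^esub>) \<and> z = finsum ind (components z) {..<n}"
proof -
  from ex_decomposition[OF z] obtain s n where s: "\<And>i. s i \<in> ind_deg i" "\<And>i. i \<ge> n \<Longrightarrow> s i = \<zero>\<^bsub>ind\<^esub>"
    "z = finsum ind s {..<n::nat}" by blast
  have "components z i = s i" for i
    unfolding s(3) using components_finsum[OF s(1), of "{..<n}" i] s(2)[of i] by auto
  then have "components z = s" by auto
  then show "components z i \<in> ind_deg i"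
    "\<exists>n. (\<forall>i\<ge>n. components z i = \<zero>\<^bsub>ind\<^esub>) \<and> z = finsum ind (components z) {..<n}"
    using s by auto
qed

lemma direct_sum: "is_direct_sum ind ind_deg"
  unfolding is_direct_sum_def
proof (intro conjI allI ballI)
  fix z assume z: "z \<in> carrier ind"
  from decomposition(2)[OF z] obtain n where n: "\<And>i. i \<ge> n \<Longrightarrow> components z i = \<zero>\<^bsub>ind\<^esub>"
    "z = finsum ind (components z) {..<n}" by blast
  let ?P = "\<lambda>s. (\<forall>i. s i \<in> ind_deg i) \<and> finite {i. s i \<noteq> \<zero>\<^bsub>ind\<^esub>} \<and> z = finsum ind s {i. s i \<noteq> \<zero>\<^bsub>ind\<^esub>}"
  show "\<exists>!s. ?P s"
  proof (rule ex1I[of _ "components z"])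
    have sub: "{i. components z i \<noteq> \<zero>\<^bsub>ind\<^esub>} \<subseteq> {..<n}" using n(1) by (auto simp: not_less[symmetric])
    then have "finsum ind (components z) {i. components z i \<noteq> \<zero>\<^bsub>ind\<^esub>} = finsum ind (components z) {..<n}"
      using components_closed[OF z] by (intro R.V.finsum_mono_neutral) auto
    then show "?P (components z)"
      using n(2) decomposition(1)[OF z] finite_subset[OF sub] by simp
  next
    fix s assume s: "?P s"
    show "s = components z"
    proof
      fix i
      have "components z i = components (finsum ind s {i. s i \<noteq> \<zero>\<^bsub>ind\<^esub>}) i" using s by metis
      also have "\<dots> = s i" using s by (subst components_finsum) auto
      finally show "s i = components z i" ..
    qed
  qed
qed (rule submodule_ind_deg)

end

section \<open>The filtration and its quotients\<close>

context current_module
begin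

lemma components_zero: "components \<zero>\<^bsub>ind\<^esub> i = \<zero>\<^bsub>ind\<^esub>"
  using linear_mapping.zero[OF linear_components] by simp

lemma components_add:
  "\<lbrakk>y \<in> carrier ind; z \<in> carrier ind\<rbrakk> \<Longrightarrow> components (y \<oplus>\<^bsub>ind\<^esub> z) i = components y i \<oplus>\<^bsub>ind\<^esub> components z i"
  using linear_mapping.add[OF linear_components] by simp

lemma components_smult:
  "z \<in> carrier ind \<Longrightarrow> components (c \<odot>\<^bsub>ind\<^esub> z) i = c \<odot>\<^bsub>ind\<^esub> components z i"
  using linear_mapping.smult[OF linear_components] by simp

lemma components_diff:
  "\<lbrakk>y \<in> carrier ind; z \<in> carrier ind\<rbrakk> \<Longrightarrow> components (y \<ominus>\<^bsub>ind\<^esub> z) i = components y i \<ominus>\<^bsub>ind\<^esub> components z i"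
  by (simp add: R.V.diff_eq_smult components_add components_smult components_closed)

text \<open>The filtration is described by vanishing of the components of low degree. This is what makes
  all statements about the quotients computations with components.\<close>

lemma ind_ge_iff: "z \<in> ind_ge N \<longleftrightarrow> z \<in> carrier ind \<and> (\<forall>i<N. components z i = \<zero>\<^bsub>ind\<^esub>)"
proof
  assume "z \<in> ind_ge N"
  then show "z \<in> carrier ind \<and> (\<forall>i<N. components z i = \<zero>\<^bsub>ind\<^esub>)"
    unfolding ind_ge_def using degs_closed
  proof (induction rule: R.V.lin_span_induct)
    case (base x)
    then obtain k where "k \<ge> N" "x \<in> ind_deg k" by auto
    then show ?case using ind_deg_closed[of x k] by (auto simp: components_deg at_degree_def)
  qed (simp_all add: components_zero components_add components_smult)
next
  assume z: "z \<in> carrier ind \<and> (\<forall>i<N. components z i = \<zero>\<^bsub>ind\<^esub>)"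
  then obtain n where n: "z = finsum ind (components z) {..<n::nat}" using decomposition(2) by blast
  have sub: "submodule (ind_ge N) KK ind" unfolding ind_ge_def by (rule R.V.submodule_lin_span[OF degs_closed])
  have "components z i \<in> ind_ge N" for i
  proof (cases "i < N")
    case True
    then show ?thesis using z R.V.submodule_zero[OF sub] by simp
  next
    case False
    then have "components z i \<in> (\<Union>i\<in>{N..}. ind_deg i)" using decomposition(1)[of z i] z by auto
    then show ?thesis unfolding ind_ge_def by (rule R.V.lin_span_base[OF degs_closed])
  qed
  then have "finsum ind (components z) {..<n} \<in> ind_ge N" by (intro R.V.submodule_finsum[OF sub])
  then show "z \<in> ind_ge N" using n by simp
qed

lemma submodule_ind_ge: "submodule (ind_ge N) KK ind"
  unfolding ind_ge_def by (rule R.V.submodule_lin_span[OF degs_closed])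

lemma completion_act_cong:
  assumes "\<And>j. j \<le> i \<Longrightarrow> x j = y j" "\<And>j. j \<le> i \<Longrightarrow> v j = w j"
    "y \<in> series" "\<And>j. w j \<in> carrier ind"
  shows "completion_act x v i = completion_act y w i"
  unfolding completion_act_def using assms
  by (intro R.V.finsum_cong') (auto simp: term_act_closed)

lemma completion_act_zero: "x \<in> series \<Longrightarrow> completion_act x (\<lambda>i. \<zero>\<^bsub>ind\<^esub>) i = \<zero>\<^bsub>ind\<^esub>"
  using linear_mapping.zero[OF lie_rep.linear_act[OF lie_rep_families]] by simp

lemma polys_series: "x \<in> polys \<Longrightarrow> x \<in> series"
  by (simp add: polys_def)

lemma ind_ge_invariant:
  assumes x: "x \<in> polys" and z: "z \<in> ind_ge N"
  shows "ind_act x z \<in> ind_ge N"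
proof -
  have zc: "z \<in> carrier ind" and z0: "\<And>i. i < N \<Longrightarrow> components z i = \<zero>\<^bsub>ind\<^esub>"
    using z by (auto simp: ind_ge_iff)
  have "components (ind_act x z) i = \<zero>\<^bsub>ind\<^esub>" if "i < N" for i
  proof -
    have "components (ind_act x z) i = completion_act x (components z) i"
      by (simp only: components_act[OF x zc])
    also have "\<dots> = completion_act x (\<lambda>i. \<zero>\<^bsub>ind\<^esub>) i"
      using that z0 polys_series[OF x] by (intro completion_act_cong) auto
    finally show ?thesis by (simp add: completion_act_zero polys_series[OF x])
  qed
  then show ?thesis using ind_act_closed[OF x zc] by (simp add: ind_ge_iff)
qed

lemma ind_ge_antimono: "M \<le> N \<Longrightarrow> ind_ge N \<subseteq> ind_ge M"
  by (auto simp: ind_ge_iff)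

lemma vec_space_ind_quot: "vec_space (ind_quot N)"
  unfolding ind_quot_def by (rule R.V.vec_space_mod_quot[OF submodule_ind_ge])

abbreviation coset where "coset N z \<equiv> ind_ge N +>\<^bsub>ind\<^esub> z"

lemma coset_eq_iff:
  assumes "y \<in> carrier ind" "z \<in> carrier ind"
  shows "coset N y = coset N z \<longleftrightarrow> (\<forall>i<N. components y i = components z i)"
  using assms
  by (auto simp: R.V.coset_eq_iff[OF submodule_ind_ge] ind_ge_iff components_diff components_closed R.V.diff_eq_zero_iff)

lemma linear_coset: "linear_mapping ind (ind_quot N) (coset N)"
  unfolding ind_quot_def by (rule R.V.linear_mapping_coset[OF submodule_ind_ge])

lemma ind_quotE:
  assumes "Z \<in> carrier (ind_quot N)" obtains z where "z \<in> carrier ind" "Z = coset N z"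
  using assms unfolding ind_quot_def by (rule R.V.mod_quot_carrierE)

lemma quot_act_poly_coset:
  "\<lbrakk>x \<in> polys; z \<in> carrier ind\<rbrakk> \<Longrightarrow> quot_act_poly N x (coset N z) = coset N (ind_act x z)"
  unfolding quot_act_poly_def
  using lie_rep_quotient(2)[OF lie_rep_ind submodule_ind_ge, of N x z] ind_ge_invariant by simp

lemma lie_rep_quot_act_poly: "lie_rep (N_poly G \<theta>) (ind_quot N) (quot_act_poly N)"
proof -
  have "quot_act_poly N = (\<lambda>x Z. \<Union>v\<in>Z. ind_ge N +>\<^bsub>ind\<^esub> ind_act x v)"
    by (simp add: quot_act_poly_def fun_eq_iff)
  then show ?thesis
    unfolding ind_quot_def
    using lie_rep_quotient(1)[OF lie_rep_ind submodule_ind_ge, of N] ind_ge_invariant by simp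
qed

text \<open>Only the coefficients of degree less than \<open>N\<close> act on the quotient.\<close>

lemma quot_act_cut:
  assumes x: "x \<in> polys" and Z: "Z \<in> carrier (ind_quot N)"
  shows "quot_act N (cut_at G N x) Z = quot_act_poly N x Z"
proof -
  define y where "y = (SOME y. y \<in> polys \<and> cut_at G N y = cut_at G N x)"
  have "y \<in> polys \<and> cut_at G N y = cut_at G N x"
    unfolding y_def by (rule someI[of "\<lambda>y. y \<in> polys \<and> cut_at G N y = cut_at G N x" x]) (simp add: x)
  then have y: "y \<in> polys" and cut: "cut_at G N y = cut_at G N x" by auto
  have eq: "y j = x j" if "j \<le> N" for j
    using fun_cong[OF cut, of j] that by (simp add: cut_at_def)
  from Z obtain z where z: "z \<in> carrier ind" "Z = coset N z" by (rule ind_quotE)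
  have "components (ind_act y z) i = components (ind_act x z) i" if "i < N" for i
  proof -
    have "completion_act y (components z) i = completion_act x (components z) i"
      using that eq polys_series[OF x] components_closed[OF z(1)] by (intro completion_act_cong) auto
    then show ?thesis by (simp only: components_act[OF _ z(1)] x y)
  qed
  then have "coset N (ind_act y z) = coset N (ind_act x z)"
    using x y z by (simp add: coset_eq_iff ind_act_closed)
  moreover have "quot_act N (cut_at G N x) Z = quot_act_poly N y Z"
    by (simp add: quot_act_def y_def)
  ultimately show ?thesis using x y z by (simp add: quot_act_poly_coset)
qed

lemma quot_act_coset:
  assumes "x \<in> series" "z \<in> carrier ind"
  shows "quot_act N (cut_at G N x) (coset N z) = coset N (ind_act (cut_at G N x) z)"
proof -
  let ?x = "cut_at G N x"
  have x: "?x \<in> truncated N" by (rule cut_at_truncated[OF assms(1)])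
  then have xp: "?x \<in> polys" using truncated_subset by auto
  have "quot_act N ?x (coset N z) = quot_act N (cut_at G N ?x) (coset N z)" by (simp only: cut_at_id[OF x])
  also have "\<dots> = quot_act_poly N ?x (coset N z)"
    by (rule quot_act_cut[OF xp linear_mapping.closed[OF linear_coset assms(2)]])
  also have "\<dots> = coset N (ind_act ?x z)" by (rule quot_act_poly_coset[OF xp assms(2)])
  finally show ?thesis .
qed

lemma lie_rep_quot_act: "lie_rep (N_trunc G \<theta> N) (ind_quot N) (quot_act N)"
proof (rule lie_rep_pushforward[OF _ lie_algebra_N_trunc lie_hom_cut_at])
  show "lie_rep (N_poly G \<theta>) (ind_quot N) (\<lambda>x. quot_act N (cut_at G N x))"
    by (rule lie_rep_cong[OF lie_rep_quot_act_poly]) (simp add: quot_act_cut)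
qed (simp add: cut_at_surj)

lemma lie_rep_quot_act_rho:
  assumes "s * s = 1"
  shows "lie_rep (k_aff G \<theta>) (ind_quot N) (\<lambda>x. quot_act N (rho G s N x))"
  by (rule lie_rep_pullback[OF lie_rep_quot_act lie_algebra_k_aff lie_hom_rho[OF assms]])

subsection \<open>Finite dimension\<close>

definition comp_basis :: "nat \<Rightarrow> 'g set" where
  "comp_basis k = (if even k then kpart else ppart) ` B"

lemma comp_basis: "finite (comp_basis k)" "comp_basis k \<subseteq> comp k" "comp k \<subseteq> lin_span G (comp_basis k)"
proof -
  let ?\<pi> = "if even k then kpart else ppart"
  have \<pi>: "linear_mapping G G ?\<pi>" using linear_kpart linear_ppart by simp
  show "finite (comp_basis k)" unfolding comp_basis_def using finite_basis by simp
  show sub: "comp_basis k \<subseteq> comp k"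
    using basis_closed theta_kpart theta_ppart
    by (auto simp: comp_basis_def comp_def fix_space_def anti_space_def)
  have cl: "comp_basis k \<subseteq> carrier G" using sub comp_closed by blast
  show "comp k \<subseteq> lin_span G (comp_basis k)"
  proof
    fix x assume x: "x \<in> comp k"
    then have xG: "x \<in> carrier G" by (rule comp_closed)
    have "x = ?\<pi> x"
      using x by (auto simp: comp_def fix_space_def anti_space_def kpart_fix ppart_anti)
    also have "\<dots> = ?\<pi> (finsum G (\<lambda>b. l b x \<odot> b) B)" using xG by (simp add: expand)
    also have "\<dots> = finsum G (\<lambda>b. ?\<pi> (l b x \<odot> b)) B"
      using basis_closed by (intro linear_mapping.sum[OF \<pi>]) auto
    also have "\<dots> \<in> lin_span G (comp_basis k)"
    proof (rule submodule_finsum[OF submodule_lin_span[OF cl]])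
      fix b assume b: "b \<in> B"
      have "?\<pi> b \<in> lin_span G (comp_basis k)"
        by (rule lin_span_base[OF cl]) (use b in \<open>auto simp: comp_basis_def\<close>)
      then have "l b x \<odot> ?\<pi> b \<in> lin_span G (comp_basis k)" by (rule submodule_smult[OF submodule_lin_span[OF cl]])
      then show "?\<pi> (l b x \<odot> b) \<in> lin_span G (comp_basis k)"
        using linear_mapping.smult[OF \<pi> basis_closed[OF b]] by simp
    qed
    finally show "x \<in> lin_span G (comp_basis k)" .
  qed
qed

definition raised :: "nat \<Rightarrow> ('k, 'g, 'v) ind set" where
  "raised i = {ind_act x z | x z k. 0 < k \<and> k \<le> i \<and> x \<in> N_deg G \<theta> k \<and> z \<in> ind_deg (i - k)}"

lemma raised_closed: "raised i \<subseteq> carrier ind"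
  using ind_act_closed[OF N_deg_polys ind_deg_closed] by (auto simp: raised_def)

text \<open>This is \<open>x (y d) = [x, y] d + y (x d)\<close>, where \<open>[x, y]\<close> has the degree of \<open>y\<close> and \<open>x d\<close> that of \<open>d\<close>.\<close>

lemma lin_span_raised_invariant:
  assumes x: "x \<in> N_deg G \<theta> 0" and z: "z \<in> lin_span ind (raised i)"
  shows "ind_act x z \<in> lin_span ind (raised i)"
proof (rule linear_mapping.maps_span[OF linear_ind_act[OF N_deg_polys[OF x]] raised_closed
      R.V.submodule_lin_span[OF raised_closed] _ z])
  fix u assume "u \<in> raised i"
  then obtain y d k where k: "0 < k" "k \<le> i" and y: "y \<in> N_deg G \<theta> k" and d: "d \<in> ind_deg (i - k)"
    and u: "u = ind_act y d" by (auto simp: raised_def)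
  note xp = N_deg_polys[OF x] and yp = N_deg_polys[OF y] and dc = ind_deg_closed[OF d]
  obtain a b where a: "a \<in> comp 0" "x = mono G 0 a" and b: "b \<in> comp k" "y = mono G k b"
    using x y by (auto simp: N_deg_eq)
  have br: "current_bracket G x y \<in> N_deg G \<theta> k"
    using comp_bracket[OF a(1) b(1)] mono_bracket[of a b 0 k] a b by (auto simp: N_deg_eq comp_closed)
  have "ind_act (current_bracket G x y) d = ind_act x (ind_act y d) \<ominus>\<^bsub>ind\<^esub> ind_act y (ind_act x d)"
    using R.act_lbracket[of x y d] xp yp dc by simp
  moreover have cl: "ind_act x (ind_act y d) \<in> carrier ind" "ind_act y (ind_act x d) \<in> carrier ind"
    using ind_act_closed xp yp dc by simp_all
  ultimately have "ind_act x u = ind_act (current_bracket G x y) d \<oplus>\<^bsub>ind\<^esub> ind_act y (ind_act x d)"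
    using R.V.diff_add_diff[of "ind_act x (ind_act y d)" "ind_act y (ind_act x d)" "\<zero>\<^bsub>ind\<^esub>"] by (simp add: u)
  moreover have "ind_act (current_bracket G x y) d \<in> raised i" using br d k by (auto simp: raised_def)
  moreover have "ind_act y (ind_act x d) \<in> raised i"
    using ind_act_deg[OF x d] y k by (auto simp: raised_def)
  ultimately show "ind_act x u \<in> lin_span ind (raised i)"
    using R.V.submodule_add[OF R.V.submodule_lin_span[OF raised_closed]] R.V.lin_span_base[OF raised_closed] by simp
qed

text \<open>Among the letters of a word of positive degree the first one of positive degree may be moved to the
  front: the letters of degree \<open>0\<close> before it preserve the span of \<^const>\<open>raised\<close>.\<close>

lemma ind_deg_raised:
  assumes "0 < i"
  shows "ind_deg i \<subseteq> lin_span ind (raised i)"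
proof -
  have "foldr ind_act w (unit v) \<in> lin_span ind (raised i)" if v: "v \<in> carrier V" and w: "w \<in> hom_words i" for w v
    using w
  proof (induction w rule: list.induct)
    case Nil
    then show ?case using assms by (simp add: hom_words_Nil_iff)
  next
    case (Cons x w)
    then obtain k where k: "k \<le> i" "x \<in> N_deg G \<theta> k" "w \<in> hom_words (i - k)"
      by (auto simp: hom_words_Cons_iff)
    show ?case
    proof (cases "k = 0")
      case True
      then show ?thesis using Cons.IH k lin_span_raised_invariant by simp
    next
      case False
      then have "ind_act x (foldr ind_act w (unit v)) \<in> raised i"
        using k word_in_ind_deg[OF k(3) v] by (auto simp: raised_def)
      then show ?thesis using R.V.lin_span_base[OF raised_closed] by simp
    qed
  qed
  then have "word_vectors i \<subseteq> lin_span ind (raised i)" by blast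
  then show ?thesis
    unfolding ind_deg_eq by (rule R.V.lin_span_least[OF R.V.submodule_lin_span[OF raised_closed]])
qed

lemma ind_deg_0: "ind_deg 0 = unit ` carrier V"
proof
  interpret u: linear_mapping V ind unit by (rule linear_unit)
  have "foldr ind_act w (unit v) \<in> unit ` carrier V" if v: "v \<in> carrier V" and w: "w \<in> hom_words 0" for w v
    using w
  proof (induction w rule: list.induct)
    case Nil
    then show ?case using v by simp
  next
    case (Cons x w)
    then have x: "x \<in> N_deg G \<theta> 0" and w: "w \<in> hom_words 0" by (auto simp: hom_words_Cons_iff)
    then obtain y where y: "y \<in> comp 0" "x = mono G 0 y" by (auto simp: N_deg_eq)
    from Cons.IH[OF w] obtain v' where v': "v' \<in> carrier V" "foldr ind_act w (unit v) = unit v'" by blast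
    have "act y v' \<in> carrier V"
      using lie_rep.act_closed[OF rep, of y v'] y v' by (simp add: k_fin_def comp_def)
    then show ?case using y v' ind_act_unit[OF y(1) v'(1)] by simp
  qed
  then have "word_vectors 0 \<subseteq> unit ` carrier V" by blast
  moreover have "submodule (unit ` carrier V) KK ind"
    by (intro u.submodule_image V.subspaceI) auto
  ultimately show "ind_deg 0 \<subseteq> unit ` carrier V" unfolding ind_deg_eq by (intro R.V.lin_span_least)
  show "unit ` carrier V \<subseteq> ind_deg 0" using unit_in_ind_deg by blast
qed

text \<open>Induction on the degree: each of the finitely many positive degrees \<open>k \<le> i\<close> contributes a finite set of
  letters applied to a finite set of vectors of degree \<open>i - k\<close>.\<close>

lemma ind_deg_finite_span:
  assumes V: "fin_dim V"
  shows "\<exists>S. finite S \<and> S \<subseteq> carrier ind \<and> ind_deg i \<subseteq> lin_span ind S"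
proof (induction i rule: less_induct)
  case (less i)
  show ?case
  proof (cases "i = 0")
    case True
    interpret u: linear_mapping V ind unit by (rule linear_unit)
    from V obtain C where C: "finite C" "C \<subseteq> carrier V" "lin_span V C = carrier V" by (auto simp: fin_dim_def)
    then have "ind_deg 0 = lin_span ind (unit ` C)" using u.image_lin_span[of C] by (simp add: ind_deg_0)
    then show ?thesis using C True u.closed by (intro exI[of _ "unit ` C"]) auto
  next
    case False
    from less obtain S where S: "\<And>j. j < i \<Longrightarrow> finite (S j)" "\<And>j. j < i \<Longrightarrow> S j \<subseteq> carrier ind"
      "\<And>j. j < i \<Longrightarrow> ind_deg j \<subseteq> lin_span ind (S j)" by metis
    define T where "T = (\<Union>k\<in>{0<..i}. (\<lambda>(b, s). ind_act (mono G k b) s) ` (comp_basis k \<times> S (i - k)))"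
    have T: "finite T" unfolding T_def using S(1) comp_basis(1) by (intro finite_UN_I finite_imageI finite_cartesian_product) auto
    have TV: "T \<subseteq> carrier ind"
    proof
      fix t assume "t \<in> T"
      then obtain k b s where t: "k \<in> {0<..i}" "b \<in> comp_basis k" "s \<in> S (i - k)" "t = ind_act (mono G k b) s"
        unfolding T_def by auto
      have "b \<in> comp k" "s \<in> carrier ind" using t comp_basis(2) S(2)[of "i - k"] by auto
      then show "t \<in> carrier ind" unfolding t(4) by (intro ind_act_closed mono_polys)
    qed
    have sub: "submodule (lin_span ind T) KK ind" by (rule R.V.submodule_lin_span[OF TV])
    have "raised i \<subseteq> lin_span ind T"
    proof
      fix u assume "u \<in> raised i"
      then obtain x d k where k: "0 < k" "k \<le> i" and x: "x \<in> N_deg G \<theta> k" and d: "d \<in> ind_deg (i - k)"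
        and u: "u = ind_act x d" by (auto simp: raised_def)
      from x obtain y where y: "y \<in> comp k" "x = mono G k y" by (auto simp: N_deg_eq)
      have ik: "i - k < i" using k by simp
      have base: "ind_act (mono G k b) d \<in> lin_span ind T" if b: "b \<in> comp_basis k" for b
      proof (rule linear_mapping.maps_span[OF linear_ind_act[OF mono_polys] S(2)[OF ik] sub])
        show "b \<in> comp k" using b comp_basis(2) by blast
        show "d \<in> lin_span ind (S (i - k))" using d S(3)[OF ik] by blast
        fix s assume "s \<in> S (i - k)"
        then have "ind_act (mono G k b) s \<in> T"
          unfolding T_def using b k by (intro UN_I[of k] image_eqI[of _ _ "(b, s)"]) auto
        then show "ind_act (mono G k b) s \<in> lin_span ind T" by (rule R.V.lin_span_base[OF TV])
      qed
      have "y \<in> lin_span G (comp_basis k)" using y comp_basis(3) by blast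
      then obtain c C where C: "finite C" "C \<subseteq> comp_basis k" "y = finsum G (\<lambda>b. c b \<odot> b) C"
        unfolding lin_span_def by blast
      have Ck: "C \<subseteq> comp k" using C comp_basis(2) by blast
      have "ind_act x d = finsum ind (\<lambda>b. ind_act (mono G k (c b \<odot> b)) d) C"
        unfolding y(2) C(3) using C(1) Ck ind_deg_closed[OF d] submodule_smult[OF submodule_comp]
        by (intro ind_act_mono_finsum) auto
      also have "\<dots> \<in> lin_span ind T"
      proof (rule R.V.submodule_finsum[OF sub])
        fix b assume b: "b \<in> C"
        have "ind_act (mono G k (c b \<odot> b)) d = c b \<odot>\<^bsub>ind\<^esub> ind_act (mono G k b) d"
          using R.act_smult_left[of "mono G k b" d "c b"] mono_polys b Ck ind_deg_closed[OF d]
          by (auto simp: mono_linear)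
        then show "ind_act (mono G k (c b \<odot> b)) d \<in> lin_span ind T"
          using R.V.submodule_smult[OF sub base] b C(2) by auto
      qed
      finally show "u \<in> lin_span ind T" by (simp only: u)
    qed
    then have "lin_span ind (raised i) \<subseteq> lin_span ind T" by (rule R.V.lin_span_least[OF sub])
    then have "ind_deg i \<subseteq> lin_span ind T" using ind_deg_raised False by blast
    then show ?thesis using T TV by blast
  qed
qed

lemma fin_dim_ind_quot:
  assumes V: "fin_dim V"
  shows "fin_dim (ind_quot N)"
proof -
  obtain S where S: "\<And>i. finite (S i)" "\<And>i. S i \<subseteq> carrier ind" "\<And>i. ind_deg i \<subseteq> lin_span ind (S i)"
    using ind_deg_finite_span[OF V] by metis
  interpret c: linear_mapping ind "ind_quot N" "coset N" by (rule linear_coset)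
  let ?S = "\<Union>i<N. S i"
  have SV: "?S \<subseteq> carrier ind" using S(2) by blast
  have sub: "submodule (lin_span ind ?S) KK ind" by (rule R.V.submodule_lin_span[OF SV])
  show ?thesis
  proof (rule c.W.fin_dimI)
    show "finite (coset N ` ?S)" using S(1) by simp
    show "coset N ` ?S \<subseteq> carrier (ind_quot N)" using SV by auto
    show "carrier (ind_quot N) \<subseteq> lin_span (ind_quot N) (coset N ` ?S)"
    proof
      fix Z assume "Z \<in> carrier (ind_quot N)"
      then obtain z where z: "z \<in> carrier ind" "Z = coset N z" by (rule ind_quotE)
      let ?z = "finsum ind (components z) {..<N}"
      have cz: "components z i \<in> lin_span ind ?S" if "i < N" for i
        using decomposition(1)[OF z(1), of i] S(3)[of i] R.V.lin_span_mono[of "S i" ?S] that by blast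
      then have zS: "?z \<in> lin_span ind ?S" by (intro R.V.submodule_finsum[OF sub]) auto
      then have zc: "?z \<in> carrier ind" using R.V.submodule_subset[OF sub] by blast
      have "components ?z i = components z i" if "i < N" for i
        using components_finsum[of "components z" "{..<N}" i] decomposition(1)[OF z(1)] that by simp
      then have "Z = coset N ?z" using z zc by (simp add: coset_eq_iff)
      then show "Z \<in> lin_span (ind_quot N) (coset N ` ?S)"
        using c.image_lin_span[OF SV] zS by blast
    qed
  qed
qed

section \<open>The completion\<close>

lemma completion_simps [simp]:
  "carrier completion = {v. \<forall>i. v i \<in> ind_deg i}" "\<zero>\<^bsub>completion\<^esub> = (\<lambda>i. \<zero>\<^bsub>ind\<^esub>)"
  "v \<oplus>\<^bsub>completion\<^esub> w = (\<lambda>i. v i \<oplus>\<^bsub>ind\<^esub> w i)" "c \<odot>\<^bsub>completion\<^esub> v = (\<lambda>i. c \<odot>\<^bsub>ind\<^esub> v i)"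
  by (simp_all add: completion_def)

lemma completion_act_deg:
  assumes x: "x \<in> series" and v: "\<And>i. v i \<in> ind_deg i"
  shows "completion_act x v i \<in> ind_deg i"
  unfolding completion_act_def
proof (rule R.V.submodule_finsum[OF submodule_ind_deg])
  fix j assume "j \<in> {..i}"
  then show "term_act x j (v (i - j)) \<in> ind_deg i"
    using ind_act_deg[OF mono_N_deg[OF x, of j] v[of "i - j"]] by simp
qed

lemma lie_rep_completion: "lie_rep (N_series G \<theta>) completion completion_act"
proof -
  interpret F: vec_space families by (rule vec_space_families)
  let ?C = "{v. \<forall>i. v i \<in> ind_deg i}"
  have "submodule ?C KK families"
    by (rule F.subspaceI)
      (auto intro: ind_deg_closed simp: R.V.submodule_zero[OF submodule_ind_deg]
        R.V.submodule_add[OF submodule_ind_deg] R.V.submodule_smult[OF submodule_ind_deg])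
  moreover have "completion = families\<lparr>carrier := ?C\<rparr>"
    by (simp add: completion_def families_def pi_module_def)
  ultimately show ?thesis
    using lie_rep_invariant_subspace[OF lie_rep_families, of ?C] completion_act_deg by simp
qed

lemma completion_proj_closed:
  assumes "v \<in> carrier completion"
  shows "finsum ind v {..<N} \<in> carrier ind" "completion_proj N v \<in> carrier (ind_quot N)"
proof -
  show *: "finsum ind v {..<N} \<in> carrier ind" using assms ind_deg_closed by (intro R.V.finsum_closed) auto
  show "completion_proj N v \<in> carrier (ind_quot N)"
    unfolding completion_proj_def by (rule linear_mapping.closed[OF linear_coset *])
qed

lemma components_partial_sum:
  "v \<in> carrier completion \<Longrightarrow> components (finsum ind v {..<N}) i = (if i < N then v i else \<zero>\<^bsub>ind\<^esub>)"
  by (simp add: components_finsum)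

lemma quot_bond_coset:
  assumes "M \<le> N" "z \<in> carrier ind"
  shows "quot_bond M N (coset N z) = coset M z"
proof -
  have "linear_mapping ind ind (\<lambda>z. z)" by (rule linear_mappingI) (simp_all add: vec_space_ind)
  from linear_mapping.UN_coset[OF this submodule_ind_ge submodule_ind_ge _ assms(2), of N M]
  show ?thesis using ind_ge_antimono[OF assms(1)] by (simp add: quot_bond_def)
qed

lemma carrier_inverse_limit:
  "Z \<in> carrier (inverse_limit ind_quot quot_bond) \<longleftrightarrow>
    (\<forall>N. Z N \<in> carrier (ind_quot N)) \<and> (\<forall>M N. M \<le> N \<longrightarrow> quot_bond M N (Z N) = Z M)"
  by (simp add: inverse_limit_def)

lemma completion_proj_limit:
  assumes v: "v \<in> carrier completion"
  shows "(\<lambda>N. completion_proj N v) \<in> carrier (inverse_limit ind_quot quot_bond)"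
  unfolding carrier_inverse_limit
proof (intro conjI allI impI completion_proj_closed[OF v])
  fix M N :: nat assume MN: "M \<le> N"
  then show "quot_bond M N (completion_proj N v) = completion_proj M v"
    using completion_proj_closed(1)[OF v]
    by (simp add: completion_proj_def quot_bond_coset coset_eq_iff components_partial_sum[OF v])
qed

lemma lin_map_completion_proj: "lin_map completion (inverse_limit ind_quot quot_bond) (\<lambda>v N. completion_proj N v)"
proof -
  have "completion_proj N (v \<oplus>\<^bsub>completion\<^esub> w) = completion_proj N v \<oplus>\<^bsub>ind_quot N\<^esub> completion_proj N w"
    if vw: "v \<in> carrier completion" "w \<in> carrier completion" for v w N
  proof -
    have "finsum ind (\<lambda>i. v i \<oplus>\<^bsub>ind\<^esub> w i) {..<N} = finsum ind v {..<N} \<oplus>\<^bsub>ind\<^esub> finsum ind w {..<N}"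
      using vw ind_deg_closed by (intro R.V.finsum_addf) auto
    then show ?thesis
      using linear_mapping.add[OF linear_coset completion_proj_closed(1)[OF vw(1)] completion_proj_closed(1)[OF vw(2)]]
      by (simp add: completion_proj_def)
  qed
  moreover have "completion_proj N (c \<odot>\<^bsub>completion\<^esub> v) = c \<odot>\<^bsub>ind_quot N\<^esub> completion_proj N v"
    if v: "v \<in> carrier completion" for c v N
  proof -
    have "finsum ind (\<lambda>i. c \<odot>\<^bsub>ind\<^esub> v i) {..<N} = c \<odot>\<^bsub>ind\<^esub> finsum ind v {..<N}"
      using v ind_deg_closed by (intro R.V.finsum_smult[symmetric]) auto
    then show ?thesis
      using linear_mapping.smult[OF linear_coset completion_proj_closed(1)[OF v]]
      by (simp add: completion_proj_def)
  qed
  ultimately show ?thesis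
    unfolding lin_map_def using completion_proj_limit by (auto simp: inverse_limit_def simp del: completion_simps)
qed

text \<open>The component of degree \<open>i\<close> is already determined by the member at \<open>Suc i\<close> of a compatible sequence.\<close>

lemma bij_completion_proj:
  "bij_betw (\<lambda>v N. completion_proj N v) (carrier completion) (carrier (inverse_limit ind_quot quot_bond))"
proof (rule bij_betw_imageI)
  show "inj_on (\<lambda>v N. completion_proj N v) (carrier completion)"
  proof (rule inj_onI)
    fix v w assume v: "v \<in> carrier completion" and w: "w \<in> carrier completion"
      and eq: "(\<lambda>N. completion_proj N v) = (\<lambda>N. completion_proj N w)"
    show "v = w"
    proof
      fix i
      have "coset (Suc i) (finsum ind v {..<Suc i}) = coset (Suc i) (finsum ind w {..<Suc i})"
        using fun_cong[OF eq, of "Suc i"] by (simp only: completion_proj_def)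
      then have "components (finsum ind v {..<Suc i}) i = components (finsum ind w {..<Suc i}) i"
        by (simp only: coset_eq_iff[OF completion_proj_closed(1)[OF v] completion_proj_closed(1)[OF w]] lessI)
      then show "v i = w i" by (simp only: components_partial_sum[OF v] components_partial_sum[OF w] lessI if_True)
    qed
  qed
  show "(\<lambda>v N. completion_proj N v) ` carrier completion = carrier (inverse_limit ind_quot quot_bond)"
  proof
    show "(\<lambda>v N. completion_proj N v) ` carrier completion \<subseteq> carrier (inverse_limit ind_quot quot_bond)"
      by (rule image_subsetI) (rule completion_proj_limit)
    show "carrier (inverse_limit ind_quot quot_bond) \<subseteq> (\<lambda>v N. completion_proj N v) ` carrier completion"
    proof
      fix Z assume "Z \<in> carrier (inverse_limit ind_quot quot_bond)"
      then have Z: "\<And>N. Z N \<in> carrier (ind_quot N)" and bond: "\<And>M N. M \<le> N \<Longrightarrow> quot_bond M N (Z N) = Z M"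
        by (auto simp: carrier_inverse_limit)
      have "\<exists>z. z \<in> carrier ind \<and> Z N = coset N z" for N using Z[of N] by (elim ind_quotE) blast
      then obtain z where z: "\<And>N. z N \<in> carrier ind" "\<And>N. Z N = coset N (z N)" by metis
      \<comment> \<open>\<open>Suc i\<close> is the least index at which the component of degree \<open>i\<close> is visible.\<close>
      define v where "v i = components (z (Suc i)) i" for i
      have v: "v \<in> carrier completion" using decomposition(1)[OF z(1)] by (simp add: v_def)
      have zv: "components (z N) i = v i" if "i < N" for i N
      proof -
        have "coset (Suc i) (z N) = coset (Suc i) (z (Suc i))"
          using bond[of "Suc i" N] that z quot_bond_coset[of "Suc i" N "z N"] by simp
        then show ?thesis using coset_eq_iff[OF z(1) z(1), of "Suc i" N "Suc i"] by (simp add: v_def)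
      qed
      have "Z N = completion_proj N v" for N
        using z completion_proj_closed(1)[OF v] by (simp add: completion_proj_def coset_eq_iff components_partial_sum[OF v] zv)
      then have "Z = (\<lambda>N. completion_proj N v)" by auto
      then show "Z \<in> (\<lambda>v N. completion_proj N v) ` carrier completion" using v by blast
    qed
  qed
qed

lemma completion_proj_act:
  assumes x: "x \<in> series" and v: "v \<in> carrier completion"
  shows "completion_proj N (completion_act x v) = quot_act N (cut_at G N x) (completion_proj N v)"
proof -
  let ?x = "cut_at G N x" and ?s = "finsum ind v {..<N}"
  have s: "?s \<in> carrier ind" by (rule completion_proj_closed(1)[OF v])
  have xp: "?x \<in> polys" using cut_at_truncated[OF x, of N] truncated_subset by auto
  have xv: "completion_act x v \<in> carrier completion" using completion_act_deg[OF x] v by simp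
  have "components (finsum ind (completion_act x v) {..<N}) i = components (ind_act ?x ?s) i" if "i < N" for i
  proof -
    have "completion_act x v i = completion_act ?x (components ?s) i"
    proof (rule completion_act_cong)
      show "x j = ?x j" "v j = components ?s j" if "j \<le> i" for j
        using that \<open>i < N\<close> by (simp_all only: cut_at_def components_partial_sum[OF v]) auto
    qed (use polys_series[OF xp] components_closed[OF s] in auto)
    then show ?thesis using that by (simp only: components_partial_sum[OF xv] components_act[OF xp s] if_True)
  qed
  then show ?thesis
    unfolding completion_proj_def quot_act_coset[OF x s]
    using completion_proj_closed(1)[OF xv] ind_act_closed[OF xp s] by (simp add: coset_eq_iff)
qed

end

section \<open>Faithfulness of the completion\<close>

text \<open>Only the columns with index in \<open>A\<close> are restricted, as they are the ones over which products sum.\<close>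
definition matrix_rep ::
  "('k::field, 'a, 'm) lie_scheme \<Rightarrow> 'i set \<Rightarrow> ('a \<Rightarrow> 'i \<Rightarrow> 'i \<Rightarrow> 'k fps) \<Rightarrow> bool" where
  "matrix_rep L A M \<longleftrightarrow> (\<forall>x\<in>carrier L. \<forall>a. \<forall>c\<in>A.
    (\<forall>y\<in>carrier L. M (x \<oplus>\<^bsub>L\<^esub> y) a c = M x a c + M y a c \<and>
      M (lbracket L x y) a c = mat_comm A (M x) (M y) a c) \<and>
    (\<forall>s. M (s \<odot>\<^bsub>L\<^esub> x) a c = fps_const s * M x a c))"

definition mat_vec :: "'i set \<Rightarrow> ('i \<Rightarrow> 'i \<Rightarrow> 'r::comm_ring_1) \<Rightarrow> ('i \<Rightarrow> 'r) \<Rightarrow> 'i \<Rightarrow> 'r" where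
  "mat_vec A M t a = (\<Sum>c\<in>A. M a c * t c)"

lemma mat_vec_add: "mat_vec A M (\<lambda>c. t c + u c) a = mat_vec A M t a + mat_vec A M u a"
  and mat_vec_scale: "mat_vec A M (\<lambda>c. r * t c) a = r * mat_vec A M t a"
  by (simp_all add: mat_vec_def distrib_left sum.distrib sum_distrib_left
      mult.left_commute)

lemma mat_vec_swap: "mat_vec A M (\<lambda>c. mat_vec B N (t c) b) a = mat_vec B N (\<lambda>d. mat_vec A M (\<lambda>c. t c d) a) b"
  unfolding mat_vec_def sum_distrib_left by (subst sum.swap) (simp add: mult.left_commute)

lemma mat_vec_mult: "mat_vec A (mat_mult A M N) t a = mat_vec A M (mat_vec A N t) a"
  unfolding mat_vec_def mat_mult_def sum_distrib_left sum_distrib_right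
  by (subst sum.swap) (simp add: mult.assoc)

lemma mat_vec_matrix_rep:
  assumes M: "matrix_rep L A M" and x: "x \<in> carrier L" and y: "y \<in> carrier L"
  shows "mat_vec A (M (x \<oplus>\<^bsub>L\<^esub> y)) t a = mat_vec A (M x) t a + mat_vec A (M y) t a"
    and "mat_vec A (M (s \<odot>\<^bsub>L\<^esub> x)) t a = fps_const s * mat_vec A (M x) t a"
    and "mat_vec A (M (lbracket L x y)) t a =
      mat_vec A (M x) (mat_vec A (M y) t) a - mat_vec A (M y) (mat_vec A (M x) t) a"
proof -
  show "mat_vec A (M (x \<oplus>\<^bsub>L\<^esub> y)) t a = mat_vec A (M x) t a + mat_vec A (M y) t a"
    using assms unfolding mat_vec_def sum.distrib[symmetric]
    by (intro sum.cong) (auto simp: matrix_rep_def distrib_right)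
  show "mat_vec A (M (s \<odot>\<^bsub>L\<^esub> x)) t a = fps_const s * mat_vec A (M x) t a"
    using assms unfolding mat_vec_def sum_distrib_left
    by (intro sum.cong) (auto simp: matrix_rep_def mult.assoc)
  have "mat_vec A (M (lbracket L x y)) t a =
      (\<Sum>c\<in>A. mat_mult A (M x) (M y) a c * t c - mat_mult A (M y) (M x) a c * t c)"
    using assms unfolding mat_vec_def
    by (intro sum.cong) (auto simp: matrix_rep_def mat_comm_def left_diff_distrib)
  then show "mat_vec A (M (lbracket L x y)) t a =
      mat_vec A (M x) (mat_vec A (M y) t) a - mat_vec A (M y) (mat_vec A (M x) t) a"
    by (simp add: sum_subtractf mat_vec_mult[symmetric]) (simp add: mat_vec_def)
qed

text \<open>Coordinates of the tensor product of three spaces. Entries at indices outside of the finite sets are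
  harmless, since products of matrices do not read them.\<close>
definition tensor_module :: "('k::field, 'a \<Rightarrow> 'b \<Rightarrow> 'c \<Rightarrow> 'k fps) module" where
  "tensor_module = \<lparr>carrier = UNIV, monoid.mult = undefined, monoid.one = undefined,
     ring.zero = (\<lambda>a b i. 0), ring.add = (\<lambda>t u a b i. t a b i + u a b i),
     module.smult = (\<lambda>s t a b i. fps_const s * t a b i)\<rparr>"

lemma tensor_module_simps [simp]:
  "carrier tensor_module = UNIV" "\<zero>\<^bsub>tensor_module\<^esub> = (\<lambda>a b i. 0)"
  "t \<oplus>\<^bsub>tensor_module\<^esub> u = (\<lambda>a b i. t a b i + u a b i)" "s \<odot>\<^bsub>tensor_module\<^esub> t = (\<lambda>a b i. fps_const s * t a b i)"
  by (simp_all add: tensor_module_def)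

lemma vec_space_tensor_module: "vec_space tensor_module"
  by (rule vec_spaceI)
    (simp_all add: fun_eq_iff algebra_simps fps_const_add[symmetric] fps_const_mult[symmetric]
      del: fps_const_add fps_const_mult)

definition tensor_act where
  "tensor_act A B C M N P x t a b i = mat_vec A (M x) (\<lambda>c. t c b i) a + mat_vec B (N x) (\<lambda>c. t a c i) b
     + mat_vec C (P x) (t a b) i"

text \<open>Operators on different indices commute, so that in the commutator of two elements only the three
  diagonal terms survive.\<close>

lemma lie_rep_tensor:
  fixes L :: "('k::field, 'x, 'm) lie_scheme"
  assumes L: "lie_algebra L" and M: "matrix_rep L A M" and N: "matrix_rep L B N" and P: "matrix_rep L C P"
  shows "lie_rep L tensor_module (tensor_act A B C M N P)"
proof -
  interpret L: lie_algebra L by (rule L)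
  interpret T: vec_space "tensor_module :: ('k, 'a \<Rightarrow> 'b \<Rightarrow> 'c \<Rightarrow> 'k fps) module" by (rule vec_space_tensor_module)
  have diff: "t \<ominus>\<^bsub>tensor_module\<^esub> u = (\<lambda>a b i. t a b i - u a b i)" for t u :: "'a \<Rightarrow> 'b \<Rightarrow> 'c \<Rightarrow> 'k fps"
    by (simp add: T.diff_eq_smult fps_const_neg[symmetric] del: fps_const_neg)
  note add_smult = mat_vec_matrix_rep(1,2)[OF M] mat_vec_matrix_rep(1,2)[OF N] mat_vec_matrix_rep(1,2)[OF P]
  note br = mat_vec_matrix_rep(3)[OF M] mat_vec_matrix_rep(3)[OF N] mat_vec_matrix_rep(3)[OF P]
  show ?thesis
  proof (rule lie_repI[OF L vec_space_tensor_module])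
    fix x y t assume x: "x \<in> carrier L" and y: "y \<in> carrier L"
    show "tensor_act A B C M N P (lbracket L x y) t =
        tensor_act A B C M N P x (tensor_act A B C M N P y t) \<ominus>\<^bsub>tensor_module\<^esub>
        tensor_act A B C M N P y (tensor_act A B C M N P x t)"
    proof (intro ext)
      fix a b i
      have "mat_vec A (M x) (\<lambda>c. mat_vec B (N y) (\<lambda>d. t c d i) b) a = mat_vec B (N y) (\<lambda>d. mat_vec A (M x) (\<lambda>c. t c d i) a) b"
        "mat_vec A (M x) (\<lambda>c. mat_vec C (P y) (t c b) i) a = mat_vec C (P y) (\<lambda>d. mat_vec A (M x) (\<lambda>c. t c b d) a) i"
        "mat_vec B (N x) (\<lambda>c. mat_vec C (P y) (t a c) i) b = mat_vec C (P y) (\<lambda>d. mat_vec B (N x) (\<lambda>c. t a c d) b) i"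
        for x y by (rule mat_vec_swap)+
      note swap = this
      show "tensor_act A B C M N P (lbracket L x y) t a b i =
        (tensor_act A B C M N P x (tensor_act A B C M N P y t) \<ominus>\<^bsub>tensor_module\<^esub>
        tensor_act A B C M N P y (tensor_act A B C M N P x t)) a b i"
        unfolding diff tensor_act_def mat_vec_add br[OF x y] swap by simp
    qed
  qed (simp_all add: tensor_act_def fun_eq_iff add_smult mat_vec_add mat_vec_scale distrib_left)
qed

locale faithful_current_module = current_module G B l \<theta> V act
  for G :: "('k::field, 'g) lie" (structure) and B :: "'g set" and l :: "'g \<Rightarrow> 'g \<Rightarrow> 'k" and \<theta> :: "'g \<Rightarrow> 'g"
    and V :: "('k, 'v) module" and act :: "'g \<Rightarrow> 'v \<Rightarrow> 'v" +
  fixes C :: "'v set" and m :: "'v \<Rightarrow> 'v \<Rightarrow> 'k"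
  assumes dual_basis_V: "dual_basis V C m"
    and faithful_rep: "faithful (k_fin G \<theta>) V act"
    and nontrivial: "\<exists>x\<in>carrier G. x \<noteq> \<zero>"

sublocale faithful_current_module \<subseteq> W: dual_based_space V C m
  by unfold_locales (rule dual_basis_V)

context faithful_current_module
begin

lemma k_fin_carrier: "carrier (k_fin G \<theta>) = comp 0"
  by (simp add: k_fin_def comp_def)

lemma k_fin_ops: "x \<oplus>\<^bsub>k_fin G \<theta>\<^esub> y = x \<oplus> y" "s \<odot>\<^bsub>k_fin G \<theta>\<^esub> x = s \<odot> x" "lbracket (k_fin G \<theta>) = lbracket G"
    "\<zero>\<^bsub>k_fin G \<theta>\<^esub> = \<zero>"
  by (simp_all add: k_fin_def)

lemma act_closed: "\<lbrakk>y \<in> comp 0; v \<in> carrier V\<rbrakk> \<Longrightarrow> act y v \<in> carrier V"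
  using lie_rep.act_closed[OF rep] by (simp add: k_fin_carrier)

text \<open>Row indices are arbitrary, but brackets are linear on the carrier only; therefore indices outside
  of \<open>B\<close> are replaced by zero.\<close>
definition clip :: "'g \<Rightarrow> 'g" where
  "clip b = (if b \<in> B then b else \<zero>)"

lemma clip_closed [simp]: "clip b \<in> carrier G" and clip_basis: "b \<in> B \<Longrightarrow> clip b = b"
  using basis_closed by (auto simp: clip_def)

text \<open>The dual of the adjoint representation of the constant coefficients; the sign and the transposition
  make it a representation.\<close>
definition coad_matrix :: "(nat \<Rightarrow> 'g) \<Rightarrow> 'g \<Rightarrow> 'g \<Rightarrow> 'k fps" where
  "coad_matrix x b c = fps_const (- l c (lbracket G (x 0) (clip b)))"

definition act_matrix :: "(nat \<Rightarrow> 'g) \<Rightarrow> 'v \<Rightarrow> 'v \<Rightarrow> 'k fps" where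
  "act_matrix x i k = fps_const (m i (act (x 0) k))"

lemma fps_const_sum: "fps_const (\<Sum>a\<in>A. f a) = (\<Sum>a\<in>A. fps_const (f a))"
  by (induction A rule: infinite_finite_induct) (auto simp: fps_const_add[symmetric] simp del: fps_const_add)

lemma current_bracket_0: "\<lbrakk>x 0 \<in> carrier G; y 0 \<in> carrier G\<rbrakk> \<Longrightarrow> current_bracket G x y 0 = lbracket G (x 0) (y 0)"
  by (simp add: current_bracket_def lbracket_closed)

lemma polys_closed: "x \<in> polys \<Longrightarrow> x k \<in> carrier G" and polys_0: "x \<in> polys \<Longrightarrow> x 0 \<in> comp 0"
  by (auto simp: polys_series series_closed series_comp)

lemma matrix_rep_ad: "matrix_rep (N_poly G \<theta>) B ad_matrix"
proof -
  have "ad_matrix (\<lambda>k. x k \<oplus> y k) a c = ad_matrix x a c + ad_matrix y a c"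
    "ad_matrix (\<lambda>k. s \<odot> x k) a c = fps_const s * ad_matrix x a c"
    if "x \<in> polys" "y \<in> polys" "c \<in> B" for x y a c s
    using that polys_closed basis_closed
    by (auto simp: fps_eq_iff ad_matrix_def lbracket_add_left lbracket_smult_left lbracket_closed coord_add coord_smult)
  moreover have "ad_matrix (current_bracket G x y) a c = mat_comm B (ad_matrix x) (ad_matrix y) a c"
    if "x \<in> polys" "y \<in> polys" "c \<in> B" for x y a c
    by (rule ad_matrix_bracket) (use that polys_closed in auto)
  ultimately show ?thesis by (auto simp: matrix_rep_def)
qed

lemma matrix_rep_coad: "matrix_rep (N_poly G \<theta>) B coad_matrix"
proof -
  have "coad_matrix (\<lambda>k. x k \<oplus> y k) a c = coad_matrix x a c + coad_matrix y a c"
    "coad_matrix (\<lambda>k. s \<odot> x k) a c = fps_const s * coad_matrix x a c"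
    if "x \<in> polys" "y \<in> polys" for x y a c s
    using that polys_closed
    by (auto simp: coad_matrix_def lbracket_add_left lbracket_smult_left lbracket_closed coord_add coord_smult)
  moreover have "coad_matrix (current_bracket G x y) a c = mat_comm B (coad_matrix x) (coad_matrix y) a c"
    if x: "x \<in> polys" and y: "y \<in> polys" for x y a c
  proof -
    have "mat_mult B (coad_matrix x) (coad_matrix y) a c = fps_const (l c (lbracket G (y 0) (lbracket G (x 0) (clip a))))"
      if x: "x \<in> polys" and y: "y \<in> polys" for x y
    proof -
      have "mat_mult B (coad_matrix x) (coad_matrix y) a c =
          fps_const (\<Sum>d\<in>B. l c (lbracket G (y 0) d) * l d (lbracket G (x 0) (clip a)))"
        unfolding fps_const_sum mat_mult_def
        by (rule sum.cong) (auto simp: coad_matrix_def clip_basis mult.commute)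
      then show ?thesis using x y polys_closed by (simp add: coord_bracket_bracket)
    qed
    then show ?thesis
      using x y polys_closed
      by (simp add: mat_comm_def coad_matrix_def current_bracket_0 bracket_bracket coord_diff lbracket_closed)
  qed
  ultimately show ?thesis by (auto simp: matrix_rep_def)
qed

lemma matrix_rep_act: "matrix_rep (N_poly G \<theta>) C act_matrix"
proof -
  interpret K: lie_rep "k_fin G \<theta>" V act by (rule rep)
  note K.act_add_left[simplified k_fin_carrier k_fin_ops, simp] K.act_smult_left[simplified k_fin_carrier k_fin_ops, simp]
    K.act_lbracket[simplified k_fin_carrier k_fin_ops, simp]
  have "act_matrix (\<lambda>k. x k \<oplus> y k) i c = act_matrix x i c + act_matrix y i c"
    "act_matrix (\<lambda>k. s \<odot> x k) i c = fps_const s * act_matrix x i c"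
    if "x \<in> polys" "y \<in> polys" "c \<in> C" for x y i c s
    using that polys_0 W.basis_closed
    by (auto simp: act_matrix_def act_closed W.coord_add W.coord_smult)
  moreover have "act_matrix (current_bracket G x y) i c = mat_comm C (act_matrix x) (act_matrix y) i c"
    if x: "x \<in> polys" and y: "y \<in> polys" and c: "c \<in> C" for x y i c
  proof -
    have mult: "mat_mult C (act_matrix x) (act_matrix y) i c = fps_const (m i (act (x 0) (act (y 0) c)))"
      if x: "x \<in> polys" and y: "y \<in> polys" for x y
    proof -
      have "functional V (\<lambda>v. m i (act (x 0) v))"
        using polys_0[OF x] K.act_add_right[simplified k_fin_carrier] K.act_smult_right[simplified k_fin_carrier]
        by (auto simp: functional_def act_closed W.coord_add W.coord_smult)
      from W.functional_expand[OF this, of "act (y 0) c"] show ?thesis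
        using polys_0[OF y] W.basis_closed[OF c]
        by (simp add: mat_mult_def act_matrix_def fps_const_sum act_closed mult.commute)
    qed
    show ?thesis
      using polys_0[OF x] polys_0[OF y] W.basis_closed[OF c]
      unfolding mat_comm_def mult[OF x y] mult[OF y x]
      by (simp add: act_matrix_def current_bracket_0 comp_closed W.coord_diff act_closed)
  qed
  ultimately show ?thesis by (auto simp: matrix_rep_def)
qed

abbreviation "test_act \<equiv> tensor_act B B C ad_matrix coad_matrix act_matrix"

text \<open>The tensor \<open>id \<otimes> v\<close>.\<close>
definition test_vector :: "'v \<Rightarrow> 'g \<Rightarrow> 'g \<Rightarrow> 'v \<Rightarrow> 'k fps" where
  "test_vector v a b i = fps_const (l a (clip b) * m i v)"

text \<open>In degree \<open>0\<close> the adjoint and the coadjoint matrix cancel on the identity, which leaves the action on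
  \<open>V\<close>. In positive degree only the adjoint matrix acts.\<close>

lemma nth_test_act:
  assumes y: "y \<in> comp k" and v: "v \<in> carrier V"
  shows "fps_nth (test_act (mono G k y) (test_vector v) a b i) j =
    (if j \<noteq> k then 0 else if k = 0 then l a (clip b) * m i (act y v) else l a (lbracket G y (clip b)) * m i v)"
proof -
  have yG: "y \<in> carrier G" using y by (rule comp_closed)
  have ad: "(\<Sum>c\<in>B. l a (lbracket G z c) * l c (clip b)) = l a (lbracket G z (clip b))" if "z \<in> carrier G" for z
    using functional_expand[OF functional_bracket_right[OF that], of "clip b" a] by (simp add: mult.commute)
  have mono: "mono G k y n \<in> carrier G" for n using yG by (simp add: mono_def)
  have 1: "fps_nth (mat_vec B (ad_matrix (mono G k y)) (\<lambda>c. test_vector v c b i) a) j =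
      l a (lbracket G (mono G k y j) (clip b)) * m i v"
    unfolding ad[OF mono, symmetric]
    by (simp add: mat_vec_def fps_sum_nth ad_matrix_def test_vector_def sum_distrib_right mult.assoc)
  have "(\<Sum>c\<in>B. l c (lbracket G (mono G k y 0) (clip b)) * l a (clip c)) = (\<Sum>c\<in>B. l c (lbracket G (mono G k y 0) (clip b)) * l a c)"
    by (rule sum.cong) (simp_all add: clip_basis)
  also have "\<dots> = l a (lbracket G (mono G k y 0) (clip b))"
    using functional_expand[OF coord_functional, of "lbracket G (mono G k y 0) (clip b)" a] mono by (simp add: lbracket_closed)
  finally have "(\<Sum>c\<in>B. l c (lbracket G (mono G k y 0) (clip b)) * (l a (clip c) * m i v)) =
      l a (lbracket G (mono G k y 0) (clip b)) * m i v"
    by (simp add: sum_distrib_right[symmetric] mult.assoc[symmetric])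
  then have 2: "fps_nth (mat_vec B (coad_matrix (mono G k y)) (\<lambda>c. test_vector v a c i) b) j =
      (if j = 0 then - l a (lbracket G (mono G k y 0) (clip b)) * m i v else 0)"
    by (simp add: mat_vec_def fps_sum_nth coad_matrix_def test_vector_def sum_negf)
  have 3: "fps_nth (mat_vec C (act_matrix (mono G k y)) (test_vector v a b) i) j =
      (if j = 0 then l a (clip b) * (\<Sum>c\<in>C. m i (act (mono G k y 0) c) * m c v) else 0)"
    by (simp add: mat_vec_def fps_sum_nth act_matrix_def test_vector_def sum_distrib_left mult.left_commute)
  have 4: "(\<Sum>c\<in>C. m i (act z c) * m c v) = m i (act z v)" if z: "z \<in> comp 0" for z
  proof -
    interpret K: lie_rep "k_fin G \<theta>" V act by (rule rep)
    have "functional V (\<lambda>v. m i (act z v))"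
      using z K.act_add_right[simplified k_fin_carrier] K.act_smult_right[simplified k_fin_carrier]
      by (auto simp: functional_def act_closed W.coord_add W.coord_smult)
    from W.functional_expand[OF this v] show ?thesis by (simp add: mult.commute)
  qed
  have "m i (act \<zero> v) = 0"
  proof -
    interpret K: lie_rep "k_fin G \<theta>" V act by (rule rep)
    have "act (0 \<odot> \<zero>) v = 0 \<odot>\<^bsub>V\<^esub> act \<zero> v"
      using K.act_smult_left[of \<zero> v 0] v comp_zero by (simp add: k_fin_carrier k_fin_ops)
    then show ?thesis using act_closed[OF comp_zero v] by (simp add: W.coord_zero)
  qed
  then show ?thesis
    unfolding tensor_act_def fps_add_nth 1 2 3 using y yG
    by (auto simp: mono_def 4 comp_zero coord_zero)
qed

lemma equivariant_test_vector:
  assumes y: "y \<in> comp 0" and v: "v \<in> carrier V"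
  shows "test_vector (act y v) = test_act (mono G 0 y) (test_vector v)"
  by (intro ext fps_ext) (simp add: nth_test_act[OF y v] test_vector_def)

lemma ex_test_map:
  "\<exists>\<Psi>. linear_mapping ind tensor_module \<Psi> \<and> (\<forall>v\<in>carrier V. \<Psi> (unit v) = test_vector v) \<and>
    (\<forall>x\<in>polys. \<forall>z\<in>carrier ind. \<Psi> (ind_act x z) = test_act x (\<Psi> z))"
proof (rule I.ex_equivariant_lift[OF lie_rep_tensor[OF lie_algebra_N_poly matrix_rep_ad matrix_rep_coad matrix_rep_act],
      folded ind_def ind_act_def])
  show "linear_mapping V tensor_module test_vector"
    by (rule linear_mappingI)
      (auto simp: V.vec_space_axioms vec_space_tensor_module test_vector_def W.coord_add W.coord_smult
        fun_eq_iff distrib_left mult.left_commute)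
  fix x v assume x: "x \<in> N_deg G \<theta> 0" and v: "v \<in> carrier V"
  then obtain y where y: "y \<in> comp 0" "x = mono G 0 y" by (auto simp: N_deg_eq)
  then show "test_vector (act (x 0) v) = test_act x (test_vector v)"
    using equivariant_test_vector[OF y(1) v] by (simp add: mono_def)
qed auto

lemma ex_nonzero_coord: "\<exists>a\<in>B. \<exists>b\<in>B. l a b \<noteq> 0"
proof (rule ccontr)
  assume "\<not> ?thesis"
  then have zero: "\<And>a b. \<lbrakk>a \<in> B; b \<in> B\<rbrakk> \<Longrightarrow> l a b = 0" by blast
  obtain x where x: "x \<in> carrier G" "x \<noteq> \<zero>" using nontrivial by blast
  have "l a x = l a \<zero>" if "a \<in> B" for a
    using functional_expand[OF coord_functional x(1), of a] zero[OF that] by (simp add: coord_zero)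
  then show False using eqI[OF x(1), of \<zero>] x(2) by simp
qed

text \<open>If \<open>V\<close> were zero, faithfulness would make the fixed space zero and \<open>\<theta>\<close> the negation. But then \<open>\<theta>\<close> fixes all
  brackets, so they vanish, and \<open>G\<close> would be its own centre.\<close>

lemma ex_nonzero_vector: "\<exists>v\<in>carrier V. v \<noteq> \<zero>\<^bsub>V\<^esub>"
proof (rule ccontr)
  assume "\<not> ?thesis"
  then have V0: "\<And>v. v \<in> carrier V \<Longrightarrow> v = \<zero>\<^bsub>V\<^esub>" by blast
  have fix0: "y = \<zero>" if "y \<in> comp 0" for y
    using faithful_rep that V0[OF act_closed[OF that]] by (auto simp: faithful_def k_fin_carrier k_fin_ops)
  have anti: "\<theta> x = \<ominus> x" if x: "x \<in> carrier G" for x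
  proof -
    have "kpart x \<in> comp 0" using x theta_kpart by (simp add: comp_def fix_space_def)
    then have "kpart x = \<zero>" by (rule fix0)
    then have "x = ppart x" using kpart_add_ppart[OF x] x by simp
    then show ?thesis using theta_ppart[OF x] by simp
  qed
  obtain x where x: "x \<in> carrier G" "x \<noteq> \<zero>" using nontrivial by blast
  have "lbracket G x y = \<zero>" if y: "y \<in> carrier G" for y
  proof -
    have "\<theta> (lbracket G x y) = lbracket G x y"
      unfolding theta_bracket[OF x(1) y] anti[OF x(1)] anti[OF y]
      using x y by (simp add: lbracket_minus_left lbracket_minus_right lbracket_closed)
    then have "lbracket G x y \<in> comp 0" using x y by (simp add: comp_def fix_space_def lbracket_closed)
    then show ?thesis by (rule fix0)
  qed
  then show False using centreless x by blast
qed

text \<open>The coefficient of degree \<open>k\<close> of the image of \<open>u^k y \<otimes> v\<close> is \<open>id \<otimes> y v\<close> if \<open>k = 0\<close>, and \<open>ad y \<otimes> v\<close> otherwise.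
  In the first case faithfulness of \<open>V\<close> applies, in the second the triviality of the centre.\<close>

lemma ind_act_mono_faithful:
  assumes y: "y \<in> comp k" and zero: "\<And>v. v \<in> carrier V \<Longrightarrow> ind_act (mono G k y) (unit v) = \<zero>\<^bsub>ind\<^esub>"
  shows "y = \<zero>"
proof -
  obtain \<Psi> where \<Psi>: "linear_mapping ind tensor_module \<Psi>" "\<And>v. v \<in> carrier V \<Longrightarrow> \<Psi> (unit v) = test_vector v"
    and act: "\<And>x z. \<lbrakk>x \<in> polys; z \<in> carrier ind\<rbrakk> \<Longrightarrow> \<Psi> (ind_act x z) = test_act x (\<Psi> z)"
    using ex_test_map by blast
  have "test_act (mono G k y) (test_vector v) = (\<lambda>a b i. 0)" if v: "v \<in> carrier V" for v
    using act[OF mono_polys[OF y] unit_closed[OF v]] \<Psi>(2)[OF v] zero[OF v] linear_mapping.zero[OF \<Psi>(1)] by simp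
  then have "fps_nth (test_act (mono G k y) (test_vector v) a b i) k = 0" if "v \<in> carrier V" for v a b i
    using that by simp
  then have coeff: "(if k = 0 then l a (clip b) * m i (act y v) else l a (lbracket G y (clip b)) * m i v) = 0"
    if "v \<in> carrier V" for v a b i
    using nth_test_act[OF y that, of a b i k] that by simp
  show ?thesis
  proof (cases "k = 0")
    case True
    obtain a b where "a \<in> B" "b \<in> B" "l a b \<noteq> 0" using ex_nonzero_coord by blast
    then have "m i (act y v) = 0" if "v \<in> carrier V" for v i
      using coeff[OF that, of a b i] True by (simp add: clip_basis)
    then have "act y v = \<zero>\<^bsub>V\<^esub>" if "v \<in> carrier V" for v
      using that y True by (intro W.eqI) (simp_all add: act_closed W.coord_zero)
    then show ?thesis
      using faithful_rep y True by (auto simp: faithful_def k_fin_carrier k_fin_ops)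
  next
    case False
    obtain v where v: "v \<in> carrier V" "v \<noteq> \<zero>\<^bsub>V\<^esub>" using ex_nonzero_vector by blast
    then obtain i where i: "m i v \<noteq> 0"
      using W.eqI[OF v(1) V.zero_closed] by (auto simp: W.coord_zero)
    show ?thesis
    proof (rule eq_zero_if_brackets_zero[OF comp_closed[OF y]])
      fix a b assume "a \<in> B" "b \<in> B"
      then show "l a (lbracket G y b) = 0" using coeff[OF v(1), of a b i] i False by (simp add: clip_basis)
    qed
  qed
qed

lemma ex_unit_moved:
  assumes x: "x \<in> series" and "x \<noteq> (\<lambda>k. \<zero>)"
  shows "\<exists>k. \<exists>v\<in>carrier V. term_act x k (unit v) \<noteq> \<zero>\<^bsub>ind\<^esub>"
proof (rule ccontr)
  assume "\<not> ?thesis"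
  then have "x k = \<zero>" for k by (intro ind_act_mono_faithful[OF series_comp[OF x]]) blast
  then show False using assms by auto
qed

lemma completion_act_at_degree_0:
  assumes x: "x \<in> series" and z: "z \<in> carrier ind"
  shows "completion_act x (at_degree 0 z) k = term_act x k z"
proof -
  have "completion_act x (at_degree 0 z) k = finsum ind (\<lambda>j. if j = k then term_act x j z else \<zero>\<^bsub>ind\<^esub>) {..k}"
    unfolding completion_act_def
    using x z by (intro R.V.finsum_cong')
      (auto simp: at_degree_def term_act_closed linear_mapping.zero[OF linear_term_act])
  also have "\<dots> = term_act x k z"
    using R.V.finsum_singleton[of k "{..k}" "\<lambda>j. term_act x j z"] x z by (simp add: term_act_closed eq_commute)
  finally show ?thesis .
qed

lemma faithful_completion: "faithful (N_series G \<theta>) completion completion_act"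
  unfolding faithful_def
proof (intro ballI impI)
  fix x assume "x \<in> carrier (N_series G \<theta>)" and zero: "\<forall>v\<in>carrier completion. completion_act x v = \<zero>\<^bsub>completion\<^esub>"
  then have x: "x \<in> series" by simp
  show "x = \<zero>\<^bsub>N_series G \<theta>\<^esub>"
  proof (rule ccontr)
    assume "x \<noteq> \<zero>\<^bsub>N_series G \<theta>\<^esub>"
    then obtain k v where v: "v \<in> carrier V" and nz: "term_act x k (unit v) \<noteq> \<zero>\<^bsub>ind\<^esub>"
      using ex_unit_moved[OF x] by auto
    have "at_degree 0 (unit v) \<in> carrier completion"
      using unit_in_ind_deg[OF v] R.V.submodule_zero[OF submodule_ind_deg] by (simp add: at_degree_def)
    then have "completion_act x (at_degree 0 (unit v)) k = \<zero>\<^bsub>ind\<^esub>" using zero by simp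
    then show False using nz completion_act_at_degree_0[OF x unit_closed[OF v]] by simp
  qed
qed

end

section \<open>Residual finite-dimensionality\<close>

text \<open>The representation spaces may have any type: they embed into the space of scalar sequences.\<close>

lemma residually_finite_dimensionalI:
  fixes L :: "('k::field, 'a, 'm) lie_scheme"
  assumes "\<And>x. \<lbrakk>x \<in> carrier L; x \<noteq> \<zero>\<^bsub>L\<^esub>\<rbrakk> \<Longrightarrow>
    \<exists>(V :: ('k, 'v) module) act. lie_rep L V act \<and> fin_dim V \<and> (\<exists>v\<in>carrier V. act x v \<noteq> \<zero>\<^bsub>V\<^esub>)"
  shows "residually_finite_dimensional L"
  unfolding residually_finite_dimensional_def
proof (intro ballI impI)
  fix x assume x: "x \<in> carrier L" "x \<noteq> \<zero>\<^bsub>L\<^esub>"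
  then obtain V :: "('k, 'v) module" and act v where rep: "lie_rep L V act" and fin: "fin_dim V"
    and v: "v \<in> carrier V" "act x v \<noteq> \<zero>\<^bsub>V\<^esub>" using assms by blast
  interpret lie_rep L V act by (rule rep)
  obtain \<psi> where \<psi>: "linear_mapping V (free_module (UNIV :: nat set)) \<psi>" and inj: "inj_on \<psi> (carrier V)"
    using ex_sequence_embedding[OF V.vec_space_axioms fin] .
  let ?W = "(free_module (UNIV :: nat set))\<lparr>carrier := \<psi> ` carrier V\<rparr>"
  let ?act = "\<lambda>x w. \<psi> (act x (inv_into (carrier V) \<psi> w))"
  note W = lie_rep_image[OF rep \<psi> inj]
  have "?act x (\<psi> v) \<noteq> \<zero>\<^bsub>?W\<^esub>"
    using W(3)[OF v(1), of x] linear_mapping.zero[OF W(2)] v(2)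
      inj_onD[OF inj _ act_closed[OF x(1) v(1)] V.zero_closed] by auto
  moreover have "fin_dim ?W" by (rule linear_mapping.fin_dim_image[OF W(2) fin]) simp
  moreover have "\<psi> v \<in> carrier ?W" using v(1) by simp
  ultimately show "\<exists>(W :: ('k, nat \<Rightarrow> 'k) module) act.
      lie_rep L W act \<and> fin_dim W \<and> (\<exists>w\<in>carrier W. act x w \<noteq> \<zero>\<^bsub>W\<^esub>)"
    using W(1) by blast
qed

context faithful_current_module
begin

text \<open>If the substitution produces a coefficient of degree \<open>k\<close> that moves the vector \<open>v\<close> of \<open>V\<close>, then the
  component of degree \<open>k\<close> of the image of \<open>v\<close> is nonzero, which is visible modulo degree \<open>k + 1\<close>.\<close>

lemma residually_finite_dimensional_k_aff: "residually_finite_dimensional (k_aff G \<theta>)"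
proof (rule residually_finite_dimensionalI)
  fix x assume "x \<in> carrier (k_aff G \<theta>)" "x \<noteq> \<zero>\<^bsub>k_aff G \<theta>\<^esub>"
  then have x: "x \<in> loops" and nz: "rho_series 1 x \<noteq> (\<lambda>m. \<zero>)" using rho_series_inject by auto
  have y: "rho_series 1 x \<in> series" by (rule rho_series_in_series[OF x]) simp
  obtain k v where v: "v \<in> carrier V" and kv: "term_act (rho_series 1 x) k (unit v) \<noteq> \<zero>\<^bsub>ind\<^esub>"
    using ex_unit_moved[OF y nz] by blast
  \<comment> \<open>The quotient at \<open>Suc k\<close> is the first one in which components of degree \<open>k\<close> are nonzero.\<close>
  let ?N = "Suc k" and ?y = "cut_at G (Suc k) (rho_series 1 x)"
  interpret Q: vec_space "ind_quot ?N" by (rule vec_space_ind_quot)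
  have yN: "?y \<in> polys" using cut_at_truncated[OF y, of ?N] truncated_subset by auto
  note u = unit_closed[OF v]
  have "components (ind_act ?y (unit v)) k = term_act (rho_series 1 x) k (unit v)"
    unfolding components_act[OF yN u] components_unit[OF v] completion_act_at_degree_0[OF polys_series[OF yN] u]
    by (simp add: cut_at_def)
  then have "coset ?N (ind_act ?y (unit v)) \<noteq> coset ?N \<zero>\<^bsub>ind\<^esub>"
    using kv ind_act_closed[OF yN u] by (auto simp: coset_eq_iff components_zero)
  then have "quot_act ?N (rho G 1 ?N x) (coset ?N (unit v)) \<noteq> \<zero>\<^bsub>ind_quot ?N\<^esub>"
    unfolding rho_eq quot_act_coset[OF y u] linear_mapping.zero[OF linear_coset] .
  moreover have "coset ?N (unit v) \<in> carrier (ind_quot ?N)" by (rule linear_mapping.closed[OF linear_coset u])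
  moreover have "fin_dim V"
  proof (rule V.fin_dimI[OF W.finite_basis])
    show "C \<subseteq> carrier V" using W.basis_closed by blast
    show "carrier V \<subseteq> lin_span V C"
    proof
      fix v assume v: "v \<in> carrier V"
      have "finsum V (\<lambda>b. m b v \<odot>\<^bsub>V\<^esub> b) C \<in> lin_span V C"
        unfolding lin_span_def using W.finite_basis by (intro CollectI exI[of _ "\<lambda>b. m b v"] exI[of _ C]) simp
      then show "v \<in> lin_span V C" by (simp only: W.expand[OF v])
    qed
  qed
  ultimately show "\<exists>(V :: ('k, ('k, 'g, 'v) ind set) module) act.
      lie_rep (k_aff G \<theta>) V act \<and> fin_dim V \<and> (\<exists>v\<in>carrier V. act x v \<noteq> \<zero>\<^bsub>V\<^esub>)"
    by (intro exI[of _ "ind_quot ?N"] exI[of _ "\<lambda>x. quot_act ?N (rho G 1 ?N x)"] conjI fin_dim_ind_quot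
        lie_rep_quot_act_rho bexI[of _ "coset ?N (unit v)"]) simp_all
qed

end

section \<open>Split simple Lie algebras\<close>

lemma two_neq_0: "(2::'k::real_or_complex) \<noteq> 0"
proof
  assume 2: "(2::'k) = 0"
  obtain \<phi> :: "'k \<Rightarrow> complex" where add: "\<And>x y. \<phi> (x + y) = \<phi> x + \<phi> y" and one: "\<phi> 1 = 1"
    using real_or_complex by blast
  have "\<phi> 0 = 0" using add[of 0 0] by simp
  moreover have "\<phi> 2 = 2" using add[of 1 1] one by simp
  ultimately show False using 2 by simp
qed

context split_simple_lie_algebra
begin

text \<open>The vectors fixed by the square of \<open>\<theta>\<close> form a subalgebra that contains the generators.\<close>

lemma involution_involution:
  assumes "x \<in> carrier G"
  shows "\<theta> (\<theta> x) = x"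
proof -
  interpret \<theta>: linear_mapping G G \<theta>
    using involution_hom by (simp add: linear_mapping_def linear_mapping_axioms_def lie_hom_def vec_space_axioms)
  have br: "\<theta> (lbracket G x y) = lbracket G (\<theta> x) (\<theta> y)" if "x \<in> carrier G" "y \<in> carrier G" for x y
    using involution_hom that by (simp add: lie_hom_def)
  have "{x \<in> carrier G. \<theta> (\<theta> x) = x} = carrier G"
  proof (rule generated)
    show "lie_subalgebra G {x \<in> carrier G. \<theta> (\<theta> x) = x}"
      unfolding lie_subalgebra_def
      by (auto intro!: subspaceI simp: \<theta>.zero \<theta>.add \<theta>.smult br lbracket_closed)
    show "e i \<in> {x \<in> carrier G. \<theta> (\<theta> x) = x} \<and> f i \<in> {x \<in> carrier G. \<theta> (\<theta> x) = x}" if "i < n" for i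
      using that generators_closed by (simp add: involution_e involution_f \<theta>.minus)
  qed
  then show ?thesis using assms by blast
qed

text \<open>The centre is an ideal, and it is not everything because \<open>G\<close> is not abelian.\<close>

lemma centre_trivial:
  assumes x: "x \<in> carrier G" and "\<And>y. y \<in> carrier G \<Longrightarrow> lbracket G x y = \<zero>"
  shows "x = \<zero>"
proof -
  let ?Z = "{x \<in> carrier G. \<forall>y\<in>carrier G. lbracket G x y = \<zero>}"
  have "lie_ideal G ?Z"
    unfolding lie_ideal_def
  proof (intro conjI ballI)
    show "submodule ?Z KK G"
      by (rule subspaceI) (auto simp: lbracket_add_left lbracket_smult_left)
    fix y z assume y: "y \<in> carrier G" and z: "z \<in> ?Z"
    then have "lbracket G y z = \<zero>" using lbracket_flip[of z y] by simp
    then show "lbracket G y z \<in> ?Z" by simp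
  qed
  then have "?Z = {\<zero>}" using simple nonabelian by blast
  then show ?thesis using assms by blast
qed

end

theorem theoremB:
  fixes G :: "('k::real_or_complex, 'g) lie"
    and n :: nat and a :: "nat \<Rightarrow> nat \<Rightarrow> int" and e f h :: "nat \<Rightarrow> 'g" and \<theta> :: "'g \<Rightarrow> 'g"
    and V :: "('k, 'v) module" and act :: "'g \<Rightarrow> 'v \<Rightarrow> 'v"
  defines "ind \<equiv> current_induction.ind G \<theta> V act"
    and "ind_act \<equiv> current_induction.ind_act G \<theta> V act"
    and "ind_deg \<equiv> current_induction.ind_deg G \<theta> V act"
    and "ind_ge \<equiv> current_induction.ind_ge G \<theta> V act"
    and "ind_quot \<equiv> current_induction.ind_quot G \<theta> V act"
    and "quot_act_poly \<equiv> current_induction.quot_act_poly G \<theta> V act"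
    and "quot_act \<equiv> current_induction.quot_act G \<theta> V act"
    and "completion \<equiv> current_induction.completion G \<theta> V act"
    and "completion_act \<equiv> current_induction.completion_act G \<theta> V act"
    and "quot_bond \<equiv> current_induction.quot_bond G \<theta> V act"
    and "completion_proj \<equiv> current_induction.completion_proj G \<theta> V act"
  assumes "split_simple_lie_algebra G n a e f h \<theta>"
    and "lie_rep (k_fin G \<theta>) V act" and "fin_dim V" and "faithful (k_fin G \<theta>) V act"
  shows
    "lie_rep (N_poly G \<theta>) ind ind_act \<and>
     is_direct_sum ind ind_deg \<and>
     (\<forall>k i. \<forall>x\<in>N_deg G \<theta> k. \<forall>v\<in>ind_deg i. ind_act x v \<in> ind_deg (k + i)) \<and>
     (\<forall>N. submodule (ind_ge N) KK ind \<and>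
          (\<forall>x\<in>carrier (N_poly G \<theta>). \<forall>v\<in>ind_ge N. ind_act x v \<in> ind_ge N)) \<and>
     (\<forall>N. fin_dim (ind_quot N) \<and>
          lie_rep (N_poly G \<theta>) (ind_quot N) (quot_act_poly N) \<and>
          lie_rep (N_trunc G \<theta> N) (ind_quot N) (quot_act N) \<and>
          (\<forall>x\<in>carrier (N_poly G \<theta>). \<forall>Z\<in>carrier (ind_quot N).
             quot_act N (cut_at G N x) Z = quot_act_poly N x Z) \<and>
          (\<forall>s\<in>{1, -1}. lie_hom (k_aff G \<theta>) (N_trunc G \<theta> N) (rho G s N) \<and>
             lie_rep (k_aff G \<theta>) (ind_quot N) (\<lambda>x. quot_act N (rho G s N x)))) \<and>
     (lie_rep (N_series G \<theta>) completion completion_act \<and>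
      faithful (N_series G \<theta>) completion completion_act) \<and>
     (let lim = inverse_limit ind_quot quot_bond; \<Phi> = (\<lambda>v N. completion_proj N v)
      in lin_map completion lim \<Phi> \<and> bij_betw \<Phi> (carrier completion) (carrier lim) \<and>
         (\<forall>x\<in>carrier (N_series G \<theta>). \<forall>v\<in>carrier completion. \<forall>N.
            completion_proj N (completion_act x v) =
              quot_act N (cut_at G N x) (completion_proj N v))) \<and>
     residually_finite_dimensional (k_aff G \<theta>)"
proof -
  interpret S: split_simple_lie_algebra G n a e f h \<theta> by fact
  interpret V: vec_space V
    using \<open>lie_rep (k_fin G \<theta>) V act\<close> by (simp add: lie_rep_def vec_space_def)
  obtain B l where B: "dual_basis G B l" using S.ex_dual_basis[OF S.finite_dimensional] .
  obtain C m where C: "dual_basis V C m" using V.ex_dual_basis[OF \<open>fin_dim V\<close>] .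
  have "twisted_currents G B l \<theta>"
    by (intro twisted_currents.intro twisted_currents_axioms.intro dual_based_space.intro dual_based_space_axioms.intro
        S.lie_algebra_axioms S.vec_space_axioms B S.involution_hom S.involution_involution two_neq_0)
      (assumption, rule S.centre_trivial)
  then interpret F: faithful_current_module G B l \<theta> V act C m
  proof (intro faithful_current_module.intro faithful_current_module_axioms.intro current_module.intro
      current_module_axioms.intro C assms(13,15))
    show "\<exists>x\<in>carrier G. x \<noteq> \<zero>\<^bsub>G\<^esub>" using S.nonabelian S.lbracket_closed by blast
  qed
  have sq: "s * s = 1" if "s \<in> {1, -1}" for s :: 'k using that by auto
  show ?thesis
    unfolding assms(1-11) Let_def
    by (intro conjI ballI allI F.lie_rep_ind F.direct_sum F.ind_act_deg F.submodule_ind_ge F.ind_ge_invariant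
        F.fin_dim_ind_quot[OF \<open>fin_dim V\<close>] F.lie_rep_quot_act_poly F.lie_rep_quot_act F.quot_act_cut
        F.lie_hom_rho[OF sq] F.lie_rep_quot_act_rho[OF sq] F.lie_rep_completion F.faithful_completion
        F.lin_map_completion_proj F.bij_completion_proj F.completion_proj_act
        F.residually_finite_dimensional_k_aff)
      (assumption | simp only: F.N_simps)+
qed

end
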